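(* Let $n\ge1$ and let $\mathcal D=\{D^\lambda\}_{\lambda\in[0,1]}$, $\widetilde{\mathcal D}=\{\tilde D^\lambda\}_{\lambda\in[0,1]}$ be two continuous families (of class $C^{2,0}$) of bounded strictly pseudoconvex domains in $\mathbf C^n$ with $C^2$ boundaries. Let $F=\{F^\lambda\}$ be a family of biholomorphisms $F^\lambda\colon D^\lambda\to\tilde D^\lambda$. If $\mathrm{Aut}(D^0)=\{\mathrm{Id}\}$, then each $F^\lambda$ extends continuously to $\overline{D^\lambda}$ and $F^\lambda\circ\Gamma^\lambda$ converges to $F^0\circ\Gamma^0$ uniformly on $\overline D$ as $\lambda\to0$, for any parameterization $\Gamma\in C^{2,0}(\overline D)$ of $\mathcal D$.
   Context: A family $\{D^\lambda\}_{\lambda\in[0,1]}$ is of class $C^{2,0}$ (a continuous family of domains with $C^2$ boundary) if there are a bounded domain $D$ with $C^2$ boundary and embeddings $\Gamma^\lambda$ of $\overline D$ onto $\overline{D^\lambda}$ such that the partial derivatives $\partial_x^\ell\Gamma^\lambda(x)$, $\ell\le 2$, are continuous in $(x,\lambda)\in\overline D\times[0,1]$; $\Gamma$ is called a parameterization, written $\Gamma\in C^{2,0}(\overline D)$. $\mathrm{Aut}$ is the group of holomorphic automorphisms. *)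

theory Defs
  imports "HOL-Analysis.Analysis"
begin

text \<open>Complex n-space is modelled as complex ^ 'n for a finite index type 'n
  (so n = CARD('n) >= 1).  Derivatives are real Frechet derivatives.\<close>

definition C2_on ::
  "('a::real_normed_vector) set \<Rightarrow> ('a \<Rightarrow> 'b::real_normed_vector)
   \<Rightarrow> ('a \<Rightarrow> ('a \<Rightarrow>\<^sub>L 'b)) \<Rightarrow> ('a \<Rightarrow> ('a \<Rightarrow>\<^sub>L ('a \<Rightarrow>\<^sub>L 'b))) \<Rightarrow> bool" where
  "C2_on U f Df D2f \<longleftrightarrow>
     (\<forall>z\<in>U. (f has_derivative blinfun_apply (Df z)) (at z)) \<and>
     (\<forall>z\<in>U. (Df has_derivative blinfun_apply (D2f z)) (at z)) \<and>
     continuous_on U Df \<and> continuous_on U D2f"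

definition bounded_domain :: "('a::real_normed_vector) set \<Rightarrow> bool" where
  "bounded_domain D \<longleftrightarrow> open D \<and> connected D \<and> D \<noteq> {} \<and> bounded D"

definition C2_defining_function ::
  "(complex^'n) set \<Rightarrow> (complex^'n) set \<Rightarrow> (complex^'n \<Rightarrow> real)
   \<Rightarrow> (complex^'n \<Rightarrow> ((complex^'n) \<Rightarrow>\<^sub>L real))
   \<Rightarrow> (complex^'n \<Rightarrow> ((complex^'n) \<Rightarrow>\<^sub>L ((complex^'n) \<Rightarrow>\<^sub>L real))) \<Rightarrow> bool" where
  "C2_defining_function D U \<rho> D\<rho> D2\<rho> \<longleftrightarrow>
     open U \<and> frontier D \<subseteq> U \<and> C2_on U \<rho> D\<rho> D2\<rho> \<and>
     D \<inter> U = {z\<in>U. \<rho> z < 0} \<and>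
     (\<forall>p\<in>frontier D. D\<rho> p \<noteq> 0)"

definition bounded_C2_domain :: "(complex^'n) set \<Rightarrow> bool" where
  "bounded_C2_domain D \<longleftrightarrow> bounded_domain D \<and>
     (\<exists>U \<rho> D\<rho> D2\<rho>. C2_defining_function D U \<rho> D\<rho> D2\<rho>)"

text \<open>Bounded strictly pseudoconvex domain with C^2 boundary: the Levi form of a
  C^2 defining function is positive definite on the complex tangent space at every
  boundary point.  For w in C^n, the complex tangent condition
  \<Sum> d\<rho>/dz_j (p) w_j = 0 is (D\<rho> p w = 0 and D\<rho> p (i w) = 0), and the Levi form
  \<Sum> d^2\<rho>/dz_j d\<bar>z_k (p) w_j \<bar>w_k equals (D2\<rho> p w w + D2\<rho> p (i w) (i w))/4.\<close>
definition bounded_strictly_pseudoconvex_C2 :: "(complex^'n) set \<Rightarrow> bool" where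
  "bounded_strictly_pseudoconvex_C2 D \<longleftrightarrow> bounded_domain D \<and>
     (\<exists>U \<rho> D\<rho> D2\<rho>. C2_defining_function D U \<rho> D\<rho> D2\<rho> \<and>
        (\<forall>p\<in>frontier D. \<forall>w. w \<noteq> 0 \<longrightarrow> D\<rho> p w = 0 \<longrightarrow> D\<rho> p (\<i> *s w) = 0 \<longrightarrow>
            (D2\<rho> p w w + D2\<rho> p (\<i> *s w) (\<i> *s w)) / 4 > 0))"

definition holomorphic_map_on :: "(complex^'n \<Rightarrow> complex^'m) \<Rightarrow> (complex^'n) set \<Rightarrow> bool" where
  "holomorphic_map_on f U \<longleftrightarrow>
     (\<forall>z\<in>U. \<exists>L. (f has_derivative L) (at z) \<and> (\<forall>c v. L (c *s v) = c *s L v))"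

definition biholomorphism :: "(complex^'n \<Rightarrow> complex^'n) \<Rightarrow> (complex^'n) set \<Rightarrow> (complex^'n) set \<Rightarrow> bool" where
  "biholomorphism F D D' \<longleftrightarrow> bij_betw F D D' \<and> holomorphic_map_on F D \<and>
     (\<exists>G. holomorphic_map_on G D' \<and> (\<forall>z\<in>D. G (F z) = z) \<and> (\<forall>w\<in>D'. F (G w) = w))"

definition trivial_Aut :: "(complex^'n) set \<Rightarrow> bool" where
  "trivial_Aut D \<longleftrightarrow> (\<forall>\<phi>. biholomorphism \<phi> D D \<longrightarrow> (\<forall>z\<in>D. \<phi> z = z))"

definition parameterization ::
  "(complex^'n) set \<Rightarrow> (real \<Rightarrow> complex^'n \<Rightarrow> complex^'n) \<Rightarrow> (real \<Rightarrow> (complex^'n) set) \<Rightarrow> bool" where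
  "parameterization D0 \<Gamma> Dfam \<longleftrightarrow> bounded_C2_domain D0 \<and>
     (\<exists>D\<Gamma> D2\<Gamma>.
        (\<forall>t\<in>{0..1}. \<forall>x\<in>D0. (\<Gamma> t has_derivative blinfun_apply (D\<Gamma> t x)) (at x)) \<and>
        (\<forall>t\<in>{0..1}. \<forall>x\<in>D0. (D\<Gamma> t has_derivative blinfun_apply (D2\<Gamma> t x)) (at x)) \<and>
        continuous_on ({0..1} \<times> closure D0) (\<lambda>(t, x). \<Gamma> t x) \<and>
        continuous_on ({0..1} \<times> closure D0) (\<lambda>(t, x). D\<Gamma> t x) \<and>
        continuous_on ({0..1} \<times> closure D0) (\<lambda>(t, x). D2\<Gamma> t x) \<and>
        (\<forall>t\<in>{0..1}. inj_on (\<Gamma> t) (closure D0) \<and> \<Gamma> t ` closure D0 = closure (Dfam t) \<and>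
            (\<forall>x\<in>closure D0. inj (blinfun_apply (D\<Gamma> t x)))))"

definition C20_family :: "(real \<Rightarrow> (complex^'n) set) \<Rightarrow> bool" where
  "C20_family Dfam \<longleftrightarrow> (\<exists>D0 \<Gamma>. parameterization D0 \<Gamma> Dfam)"

end

theory Submission
  imports Defs "HOL-Complex_Analysis.Complex_Analysis"
begin

text \<open>Suppose the inverse maps \<open>G\<^sup>t\<close> did not keep points of bounded depth away from the boundary as
  \<open>t \<rightarrow> 0\<close>. Rescaling anisotropically at the boundary points approached by the images (Wong--Rosay) and
  passing to a limit by Montel's theorem would identify the target at \<open>t = 0\<close> with a Siegel domain
  \<open>{siegel g B < 0}\<close>, whose translations give a nontrivial automorphism of \<open>D\<^sup>0\<close>. So there is a uniform
  depth control for \<open>G\<^sup>t\<close>. Combined with a Hopf lemma in the source and a Harnack inequality for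
  Levi polynomials in the target, all uniform in \<open>t\<close> because of the \<open>C\<^sup>2\<close> control, it bounds the
  derivative of \<open>F\<^sup>t\<close> at \<open>z\<close> by a constant times the inverse square root of the distance from \<open>z\<close>
  to the boundary. Integrating along transversals makes the maps \<open>F\<^sup>t \<circ> \<Gamma>\<^sup>t\<close> equicontinuous up to the
  boundary. Interior limits of \<open>F\<^sup>t\<close> as \<open>t \<rightarrow> 0\<close> are biholomorphic by the depth control, hence equal to
  \<open>F\<^sup>0\<close> since \<open>Aut(D\<^sup>0)\<close> is trivial. For a single \<open>t\<close> the depth control is just compactness.\<close>

section \<open>Holomorphic maps of several variables\<close>

text \<open>No dependence of F^t on t is assumed, so continuity in t has to come from rigidity of
  the limiting domain, and continuity up to the boundary from estimates whose constants do not see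
  t. The boundary data used is a quadratic form with an error
  \<open>\<epsilon> * (norm v)\<^sup>2\<close>, and this is what the parameterization carries from
  D^0 to D^t. Two sizes of error occur. The fixed size c/8 is half of the contribution c/4 of the
  Levi form and suffices for Levi polynomials to act as local peak functions. The scaling limit
  needs every \<epsilon> > 0 with one and the same form, since only then do the rescaled domains
  converge to a single Siegel domain. Depth control is asked of the inverses G^t because the Hopf
  lemma is applied to G^t on discs in balls that touch the boundary of the target from inside. This
  is the direction that bounds the depth of F^t z from above by the depth of z, and so leads to a
  derivative bound that is integrable along transversals.\<close>

lemma norm_vector_smult: "norm (c *s (v::complex^'n)) = cmod c * norm v"
  by (simp add: norm_vec_def L2_set_def norm_mult power_mult_distrib sum_distrib_left[symmetric] real_sqrt_mult)

lemma bounded_linear_vector_smult_left: "bounded_linear (\<lambda>c. c *s (v::complex^'n))"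
  by (rule linear_conv_bounded_linear[THEN iffD1])
     (auto intro!: linearI simp: vec_eq_iff algebra_simps)

lemma bounded_linear_vector_smult_right: "bounded_linear (\<lambda>v. c *s (v::complex^'n))"
  by (rule linear_conv_bounded_linear[THEN iffD1])
     (auto intro!: linearI simp: vec_eq_iff algebra_simps)

lemma has_derivative_affine_line:
  "((\<lambda>\<zeta>. a + \<zeta> *s (b::complex^'n)) has_derivative (\<lambda>h. h *s b)) F"
  using bounded_linear_imp_has_derivative[OF bounded_linear_vector_smult_left, of b F]
  by (auto intro!: derivative_eq_intros)

section \<open>Hermitian product, scalar and vector-valued holomorphic maps\<close>

definition cip :: "complex^'n \<Rightarrow> complex^'n \<Rightarrow> complex" where
  "cip v w = (\<Sum>k\<in>UNIV. v $ k * cnj (w $ k))"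

lemma Re_cip: "Re (cip v w) = v \<bullet> w"
  by (simp add: cip_def inner_vec_def inner_complex_def)

lemma cip_add_left: "cip (u + v) w = cip u w + cip v w"
  and cip_diff_left: "cip (u - v) w = cip u w - cip v w"
  and cip_smult_left: "cip (c *s v) w = c * cip v w"
  and cip_scaleR_left: "cip (r *\<^sub>R v) w = r *\<^sub>R cip v w"
  and cip_scaleR_right: "cip v (r *\<^sub>R w) = r *\<^sub>R cip v w"
  and cip_minus_left: "cip (- v) w = - cip v w"
  by (simp_all add: cip_def algebra_simps sum.distrib sum_subtractf sum_distrib_left sum_negf scaleR_sum_right)

lemma cip_self: "cip v v = complex_of_real ((norm v)^2)"
proof -
  have "(norm v)^2 = (\<Sum>k\<in>UNIV. (cmod (v $ k))^2)"
    by (simp add: norm_vec_def L2_set_def sum_nonneg)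
  then show ?thesis
    by (simp only: cip_def complex_norm_square of_real_sum)
qed

lemma norm_cip_le: "cmod (cip v w) \<le> norm v * norm w"
proof -
  have "cmod (cip v w) \<le> (\<Sum>k\<in>UNIV. cmod (v $ k) * cmod (w $ k))"
    unfolding cip_def by (rule sum_norm_le) (simp add: norm_mult)
  also have "\<dots> \<le> L2_set (\<lambda>k. cmod (v $ k)) UNIV * L2_set (\<lambda>k. cmod (w $ k)) UNIV"
    using L2_set_mult_ineq[of "\<lambda>k. cmod (v $ k)" "\<lambda>k. cmod (w $ k)" UNIV] by simp
  finally show ?thesis by (simp add: norm_vec_def)
qed

lemma bounded_linear_cip: "bounded_linear (\<lambda>v. cip v w)"
  by (rule linear_conv_bounded_linear[THEN iffD1]) (auto intro!: linearI simp: cip_add_left cip_scaleR_left)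

text \<open>Scalar counterpart of \<open>holomorphic_map_on\<close>, needed separately because
  \<open>complex\<close> and \<open>complex^'m\<close> are different types.\<close>

definition cholo :: "(complex^'n \<Rightarrow> complex) \<Rightarrow> (complex^'n) set \<Rightarrow> bool" where
  "cholo h U \<longleftrightarrow> (\<forall>z\<in>U. \<exists>L. (h has_derivative L) (at z) \<and> (\<forall>c v. L (c *s v) = c * L v))"

lemma cholo_subset: "cholo h U \<Longrightarrow> V \<subseteq> U \<Longrightarrow> cholo h V"
  by (auto simp: cholo_def)

lemma holomorphic_map_on_subset: "holomorphic_map_on f U \<Longrightarrow> V \<subseteq> U \<Longrightarrow> holomorphic_map_on f V"
  by (auto simp: holomorphic_map_on_def)

lemma holomorphic_map_on_continuous: "holomorphic_map_on f U \<Longrightarrow> continuous_on U f"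
  by (metis (no_types, lifting) continuous_at_imp_continuous_on has_derivative_continuous holomorphic_map_on_def)

lemma cholo_continuous: "cholo f U \<Longrightarrow> continuous_on U f"
  by (metis (no_types, lifting) continuous_at_imp_continuous_on has_derivative_continuous cholo_def)

lemma holomorphic_map_on_compose:
  assumes "holomorphic_map_on f U" "holomorphic_map_on g V" "f ` U \<subseteq> V"
  shows "holomorphic_map_on (g \<circ> f) U"
  unfolding holomorphic_map_on_def
proof
  fix z assume z: "z \<in> U"
  then obtain L where L: "(f has_derivative L) (at z)" "\<forall>c v. L (c *s v) = c *s L v"
    using assms(1) by (auto simp: holomorphic_map_on_def)
  have "f z \<in> V" using assms(3) z by auto
  then obtain M where M: "(g has_derivative M) (at (f z))" "\<forall>c v. M (c *s v) = c *s M v"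
    using assms(2) by (auto simp: holomorphic_map_on_def)
  show "\<exists>L. (g \<circ> f has_derivative L) (at z) \<and> (\<forall>c v. L (c *s v) = c *s L v)"
    using diff_chain_at[OF L(1) M(1)] L(2) M(2) by (intro exI[of _ "M \<circ> L"]) auto
qed

lemma cholo_compose:
  assumes "holomorphic_map_on f U" "cholo g V" "f ` U \<subseteq> V"
  shows "cholo (g \<circ> f) U"
  unfolding cholo_def
proof
  fix z assume z: "z \<in> U"
  then obtain L where L: "(f has_derivative L) (at z)" "\<forall>c v. L (c *s v) = c *s L v"
    using assms(1) by (auto simp: holomorphic_map_on_def)
  have "f z \<in> V" using assms(3) z by auto
  then obtain M where M: "(g has_derivative M) (at (f z))" "\<forall>c v. M (c *s v) = c * M v"
    using assms(2) by (auto simp: cholo_def)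
  show "\<exists>L. (g \<circ> f has_derivative L) (at z) \<and> (\<forall>c v. L (c *s v) = c * L v)"
    using diff_chain_at[OF L(1) M(1)] L(2) M(2) by (intro exI[of _ "M \<circ> L"]) auto
qed

lemma holomorphic_map_on_affine:
  assumes "bounded_linear A" "\<And>c v. A (c *s v) = c *s A v"
  shows "holomorphic_map_on (\<lambda>z. A z + b) U"
  unfolding holomorphic_map_on_def
proof
  fix z
  have "((\<lambda>z. A z + b) has_derivative A) (at z)"
    using bounded_linear_imp_has_derivative[OF assms(1), of "at z"] by (auto intro!: derivative_eq_intros)
  then show "\<exists>L. ((\<lambda>z. A z + b) has_derivative L) (at z) \<and> (\<forall>c v. L (c *s v) = c *s L v)"
    using assms(2) by blast
qed

lemma holomorphic_map_on_diff:
  assumes "holomorphic_map_on f U" "holomorphic_map_on g U"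
  shows "holomorphic_map_on (\<lambda>z. f z - g z) U"
  unfolding holomorphic_map_on_def
proof
  fix z assume z: "z \<in> U"
  obtain L where L: "(f has_derivative L) (at z)" "\<forall>c v. L (c *s v) = c *s L v"
    using assms(1) z by (auto simp: holomorphic_map_on_def)
  obtain M where M: "(g has_derivative M) (at z)" "\<forall>c v. M (c *s v) = c *s M v"
    using assms(2) z by (auto simp: holomorphic_map_on_def)
  show "\<exists>L. ((\<lambda>z. f z - g z) has_derivative L) (at z) \<and> (\<forall>c v. L (c *s v) = c *s L v)"
    using has_derivative_diff[OF L(1) M(1)] L(2) M(2)
    by (intro exI[of _ "\<lambda>v. L v - M v"]) (auto simp: vec_eq_iff algebra_simps)
qed

lemma cholo_cip: "holomorphic_map_on f U \<Longrightarrow> cholo (\<lambda>z. cip (f z) w) U"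
proof -
  assume f: "holomorphic_map_on f U"
  have "cholo (\<lambda>v. cip v w) UNIV"
    unfolding cholo_def
    using bounded_linear_imp_has_derivative[OF bounded_linear_cip] cip_smult_left by blast
  from cholo_compose[OF f this] show ?thesis by (simp add: o_def)
qed

lemma cholo_line_has_field_derivative:
  fixes h :: "complex^'n \<Rightarrow> complex"
  assumes "(h has_derivative L) (at (a + \<zeta> *s b))" "\<And>c v. L (c *s v) = c * L v"
  shows "((\<lambda>\<zeta>. h (a + \<zeta> *s b)) has_field_derivative L b) (at \<zeta>)"
proof -
  have "((\<lambda>\<zeta>. h (a + \<zeta> *s b)) has_derivative (\<lambda>t. L (t *s b))) (at \<zeta>)"
    using diff_chain_at[OF has_derivative_affine_line[of a b "at \<zeta>"] assms(1)] by (simp add: o_def)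
  then show ?thesis
    using assms(2) by (simp add: has_field_derivative_def mult.commute[of _ "L b"] mult_commute_abs)
qed

lemma cholo_line:
  assumes "cholo h U" "\<And>\<zeta>. \<zeta> \<in> S \<Longrightarrow> a + \<zeta> *s b \<in> U"
  shows "(\<lambda>\<zeta>. h (a + \<zeta> *s b)) holomorphic_on S"
proof -
  have "\<exists>d. ((\<lambda>\<zeta>. h (a + \<zeta> *s b)) has_field_derivative d) (at \<zeta> within S)" if "\<zeta> \<in> S" for \<zeta>
    using cholo_line_has_field_derivative[of h _ a \<zeta> b] assms that
    unfolding cholo_def by (metis has_field_derivative_at_within)
  then show ?thesis
    unfolding holomorphic_on_def field_differentiable_def by blast
qed

section \<open>Cauchy estimates\<close>

lemma cholo_Cauchy:
  assumes h: "cholo h (ball a s)" and s: "s > 0" and M: "\<And>z. z \<in> ball a s \<Longrightarrow> cmod (h z) \<le> M"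
    and L: "(h has_derivative L) (at a)"
  shows "cmod (L v) \<le> 2 * M / s * norm v"
proof (cases "v = 0")
  case True
  then show ?thesis using L by (simp add: has_derivative_bounded_linear linear_0 bounded_linear.linear)
next
  case False
  obtain L' where L': "(h has_derivative L') (at a)" "\<forall>c v. L' (c *s v) = c * L' v"
    using h s centre_in_ball unfolding cholo_def by blast
  have LL: "L = L'" using has_derivative_unique L L'(1) by blast
  \<comment> \<open>Half of the critical radius, so that the closed disc still lands in the open
    ball; this is the factor 2 in the bound.\<close>
  define r where "r = s / (2 * norm v)"
  have r: "r > 0" using s False by (simp add: r_def)
  have inb: "a + \<zeta> *s v \<in> ball a s" if "\<zeta> \<in> cball 0 r" for \<zeta>
  proof -
    have "norm (\<zeta> *s v) \<le> r * norm v"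
      using that by (simp add: norm_vector_smult mult_right_mono)
    also have "\<dots> < s" using False s by (simp add: r_def)
    finally show ?thesis by (simp add: dist_norm)
  qed
  let ?f = "\<lambda>\<zeta>. h (a + \<zeta> *s v)"
  have hol: "?f holomorphic_on cball 0 r" using cholo_line[OF h inb] by blast
  have "norm ((deriv ^^ 1) ?f 0) \<le> fact 1 * M / r ^ 1"
  proof (rule Cauchy_inequality)
    show "?f holomorphic_on ball 0 r" using hol ball_subset_cball holomorphic_on_subset by blast
    show "continuous_on (cball 0 r) ?f" using hol holomorphic_on_imp_continuous_on by blast
    show "cmod (?f x) \<le> M" if "cmod (0 - x) = r" for x
      using M[OF inb[of x]] that by simp
  qed (use r in auto)
  moreover have "deriv ?f 0 = L v"
    using cholo_line_has_field_derivative[of h L a 0 v] L L' LL by (intro DERIV_imp_deriv) auto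
  ultimately show ?thesis by (simp add: r_def field_simps)
qed

text \<open>Pairing \<open>f\<close> with the fixed vector \<open>L v\<close> reduces to the scalar
  case without a dimensional constant: \<open>cip (L v) (L v)\<close> is the square of
  \<open>norm (L v)\<close>, and one factor cancels.\<close>

lemma holomorphic_map_Cauchy:
  fixes f :: "complex^'n \<Rightarrow> complex^'m"
  assumes f: "holomorphic_map_on f (ball a s)" and s: "s > 0" and M: "\<And>z. z \<in> ball a s \<Longrightarrow> norm (f z) \<le> M"
    and L: "(f has_derivative L) (at a)"
  shows "norm (L v) \<le> 2 * M / s * norm v"
proof (cases "L v = 0")
  case True
  have "0 \<le> M" using M[of a] s norm_ge_zero[of "f a"] by (meson centre_in_ball order_trans)
  then show ?thesis using True s by simp
next
  case False
  let ?u = "L v"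
  have "cmod (cip (L v) ?u) \<le> 2 * (M * norm ?u) / s * norm v"
  proof (rule cholo_Cauchy[where h="\<lambda>z. cip (f z) ?u" and L="\<lambda>v. cip (L v) ?u"])
    show "cholo (\<lambda>z. cip (f z) ?u) (ball a s)" using cholo_cip f by blast
    show "((\<lambda>z. cip (f z) ?u) has_derivative (\<lambda>v. cip (L v) ?u)) (at a)"
      using bounded_linear.has_derivative[OF bounded_linear_cip L] .
    show "cmod (cip (f z) ?u) \<le> M * norm ?u" if "z \<in> ball a s" for z
      using norm_cip_le[of "f z" ?u] M[OF that] by (meson mult_right_mono norm_ge_zero order_trans)
  qed (rule s)
  then have "norm ?u * norm ?u \<le> (2 * M / s * norm v) * norm ?u"
    by (simp add: cip_self power2_eq_square algebra_simps norm_mult)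
  then show ?thesis using False mult_right_le_imp_le zero_less_norm_iff by blast
qed

text \<open>Each point of the half ball is the centre of a ball of radius \<open>s/2\<close> inside
  the large one, so the derivative is at most \<open>2 * M / (s/2)\<close> there, and the half ball
  is convex.\<close>

lemma holomorphic_map_Lipschitz:
  fixes f :: "complex^'n \<Rightarrow> complex^'m"
  assumes f: "holomorphic_map_on f (ball a s)" and s: "s > 0" and M: "\<And>z. z \<in> ball a s \<Longrightarrow> norm (f z) \<le> M"
    and x: "x \<in> ball a (s/2)" and y: "y \<in> ball a (s/2)"
  shows "norm (f x - f y) \<le> 4 * M / s * norm (x - y)"
proof -
  have "\<forall>z\<in>ball a (s/2). \<exists>L. (f has_derivative L) (at z)"
    using f s by (auto simp: holomorphic_map_on_def)
  then obtain L where L: "\<And>z. z \<in> ball a (s/2) \<Longrightarrow> (f has_derivative L z) (at z)" by metis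
  have "onorm (L z) \<le> 4 * M / s" if z: "z \<in> ball a (s/2)" for z
  proof (rule onorm_le)
    fix v
    have sub: "ball z (s/2) \<subseteq> ball a s"
    proof
      fix w assume "w \<in> ball z (s/2)"
      then show "w \<in> ball a s" using z dist_triangle[of a w z] by simp
    qed
    have "norm (L z v) \<le> 2 * M / (s/2) * norm v"
    proof (rule holomorphic_map_Cauchy)
      show "holomorphic_map_on f (ball z (s/2))" using holomorphic_map_on_subset f sub by blast
    qed (use s M sub L z in auto)
    then show "norm (L z v) \<le> 4 * M / s * norm v" by simp
  qed
  then show ?thesis
    using differentiable_bound[OF convex_ball, of a "s/2" f L "4 * M / s" x y] x y L
    by (meson has_derivative_at_withinI)
qed

section \<open>Harnack's inequality and the maximum principle\<close>

lemma halfplane_Harnack: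
  assumes f: "f holomorphic_on ball 0 1" and neg: "\<And>\<zeta>. \<zeta> \<in> ball 0 1 \<Longrightarrow> Re (f \<zeta>) < 0" and \<zeta>: "cmod \<zeta> \<le> 1/2"
  shows "cmod (f \<zeta>) \<le> 3 * cmod (f 0)"
proof -
  let ?a = "f 0"
  have a: "Re ?a < 0" using neg[of 0] by simp
  have nz: "f z + cnj ?a \<noteq> 0" if "z \<in> ball 0 1" for z
    using neg[OF that] a by (auto simp: complex_eq_iff)
  \<comment> \<open>The Cayley transform of the left half-plane that sends \<open>f 0\<close> to 0,
    so that Schwarz's lemma applies.\<close>
  define \<phi> where "\<phi> z = (f z - ?a) / (f z + cnj ?a)" for z
  have "\<phi> holomorphic_on ball 0 1"
    unfolding \<phi>_def using f nz by (intro holomorphic_intros) auto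
  moreover have "cmod (\<phi> z) < 1" if "norm z < 1" for z
  proof -
    have z: "z \<in> ball 0 1" using that by simp
    \<comment> \<open>The difference of the two squares is four times the product of the negative
      numbers \<open>Re (f z)\<close> and \<open>Re ?a\<close>.\<close>
    have "(cmod (f z - ?a))\<^sup>2 < (cmod (f z + cnj ?a))\<^sup>2"
      using mult_neg_neg[OF neg[OF z] a]
      unfolding cmod_power2 by (simp add: power2_eq_square algebra_simps)
    then have "cmod (f z - ?a) < cmod (f z + cnj ?a)"
      using norm_ge_zero power2_less_imp_less by blast
    then show ?thesis using nz[OF z] by (simp add: \<phi>_def norm_divide)
  qed
  ultimately have le: "cmod (\<phi> \<zeta>) \<le> 1/2"
    using Schwarz_Lemma(1)[of \<phi> \<zeta>] \<zeta> by (simp add: \<phi>_def)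
  have z: "\<zeta> \<in> ball 0 1" using \<zeta> by simp
  \<comment> \<open>With \<open>cmod (\<phi> \<zeta>) \<le> 1/2\<close> the right-hand side is at
    most 3/2 of \<open>cmod (f 0)\<close> and the factor of \<open>f \<zeta>\<close> at least 1/2,
    whence the constant 3.\<close>
  have eq: "f \<zeta> * (1 - \<phi> \<zeta>) = ?a + cnj ?a * \<phi> \<zeta>"
    using nz[OF z] by (simp add: \<phi>_def field_simps)
  have "cmod (f \<zeta>) * (1/2) \<le> cmod (f \<zeta>) * cmod (1 - \<phi> \<zeta>)"
    using norm_triangle_ineq2[of 1 "\<phi> \<zeta>"] le by (intro mult_left_mono) auto
  also have "\<dots> = cmod (?a + cnj ?a * \<phi> \<zeta>)" using eq by (metis norm_mult)
  also have "\<dots> \<le> cmod ?a + cmod ?a * cmod (\<phi> \<zeta>)"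
    by (metis complex_mod_cnj norm_mult norm_triangle_ineq)
  also have "\<dots> \<le> cmod ?a + cmod ?a * (1/2)" using le by (intro add_left_mono mult_left_mono) auto
  finally show ?thesis by simp
qed

lemma cholo_Harnack:
  fixes h :: "complex^'n \<Rightarrow> complex"
  assumes h: "cholo h (ball y s)" and neg: "\<And>z. z \<in> ball y s \<Longrightarrow> Re (h z) < 0" and x: "dist y x \<le> s / 2" and s: "s > 0"
  shows "cmod (h x) \<le> 3 * cmod (h y)"
proof (cases "x = y")
  case True then show ?thesis by simp
next
  case False
  define d where "d = norm (x - y)"
  \<comment> \<open>Normalised so that the unit disc fills the ball along the line through
    \<open>y\<close> and \<open>x\<close>, with \<open>x\<close> at parameter
    \<open>d/s \<le> 1/2\<close>.\<close>
  define v where "v = (s / d) *\<^sub>R (x - y)"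
  have d: "d > 0" "d \<le> s/2" using False x by (auto simp: d_def dist_norm norm_minus_commute)
  have inb: "y + \<zeta> *s v \<in> ball y s" if "\<zeta> \<in> ball 0 1" for \<zeta>
  proof -
    have "norm (\<zeta> *s v) < s"
      using that s d unfolding norm_vector_smult v_def norm_scaleR d_def[symmetric] by simp
    then show ?thesis by (simp add: dist_norm)
  qed
  have "cmod (h (y + of_real (d/s) *s v)) \<le> 3 * cmod (h (y + 0 *s v))"
    by (rule halfplane_Harnack[where f="\<lambda>\<zeta>. h (y + \<zeta> *s v)"])
       (use cholo_line[OF h inb, of "ball 0 1"] inb neg d s in \<open>auto simp: field_simps norm_divide\<close>)
  moreover have "y + complex_of_real (d/s) *s v = x"
    unfolding v_def vec_eq_iff using d s by (auto simp: vector_scaleR_component) (auto simp: scaleR_conv_of_real)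
  moreover have "y + 0 *s v = y" by (simp add: vec_eq_iff)
  ultimately show ?thesis by simp
qed

lemma cholo_Re_max:
  fixes h :: "complex^'n \<Rightarrow> complex"
  assumes h: "cholo h (ball y s)" and le: "\<And>z. z \<in> ball y s \<Longrightarrow> Re (h z) \<le> 0" and y: "Re (h y) = 0" and x: "x \<in> ball y s"
  shows "Re (h x) = 0"
proof (cases "x = y")
  case True then show ?thesis using y by simp
next
  case False
  define d where "d = norm (x - y)"
  have d: "d > 0" "d < s" using False x by (auto simp: d_def dist_norm norm_minus_commute)
  \<comment> \<open>The modulus of the exponential is governed by the real part, so a maximum of
    \<open>Re h\<close> becomes a maximum of the modulus. The disc has radius \<open>s/d > 1\<close>
    and thus contains the parameter 1 of \<open>x\<close>.\<close>
  let ?g = "\<lambda>\<zeta>. exp (h (y + \<zeta> *s (x - y)))"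
  have inb: "y + \<zeta> *s (x - y) \<in> ball y s" if "\<zeta> \<in> ball 0 (s/d)" for \<zeta>
  proof -
    have "norm (\<zeta> *s (x - y)) < s"
      using that d unfolding norm_vector_smult d_def[symmetric] by (simp add: field_simps)
    moreover have "dist y (y + \<zeta> *s (x - y)) = norm (\<zeta> *s (x - y))"
      by (metis add_diff_cancel_left' dist_commute dist_norm)
    ultimately show ?thesis by simp
  qed
  have "?g constant_on ball 0 (s/d)"
  proof (rule maximum_modulus_principle)
    show "?g holomorphic_on ball 0 (s/d)" using cholo_line[OF h inb] by (intro holomorphic_intros)
    show "norm (?g z) \<le> norm (?g 0)" if "z \<in> ball 0 (s/d)" for z
      using le[OF inb[OF that]] y by simp
  qed (use d in auto)
  moreover have "0 \<in> ball 0 (s/d)" "1 \<in> ball (0::complex) (s/d)" using d by auto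
  ultimately have "?g 1 = ?g 0" unfolding constant_on_def by metis
  then have "norm (exp (h x)) = norm (exp (h y))" by simp
  then show ?thesis using y by simp
qed

text \<open>The peak functions at the points of \<open>X - S\<close> make \<open>{x \<in> \<Omega>. H x \<notin> S}\<close> open and closed in \<open>\<Omega>\<close>.\<close>
lemma holomorphic_map_stays_inside:
  assumes H: "holomorphic_map_on H \<Omega>" and \<Omega>: "open \<Omega>" "connected \<Omega>"
    and HX: "\<And>x. x \<in> \<Omega> \<Longrightarrow> H x \<in> X" and S: "open S"
    and peak: "\<And>p. p \<in> X - S \<Longrightarrow> \<exists>r>0. \<exists>P. cholo P (ball p r) \<and> Re (P p) = 0
            \<and> (\<forall>v\<in>X \<inter> ball p r. Re (P v) \<le> 0) \<and> (\<forall>v\<in>S \<inter> ball p r. Re (P v) < 0)"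
    and x0: "x0 \<in> \<Omega>" "H x0 \<in> S" and x: "x \<in> \<Omega>"
  shows "H x \<in> S"
proof -
  have cont: "continuous_on \<Omega> H" using holomorphic_map_on_continuous H .
  let ?A = "\<Omega> \<inter> H -` S" and ?B = "{x\<in>\<Omega>. H x \<notin> S}"
  have A: "open ?A" using continuous_open_preimage[OF cont \<Omega>(1) S] .
  have B: "open ?B"
    unfolding open_contains_ball
  proof
    fix y assume y: "y \<in> ?B"
    then obtain r P where r: "r > 0" and P: "cholo P (ball (H y) r)" "Re (P (H y)) = 0"
      "\<forall>v\<in>X \<inter> ball (H y) r. Re (P v) \<le> 0" "\<forall>v\<in>S \<inter> ball (H y) r. Re (P v) < 0"
      using peak[of "H y"] HX by auto
    have "open (\<Omega> \<inter> H -` ball (H y) r)" using continuous_open_preimage[OF cont \<Omega>(1)] by blast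
    then obtain s where s: "s > 0" "ball y s \<subseteq> \<Omega> \<inter> H -` ball (H y) r"
      using y r unfolding open_contains_ball by force
    have c: "cholo (P \<circ> H) (ball y s)"
      using s by (intro cholo_compose[OF holomorphic_map_on_subset[OF H] P(1)]) auto
    \<comment> \<open>A value outside \<open>S\<close> propagates: the real part of
      \<open>P \<circ> H\<close> has its maximum 0 at \<open>y\<close>, hence vanishes near
      \<open>y\<close>, whereas points of \<open>S\<close> near \<open>H y\<close> have negative
      \<open>Re P\<close>.\<close>
    have z: "Re ((P \<circ> H) z) = 0" if "z \<in> ball y s" for z
      using cholo_Re_max[OF c _ _ that] s P(2,3) HX by fastforce
    have "ball y s \<subseteq> ?B"
    proof
      fix z assume zz: "z \<in> ball y s"
      then have "H z \<in> ball (H y) r" "z \<in> \<Omega>" using s by auto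
      then show "z \<in> ?B" using z[OF zz] P(4) by (force simp: o_def)
    qed
    then show "\<exists>e>0. ball y e \<subseteq> ?B" using s by blast
  qed
  have "?B = {}"
    using connectedD[OF \<Omega>(2) A B] x0 by blast
  then show ?thesis using x by blast
qed

section \<open>Locally uniform limits\<close>

text \<open>Local uniformity is all that can be asked: the maps considered later are holomorphic
  near a given point only from some index on.\<close>

definition lconv :: "(nat \<Rightarrow> 'a::metric_space \<Rightarrow> 'b::metric_space) \<Rightarrow> ('a \<Rightarrow> 'b) \<Rightarrow> 'a set \<Rightarrow> bool" where
  "lconv f g \<Omega> \<longleftrightarrow> (\<forall>x\<in>\<Omega>. \<exists>s>0. uniform_limit (ball x s) f g sequentially)"

text \<open>The index \<open>J\<close> may depend on the ball, because the domains of the maps vary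
  with \<open>j\<close> and contain a given ball only eventually.\<close>

definition evt_holo_bdd :: "(nat \<Rightarrow> complex^'n \<Rightarrow> complex^'m) \<Rightarrow> (complex^'n) set \<Rightarrow> bool" where
  "evt_holo_bdd f \<Omega> \<longleftrightarrow> (\<forall>x\<in>\<Omega>. \<exists>s>0. \<exists>M J. \<forall>j\<ge>J. holomorphic_map_on (f j) (ball x s) \<and> (\<forall>y\<in>ball x s. norm (f j y) \<le> M))"

text \<open>Evaluation at moving points is what permits passing to the limit in compositions such as
  \<open>f j (k j v)\<close>.\<close>

lemma lconv_tendsto_at:
  assumes "lconv f g \<Omega>" "x \<in> \<Omega>" "continuous (at x) g" "u \<longlonglongrightarrow> x"
  shows "(\<lambda>j. f j (u j)) \<longlonglongrightarrow> g x"
proof -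
  obtain s where s: "s > 0" and lim: "uniform_limit (ball x s) f g sequentially"
    using assms(1,2) unfolding lconv_def by blast
  have ev: "\<forall>\<^sub>F j in sequentially. u j \<in> ball x s"
    using tendstoD[OF assms(4) s] by (simp add: dist_commute)
  have gu: "(\<lambda>j. g (u j)) \<longlonglongrightarrow> g x"
    using assms(3,4) by (simp add: continuous_at_sequentially o_def)
  show ?thesis
  proof (rule tendstoI)
    fix e :: real assume e: "e > 0"
    with lim have "\<forall>\<^sub>F j in sequentially. \<forall>y\<in>ball x s. dist (f j y) (g y) < e/2"
      unfolding uniform_limit_iff by (meson half_gt_zero)
    moreover have "\<forall>\<^sub>F j in sequentially. dist (g (u j)) (g x) < e/2"
      using tendstoD[OF gu, of "e/2"] e by simp
    ultimately show "\<forall>\<^sub>F j in sequentially. dist (f j (u j)) (g x) < e"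
      using ev
    proof eventually_elim
      case (elim j)
      then have "dist (f j (u j)) (g (u j)) < e/2" by blast
      with elim(2) show ?case using dist_triangle[of "f j (u j)" "g x" "g (u j)"] by linarith
    qed
  qed
qed

lemma lconv_subseq:
  assumes "lconv f g \<Omega>" "strict_mono k"
  shows "lconv (\<lambda>j. f (k j)) g \<Omega>"
  unfolding lconv_def
proof
  fix x assume "x \<in> \<Omega>"
  then obtain s where s: "s > 0" "uniform_limit (ball x s) f g sequentially"
    using assms(1) unfolding lconv_def by blast
  have "uniform_limit (ball x s) (\<lambda>j. f (k j)) g sequentially"
    unfolding uniform_limit_iff
  proof (intro allI impI)
    fix e :: real assume "e > 0"
    with s(2) have "\<forall>\<^sub>F j in sequentially. \<forall>y\<in>ball x s. dist (f j y) (g y) < e"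
      by (simp add: uniform_limit_iff)
    from eventually_subseq[OF assms(2) this]
    show "\<forall>\<^sub>F j in sequentially. \<forall>y\<in>ball x s. dist (f (k j) y) (g y) < e" .
  qed
  then show "\<exists>s>0. uniform_limit (ball x s) (\<lambda>j. f (k j)) g sequentially" using s by blast
qed

lemma evt_holo_bdd_subseq:
  assumes "evt_holo_bdd f \<Omega>" "strict_mono k"
  shows "evt_holo_bdd (\<lambda>j. f (k j)) \<Omega>"
  unfolding evt_holo_bdd_def
proof
  fix x assume "x \<in> \<Omega>"
  then obtain s M J where s: "s > 0" and J: "\<And>j. j \<ge> J \<Longrightarrow> holomorphic_map_on (f j) (ball x s) \<and> (\<forall>y\<in>ball x s. norm (f j y) \<le> M)"
    using assms(1) unfolding evt_holo_bdd_def by blast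
  show "\<exists>s>0. \<exists>M J. \<forall>j\<ge>J. holomorphic_map_on (f (k j)) (ball x s) \<and> (\<forall>y\<in>ball x s. norm (f (k j) y) \<le> M)"
    using s J seq_suble[OF assms(2)] by (metis order_trans)
qed

text \<open>Cauchy's estimate for differences makes the derivatives uniformly Cauchy on the half
  ball. Their limit is then the derivative of the limit map, and complex linearity passes to it
  pointwise.\<close>

lemma holomorphic_map_uniform_limit:
  fixes f :: "nat \<Rightarrow> complex^'n \<Rightarrow> complex^'m"
  assumes s: "s > 0" and lim: "uniform_limit (ball a s) f g sequentially"
    and hol: "\<And>j. j \<ge> J \<Longrightarrow> holomorphic_map_on (f j) (ball a s)"
  shows "holomorphic_map_on g (ball a (s/2))"
proof -
  let ?B = "ball a (s/2)"
  have sub: "ball x (s/2) \<subseteq> ball a s" if "x \<in> ?B" for x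
  proof
    fix w assume "w \<in> ball x (s/2)"
    then show "w \<in> ball a s" using that dist_triangle[of a w x] by simp
  qed
  \<comment> \<open>The shift makes every term holomorphic, not only those from \<open>J\<close>
    on.\<close>
  define h where "h n = f (n + J)" for n
  have "\<forall>n. \<forall>x\<in>?B. \<exists>L. (h n has_derivative L) (at x) \<and> (\<forall>c v. L (c *s v) = c *s L v)"
    using hol s unfolding h_def holomorphic_map_on_def by (simp add: less_imp_le)
  then obtain L where L: "\<And>n x. x \<in> ?B \<Longrightarrow> (h n has_derivative L n x) (at x)"
    and Lc: "\<And>n x c v. x \<in> ?B \<Longrightarrow> L n x (c *s v) = c *s L n x v" by metis
  have cau: "\<exists>N. \<forall>m\<ge>N. \<forall>n\<ge>N. \<forall>x\<in>?B. \<forall>v. norm (L m x v - L n x v) \<le> e * norm v" if e: "e > 0" for e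
  proof -
    \<comment> \<open>Cauchy's estimate for a difference bounded by \<open>2 * e'\<close> on a ball
      of radius \<open>s/2\<close> has the factor \<open>2 * (2 * e') / (s/2)\<close>, which is
      \<open>e\<close>.\<close>
    define e' where "e' = e * s / 8"
    have e': "e' > 0" using e s by (simp add: e'_def)
    from lim e' have "\<forall>\<^sub>F j in sequentially. \<forall>y\<in>ball a s. dist (f j y) (g y) < e'"
      by (simp add: uniform_limit_iff)
    then obtain N where N: "\<And>j y. j \<ge> N \<Longrightarrow> y \<in> ball a s \<Longrightarrow> dist (f j y) (g y) < e'"
      unfolding eventually_sequentially by blast
    have "norm (L m x v - L n x v) \<le> e * norm v" if mn: "m \<ge> N" "n \<ge> N" and x: "x \<in> ?B" for m n x v
    proof -
      have "norm (L m x v - L n x v) \<le> 2 * (2 * e') / (s/2) * norm v"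
      proof (rule holomorphic_map_Cauchy[where f="\<lambda>z. h m z - h n z" and a=x and L="\<lambda>v. L m x v - L n x v"])
        show "holomorphic_map_on (\<lambda>z. h m z - h n z) (ball x (s/2))"
          using hol sub[OF x] unfolding h_def
          by (intro holomorphic_map_on_diff) (meson holomorphic_map_on_subset le_add2)+
        show "((\<lambda>z. h m z - h n z) has_derivative (\<lambda>v. L m x v - L n x v)) (at x)"
          using has_derivative_diff[OF L[OF x] L[OF x]] .
        show "norm (h m z - h n z) \<le> 2 * e'" if "z \<in> ball x (s/2)" for z
        proof -
          have "z \<in> ball a s" using sub[OF x] that by blast
          then have "dist (h m z) (g z) < e'" "dist (h n z) (g z) < e'"
            using N mn unfolding h_def by auto
          then show ?thesis using dist_triangle2[of "h m z" "h n z" "g z"] by (simp add: dist_norm)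
        qed
      qed (use s in auto)
      also have "\<dots> = e * norm v" using s by (simp add: e'_def)
      finally show ?thesis .
    qed
    then show ?thesis by blast
  qed
  define g' where "g' x v = lim (\<lambda>n. L n x v)" for x v
  have Lconv: "(\<lambda>n. L n x v) \<longlonglongrightarrow> g' x v" if x: "x \<in> ?B" for x v
  proof -
    have "Cauchy (\<lambda>n. L n x v)"
    proof (rule CauchyI)
      fix e :: real assume e: "e > 0"
      have pos: "e / (2 * (norm v + 1)) > 0" using e by (simp add: add_nonneg_pos)
      obtain N where N: "\<forall>m\<ge>N. \<forall>n\<ge>N. \<forall>x\<in>?B. \<forall>v'. norm (L m x v' - L n x v') \<le> e / (2 * (norm v + 1)) * norm v'"
        using cau[OF pos] by blast
      have "e / (2 * (norm v + 1)) * norm v < e"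
      proof -
        have "norm v + 1 > 0" by (simp add: add_nonneg_pos)
        then have "e * norm v < e * (2 * (norm v + 1))" using e by (intro mult_strict_left_mono) auto
        then show ?thesis using \<open>norm v + 1 > 0\<close> by (simp add: field_simps)
      qed
      then show "\<exists>M. \<forall>m\<ge>M. \<forall>n\<ge>M. norm (L m x v - L n x v) < e"
        using N x by (meson le_less_trans)
    qed
    then show ?thesis unfolding g'_def by (simp add: Cauchy_convergent_iff convergent_LIMSEQ_iff)
  qed
  have nle: "\<forall>\<^sub>F n in sequentially. \<forall>x\<in>?B. \<forall>v. norm (L n x v - g' x v) \<le> e * norm v" if e: "e > 0" for e
  proof -
    obtain N where N: "\<forall>m\<ge>N. \<forall>n\<ge>N. \<forall>x\<in>?B. \<forall>v. norm (L m x v - L n x v) \<le> e * norm v"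
      using cau[OF e] by blast
    have "norm (L m x v - g' x v) \<le> e * norm v" if "m \<ge> N" "x \<in> ?B" for m x v
    proof (rule tendsto_upperbound)
      show "(\<lambda>n. norm (L m x v - L n x v)) \<longlonglongrightarrow> norm (L m x v - g' x v)"
        using Lconv[OF that(2)] by (intro tendsto_intros)
      show "\<forall>\<^sub>F n in sequentially. norm (L m x v - L n x v) \<le> e * norm v"
        using N that unfolding eventually_sequentially by blast
    qed simp
    then show ?thesis unfolding eventually_sequentially by blast
  qed
  have hlim: "(\<lambda>n. h n x) \<longlonglongrightarrow> g x" if "x \<in> ball a s" for x
    unfolding h_def using tendsto_uniform_limitI[OF lim that] by (rule LIMSEQ_ignore_initial_segment)
  have "\<exists>G. \<forall>x\<in>?B. (\<lambda>n. h n x) \<longlonglongrightarrow> G x \<and> (G has_derivative g' x) (at x within ?B)"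
    by (rule has_derivative_sequence[of ?B h L g' a "g a"])
       (use L nle s hlim in \<open>auto intro: has_derivative_at_withinI\<close>)
  then obtain G where G: "\<And>x. x \<in> ?B \<Longrightarrow> (\<lambda>n. h n x) \<longlonglongrightarrow> G x" "\<And>x. x \<in> ?B \<Longrightarrow> (G has_derivative g' x) (at x within ?B)"
    by blast
  have eq: "G x = g x" if "x \<in> ?B" for x
    using LIMSEQ_unique[OF G(1)[OF that] hlim] that s by auto
  have gc: "g' x (c *s v) = c *s g' x v" if "x \<in> ?B" for x c v
  proof -
    have "(\<lambda>n. L n x (c *s v)) \<longlonglongrightarrow> c *s g' x v"
      using bounded_linear.tendsto[OF bounded_linear_vector_smult_right[of c] Lconv[OF that, of v]] Lc[OF that] by simp
    then show ?thesis using LIMSEQ_unique Lconv[OF that] by blast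
  qed
  show ?thesis
    unfolding holomorphic_map_on_def
  proof
    fix x assume x: "x \<in> ?B"
    have "(g has_derivative g' x) (at x within ?B)"
      using G(2)[OF x] eq x by (metis (no_types, lifting) has_derivative_transform)
    then have "(g has_derivative g' x) (at x)" using x by (simp add: at_within_open[OF _ open_ball])
    then show "\<exists>L. (g has_derivative L) (at x) \<and> (\<forall>c v. L (c *s v) = c *s L v)" using gc[OF x] by blast
  qed
qed

text \<open>A diagonal subsequence converges on a countable dense set; the Lipschitz bound from
  Cauchy's estimate is the equicontinuity that upgrades this to locally uniform convergence.\<close>

lemma Montel_subsequence:
  fixes f :: "nat \<Rightarrow> complex^'n \<Rightarrow> complex^'m"
  assumes f: "evt_holo_bdd f \<Omega>"
  obtains k g where "strict_mono k" "holomorphic_map_on g \<Omega>" "lconv (\<lambda>j. f (k j)) g \<Omega>"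
proof -
  obtain T :: "(complex^'n) set" where T: "countable T" "\<And>X. open X \<Longrightarrow> X \<noteq> {} \<Longrightarrow> \<exists>d\<in>T. d \<in> X"
    using countable_dense_setE by blast
  let ?bd = "\<lambda>x. \<exists>M. \<forall>j. norm (f j x) \<le> M"
  have bd: "?bd x" if "x \<in> ball y s" "\<And>j z. j \<ge> J \<Longrightarrow> z \<in> ball y s \<Longrightarrow> norm (f j z) \<le> M" for x y s J M
  proof -
    have "finite ((\<lambda>j. norm (f j x)) ` {..<J})" by simp
    then obtain M' where M': "\<forall>v\<in>(\<lambda>j. norm (f j x)) ` {..<J}. v \<le> M'"
      by (meson bdd_above.E bdd_above_finite)
    have "norm (f j x) \<le> max M M'" for j
      using M' that by (cases "j < J") (auto simp: max.coboundedI1 max.coboundedI2)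
    then show ?thesis by blast
  qed
  \<comment> \<open>By \<open>bd\<close> every dense point close enough to a point of \<Omega>
    belongs to \<open>S\<close>, since only finitely many indices escape the local bound.\<close>
  define S where "S = {x\<in>T. ?bd x}"
  have "\<forall>x\<in>S. \<exists>M. \<forall>j. norm (f j x) \<le> M" unfolding S_def by blast
  then obtain M where M: "\<And>x j. x \<in> S \<Longrightarrow> norm (f j x) \<le> M x" by metis
  \<comment> \<open>The factor brings all pointwise bounds below the common bound 1; it is undone in
    \<open>conv\<close>.\<close>
  obtain k where k: "strict_mono (k::nat\<Rightarrow>nat)"
    and kl: "\<And>x. x \<in> S \<Longrightarrow> \<exists>l. (\<lambda>n. (1 / (1 + \<bar>M x\<bar>)) *\<^sub>R f (k n) x) \<longlonglongrightarrow> l"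
  proof (rule function_convergent_subsequence[of S "\<lambda>n x. (1 / (1 + \<bar>M x\<bar>)) *\<^sub>R f n x" 1])
    show "countable S" using T(1) by (simp add: S_def)
    show "norm ((1 / (1 + \<bar>M x\<bar>)) *\<^sub>R f n x) \<le> 1" if "x \<in> S" for n x
      using M[OF that, of n] by (simp add: field_simps)
  qed auto
  have conv: "Cauchy (\<lambda>n. f (k n) x)" if xS: "x \<in> S" for x
  proof -
    obtain l where l: "(\<lambda>n. (1 / (1 + \<bar>M x\<bar>)) *\<^sub>R f (k n) x) \<longlonglongrightarrow> l" using kl[OF xS] by auto
    have "(\<lambda>n. f (k n) x) \<longlonglongrightarrow> (1 + \<bar>M x\<bar>) *\<^sub>R l"
    proof -
      have "1 + \<bar>M x\<bar> \<noteq> 0" using abs_ge_zero[of "M x"] by linarith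
      then show ?thesis using tendsto_scaleR[OF tendsto_const[of "1 + \<bar>M x\<bar>"] l] by simp
    qed
    then show ?thesis using LIMSEQ_imp_Cauchy by blast
  qed
  define g where "g x = lim (\<lambda>n. f (k n) x)" for x
  have main: "\<exists>s>0. uniform_limit (ball x s) (\<lambda>n. f (k n)) g sequentially \<and> (\<exists>J. \<forall>j\<ge>J. holomorphic_map_on (f (k j)) (ball x s))"
    if x: "x \<in> \<Omega>" for x
  proof -
    obtain s C J where s: "s > 0" and J: "\<forall>j\<ge>J. holomorphic_map_on (f j) (ball x s) \<and> (\<forall>y\<in>ball x s. norm (f j y) \<le> C)"
      using bspec[OF f[unfolded evt_holo_bdd_def] x] by blast
    have hol: "\<And>j. j \<ge> J \<Longrightarrow> holomorphic_map_on (f j) (ball x s)"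
      and C: "\<And>j y. j \<ge> J \<Longrightarrow> y \<in> ball x s \<Longrightarrow> norm (f j y) \<le> C"
      using J by blast+
    \<comment> \<open>The summand 1 keeps \<open>K\<close> positive when \<open>C\<close> is
      0.\<close>
    define K where "K = 4 * C / s + 1"
    have C0: "C \<ge> 0" using C[of J x] s norm_ge_zero[of "f J x"] by (meson centre_in_ball order_refl order_trans)
    have K: "K > 0" using C0 s by (simp add: K_def add_nonneg_pos)
    have lip: "norm (f j y - f j z) \<le> K * norm (y - z)" if "j \<ge> J" "y \<in> ball x (s/2)" "z \<in> ball x (s/2)" for j y z
    proof -
      have "norm (f j y - f j z) \<le> 4 * C / s * norm (y - z)"
        using holomorphic_map_Lipschitz[OF hol s] C that by blast
      also have "\<dots> \<le> K * norm (y - z)" by (intro mult_right_mono) (auto simp: K_def)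
      finally show ?thesis .
    qed
    have "uniformly_Cauchy_on (ball x (s/4)) (\<lambda>n. f (k n))"
    proof (rule uniformly_Cauchy_onI)
      fix e :: real assume e: "e > 0"
      \<comment> \<open>Each of the two Lipschitz errors stays below e/4, which leaves e/2 for the
        finitely many points of the net.\<close>
      define d where "d = e / (4 * K)"
      have d: "d > 0" using e K by (simp add: d_def)
      have "cball x (s/4) \<subseteq> (\<Union>z\<in>S \<inter> ball x (s/2). ball z d)"
      proof
        fix y assume y: "y \<in> cball x (s/4)"
        have "y \<in> ball y d \<inter> ball x (s/2)" using y d s by auto
        then obtain z where z: "z \<in> T" "z \<in> ball y d \<inter> ball x (s/2)"
          using T(2)[OF open_Int[OF open_ball open_ball], of y d x "s/2"] by blast
        have "?bd z" using bd[of z x s J C] C z s by auto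
        then have "z \<in> S \<inter> ball x (s/2)" using z by (auto simp: S_def)
        moreover have "y \<in> ball z d" using z by (simp add: dist_commute)
        ultimately show "y \<in> (\<Union>z\<in>S \<inter> ball x (s/2). ball z d)" by blast
      qed
      then obtain Z where Z: "Z \<subseteq> S \<inter> ball x (s/2)" "finite Z" "cball x (s/4) \<subseteq> (\<Union>z\<in>Z. ball z d)"
        by (rule compactE_image[OF compact_cball open_ball])
      have "\<forall>z\<in>Z. \<exists>N. \<forall>m\<ge>N. \<forall>n\<ge>N. norm (f (k m) z - f (k n) z) < e/2"
        (is "\<forall>z\<in>Z. ?Q z")
      proof
        fix z assume "z \<in> Z"
        then show "\<exists>N. \<forall>m\<ge>N. \<forall>n\<ge>N. norm (f (k m) z - f (k n) z) < e/2"
          using CauchyD[OF conv[of z], of "e/2"] Z(1) e by (meson IntD1 half_gt_zero subsetD)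
      qed
      then obtain N where N: "\<forall>z\<in>Z. \<forall>m\<ge>N z. \<forall>n\<ge>N z. norm (f (k m) z - f (k n) z) < e/2"
        by (rule bchoice[THEN exE])
      obtain N1 where N1: "\<And>z. z \<in> Z \<Longrightarrow> N z \<le> N1"
        using finite_nat_set_iff_bounded_le[of "N ` Z"] Z(2) by auto
      have "dist (f (k m) y) (f (k n) y) < e" if y: "y \<in> ball x (s/4)" and mn: "m \<ge> max N1 J" "n \<ge> max N1 J" for m n y
      proof -
        have "y \<in> cball x (s/4)" using y by simp
        then obtain z where z: "z \<in> Z" "y \<in> ball z d" using Z(3) by blast
        have zz: "z \<in> ball x (s/2)" "y \<in> ball x (s/2)" using Z(1) z y s by auto
        have kk: "k m \<ge> J" "k n \<ge> J" using mn seq_suble[OF k] by (meson max.boundedE order_trans)+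
        have yz: "K * norm (y - z) < e/4"
        proof -
          have "K * norm (y - z) < K * d" using z K by (simp add: dist_norm norm_minus_commute)
          then show ?thesis using K by (simp add: d_def)
        qed
        have 1: "norm (f (k m) y - f (k m) z) < e/4" "norm (f (k n) y - f (k n) z) < e/4"
          using lip[OF kk(1) zz(2,1)] lip[OF kk(2) zz(2,1)] yz by auto
        have 2: "norm (f (k m) z - f (k n) z) < e/2" using bspec[OF N z(1)] N1[OF z(1)] mn by simp
        have "dist (f (k m) y) (f (k n) y) \<le> dist (f (k m) y) (f (k m) z) + dist (f (k m) z) (f (k n) z) + dist (f (k n) y) (f (k n) z)"
          by (smt (verit) dist_commute dist_triangle)
        then show ?thesis using 1 2 by (simp add: dist_norm)
      qed
      then show "\<exists>M. \<forall>x\<in>ball x (s/4). \<forall>m\<ge>M. \<forall>n\<ge>M. dist (f (k m) x) (f (k n) x) < e" by blast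
    qed
    then have "uniform_limit (ball x (s/4)) (\<lambda>n. f (k n)) g sequentially"
      unfolding g_def using Cauchy_uniformly_convergent uniformly_convergent_uniform_limit_iff by blast
    moreover have "holomorphic_map_on (f (k j)) (ball x (s/4))" if "j \<ge> J" for j
    proof (rule holomorphic_map_on_subset[OF hol])
      show "k j \<ge> J" using that seq_suble[OF k] order_trans by blast
      show "ball x (s/4) \<subseteq> ball x s" using s by (auto intro: subset_ball)
    qed
    ultimately show ?thesis using s by (intro exI[of _ "s/4"]) auto
  qed
  have "holomorphic_map_on g \<Omega>"
    unfolding holomorphic_map_on_def
  proof
    fix x assume "x \<in> \<Omega>"
    then obtain s J where s: "s > 0" "uniform_limit (ball x s) (\<lambda>n. f (k n)) g sequentially"
      "\<forall>j\<ge>J. holomorphic_map_on (f (k j)) (ball x s)"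
      using main by blast
    then have "holomorphic_map_on g (ball x (s/2))" using holomorphic_map_uniform_limit by blast
    then show "\<exists>L. (g has_derivative L) (at x) \<and> (\<forall>c v. L (c *s v) = c *s L v)"
      using s(1) by (simp add: holomorphic_map_on_def)
  qed
  moreover have "lconv (\<lambda>j. f (k j)) g \<Omega>" using main unfolding lconv_def by blast
  ultimately show thesis using that k by blast
qed

section \<open>Strictly pseudoconvex boundary points\<close>

lemma iI_smult_simps [simp]:
  "\<i> *s (\<i> *s v) = - (v::complex^'n)" "norm (\<i> *s v) = norm v"
  by (simp_all add: vec_eq_iff norm_vector_smult)

text \<open>Splitting \<open>c *s v\<close> into real multiples of \<open>v\<close> and
  \<open>\<i> *s v\<close> reduces complex linearity of a real-linear map to the single multiplier
  \<open>\<i>\<close>.\<close>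

lemma complex_linear_of_i:
  fixes L :: "complex^'n \<Rightarrow> complex"
  assumes L: "linear L" and i: "\<And>v. L (\<i> *s v) = \<i> * L v"
  shows "L (c *s v) = c * L v"
proof -
  have "c *s v = Re c *\<^sub>R v + Im c *\<^sub>R (\<i> *s v)"
    by (simp add: vec_eq_iff complex_eq_iff algebra_simps)
  then have "L (c *s v) = Re c *\<^sub>R L v + Im c *\<^sub>R (\<i> * L v)"
    using i by (simp add: linear_add[OF L] linear_scale[OF L])
  also have "\<dots> = c * L v" by (simp add: complex_eq_iff)
  finally show ?thesis .
qed

text \<open>For a function with gradient \<open>g\<close> and Hessian \<open>B\<close>, this is the Levi polynomial.\<close>
definition levi_poly :: "complex^'n \<Rightarrow> ((complex^'n) \<Rightarrow>\<^sub>L (complex^'n)) \<Rightarrow> complex^'n \<Rightarrow> complex" where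
  "levi_poly g B v = cip v g + Complex ((B v \<bullet> v - B (\<i> *s v) \<bullet> (\<i> *s v)) / 4)
      (- (B v \<bullet> (\<i> *s v) + B (\<i> *s v) \<bullet> v) / 4)"

text \<open>The correction term in \<open>levi_poly\<close> is the holomorphic quadratic polynomial
  whose real part is the pluriharmonic part of \<open>(B v \<bullet> v) / 2\<close>, symmetrised
  because \<open>B\<close> itself may fail to be symmetric. What it misses of that form is a quarter
  of the Levi sum.\<close>

lemma Re_levi_poly:
  "Re (levi_poly g B v) = g \<bullet> v + (B v \<bullet> v) / 2 - (B v \<bullet> v + B (\<i> *s v) \<bullet> (\<i> *s v)) / 4"
  by (simp add: levi_poly_def Re_cip inner_commute field_simps)

lemma inner_blinfun_le: "\<bar>blinfun_apply B v \<bullet> w\<bar> \<le> norm B * norm v * norm w"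
  using Cauchy_Schwarz_ineq2[of "B v" w] mult_right_mono[OF norm_blinfun[of B v], of "norm w"] by fastforce

lemma norm_levi_poly_diff_cip: "cmod (levi_poly g B v - cip v g) \<le> norm B * (norm v)\<^sup>2"
proof -
  have b: "\<bar>B u \<bullet> w\<bar> \<le> norm B * (norm v)\<^sup>2" if "norm u = norm v" "norm w = norm v" for u w
    using inner_blinfun_le[of B u w] that by (simp add: power2_eq_square mult.assoc)
  have "\<bar>(a - b) / 4\<bar> + \<bar>- (c + d) / 4\<bar> \<le> K"
    if "\<bar>a\<bar> \<le> K" "\<bar>b\<bar> \<le> K" "\<bar>c\<bar> \<le> K" "\<bar>d\<bar> \<le> K" for a b c d K :: real
  proof -
    have "\<bar>a - b\<bar> \<le> 2 * K" "\<bar>c + d\<bar> \<le> 2 * K" using that by linarith+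
    then show ?thesis unfolding abs_divide abs_minus_cancel by simp
  qed
  note k = this[OF b b b b, of v v "\<i> *s v" "\<i> *s v" v "\<i> *s v" "\<i> *s v" v]
  have "cmod (Complex ((B v \<bullet> v - B (\<i> *s v) \<bullet> (\<i> *s v)) / 4) (- (B v \<bullet> (\<i> *s v) + B (\<i> *s v) \<bullet> v) / 4))
      \<le> norm B * (norm v)\<^sup>2"
    using cmod_le[of "Complex ((B v \<bullet> v - B (\<i> *s v) \<bullet> (\<i> *s v)) / 4) (- (B v \<bullet> (\<i> *s v) + B (\<i> *s v) \<bullet> v) / 4)"] k
    unfolding complex.sel by simp
  then show ?thesis by (simp add: levi_poly_def)
qed

lemma norm_levi_poly_le: "cmod (levi_poly g B v) \<le> norm g * norm v + norm B * (norm v)\<^sup>2"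
  using norm_levi_poly_diff_cip[of g B v] norm_cip_le[of v g] norm_triangle_sub[of "levi_poly g B v" "cip v g"]
  by (simp add: mult.commute)

lemma cholo_levi_poly: "cholo (\<lambda>w. levi_poly g B (w - q)) U"
  unfolding cholo_def
proof
  fix z
  define v where "v = z - q"
  define L where "L h = cip h g + Complex ((B v \<bullet> h + B h \<bullet> v - (B (\<i> *s v) \<bullet> (\<i> *s h) + B (\<i> *s h) \<bullet> (\<i> *s v))) / 4)
      (- (B v \<bullet> (\<i> *s h) + B h \<bullet> (\<i> *s v) + (B (\<i> *s v) \<bullet> h + B (\<i> *s h) \<bullet> v)) / 4)" for h
  have V: "((\<lambda>w. w - q) has_derivative (\<lambda>h. h)) (at z)"
    by (auto intro!: derivative_eq_intros)
  have sm: "((\<lambda>w. \<i> *s (w - q)) has_derivative (\<lambda>h. \<i> *s h)) (at z)"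
    using bounded_linear.has_derivative[OF bounded_linear_vector_smult_right V] .
  have cp: "((\<lambda>w. cip (w - q) g) has_derivative (\<lambda>h. cip h g)) (at z)"
    using bounded_linear.has_derivative[OF bounded_linear_cip V] .
  have B1: "((\<lambda>w. B (\<i> *s (w - q))) has_derivative (\<lambda>h. B (\<i> *s h))) (at z)"
    using bounded_linear.has_derivative[OF blinfun.bounded_linear_right sm] .
  have B2: "((\<lambda>w. B (w - q)) has_derivative (\<lambda>h. B h)) (at z)"
    by (auto intro!: derivative_eq_intros)
  have "((\<lambda>w. levi_poly g B (w - q)) has_derivative L) (at z)"
    unfolding levi_poly_def Complex_eq L_def v_def
    by (rule has_derivative_add[OF cp has_derivative_add[OF has_derivative_of_real has_derivative_mult_right[OF has_derivative_of_real]]]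
             bounded_linear.has_derivative[OF bounded_linear_divide]
             has_derivative_diff[OF has_derivative_inner[OF B2 V] has_derivative_inner[OF B1 sm]]
             has_derivative_minus[OF has_derivative_add[OF has_derivative_inner[OF B2 sm] has_derivative_inner[OF B1 V]]])+
  moreover have "L (c *s h) = c * L h" for c h
  proof (rule complex_linear_of_i)
    show "linear L" using \<open>(_ has_derivative L) _\<close> has_derivative_linear by blast
    show "L (\<i> *s v) = \<i> * L v" for v
      by (simp add: L_def cip_smult_left complex_eq_iff blinfun.minus_right inner_minus_right inner_minus_left
          add_divide_distrib diff_divide_distrib)
  qed
  ultimately show "\<exists>L. ((\<lambda>w. levi_poly g B (w - q)) has_derivative L) (at z) \<and> (\<forall>c v. L (c *s v) = c * L v)"
    by blast
qed

text \<open>The inequalities on \<open>q + v\<close> say that near \<open>q\<close> the set \<open>D\<close> agrees, up to an error \<open>\<epsilon> |v|\<^sup>2\<close>, with the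
  sublevel set of the quadratic form given by \<open>g\<close> and \<open>B\<close>. All constants are explicit because they
  have to be uniform along a family of domains.\<close>
definition spsc_at :: "(complex^'n) set \<Rightarrow> complex^'n \<Rightarrow> complex^'n \<Rightarrow> ((complex^'n) \<Rightarrow>\<^sub>L (complex^'n))
    \<Rightarrow> real \<Rightarrow> real \<Rightarrow> real \<Rightarrow> real \<Rightarrow> bool" where
  "spsc_at D q g B c C \<epsilon> r \<longleftrightarrow> c \<le> norm g \<and> norm g \<le> C \<and> norm B \<le> C
     \<and> (\<forall>v. c * (norm v)\<^sup>2 \<le> B v \<bullet> v + B (\<i> *s v) \<bullet> (\<i> *s v))
     \<and> (\<forall>v. norm v < r \<longrightarrow> (q + v \<in> D \<longrightarrow> g \<bullet> v + (B v \<bullet> v) / 2 \<le> \<epsilon> * (norm v)\<^sup>2)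
                          \<and> (g \<bullet> v + (B v \<bullet> v) / 2 < - (\<epsilon> * (norm v)\<^sup>2) \<longrightarrow> q + v \<in> D))"

text \<open>The error c/8 uses up half of the gain c/4 from the Levi form in
  \<open>Re_levi_poly\<close>. The other half makes the Levi polynomial a local peak function at
  \<open>q\<close>, with quadratic decay.\<close>

lemma spsc_at_support:
  assumes "spsc_at D q g B c C (c/8) r" "q + v \<in> D" "norm v < r"
  shows "Re (levi_poly g B v) \<le> - (c/8) * (norm v)\<^sup>2"
proof -
  have "g \<bullet> v + (B v \<bullet> v) / 2 \<le> (c/8) * (norm v)\<^sup>2" "c * (norm v)\<^sup>2 \<le> B v \<bullet> v + B (\<i> *s v) \<bullet> (\<i> *s v)"
    using assms unfolding spsc_at_def by blast+
  then show ?thesis unfolding Re_levi_poly by (simp add: algebra_simps)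
qed

lemma spsc_at_support_closure:
  assumes s: "spsc_at D q g B c C (c/8) r" and v: "q + v \<in> closure D" "norm v < r"
  shows "Re (levi_poly g B v) \<le> - (c/8) * (norm v)\<^sup>2"
proof -
  obtain x where x: "\<And>n. x n \<in> D" "x \<longlonglongrightarrow> q + v"
    using v(1) closure_sequential by blast
  have lim: "(\<lambda>n. x n - q) \<longlonglongrightarrow> v" using tendsto_diff[OF x(2) tendsto_const[of q]] by simp
  have cont: "isCont (\<lambda>w. levi_poly g B (w - q)) (q + v)"
    using cholo_continuous[OF cholo_levi_poly[of g B q UNIV]] continuous_on_eq_continuous_at by blast
  have l1: "(\<lambda>n. Re (levi_poly g B (x n - q))) \<longlonglongrightarrow> Re (levi_poly g B (q + v - q))"
    using isCont_tendsto_compose[OF cont x(2)] by (intro tendsto_Re)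
  have l2: "(\<lambda>n. - (c/8) * (norm (x n - q))\<^sup>2) \<longlonglongrightarrow> - (c/8) * (norm v)\<^sup>2"
    by (intro tendsto_intros lim)
  have "\<forall>\<^sub>F n in sequentially. norm (x n - q) < r"
    using order_tendstoD(2)[OF tendsto_norm[OF lim] v(2)] .
  then have ev: "\<forall>\<^sub>F n in sequentially. Re (levi_poly g B (x n - q)) \<le> - (c/8) * (norm (x n - q))\<^sup>2"
    by eventually_elim (use spsc_at_support[OF s] x(1) in simp)
  show ?thesis using tendsto_le[OF sequentially_bot l2 l1 ev] by simp
qed

text \<open>In the ball, |v|^2 < -2 \<rho> (v . sgn g) bounds \<open>g \<bullet> v\<close> by -c
  |v|^2 / (2 \<rho>), and \<open>\<rho> \<le> c / (2 * C)\<close> turns this into -C |v|^2, enough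
  to absorb the Hessian and the error. The radius depends on the constants alone.\<close>

lemma spsc_at_interior_ball:
  assumes s: "spsc_at D q g B c C (c/8) r" and c: "c > 0" and \<rho>: "0 < \<rho>" "\<rho> \<le> r/2" "\<rho> \<le> c / (2 * C)"
  shows "ball (q - \<rho> *\<^sub>R sgn g) \<rho> \<subseteq> D"
proof
  fix w assume w: "w \<in> ball (q - \<rho> *\<^sub>R sgn g) \<rho>"
  define v where "v = w - q"
  have gn: "c \<le> norm g" "norm g \<le> C" "norm B \<le> C" using s by (auto simp: spsc_at_def)
  have "g \<noteq> 0" using gn c by (metis norm_zero not_le)
  then have sg: "norm (sgn g) = 1" by (simp add: norm_sgn)
  have "norm (v + \<rho> *\<^sub>R sgn g) < \<rho>" using w by (simp add: v_def dist_norm norm_minus_commute algebra_simps)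
  then have "(norm (v + \<rho> *\<^sub>R sgn g))\<^sup>2 < \<rho>\<^sup>2" using \<rho>(1) by (simp add: power_strict_mono)
  moreover have "(norm (v + \<rho> *\<^sub>R sgn g))\<^sup>2 = (norm v)\<^sup>2 + 2 * \<rho> * (v \<bullet> sgn g) + \<rho>\<^sup>2"
  proof -
    have "sgn g \<bullet> sgn g = 1" using sg by (simp add: norm_eq_1)
    then show ?thesis unfolding power2_norm_eq_inner
      by (simp add: inner_add_left inner_add_right inner_commute power2_eq_square algebra_simps)
  qed
  ultimately have vs: "(norm v)\<^sup>2 < - 2 * \<rho> * (v \<bullet> sgn g)" by simp
  have v0: "norm v \<noteq> 0" using vs by auto
  have "(norm v)\<^sup>2 < 2 * \<rho> * norm v"
  proof -
    have "- (v \<bullet> sgn g) \<le> norm v" using Cauchy_Schwarz_ineq2[of v "sgn g"] sg by simp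
    then have "2 * \<rho> * - (v \<bullet> sgn g) \<le> 2 * \<rho> * norm v" using \<rho>(1) by (intro mult_left_mono) auto
    then show ?thesis using vs by simp
  qed
  then have vr: "norm v < 2 * \<rho>" using v0 by (simp add: power2_eq_square)
  have C0: "C > 0" using gn c by linarith
  have gv: "g \<bullet> v = norm g * (v \<bullet> sgn g)"
    using \<open>g \<noteq> 0\<close> by (simp add: sgn_div_norm inner_commute)
  have neg: "v \<bullet> sgn g < 0" using vs \<rho>(1) zero_le_power2[of "norm v"] by (smt (verit, best) mult_nonneg_nonneg mult_minus_left)
  have "2 * \<rho> * (g \<bullet> v) \<le> 2 * \<rho> * (c * (v \<bullet> sgn g))"
    unfolding gv using \<rho>(1) gn neg by (intro mult_left_mono mult_right_mono_neg) auto
  also have "\<dots> < - c * (norm v)\<^sup>2"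
    using mult_strict_left_mono[OF vs c] by (simp add: algebra_simps)
  also have "\<dots> \<le> - (2 * \<rho> * C) * (norm v)\<^sup>2"
    using \<rho>(3) C0 by (intro mult_right_mono) (auto simp: field_simps)
  finally have "2 * \<rho> * (g \<bullet> v) < - (2 * \<rho> * C) * (norm v)\<^sup>2" .
  then have "(2 * \<rho>) * (g \<bullet> v) < (2 * \<rho>) * (- C * (norm v)\<^sup>2)"
    by (simp only: mult_minus_left mult_minus_right mult.assoc)
  then have "g \<bullet> v < - C * (norm v)\<^sup>2"
    by (rule mult_less_cancel_left_pos[THEN iffD1, rotated]) (use \<rho> in simp)
  moreover have "B v \<bullet> v \<le> C * (norm v)\<^sup>2"
  proof -
    have "B v \<bullet> v \<le> norm B * norm v * norm v" using inner_blinfun_le[of B v v] by linarith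
    also have "\<dots> = norm B * (norm v)\<^sup>2" by (simp add: power2_eq_square)
    also have "\<dots> \<le> C * (norm v)\<^sup>2" using gn by (intro mult_right_mono) auto
    finally show ?thesis .
  qed
  moreover have "c/8 * (norm v)\<^sup>2 \<le> C/2 * (norm v)\<^sup>2" using gn c by (intro mult_right_mono) auto
  ultimately have "g \<bullet> v + (B v \<bullet> v) / 2 < - (c/8 * (norm v)\<^sup>2)" by simp
  moreover have "norm v < r" using vr \<rho>(2) by simp
  ultimately have "q + v \<in> D" using s unfolding spsc_at_def by blast
  then show "w \<in> D" by (simp add: v_def)
qed

section \<open>Depth, the distance to the complement\<close>

definition dep :: "'a::metric_space set \<Rightarrow> 'a \<Rightarrow> real" where "dep D z = infdist z (- D)"

lemma dep_nonneg [simp]: "0 \<le> dep D z" by (simp add: dep_def infdist_nonneg)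

lemma dep_le: "w \<notin> D \<Longrightarrow> dep D z \<le> dist z w"
  by (simp add: dep_def infdist_le)

lemma ball_dep_subset: "ball z (dep D z) \<subseteq> D"
proof
  fix w assume "w \<in> ball z (dep D z)"
  then show "w \<in> D" using dep_le[of w D z] by (cases "w \<in> D") auto
qed

text \<open>The distance to the empty set is 0 by convention, so a lower bound has to exclude
  \<open>D = UNIV\<close>.\<close>

lemma dep_ge:
  fixes D :: "'a::metric_space set"
  assumes "\<And>w. w \<notin> D \<Longrightarrow> d \<le> dist z w" "D \<noteq> UNIV" shows "d \<le> dep D z"
  unfolding dep_def infdist_def using assms by (auto intro!: cINF_greatest)

lemma dep_ge_ball:
  fixes D :: "'a::metric_space set"
  assumes "ball z d \<subseteq> D" "D \<noteq> UNIV" shows "d \<le> dep D z"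
proof (rule dep_ge[OF _ assms(2)])
  fix w assume "w \<notin> D"
  then have "w \<notin> ball z d" using assms(1) by blast
  then show "d \<le> dist z w" by simp
qed

lemma dep_attained:
  fixes D :: "'a::euclidean_space set"
  assumes "open D" "bounded D" "z \<in> D"
  obtains q where "q \<in> frontier D" "dist z q = dep D z"
proof -
  have ne: "- D \<noteq> {}" using assms(2) not_bounded_UNIV by (metis Compl_UNIV_eq double_complement)
  obtain q where q: "q \<in> - D" "infdist z (- D) = dist z q"
    using infdist_attains_inf[of "- D" z] ne assms(1) by (auto simp: closed_Compl)
  have zq: "dist z q > 0" using q assms(3) by auto
  have "q \<in> closure (ball z (dist z q))" using zq by simp
  moreover have "ball z (dist z q) \<subseteq> D" using ball_dep_subset[of z D] q by (simp add: dep_def)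
  ultimately have "q \<in> closure D" using closure_mono by blast
  then show thesis using that[of q] q assms(1) by (auto simp: frontier_def interior_open dep_def)
qed

lemma dep_pos:
  fixes D :: "'a::euclidean_space set"
  assumes "open D" "bounded D" "z \<in> D"
  shows "dep D z > 0"
proof -
  obtain q where "q \<in> frontier D" "dist z q = dep D z" using dep_attained[OF assms] .
  moreover have "q \<noteq> z" using calculation assms(1,3) by (auto simp: frontier_def interior_open)
  ultimately show ?thesis by (metis zero_less_dist_iff)
qed

lemma dep_lipschitz: "dep D z \<le> dep D w + dist z w"
  unfolding dep_def using infdist_triangle by blast

text \<open>The ball about \<open>z\<close> of radius \<open>dep D z\<close> lies in
  \<open>D\<close>. If \<open>sgn g\<close> differed from the unit vector \<open>u\<close> pointing
  from \<open>z\<close> to \<open>q\<close>, then sgn g - u would lead from \<open>q\<close> into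
  this ball while the linear form \<open>g\<close> increases along it, contradicting the first
  inequality of \<open>spsc_at\<close> to first order. This places \<open>z\<close> on the axis of
  the interior balls at \<open>q\<close>.\<close>

lemma spsc_at_normal:
  assumes s: "spsc_at D q g B c C \<epsilon> r" and c: "c > 0" "r > 0" and D: "open D" "z \<in> D"
    and q: "q \<notin> D" "dist z q = dep D z"
  shows "z = q - dep D z *\<^sub>R sgn g"
proof -
  define d where "d = dep D z"
  have d: "d > 0" using q D unfolding d_def by (metis zero_less_dist_iff)
  define u where "u = (1/d) *\<^sub>R (q - z)"
  have "norm (q - z) = d" using q by (simp add: dist_norm norm_minus_commute d_def)
  then have u: "norm u = 1" "z = q - d *\<^sub>R u" using d by (auto simp: u_def)
  have gn: "c \<le> norm g" using s by (simp add: spsc_at_def)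
  have "g \<noteq> 0" using gn c by (metis norm_zero not_le)
  then have sg: "norm (sgn g) = 1" by (simp add: norm_sgn)
  have "sgn g = u"
  proof (rule ccontr)
    assume ne: "sgn g \<noteq> u"
    define h where "h = sgn g - u"
    have uu: "u \<bullet> u = 1" "sgn g \<bullet> sgn g = 1" using u sg by (simp_all add: norm_eq_1)
    have h2: "h \<bullet> h = 2 - 2 * (sgn g \<bullet> u)"
      by (simp add: h_def inner_diff_left inner_diff_right uu inner_commute)
    have hh: "h \<bullet> h > 0" using ne by (simp add: h_def)
    have hu: "h \<bullet> u = - (h \<bullet> h) / 2" by (simp add: h2) (simp add: h_def inner_diff_left uu)
    have gh: "g \<bullet> h = norm g * (h \<bullet> h) / 2"
    proof -
      have "g = norm g *\<^sub>R sgn g" using \<open>g \<noteq> 0\<close> by (simp add: sgn_div_norm)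
      then have "g \<bullet> h = norm g * (sgn g \<bullet> h)" by (metis inner_scaleR_left)
      then show ?thesis by (simp add: h2) (simp add: h_def inner_diff_right uu)
    qed
    have inball: "q + \<tau> *\<^sub>R h \<in> D" if t: "0 < \<tau>" "\<tau> < d" for \<tau>
    proof -
      have "(norm (\<tau> *\<^sub>R h + d *\<^sub>R u))\<^sup>2 = \<tau>\<^sup>2 * (h \<bullet> h) + 2 * \<tau> * d * (h \<bullet> u) + d\<^sup>2"
        unfolding power2_norm_eq_inner
        by (simp add: inner_add_left inner_add_right uu inner_commute power2_eq_square algebra_simps)
      also have "\<dots> = \<tau> * (\<tau> - d) * (h \<bullet> h) + d\<^sup>2" by (simp add: hu power2_eq_square algebra_simps)
      also have "\<dots> < d\<^sup>2" using t hh by (simp add: mult_pos_neg mult_neg_pos)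
      finally have "norm (\<tau> *\<^sub>R h + d *\<^sub>R u) < d" using d by (simp add: power_less_imp_less_base)
      then have "q + \<tau> *\<^sub>R h \<in> ball z d" unfolding u(2) by (simp add: dist_norm norm_minus_commute algebra_simps)
      then show ?thesis using ball_dep_subset d_def by blast
    qed
    have le: "g \<bullet> h \<le> \<tau> * (\<epsilon> * (h \<bullet> h) - (B h \<bullet> h) / 2)" if t: "0 < \<tau>" "\<tau> < min d (r / (norm h + 1))" for \<tau>
    proof -
      have "norm h + 1 > 0" by (simp add: add_nonneg_pos)
      then have "\<tau> * (norm h + 1) < r" using t(2) by (simp add: pos_less_divide_eq)
      then have "norm (\<tau> *\<^sub>R h) < r" using t by (simp add: algebra_simps)
      then have "g \<bullet> (\<tau> *\<^sub>R h) + (B (\<tau> *\<^sub>R h) \<bullet> (\<tau> *\<^sub>R h)) / 2 \<le> \<epsilon> * (norm (\<tau> *\<^sub>R h))\<^sup>2"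
        using s inball[of \<tau>] t unfolding spsc_at_def min_less_iff_conj by blast
      moreover have "(norm (\<tau> *\<^sub>R h))\<^sup>2 = \<tau> * (\<tau> * (h \<bullet> h))"
        by (simp only: power2_norm_eq_inner inner_scaleR_left inner_scaleR_right)
      ultimately have "\<tau> * (g \<bullet> h) \<le> \<tau> * (\<tau> * (\<epsilon> * (h \<bullet> h) - (B h \<bullet> h) / 2))"
        by (simp add: blinfun.scaleR_right algebra_simps)
      then show ?thesis using t by simp
    qed
    have "min d (r / (norm h + 1)) > 0" using d c by (simp add: add_nonneg_pos)
    then have "g \<bullet> h \<le> 0"
    proof -
      let ?m = "min d (r / (norm h + 1))" and ?a = "\<epsilon> * (h \<bullet> h) - (B h \<bullet> h) / 2"
      assume m: "?m > 0"
      have "((\<lambda>\<tau>. \<tau> * ?a) \<longlongrightarrow> 0 * ?a) (at_right 0)" by (intro tendsto_intros)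
      moreover have "\<forall>\<^sub>F \<tau> in at_right 0. g \<bullet> h \<le> \<tau> * ?a"
        using le m unfolding eventually_at_right_field by (intro exI[of _ ?m]) auto
      ultimately show ?thesis using tendsto_lowerbound[of "\<lambda>\<tau>. \<tau> * ?a" 0 "at_right 0"] by simp
    qed
    moreover have "g \<bullet> h > 0" unfolding gh using hh \<open>g \<noteq> 0\<close> by simp
    ultimately show False by simp
  qed
  then show ?thesis using u d_def by simp
qed

text \<open>Levi polynomials serve as the peak functions: on \<open>closure D\<close> near
  \<open>p\<close> their real part is at most a negative multiple of the squared distance to
  \<open>p\<close>.\<close>

lemma holomorphic_map_stays_in_spsc:
  assumes H: "holomorphic_map_on H \<Omega>" and \<Omega>: "open \<Omega>" "connected \<Omega>" and Dc: "open D" "c > 0" "r > 0"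
    and sp: "\<And>q. q \<in> frontier D \<Longrightarrow> \<exists>g B. spsc_at D q g B c C (c/8) r"
    and HX: "\<And>x. x \<in> \<Omega> \<Longrightarrow> H x \<in> closure D" and x0: "x0 \<in> \<Omega>" "H x0 \<in> D" and x: "x \<in> \<Omega>"
  shows "H x \<in> D"
proof (rule holomorphic_map_stays_inside[OF H \<Omega> HX _ _ x0 x])
  show "open D" by (rule Dc)
  fix p assume p: "p \<in> closure D - D"
  then have "p \<in> frontier D" using Dc(1) by (simp add: frontier_def interior_open)
  then obtain g B where s: "spsc_at D p g B c C (c/8) r" using sp by blast
  define P where "P x = levi_poly g B (x - p)" for x
  have le: "Re (P x) \<le> - (c/8) * (norm (x - p))\<^sup>2" if "x \<in> closure D \<inter> ball p r" for x
    unfolding P_def by (rule spsc_at_support_closure[OF s]) (use that in \<open>auto simp: dist_norm norm_minus_commute\<close>)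
  have "Re (P p) = 0" by (simp add: P_def Re_levi_poly blinfun.zero_right vec_eq_iff[of "_ *s _"])
  moreover have "\<forall>x\<in>closure D \<inter> ball p r. Re (P x) \<le> 0"
  proof
    fix x assume x: "x \<in> closure D \<inter> ball p r"
    have "(c/8) * (norm (x - p))\<^sup>2 \<ge> 0" using Dc by simp
    then show "Re (P x) \<le> 0" using le[OF x] by linarith
  qed
  moreover have "\<forall>x\<in>D \<inter> ball p r. Re (P x) < 0"
  proof
    fix x assume x: "x \<in> D \<inter> ball p r"
    then have "x \<noteq> p" using p by auto
    then have "(c/8) * (norm (x - p))\<^sup>2 > 0" using Dc by simp
    moreover have "x \<in> closure D \<inter> ball p r" using x closure_subset[of D] by blast
    ultimately show "Re (P x) < 0" using le[of x] by linarith
  qed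
  moreover have "cholo P (ball p r)" unfolding P_def by (rule cholo_levi_poly)
  ultimately show "\<exists>r>0. \<exists>P. cholo P (ball p r) \<and> Re (P p) = 0 \<and> (\<forall>v\<in>closure D \<inter> ball p r. Re (P v) \<le> 0) \<and> (\<forall>v\<in>D \<inter> ball p r. Re (P v) < 0)"
    using Dc(3) by blast
qed

text \<open>Only the constants are recorded, not the gradients and Hessians: they are all that the
  derivative bound for the maps may depend on.\<close>

definition spsc_dom :: "(complex^'n) set \<Rightarrow> real \<Rightarrow> real \<Rightarrow> real \<Rightarrow> real \<Rightarrow> bool" where
  "spsc_dom D c C r R \<longleftrightarrow> open D \<and> D \<subseteq> ball 0 R \<and> 0 < c \<and> 0 < r \<and>
     (\<forall>q\<in>frontier D. \<exists>g B. spsc_at D q g B c C (c/8) r)"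

section \<open>Boundary estimates\<close>

lemma spsc_at_norm_levi_poly_le:
  assumes "spsc_at D q g B c C \<epsilon> r" "norm v < r"
  shows "cmod (levi_poly g B v) \<le> C * (1 + r) * norm v"
proof -
  have gn: "norm g \<le> C" "norm B \<le> C" using assms(1) by (auto simp: spsc_at_def)
  have "norm g * norm v + norm B * (norm v)\<^sup>2 \<le> C * norm v + C * (r * norm v)"
    using gn assms(2) norm_ge_zero[of g] norm_ge_zero[of B]
    by (intro add_mono mult_mono) (auto simp: power2_eq_square intro!: mult_right_mono intro: order_trans[OF norm_ge_zero])
  then show ?thesis using norm_levi_poly_le[of g B v] by (simp add: algebra_simps)
qed

text \<open>The Levi polynomial is known to be negative only within distance \<open>r\<close> of
  \<open>q\<close>. The Lipschitz bound keeps a smaller ball inside that region, where Harnack's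
  inequality applies; the second estimate follows because the negative real part dominates the
  squared distance.\<close>

lemma spsc_at_Harnack:
  fixes G :: "complex^'m \<Rightarrow> complex^'n"
  assumes s: "spsc_at D q g B c C (c/8) r" and c: "c > 0" "r > 0" and D: "D \<subseteq> ball 0 R" "open D" "q \<notin> D"
    and G: "holomorphic_map_on G (ball y s0)" "s0 > 0" "G ` ball y s0 \<subseteq> D" and y: "norm (G y - q) < r/2"
    and x: "dist y x \<le> min (s0/2) (s0 * r / (8 * R)) / 2"
  shows "cmod (levi_poly g B (G x - q)) \<le> 3 * cmod (levi_poly g B (G y - q))"
    and "(c/8) * (norm (G x - q))\<^sup>2 \<le> 3 * cmod (levi_poly g B (G y - q))"
proof -
  \<comment> \<open>With Lipschitz constant \<open>4 * R / s0\<close>, the second entry lets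
    \<open>G\<close> move by at most \<open>r/2\<close>, and \<open>G y\<close> is within
    \<open>r/2\<close> of \<open>q\<close>.\<close>
  define s where "s = min (s0/2) (s0 * r / (8 * R))"
  have bd: "norm (G x) \<le> R" if "x \<in> ball y s0" for x
    using G(3) D(1) that by (force simp: dist_norm)
  have R: "R > 0" using D(1) G(2,3) by (metis ball_empty centre_in_ball image_subset_iff in_mono empty_iff not_le)
  have sp: "s > 0" using G(2) R c by (simp add: s_def)
  have ss: "s \<le> s0/2" "s \<le> s0 * r / (8 * R)" by (auto simp: s_def)
  have near: "norm (G z - q) < r" if z: "z \<in> ball y s" for z
  proof -
    have "norm (G z - G y) \<le> 4 * R / s0 * norm (z - y)"
      using holomorphic_map_Lipschitz[OF G(1,2) bd] z ss G(2) by (auto simp: dist_commute)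
    also have "\<dots> \<le> 4 * R / s0 * s"
      using z R G(2) by (intro mult_left_mono) (auto simp: dist_norm norm_minus_commute)
    also have "\<dots> \<le> 4 * R / s0 * (s0 * r / (8 * R))" using ss R G(2) by (intro mult_left_mono) auto
    also have "\<dots> = r/2" using R G(2) by simp
    finally show ?thesis using y norm_triangle_ineq[of "G z - G y" "G y - q"] by simp
  qed
  have inD: "G z \<in> D" if "z \<in> ball y s" for z using G(2,3) that ss by (auto simp: image_subset_iff)
  have neg: "Re (levi_poly g B (G z - q)) \<le> - (c/8) * (norm (G z - q))\<^sup>2" if "z \<in> ball y s" for z
    using spsc_at_support[OF s, of "G z - q"] near[OF that] inD[OF that] by simp
  have neg': "Re (levi_poly g B (G z - q)) < 0" if "z \<in> ball y s" for z
  proof -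
    have "G z \<noteq> q" using inD[OF that] D(3) by auto
    then have "(c/8) * (norm (G z - q))\<^sup>2 > 0" using c by simp
    then show ?thesis using neg[OF that] by linarith
  qed
  have ch: "cholo (\<lambda>z. levi_poly g B (G z - q)) (ball y s)"
  proof -
    have "ball y s \<subseteq> ball y s0" using ss(1) G(2) by (intro subset_ball) simp
    from cholo_compose[OF holomorphic_map_on_subset[OF G(1) this] cholo_levi_poly[of g B q UNIV]]
    show ?thesis by (simp add: o_def)
  qed
  show 1: "cmod (levi_poly g B (G x - q)) \<le> 3 * cmod (levi_poly g B (G y - q))"
    using cholo_Harnack[OF ch neg' _ sp] x s_def by simp
  have "x \<in> ball y s" using x sp s_def by auto
  then show "(c/8) * (norm (G x - q))\<^sup>2 \<le> 3 * cmod (levi_poly g B (G y - q))"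
    using 1 neg[of x] abs_Re_le_cmod[of "levi_poly g B (G x - q)"] by simp
qed

text \<open>On the set where \<open>Re h > - c \<eta>\<^sup>2\<close>, compare \<open>exp (h / (c \<eta>\<^sup>2))\<close> with \<open>\<zeta>\<close> by the maximum principle.\<close>
lemma disc_Hopf:
  assumes h: "h holomorphic_on ball 0 1" and N: "continuous_on (ball 0 1) N"
    and pos: "c > 0" "\<eta> > 0" "\<eta> < r" and N0: "\<And>\<zeta>. N \<zeta> \<ge> (0::real)"
    and neg: "\<And>\<zeta>. \<zeta> \<in> ball 0 1 \<Longrightarrow> N \<zeta> < r \<Longrightarrow> Re (h \<zeta>) \<le> - c * (N \<zeta>)\<^sup>2"
    and inner: "\<And>\<zeta>. cmod \<zeta> \<le> 1/2 \<Longrightarrow> N \<zeta> \<ge> \<eta>"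
    and \<zeta>0: "\<zeta>0 \<in> ball 0 1" "N \<zeta>0 < r"
  shows "Re (h \<zeta>0) \<le> - (c * \<eta>\<^sup>2) * (1 - cmod \<zeta>0)"
proof (cases "Re (h \<zeta>0) > - (c * \<eta>\<^sup>2)")
  case False
  have "c * \<eta>\<^sup>2 * cmod \<zeta>0 \<ge> 0" using pos by simp
  then show ?thesis using False by (simp add: algebra_simps)
next
  case True
  define c1 where "c1 = c * \<eta>\<^sup>2"
  have c1: "c1 > 0" using pos by (simp add: c1_def)
  have small: "N \<zeta> \<le> \<eta> \<and> (Re (h \<zeta>) > - c1 \<longrightarrow> N \<zeta> < \<eta>)" if "\<zeta> \<in> ball 0 1" "N \<zeta> < r" "Re (h \<zeta>) \<ge> - c1" for \<zeta>
  proof -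
    have "c * (N \<zeta>)\<^sup>2 \<le> c * \<eta>\<^sup>2" using neg[OF that(1,2)] that(3) by (simp add: c1_def)
    then have "(N \<zeta>)\<^sup>2 \<le> \<eta>\<^sup>2" using pos(1) mult_le_cancel_left_pos by blast
    then have 1: "N \<zeta> \<le> \<eta>" by (rule power2_le_imp_le) (use pos in simp)
    have "N \<zeta> < \<eta>" if "Re (h \<zeta>) > - c1"
    proof -
      have "c * (N \<zeta>)\<^sup>2 < c * \<eta>\<^sup>2" using neg[OF \<open>\<zeta> \<in> ball 0 1\<close> \<open>N \<zeta> < r\<close>] that by (simp add: c1_def)
      then have "(N \<zeta>)\<^sup>2 < \<eta>\<^sup>2" using pos(1) mult_less_cancel_left_pos by blast
      then show ?thesis by (rule power2_less_imp_less) (use pos in simp)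
    qed
    with 1 show ?thesis by blast
  qed
  \<comment> \<open>Smaller discs are used because \<open>h\<close> is holomorphic only on the open
    unit disc.\<close>
  have key: "exp (Re (h \<zeta>0) / c1) * s \<le> cmod \<zeta>0" if s: "cmod \<zeta>0 < s" "s < 1" for s
  proof -
    have s0: "s > 0" using s(1) norm_ge_zero[of \<zeta>0] by linarith
    \<comment> \<open>On \<open>W\<close> the bound for \<open>Re h\<close> forces
      \<open>N < \<eta>\<close>. Hence \<open>W\<close> avoids the disc of radius 1/2, and with it
      the pole of the quotient, and its closure stays away from \<open>N = r\<close>, beyond which
      nothing is known.\<close>
    define W where "W = {\<zeta>\<in>ball 0 s. N \<zeta> < r \<and> Re (h \<zeta>) > - c1}"
    have sub: "ball 0 s \<subseteq> ball (0::complex) 1" using s by (intro subset_ball) simp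
    have ch1: "continuous_on (ball 0 1) h" using h holomorphic_on_imp_continuous_on by blast
    have cN: "continuous_on (ball 0 s) N" and ch: "continuous_on (ball 0 s) h"
      using continuous_on_subset[OF N sub] continuous_on_subset[OF ch1 sub] by auto
    have W: "open W"
    proof -
      have "W = (ball 0 s \<inter> N -` {..<r}) \<inter> (ball 0 s \<inter> (\<lambda>z. Re (h z)) -` {-c1<..})" by (auto simp: W_def)
      moreover have "open (ball 0 s \<inter> N -` {..<r})"
        by (rule continuous_open_preimage[OF cN open_ball open_lessThan])
      moreover have "open (ball 0 s \<inter> (\<lambda>z. Re (h z)) -` {-c1<..})"
        by (rule continuous_open_preimage[OF continuous_on_Re[OF ch] open_ball open_greaterThan])
      ultimately show ?thesis using open_Int by metis
    qed
    have clW: "cmod z \<le> s \<and> N z \<le> \<eta> \<and> Re (h z) \<ge> - c1 \<and> cmod z \<ge> 1/2" if z: "z \<in> closure W" for z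
    proof -
      obtain x where x: "\<And>n. x n \<in> W" "x \<longlonglongrightarrow> z" using z closure_sequential by blast
      have xb: "x n \<in> ball 0 1 \<and> N (x n) \<le> \<eta> \<and> cmod (x n) \<le> s \<and> - c1 \<le> Re (h (x n)) \<and> 1/2 \<le> cmod (x n)" for n
      proof -
        have a: "x n \<in> ball 0 s" "N (x n) < r" "Re (h (x n)) > - c1" using x(1)[of n] by (auto simp: W_def)
        then have b: "x n \<in> ball 0 1" using s by auto
        have "N (x n) < \<eta>" using small[OF b a(2)] a(3) by simp
        then have "1/2 < cmod (x n)" using inner[of "x n"] by (meson leD le_less_linear)
        then show ?thesis using a b \<open>N (x n) < \<eta>\<close> by simp
      qed
      have zs: "cmod z \<le> s" using tendsto_upperbound[OF tendsto_norm[OF x(2)]] xb by (simp add: always_eventually)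
      then have z1: "z \<in> ball 0 1" using s by simp
      have "isCont N z" "isCont h z"
        using N[unfolded continuous_on_eq_continuous_at[OF open_ball]]
          ch1[unfolded continuous_on_eq_continuous_at[OF open_ball]] z1 by blast+
      then have Nl: "(\<lambda>n. N (x n)) \<longlonglongrightarrow> N z" and hl: "(\<lambda>n. Re (h (x n))) \<longlonglongrightarrow> Re (h z)"
        by (auto intro!: isCont_tendsto_compose[OF _ x(2)] tendsto_Re)
      have "N z \<le> \<eta>" using tendsto_upperbound[OF Nl] xb by (simp add: always_eventually)
      moreover have "- c1 \<le> Re (h z)" using tendsto_lowerbound[OF hl] xb by (simp add: always_eventually)
      moreover have "1/2 \<le> cmod z" using tendsto_lowerbound[OF tendsto_norm[OF x(2)], of "1/2"] xb by (simp add: always_eventually)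
      ultimately show ?thesis using zs by blast
    qed
    let ?f = "\<lambda>z. exp (h z / of_real c1) / z"
    have clW1: "closure W \<subseteq> ball 0 1 - {0}" using clW s by fastforce
    have hol: "?f holomorphic_on ball 0 1 - {0}"
      using h by (intro holomorphic_intros) (auto intro: holomorphic_on_subset c1[THEN less_imp_neq, symmetric])
    have n1: "norm (?f \<zeta>0) \<le> 1 / s"
    proof (rule maximum_modulus_frontier[of ?f W])
      show "?f holomorphic_on interior W"
        using hol clW1 closure_subset interior_subset by (meson holomorphic_on_subset order_trans)
      show "continuous_on (closure W) ?f"
        using hol clW1 holomorphic_on_imp_continuous_on continuous_on_subset by blast
      show "bounded W" by (rule bounded_subset[of "ball 0 s"]) (auto simp: W_def)
      show "\<zeta>0 \<in> W" using True \<zeta>0 s by (auto simp: W_def c1_def)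
      show "norm (?f z) \<le> 1 / s" if z: "z \<in> frontier W" for z
      proof -
        have zc: "z \<in> closure W" "z \<notin> W" using z W by (auto simp: frontier_def interior_open)
        note zz = clW[OF zc(1)]
        have nf: "norm (?f z) = exp (Re (h z) / c1) / cmod z"
          by (simp add: norm_divide)
        have z1: "z \<in> ball 0 1" using zz s by simp
        have Nr: "N z < r" using zz pos by linarith
        consider "cmod z = s" | "Re (h z) = - c1" using zc(2) zz Nr by (fastforce simp: W_def)
        then show ?thesis
        proof cases
          case 1
          have "Re (h z) \<le> 0" using neg[OF z1 Nr] pos by (smt (verit) mult_nonneg_nonneg mult_minus_left zero_le_power2)
          then have "exp (Re (h z) / c1) \<le> 1" using c1 by (simp add: divide_nonpos_pos)
          then show ?thesis unfolding nf 1 using s0 by (simp add: divide_right_mono)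
        next
          case 2
          \<comment> \<open>On this part of the frontier the exponential equals
            \<open>exp (-1)\<close>, which is at most 1/2 and thus at most
            \<open>cmod z\<close>.\<close>
          have "exp (-1::real) \<le> 1/2"
            using exp_ge_add_one_self[of 1] by (simp add: exp_minus field_simps)
          then have "exp (Re (h z) / c1) \<le> cmod z" unfolding 2 using c1 zz by simp
          then have "exp (Re (h z) / c1) / cmod z \<le> 1" using zz by (simp add: divide_le_eq)
          also have "1 \<le> 1 / s" using s s0 by simp
          finally show ?thesis unfolding nf .
        qed
      qed
    qed
    have z0: "\<zeta>0 \<noteq> 0" using clW1 closure_subset[of W] True \<zeta>0 s by (auto simp: W_def c1_def)
    have n2: "norm (?f \<zeta>0) = exp (Re (h \<zeta>0) / c1) / cmod \<zeta>0" by (simp add: norm_divide)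
    have A: "E * s \<le> m" if "E / m \<le> 1 / s" "m > 0" for E m :: real
      using that s0 by (simp add: field_simps)
    show ?thesis by (rule A[OF n1[unfolded n2]]) (use z0 in simp)
  qed
  \<comment> \<open>Let \<open>s\<close> tend to 1; afterwards \<open>1 + x \<le> exp x\<close>
    gives the linear bound.\<close>
  have "exp (Re (h \<zeta>0) / c1) * 1 \<le> cmod \<zeta>0"
  proof (rule tendsto_upperbound)
    show "((\<lambda>s. exp (Re (h \<zeta>0) / c1) * s) \<longlongrightarrow> exp (Re (h \<zeta>0) / c1) * 1) (at_left 1)"
      by (intro tendsto_intros)
    show "\<forall>\<^sub>F s in at_left 1. exp (Re (h \<zeta>0) / c1) * s \<le> cmod \<zeta>0"
      using key \<zeta>0(1) unfolding eventually_at_left_field by (intro exI[of _ "cmod \<zeta>0"]) auto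
  qed simp
  then have "1 + Re (h \<zeta>0) / c1 \<le> cmod \<zeta>0" using exp_ge_add_one_self[of "Re (h \<zeta>0) / c1"] by linarith
  then have "Re (h \<zeta>0) / c1 \<le> - (1 - cmod \<zeta>0)" by simp
  then show ?thesis using c1 unfolding c1_def[symmetric] by (simp add: divide_le_eq mult.commute right_diff_distrib)
qed

text \<open>The disc along \<open>e\<close> in the interior ball has its inner half at depth at
  least \<open>\<rho>/2\<close>, so \<open>G\<close> sends that half to depth at least \<eta>. Let
  \<open>q\<close> be the boundary point nearest to the image of \<open>q' - d *\<^sub>R e\<close>.
  By \<open>disc_Hopf\<close> the Levi polynomial at \<open>q\<close> is at least a multiple of
  \<open>d\<close> in modulus, while it is at most a multiple of the distance to
  \<open>q\<close>.\<close>

lemma dep_le_of_interior_control: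
  fixes G :: "complex^'n \<Rightarrow> complex^'m"
  assumes D: "spsc_dom D c C r R"
    and G: "holomorphic_map_on G D'" "G ` D' \<subseteq> D"
    and D': "ball (q' - \<rho> *\<^sub>R e) \<rho> \<subseteq> D'" "norm e = 1" "0 < d" "d < \<rho>" "D' \<noteq> UNIV"
    and \<eta>: "0 < \<eta>" "\<eta> < r" and K: "\<And>x. x \<in> D' \<Longrightarrow> dep D' x \<ge> \<rho>/2 \<Longrightarrow> dep D (G x) \<ge> \<eta>"
  shows "d \<le> (\<rho> / r + 8 * \<rho> * C * (1 + r) / (c * \<eta>\<^sup>2)) * dep D (G (q' - d *\<^sub>R e))"
proof -
  let ?w = "q' - d *\<^sub>R e"
  have Dc: "open D" "D \<subseteq> ball 0 R" "c > 0" "r > 0"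
    and at: "\<And>q. q \<in> frontier D \<Longrightarrow> \<exists>g B. spsc_at D q g B c C (c/8) r"
    using D unfolding spsc_dom_def by auto
  have bD: "bounded D" using Dc(2) bounded_ball bounded_subset by blast
  define a where "a = q' - \<rho> *\<^sub>R e"
  define b where "b = \<rho> *\<^sub>R e"
  define \<zeta>0 where "\<zeta>0 = complex_of_real (1 - d/\<rho>)"
  have \<rho>: "\<rho> > 0" using D' by simp
  have disc: "a + \<zeta> *s b \<in> ball a \<rho>" "dist a (a + \<zeta> *s b) = \<rho> * cmod \<zeta>" if "cmod \<zeta> < 1" for \<zeta>
  proof -
    show "dist a (a + \<zeta> *s b) = \<rho> * cmod \<zeta>"
      using \<rho> D'(2) by (simp add: dist_norm norm_vector_smult b_def)
    then show "a + \<zeta> *s b \<in> ball a \<rho>" using that \<rho> by simp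
  qed
  have inD': "a + \<zeta> *s b \<in> D'" if "cmod \<zeta> < 1" for \<zeta> using disc(1)[OF that] D'(1) a_def by blast
  have w: "?w = a + \<zeta>0 *s b"
    unfolding a_def b_def \<zeta>0_def using \<rho>
    by (simp add: vec_eq_iff vector_scaleR_component) (simp add: scaleR_conv_of_real field_simps)
  have c0: "cmod \<zeta>0 = 1 - d/\<rho>"
    unfolding \<zeta>0_def norm_of_real using D' \<rho> by simp
  have c01: "cmod \<zeta>0 < 1" using c0 D' \<rho> by simp
  have wD: "G ?w \<in> D" using inD'[OF c01] G(2) w by auto
  obtain q where q: "q \<in> frontier D" "dist (G ?w) q = dep D (G ?w)"
    using dep_attained[OF Dc(1) bD wD] .
  have qD: "q \<notin> D" using q Dc(1) by (simp add: frontier_def interior_open)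
  obtain g B where s: "spsc_at D q g B c C (c/8) r" using at[OF q(1)] by blast
  have C0: "C \<ge> 0" using s Dc(3) unfolding spsc_at_def by linarith
  let ?dG = "dep D (G ?w)"
  show ?thesis
  proof (cases "?dG < r")
    case False
    \<comment> \<open>The image is out of reach of the local form; here \<open>d < \<rho>\<close>
      and \<open>r \<le> ?dG\<close> suffice, which accounts for the summand
      \<open>\<rho> / r\<close>.\<close>
    have "d \<le> \<rho> / r * ?dG" using False D' Dc by (simp add: pos_le_divide_eq) (smt (verit) mult_mono)
    moreover have "8 * \<rho> * C * (1 + r) / (c * \<eta>\<^sup>2) * ?dG \<ge> 0" using \<rho> C0 Dc by simp
    ultimately show ?thesis by (simp add: algebra_simps)
  next
    case True
    define h where "h \<zeta> = levi_poly g B (G (a + \<zeta> *s b) - q)" for \<zeta>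
    define N where "N \<zeta> = norm (G (a + \<zeta> *s b) - q)" for \<zeta>
    have ch: "cholo (\<lambda>z. levi_poly g B (G z - q)) D'"
      using cholo_compose[OF G(1) cholo_levi_poly[of g B q UNIV]] by (simp add: o_def)
    have "Re (h \<zeta>0) \<le> - ((c/8) * \<eta>\<^sup>2) * (1 - cmod \<zeta>0)"
    proof (rule disc_Hopf[where N=N and r=r])
      show "h holomorphic_on ball 0 1"
        unfolding h_def using cholo_line[OF ch, of "ball 0 1" a b] inD' by simp
      have "continuous_on (ball 0 1) (\<lambda>\<zeta>. G (a + \<zeta> *s b))"
      proof (rule continuous_on_compose2[OF holomorphic_map_on_continuous[OF G(1)]])
        show "continuous_on (ball 0 1) (\<lambda>\<zeta>. a + \<zeta> *s b)"
          by (intro continuous_at_imp_continuous_on ballI has_derivative_continuous[OF has_derivative_affine_line])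
      qed (use inD' in auto)
      then show "continuous_on (ball 0 1) N" unfolding N_def by (intro continuous_intros)
      show "Re (h \<zeta>) \<le> - (c/8) * (N \<zeta>)\<^sup>2" if "\<zeta> \<in> ball 0 1" "N \<zeta> < r" for \<zeta>
      proof -
        have "G (a + \<zeta> *s b) \<in> D" using inD'[of \<zeta>] that(1) G(2) by auto
        then show ?thesis
          using spsc_at_support[OF s, of "G (a + \<zeta> *s b) - q"] that(2) unfolding h_def N_def by simp
      qed
      show "\<eta> \<le> N \<zeta>" if "cmod \<zeta> \<le> 1/2" for \<zeta>
      proof -
        have z1: "cmod \<zeta> < 1" using that by simp
        have "dist a (a + \<zeta> *s b) \<le> \<rho>/2" using disc(2)[OF z1] that \<rho> by simp
        then have "ball (a + \<zeta> *s b) (\<rho>/2) \<subseteq> ball a \<rho>" using ball_subset_ball_iff[of "a + \<zeta> *s b" "\<rho>/2" a \<rho>] by (simp add: dist_commute)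
        then have "ball (a + \<zeta> *s b) (\<rho>/2) \<subseteq> D'" using D'(1) a_def by blast
        then have "\<rho>/2 \<le> dep D' (a + \<zeta> *s b)" using dep_ge_ball D'(5) by blast
        then have "\<eta> \<le> dep D (G (a + \<zeta> *s b))" using K inD'[OF z1] by blast
        also have "\<dots> \<le> N \<zeta>" using dep_le[OF qD] by (simp add: N_def dist_norm)
        finally show ?thesis .
      qed
      show "N \<zeta>0 < r" using True q(2) w by (simp add: N_def dist_norm)
    qed (use Dc \<eta> c01 in \<open>auto simp: N_def\<close>)
    then have "(c/8) * \<eta>\<^sup>2 * (d/\<rho>) \<le> - Re (h \<zeta>0)" using c0 by (simp add: algebra_simps)
    also have "\<dots> \<le> cmod (h \<zeta>0)" using abs_Re_le_cmod[of "h \<zeta>0"] by linarith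
    also have "\<dots> \<le> C * (1 + r) * norm (G ?w - q)"
      unfolding h_def w[symmetric] using spsc_at_norm_levi_poly_le[OF s, of "G ?w - q"] True q(2) by (simp add: dist_norm)
    also have "\<dots> = C * (1 + r) * ?dG" using q(2) by (simp add: dist_norm)
    finally have "d * (c * \<eta>\<^sup>2) \<le> 8 * \<rho> * C * (1 + r) * ?dG" using \<rho> by (simp add: field_simps)
    then have "d \<le> 8 * \<rho> * C * (1 + r) / (c * \<eta>\<^sup>2) * ?dG"
      using Dc \<eta> by (simp add: pos_le_divide_eq)
    moreover have "\<rho> / r * ?dG \<ge> 0" using \<rho> Dc by simp
    ultimately show ?thesis by (simp add: algebra_simps)
  qed
qed

text \<open>\<open>disc_Hopf\<close> bounds the depth of \<open>F z\<close> by a multiple of the depth of \<open>z\<close>. If \<open>F z\<close> is near the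
  boundary, Harnack's inequality confines \<open>F\<close> on a ball about \<open>z\<close> to a neighbourhood of a boundary
  point with radius of the order of the square root of that depth, and Cauchy's estimate applies.\<close>
lemma gradient_estimate:
  fixes c C r R c' C' r' R' \<eta> :: real
  assumes cr: "0 < c" "0 < r" "0 < c'" "0 < r'" "0 < \<eta>" "\<eta> < r" "0 < \<rho>" "\<rho> \<le> r'/2" "\<rho> \<le> c' / (2 * C')"
  obtains K where "\<And>(D::(complex^'n) set) (D'::(complex^'n) set) F G z L v. \<lbrakk>spsc_dom D c C r R; spsc_dom D' c' C' r' R';
      holomorphic_map_on F D; holomorphic_map_on G D'; F ` D \<subseteq> D'; G ` D' \<subseteq> D; \<forall>z\<in>D. G (F z) = z;
      \<forall>x\<in>D'. \<rho>/2 \<le> dep D' x \<longrightarrow> \<eta> \<le> dep D (G x); z \<in> D; (F has_derivative L) (at z)\<rbrakk>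
      \<Longrightarrow> norm (L v) \<le> K * norm v / sqrt (dep D z)"
proof -
  \<comment> \<open>The second entry is for images near the boundary, through
    \<open>dep_le_of_interior_control\<close>; the third is for images at depth at least \<rho>,
    where the hypothesis on \<open>G\<close> bounds the depth of \<open>z\<close> below.\<close>
  define K1 where "K1 = max 1 (max (\<rho> / r + 8 * \<rho> * C * (1 + r) / (c * \<eta>\<^sup>2)) (2 * \<bar>R'\<bar> / \<eta>))"
  define K4 where "K4 = 24 * C' * (1 + r') * K1 / c'"
  \<comment> \<open>The radius of \<open>spsc_at_Harnack\<close> for \<open>s0 = d\<close> is
    \<open>\<kappa> * d\<close>.\<close>
  define \<kappa> where "\<kappa> = min (1/2) (r' / (8 * \<bar>R'\<bar>)) / 2"
  define K where "K = max (2 * sqrt K4 / \<kappa>) (2 * \<bar>R'\<bar> * sqrt (2 * K1 / r'))"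
  have K1: "K1 \<ge> 1" by (simp add: K1_def)
  have main: "norm (L v) \<le> K * norm v / sqrt (dep D z)"
    if D: "spsc_dom D c C r R" and D': "spsc_dom D' c' C' r' R'"
      and F: "holomorphic_map_on F D" "F ` D \<subseteq> D'" and G: "holomorphic_map_on G D'" "G ` D' \<subseteq> D"
      and GF: "\<forall>z\<in>D. G (F z) = z" and Kc: "\<forall>x\<in>D'. \<rho>/2 \<le> dep D' x \<longrightarrow> \<eta> \<le> dep D (G x)"
      and z: "z \<in> D" and L: "(F has_derivative L) (at z)"
    for D D' :: "(complex^'n) set" and F G z L v
  proof -
    have Dc: "open D" "D \<subseteq> ball 0 R" and Dc': "open D'" "D' \<subseteq> ball 0 R'"
      and at': "\<And>q. q \<in> frontier D' \<Longrightarrow> \<exists>g B. spsc_at D' q g B c' C' (c'/8) r'"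
      using D D' unfolding spsc_dom_def by auto
    have bD: "bounded D" "bounded D'" using Dc(2) Dc'(2) bounded_ball bounded_subset by blast+
    have nU: "D' \<noteq> UNIV" using bD(2) not_bounded_UNIV by auto
    have wD: "F z \<in> D'" using z F(2) by auto
    have R': "R' > 0" using wD Dc'(2) by (metis ball_empty empty_iff in_mono not_le)
    obtain q where q: "q \<in> frontier D'" "dist (F z) q = dep D' (F z)"
      using dep_attained[OF Dc'(1) bD(2) wD] .
    have qD: "q \<notin> D'" using q Dc'(1) by (simp add: frontier_def interior_open)
    obtain g B where s: "spsc_at D' q g B c' C' (c'/8) r'" using at'[OF q(1)] by blast
    have C0: "C' \<ge> 0" using s cr unfolding spsc_at_def by linarith
    define d where "d = dep D z"
    have d: "d > 0" using dep_pos[OF Dc(1) bD(1) z] d_def by simp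
    define d' where "d' = dep D' (F z)"
    have d': "d' > 0" using dep_pos[OF Dc'(1) bD(2) wD] d'_def by simp
    have nb: "norm (F x) \<le> R'" if "x \<in> D" for x
      using F(2) Dc'(2) that by (force simp: dist_norm)
    have ballD: "ball z d \<subseteq> D" using ball_dep_subset d_def by blast
    have dd: "d' \<le> K1 * d"
    proof (cases "d' < \<rho>")
      case True
      have g0: "g \<noteq> 0" using s cr unfolding spsc_at_def by (metis norm_zero not_le)
      have nrm: "F z = q - d' *\<^sub>R sgn g"
        using spsc_at_normal[OF s cr(3,4) Dc'(1) wD qD] q(2) d'_def by simp
      have "d' \<le> (\<rho> / r + 8 * \<rho> * C * (1 + r) / (c * \<eta>\<^sup>2)) * dep D (G (q - d' *\<^sub>R sgn g))"
      proof (rule dep_le_of_interior_control[OF D G])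
        show "ball (q - \<rho> *\<^sub>R sgn g) \<rho> \<subseteq> D'" using spsc_at_interior_ball[OF s] cr by blast
        show "norm (sgn g) = 1" using g0 by (simp add: norm_sgn)
      qed (use d' True nU cr Kc in auto)
      then have "d' \<le> (\<rho> / r + 8 * \<rho> * C * (1 + r) / (c * \<eta>\<^sup>2)) * d"
      proof -
        have "G (q - d' *\<^sub>R sgn g) = z" using nrm[symmetric] GF z by simp
        then show ?thesis using \<open>d' \<le> _ * dep D (G _)\<close> by (simp only: d_def)
      qed
      also have "\<dots> \<le> K1 * d" using d by (intro mult_right_mono) (auto simp: K1_def)
      finally show ?thesis .
    next
      case False
      then have "\<rho>/2 \<le> dep D' (F z)" using cr d'_def by simp
      then have "\<eta> \<le> dep D (G (F z))" using Kc wD by blast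
      then have "\<eta> \<le> d" using GF z d_def by simp
      have "dist (F z) q \<le> 2 * R'"
      proof -
        have "q \<in> closure D'" using q by (simp add: frontier_def)
        moreover have "closure D' \<subseteq> cball 0 R'" using Dc'(2) by (intro closure_minimal) (auto intro: less_imp_le)
        ultimately have "norm q \<le> R'" by auto
        then show ?thesis using nb[OF z] norm_triangle_ineq4[of "F z" q] by (simp add: dist_norm)
      qed
      then have "d' \<le> 2 * \<bar>R'\<bar> / \<eta> * \<eta>" using q(2) d'_def cr R' by simp
      also have "\<dots> \<le> 2 * \<bar>R'\<bar> / \<eta> * d" using \<open>\<eta> \<le> d\<close> cr by (intro mult_left_mono) auto
      also have "\<dots> \<le> K1 * d" using d by (intro mult_right_mono) (auto simp: K1_def)
      finally show ?thesis .
    qed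
    show ?thesis
    proof (cases "d' < r'/2")
      case True
      have \<kappa>: "\<kappa> > 0" using cr R' by (simp add: \<kappa>_def)
      have ms: "min (d/2) (d * r' / (8 * R')) / 2 = \<kappa> * d"
        using d R' unfolding \<kappa>_def by (auto simp: min_def field_simps)
      have near: "norm (F x - q) \<le> sqrt (K4 * d)" if x: "x \<in> ball z (\<kappa> * d)" for x
      proof -
        have "(c'/8) * (norm (F x - q))\<^sup>2 \<le> 3 * cmod (levi_poly g B (F z - q))"
        proof (rule spsc_at_Harnack(2)[OF s cr(3,4) Dc'(2,1) qD, of F z d])
          show "holomorphic_map_on F (ball z d)" using holomorphic_map_on_subset[OF F(1) ballD] .
          show "F ` ball z d \<subseteq> D'" using F(2) ballD by blast
          show "norm (F z - q) < r'/2" using True q(2) d'_def by (simp add: dist_norm)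
          show "dist z x \<le> min (d/2) (d * r' / (8 * R')) / 2" using x ms by simp
        qed (rule d)
        also have "\<dots> \<le> 3 * (C' * (1 + r') * norm (F z - q))"
          using spsc_at_norm_levi_poly_le[OF s, of "F z - q"] True q(2) d'_def cr by (simp add: dist_norm)
        also have "\<dots> \<le> 3 * (C' * (1 + r') * (K1 * d))"
          using dd q(2) d'_def C0 cr by (intro mult_left_mono) (auto simp: dist_norm)
        finally have "(norm (F x - q))\<^sup>2 \<le> K4 * d" using cr by (simp add: K4_def field_simps)
        then show ?thesis by (rule real_le_rsqrt)
      qed
      \<comment> \<open>An oscillation of order sqrt d over a radius of order d gives the rate 1 /
        sqrt d.\<close>
      have "norm (L v) \<le> 2 * sqrt (K4 * d) / (\<kappa> * d) * norm v"
      proof (rule holomorphic_map_Cauchy[where f="\<lambda>x. F x - q" and a=z])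
        have "ball z (\<kappa> * d) \<subseteq> ball z d" using d unfolding \<kappa>_def by (intro subset_ball) (auto simp: min_def)
        then have "holomorphic_map_on F (ball z (\<kappa> * d))" using holomorphic_map_on_subset[OF F(1)] ballD by blast
        moreover have "holomorphic_map_on (\<lambda>x. q) (ball z (\<kappa> * d))"
          unfolding holomorphic_map_on_def by (auto intro!: exI[of _ "\<lambda>_. 0"])
        ultimately show "holomorphic_map_on (\<lambda>x. F x - q) (ball z (\<kappa> * d))" by (rule holomorphic_map_on_diff)
        show "((\<lambda>x. F x - q) has_derivative L) (at z)" using has_derivative_diff[OF L has_derivative_const[of q]] by simp
      qed (use near d \<kappa> in auto)
      also have "\<dots> = (2 * sqrt K4 / \<kappa>) * norm v / sqrt d"
      proof -
        have "sqrt d * sqrt d = d" using d by simp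
        then have "sqrt (K4 * d) / d = sqrt K4 / sqrt d" using d by (simp add: real_sqrt_mult field_simps)
        then have "2 * (sqrt (K4 * d) / d) / \<kappa> * norm v = 2 * (sqrt K4 / sqrt d) / \<kappa> * norm v" by simp
        then show ?thesis by (simp add: mult.commute mult.left_commute)
      qed
      also have "\<dots> \<le> K * norm v / sqrt d"
        using d by (intro divide_right_mono mult_right_mono) (auto simp: K_def)
      finally show ?thesis by (simp add: d_def)
    next
      case False
      \<comment> \<open>The depth \<open>d\<close> is bounded below, so the crude Cauchy bound of
        order 1/d is already a multiple of 1 / sqrt d.\<close>
      then have "r'/2 \<le> K1 * d" using dd by simp
      then have "1 \<le> 2 * K1 / r' * d" using cr by (simp add: field_simps)
      then have s1: "1 \<le> sqrt (2 * K1 / r') * sqrt d" by (metis real_sqrt_mult real_sqrt_ge_1_iff)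
      have "norm (L v) \<le> 2 * R' / d * norm v"
        using holomorphic_map_Cauchy[OF holomorphic_map_on_subset[OF F(1) ballD] d _ L] nb ballD by blast
      also have "\<dots> = 2 * R' * norm v / sqrt d * (1 / sqrt d)" using d by (simp add: real_sqrt_mult_self field_simps)
      also have "\<dots> \<le> 2 * R' * norm v / sqrt d * sqrt (2 * K1 / r')"
        using s1 d R' by (intro mult_left_mono) (auto simp: divide_le_eq)
      also have "\<dots> = (2 * \<bar>R'\<bar> * sqrt (2 * K1 / r')) * norm v / sqrt d" using R' by simp
      also have "\<dots> \<le> K * norm v / sqrt d"
        using d by (intro divide_right_mono mult_right_mono) (auto simp: K_def)
      finally show ?thesis by (simp add: d_def)
    qed
  qed
  show thesis
    by (rule that[of K]) (rule main, assumption+)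
qed

section \<open>Domains with boundary of class C2\<close>

lemma defining_function_le_0_closure:
  assumes "open U" "continuous_on U \<rho>" "D \<inter> U = {z\<in>U. \<rho> z < 0}" "z \<in> closure D" "z \<in> U"
  shows "\<rho> z \<le> (0::real)"
proof (rule ccontr)
  assume "\<not> \<rho> z \<le> 0"
  then have z: "z \<in> U \<inter> \<rho> -` {0<..}" using assms(5) by simp
  have "open (U \<inter> \<rho> -` {0<..})" using continuous_open_preimage[OF assms(2,1) open_greaterThan] .
  then have "D \<inter> (U \<inter> \<rho> -` {0<..}) \<noteq> {}" using z assms(4) by (metis IntI disjoint_iff open_Int_closure_eq_empty)
  then obtain x where "x \<in> D" "x \<in> U" "0 < \<rho> x" by auto
  moreover have "x \<in> {z\<in>U. \<rho> z < 0}" using assms(3) calculation by blast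
  ultimately show False by simp
qed

lemma defining_function_frontier:
  assumes "open D" "open U" "continuous_on U \<rho>" "D \<inter> U = {z\<in>U. \<rho> z < 0}" "z \<in> frontier D" "z \<in> U"
  shows "\<rho> z = (0::real)"
proof -
  have "z \<notin> D" "z \<in> closure D" using assms(1,5) by (auto simp: frontier_def interior_open)
  then show ?thesis using defining_function_le_0_closure[OF assms(2-4)] assms(4,6) by fastforce
qed

lemma C2_on_continuous: "C2_on U f Df D2f \<Longrightarrow> continuous_on U f"
  unfolding C2_on_def by (meson continuous_at_imp_continuous_on has_derivative_continuous)

text \<open>A boundary point interior to the closure would be a local maximum of \<rho>, against the
  nonvanishing differential. A slit disc lacks this property; it lets a domain be recovered from its
  closure, which is what a parameterization prescribes.\<close>

lemma bounded_C2_domain_interior_closure: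
  assumes "bounded_C2_domain D"
  shows "interior (closure D) = D"
proof -
  obtain U \<rho> D\<rho> D2\<rho> where D: "open D" and d: "C2_defining_function D U \<rho> D\<rho> D2\<rho>"
    using assms unfolding bounded_C2_domain_def bounded_domain_def by blast
  have U: "open U" "frontier D \<subseteq> U" "C2_on U \<rho> D\<rho> D2\<rho>" "D \<inter> U = {z\<in>U. \<rho> z < 0}" "\<And>p. p \<in> frontier D \<Longrightarrow> D\<rho> p \<noteq> 0"
    using d unfolding C2_defining_function_def by auto
  note c = C2_on_continuous[OF U(3)]
  have "p \<in> D" if p: "p \<in> interior (closure D)" for p
  proof (rule ccontr)
    assume "p \<notin> D"
    then have pf: "p \<in> frontier D" using p D interior_subset by (auto simp: frontier_def interior_open)
    then have pU: "p \<in> U" using U by blast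
    have \<rho>p: "\<rho> p = 0" using defining_function_frontier[OF D U(1) c U(4) pf pU] .
    have der: "(\<rho> has_derivative D\<rho> p) (at p)" using U(3) pU unfolding C2_on_def by blast
    have "open (interior (closure D) \<inter> U)" using U(1) by auto
    then obtain e where e: "e > 0" "ball p e \<subseteq> interior (closure D) \<inter> U"
      using p pU unfolding open_contains_ball by blast
    have "\<rho> y \<le> \<rho> p" if "y \<in> ball p e" for y
    proof -
      have "y \<in> closure D" "y \<in> U" using e(2) that interior_subset by blast+
      then show ?thesis using defining_function_le_0_closure[OF U(1) c U(4)] \<rho>p by simp
    qed
    then have "blinfun_apply (D\<rho> p) = (\<lambda>v. 0)"
      using differential_zero_maxmin[OF _ open_ball der, of p e] e(1) by auto
    then have "D\<rho> p = 0" by (intro blinfun_eqI) simp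
    then show False using U(5)[OF pf] by simp
  qed
  moreover have "D \<subseteq> interior (closure D)" using D closure_subset interior_maximal by blast
  ultimately show ?thesis by blast
qed

text \<open>A uniform cone condition: one direction \<open>n\<close> serves all points near
  \<open>p\<close>, and stepping back by \<tau> gains depth at least \<open>s * \<tau>\<close>. It
  takes the place of convexity in mean value arguments.\<close>

definition transversal :: "'a::real_normed_vector set \<Rightarrow> real \<Rightarrow> bool" where
  "transversal D s \<longleftrightarrow> 0 < s \<and> s \<le> 1 \<and> (\<forall>p\<in>closure D. \<exists>n. norm n = 1 \<and>
     (\<forall>x\<in>closure D \<inter> ball p s. \<forall>\<tau>\<in>{0<..s}. ball (x - \<tau> *\<^sub>R n) (s * \<tau>) \<subseteq> D))"

lemma bounded_C2_domain_transversal_at: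
  fixes D :: "(complex^'n) set"
  assumes "bounded_C2_domain D" and p: "p \<in> closure D"
  shows "\<exists>s>0. \<exists>n. norm n = 1 \<and> (\<forall>x\<in>closure D \<inter> ball p s. \<forall>\<tau>\<in>{0<..s}. ball (x - \<tau> *\<^sub>R n) (s * \<tau>) \<subseteq> D)"
proof (cases "p \<in> D")
  case True
  have "open D" using assms(1) unfolding bounded_C2_domain_def bounded_domain_def by blast
  then obtain e where e: "e > 0" "ball p e \<subseteq> D" using True unfolding open_contains_ball by blast
  obtain n :: "complex^'n" where n: "norm n = 1" using vector_choose_size[of 1] by auto
  define s where "s = min 1 (e/3)"
  have s: "0 < s" "s \<le> 1" "3 * s \<le> e" using e by (auto simp: s_def)
  have "ball (x - \<tau> *\<^sub>R n) (s * \<tau>) \<subseteq> D" if x: "x \<in> ball p s" and t: "0 < \<tau>" "\<tau> \<le> s" for x \<tau>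
  proof
    fix y assume y: "y \<in> ball (x - \<tau> *\<^sub>R n) (s * \<tau>)"
    have "s * \<tau> \<le> 1 * s" using s t by (intro mult_mono) auto
    then have "dist (x - \<tau> *\<^sub>R n) y < s" using y by simp
    moreover have "dist x (x - \<tau> *\<^sub>R n) \<le> s" using n t by (simp add: dist_norm)
    moreover have "dist p x < s" using x by simp
    ultimately have "dist p y < 3 * s"
      using dist_triangle[of p y x] dist_triangle[of x y "x - \<tau> *\<^sub>R n"] by linarith
    then show "y \<in> D" using e(2) s(3) by auto
  qed
  then show ?thesis using s(1) n by (intro exI[of _ s] conjI exI[of _ n]) auto
next
  case False
  obtain U \<rho> D\<rho> D2\<rho> where D: "open D" and d: "C2_defining_function D U \<rho> D\<rho> D2\<rho>"
    using assms unfolding bounded_C2_domain_def bounded_domain_def by blast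
  have U: "open U" "frontier D \<subseteq> U" "C2_on U \<rho> D\<rho> D2\<rho>" "D \<inter> U = {z\<in>U. \<rho> z < 0}" "\<And>p. p \<in> frontier D \<Longrightarrow> D\<rho> p \<noteq> 0"
    using d unfolding C2_defining_function_def by auto
  note c = C2_on_continuous[OF U(3)]
  have pf: "p \<in> frontier D" using p False D by (simp add: frontier_def interior_open)
  then have pU: "p \<in> U" using U by blast
  obtain v where v: "D\<rho> p v \<noteq> 0" using U(5)[OF pf] by (metis blinfun_eqI zero_blinfun.rep_eq)
  define n where "n = (sgn (D\<rho> p v) / norm v) *\<^sub>R v"
  have v0: "v \<noteq> 0" using v by auto
  have n: "norm n = 1" using v v0 by (simp add: n_def abs_sgn_eq)
  \<comment> \<open>Of the slope \<open>2 * m\<close> along \<open>n\<close>, the opening of the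
    cone costs \<open>m/2\<close> and the linearisation error costs \<open>m\<close>; a slope of
    \<open>m/2\<close> remains.\<close>
  define m where "m = D\<rho> p n / 2"
  have m: "m > 0" using v v0 by (simp add: m_def n_def blinfun.scaleR_right sgn_mult_abs[symmetric] zero_less_mult_iff zero_less_divide_iff sgn_real_def)
  have "continuous_on U D\<rho>" using U(3) unfolding C2_on_def by blast
  then have "isCont D\<rho> p" using U(1) pU continuous_on_eq_continuous_at by blast
  then obtain e1 where e1: "e1 > 0" "\<And>z. dist z p < e1 \<Longrightarrow> dist (D\<rho> z) (D\<rho> p) < m/2"
    using m unfolding continuous_at_eps_delta by (metis half_gt_zero)
  obtain e2 where e2: "e2 > 0" "ball p e2 \<subseteq> U" using U(1) pU unfolding open_contains_ball by blast
  define e where "e = min e1 e2"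
  have e: "e > 0" using e1 e2 by (simp add: e_def)
  have bU: "ball p e \<subseteq> U" using e2 by (auto simp: e_def)
  define s where "s = min (min 1 (e/3)) (m / (2 * (norm (D\<rho> p) + 1)))"
  have s: "0 < s" "s \<le> 1" "3 * s \<le> e" "s \<le> m / (2 * (norm (D\<rho> p) + 1))"
    using e m by (auto simp: s_def add_nonneg_pos)
  have sm: "norm (D\<rho> p) * s \<le> m/2"
  proof -
    have "norm (D\<rho> p) * s \<le> (norm (D\<rho> p) + 1) * (m / (2 * (norm (D\<rho> p) + 1)))"
      using s by (intro mult_mono) auto
    also have "\<dots> = m/2"
    proof -
      have "a * (m / (2 * a)) = m / 2" if "a \<noteq> 0" for a :: real using that by simp
      moreover have "norm (D\<rho> p) + 1 \<noteq> 0" using norm_ge_zero[of "D\<rho> p"] by linarith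
      ultimately show ?thesis by blast
    qed
    finally show ?thesis .
  qed
  have "ball (x - \<tau> *\<^sub>R n) (s * \<tau>) \<subseteq> D" if xc: "x \<in> closure D" and x: "x \<in> ball p s" and t: "0 < \<tau>" "\<tau> \<le> s" for x \<tau>
  proof
    fix y assume y: "y \<in> ball (x - \<tau> *\<^sub>R n) (s * \<tau>)"
    define u where "u = y - (x - \<tau> *\<^sub>R n)"
    have u: "norm u < s * \<tau>" using y by (simp add: u_def dist_norm norm_minus_commute)
    have st: "s * \<tau> \<le> \<tau>" using s t by (simp add: mult_left_le_one_le)
    have yx: "y - x = u - \<tau> *\<^sub>R n" by (simp add: u_def)
    have nyx: "norm (y - x) \<le> 2 * \<tau>"
    proof -
      have "norm (\<tau> *\<^sub>R n) = \<tau>" using n t by simp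
      then show ?thesis unfolding yx using norm_triangle_ineq4[of u "\<tau> *\<^sub>R n"] u st by linarith
    qed
    have xb: "x \<in> ball p e" using x s e by auto
    have yb: "y \<in> ball p e"
    proof -
      have "dist p y \<le> dist p x + norm (y - x)" using dist_triangle[of p y x] by (simp add: dist_norm norm_minus_commute)
      then show ?thesis using nyx x s t by simp
    qed
    have "norm (\<rho> y - \<rho> x - D\<rho> p (y - x)) \<le> norm (y - x) * (m/2)"
    proof (rule differentiable_bound_linearization[where f'="\<lambda>z. blinfun_apply (D\<rho> z)" and S="ball p e"])
      show "x + t *\<^sub>R (y - x) \<in> ball p e" if "t \<in> {0..1}" for t
        using convexD_alt[OF convex_ball xb yb, of t] that by (simp add: algebra_simps)
      show "(\<rho> has_derivative blinfun_apply (D\<rho> z)) (at z within ball p e)" if "z \<in> ball p e" for z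
        using U(3) bU that unfolding C2_on_def by (meson has_derivative_at_withinI subsetD)
      show "onorm (blinfun_apply (D\<rho> z) - blinfun_apply (D\<rho> p)) \<le> m/2" if "z \<in> ball p e" for z
      proof -
        have "dist (D\<rho> z) (D\<rho> p) < m/2" using e1(2)[of z] that by (simp add: e_def dist_commute)
        then show ?thesis by (simp add: dist_norm norm_blinfun.rep_eq minus_blinfun.rep_eq fun_diff_def)
      qed
    qed (use e in auto)
    then have "\<rho> y \<le> \<rho> x + D\<rho> p (y - x) + 2 * \<tau> * (m/2)"
    proof -
      have "norm (y - x) * (m/2) \<le> 2 * \<tau> * (m/2)" using nyx m by (intro mult_right_mono) auto
      then show ?thesis using \<open>norm (\<rho> y - \<rho> x - D\<rho> p (y - x)) \<le> _\<close> unfolding real_norm_def by linarith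
    qed
    moreover have "D\<rho> p (y - x) \<le> norm (D\<rho> p) * (s * \<tau>) - \<tau> * (2 * m)"
    proof -
      have "D\<rho> p u \<le> norm (D\<rho> p) * norm u" using norm_blinfun[of "D\<rho> p" u] by (simp add: abs_le_iff)
      also have "\<dots> \<le> norm (D\<rho> p) * (s * \<tau>)" using u by (intro mult_left_mono) auto
      finally show ?thesis unfolding yx by (simp add: blinfun.diff_right blinfun.scaleR_right m_def)
    qed
    moreover have "norm (D\<rho> p) * (s * \<tau>) \<le> m/2 * \<tau>" using sm t by (metis less_eq_real_def mult.assoc mult_right_mono)
    moreover have "\<rho> x \<le> 0" using defining_function_le_0_closure[OF U(1) c U(4) xc] xb bU by blast
    moreover have "m * \<tau> > 0" using m t by simp
    ultimately have "\<rho> y < 0" by (simp add: algebra_simps)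
    then show "y \<in> D" using U(4) yb bU by blast
  qed
  then show ?thesis using s(1) n by (intro exI[of _ s] conjI exI[of _ n]) auto
qed

lemma bounded_C2_domain_transversal:
  fixes D :: "(complex^'n) set"
  assumes D: "bounded_C2_domain D"
  obtains s where "transversal D s"
proof -
  have "\<forall>p\<in>closure D. \<exists>s n. s > 0 \<and> norm n = 1 \<and> (\<forall>x\<in>closure D \<inter> ball p s. \<forall>\<tau>\<in>{0<..s}. ball (x - \<tau> *\<^sub>R n) (s * \<tau>) \<subseteq> D)"
    using bounded_C2_domain_transversal_at[OF D] by blast
  then obtain s n where s: "\<And>p. p \<in> closure D \<Longrightarrow> s p > (0::real)" and n: "\<And>p. p \<in> closure D \<Longrightarrow> norm (n p) = 1"
    and T: "\<And>p x \<tau>. p \<in> closure D \<Longrightarrow> x \<in> closure D \<inter> ball p (s p) \<Longrightarrow> \<tau> \<in> {0<..s p} \<Longrightarrow> ball (x - \<tau> *\<^sub>R n p) (s p * \<tau>) \<subseteq> D"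
    by metis
  have "compact (closure D)"
    using D unfolding bounded_C2_domain_def bounded_domain_def by (simp add: compact_closure)
  then obtain P where P: "P \<subseteq> closure D" "finite P" "closure D \<subseteq> (\<Union>p\<in>P. ball p (s p / 2))"
  proof (rule compactE_image)
    show "closure D \<subseteq> (\<Union>p\<in>closure D. ball p (s p / 2))" using s by force
  qed auto
  \<comment> \<open>The covering balls have half the radius, so a point within \<open>s0\<close> of
    \<open>p\<close> still lies in the full ball of the net point; the entry 1 gives
    \<open>s0 \<le> 1\<close>.\<close>
  define s0 where "s0 = Min (insert 1 ((\<lambda>p. s p / 2) ` P))"
  have s0: "0 < s0" "s0 \<le> 1" using P s by (auto simp: s0_def)
  have s0le: "s0 \<le> s p / 2" if "p \<in> P" for p
    unfolding s0_def by (rule Min_le) (use P(2) that in auto)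
  have "\<exists>n. norm n = 1 \<and> (\<forall>x\<in>closure D \<inter> ball p s0. \<forall>\<tau>\<in>{0<..s0}. ball (x - \<tau> *\<^sub>R n) (s0 * \<tau>) \<subseteq> D)"
    if p: "p \<in> closure D" for p
  proof -
    obtain p' where p': "p' \<in> P" "p \<in> ball p' (s p' / 2)" using P(3) p by blast
    have "ball (x - \<tau> *\<^sub>R n p') (s0 * \<tau>) \<subseteq> D" if x: "x \<in> closure D" "x \<in> ball p s0" and t: "0 < \<tau>" "\<tau> \<le> s0" for x \<tau>
    proof -
      have "dist p' x < s p'" using x(2) p'(2) s0le[OF p'(1)] dist_triangle[of p' x p] by simp
      moreover have "\<tau> \<le> s p'" "s0 \<le> s p'" using t s0le[OF p'(1)] s0 by linarith+
      ultimately have "ball (x - \<tau> *\<^sub>R n p') (s p' * \<tau>) \<subseteq> D" using T[of p' x \<tau>] P(1) p'(1) x(1) t by auto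
      moreover have "s0 * \<tau> \<le> s p' * \<tau>" using \<open>s0 \<le> s p'\<close> t by (intro mult_right_mono) auto
      ultimately show ?thesis using subset_ball by blast
    qed
    then show ?thesis using n P(1) p'(1) by (intro exI[of _ "n p'"]) auto
  qed
  then have "transversal D s0" using s0 by (simp add: transversal_def)
  then show thesis using that by blast
qed

section \<open>Mean value and Taylor estimates up to the boundary\<close>

lemma segment_mvt:
  fixes h :: "'a::real_normed_vector \<Rightarrow> 'b::real_normed_vector"
  assumes c: "continuous_on S h" and S: "\<And>t. t \<in> {0..1} \<Longrightarrow> u + t *\<^sub>R (v - u) \<in> S"
    and d: "\<And>t. t \<in> {0<..<1} \<Longrightarrow> (h has_derivative blinfun_apply (Dh (u + t *\<^sub>R (v - u)))) (at (u + t *\<^sub>R (v - u)))"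
    and b: "\<And>t. t \<in> {0<..<1} \<Longrightarrow> norm (Dh (u + t *\<^sub>R (v - u)) - A) \<le> \<epsilon>"
  shows "norm (h v - h u - blinfun_apply A (v - u)) \<le> \<epsilon> * norm (v - u)"
proof -
  define f where "f t = h (u + t *\<^sub>R (v - u)) - t *\<^sub>R A (v - u)" for t
  have "norm (f 1 - f 0) \<le> 1 * (\<epsilon> * norm (v - u)) - 0 * (\<epsilon> * norm (v - u))"
  proof (rule differentiable_bound_general[of 0 1 f "\<lambda>t. t * (\<epsilon> * norm (v - u))"
        "\<lambda>t. Dh (u + t *\<^sub>R (v - u)) (v - u) - A (v - u)" "\<lambda>t. \<epsilon> * norm (v - u)"])
    have "continuous_on {0..1} (\<lambda>t. h (u + t *\<^sub>R (v - u)))"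
      by (rule continuous_on_compose2[OF c]) (use S in \<open>auto intro!: continuous_intros\<close>)
    then show "continuous_on {0..1} f" unfolding f_def by (intro continuous_intros)
    show "continuous_on {0..1} (\<lambda>t. t * (\<epsilon> * norm (v - u)))" by (intro continuous_intros)
    fix t :: real assume t: "0 < t" "t < 1"
    have l: "((\<lambda>t. u + t *\<^sub>R (v - u)) has_vector_derivative (v - u)) (at t)"
      by (auto intro!: derivative_eq_intros)
    have "((\<lambda>t. h (u + t *\<^sub>R (v - u))) has_vector_derivative Dh (u + t *\<^sub>R (v - u)) (v - u)) (at t)"
      using diff_chain_at[OF l[unfolded has_vector_derivative_def] d[of t]] t
      by (simp add: has_vector_derivative_def o_def blinfun.scaleR_right)
    then show "(f has_vector_derivative (Dh (u + t *\<^sub>R (v - u)) (v - u) - A (v - u))) (at t)"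
      unfolding f_def by (auto intro!: derivative_eq_intros)
    show "((\<lambda>t. t * (\<epsilon> * norm (v - u))) has_vector_derivative (\<epsilon> * norm (v - u))) (at t)"
      by (auto intro!: derivative_eq_intros simp: has_real_derivative_iff_has_vector_derivative[symmetric])
    have "norm ((Dh (u + t *\<^sub>R (v - u)) - A) (v - u)) \<le> norm (Dh (u + t *\<^sub>R (v - u)) - A) * norm (v - u)"
      by (rule norm_blinfun)
    also have "\<dots> \<le> \<epsilon> * norm (v - u)" using b[of t] t by (intro mult_right_mono) auto
    finally show "norm (Dh (u + t *\<^sub>R (v - u)) (v - u) - A (v - u)) \<le> \<epsilon> * norm (v - u)"
      by (simp add: blinfun.diff_left)
  qed simp
  then show ?thesis by (simp add: f_def algebra_simps)
qed

text \<open>The path from \<open>x\<close> to \<open>y\<close> first descends along the transversal \<open>n\<close>, so that it stays in \<open>D\<close>.\<close>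
lemma transversal_mvt:
  fixes h :: "'a::real_normed_vector \<Rightarrow> 'b::real_normed_vector"
  assumes T: "transversal D s" and c: "continuous_on (closure D) h"
    and d: "\<And>x. x \<in> D \<Longrightarrow> (h has_derivative blinfun_apply (Dh x)) (at x)"
    and xy: "x \<in> closure D" "y \<in> closure D" "norm (x - y) < s\<^sup>2 / 2"
    and b: "\<And>z. z \<in> D \<Longrightarrow> norm (z - y) \<le> (1 + 4/s) * norm (x - y) \<Longrightarrow> norm (Dh z - A) \<le> \<epsilon>"
  shows "norm (h x - h y - blinfun_apply A (x - y)) \<le> \<epsilon> * (1 + 4/s) * norm (x - y)"
proof (cases "x = y")
  case True then show ?thesis by simp
next
  case False
  have s: "0 < s" "s \<le> 1" using T by (auto simp: transversal_def)
  define l where "l = norm (x - y)"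
  have l: "l > 0" "l < s\<^sup>2/2" using False xy by (auto simp: l_def)
  obtain n where n: "norm n = 1" and N: "\<And>x \<tau>. x \<in> closure D \<Longrightarrow> x \<in> ball y s \<Longrightarrow> 0 < \<tau> \<Longrightarrow> \<tau> \<le> s \<Longrightarrow> ball (x - \<tau> *\<^sub>R n) (s * \<tau>) \<subseteq> D"
    using T xy(2) unfolding transversal_def by fastforce
  \<comment> \<open>Since \<open>s * \<tau> = 2 * l\<close>, the cone ball about the descended
    \<open>x\<close> contains the parallel segment of length \<open>l\<close>; the whole path has
    length \<open>2 * \<tau> + l = (1 + 4/s) * l\<close>.\<close>
  define \<tau> where "\<tau> = 2 * l / s"
  have \<tau>: "\<tau> > 0" "\<tau> \<le> s" "s * \<tau> = 2 * l" using l s by (auto simp: \<tau>_def field_simps power2_eq_square)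
  have xs: "x \<in> ball y s"
  proof -
    have "s\<^sup>2/2 < s" using s mult_left_le[of s s] by (simp add: power2_eq_square)
    then show ?thesis using l by (simp add: l_def dist_norm norm_minus_commute)
  qed
  have ys: "y \<in> ball y s" using s by simp
  have down: "z - (t * \<tau>) *\<^sub>R n \<in> D" if "z = x \<or> z = y" "0 < t" "t \<le> 1" for z t
  proof -
    have "ball (z - (t * \<tau>) *\<^sub>R n) (s * (t * \<tau>)) \<subseteq> D"
      using that xy xs ys \<tau> by (intro N) (auto simp: mult_left_le_one_le intro: order_trans[OF mult_left_le_one_le])
    moreover have "s * (t * \<tau>) > 0" using s that \<tau> by simp
    ultimately show ?thesis by (meson centre_in_ball subsetD)
  qed
  define x' where "x' = x - \<tau> *\<^sub>R n"
  define y' where "y' = y - \<tau> *\<^sub>R n"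
  have mid: "y' + t *\<^sub>R (x' - y') \<in> D" if "t \<in> {0..1}" for t
  proof -
    have "dist x' (y' + t *\<^sub>R (x' - y')) = (1 - t) * l"
    proof -
      have "x' - (y' + t *\<^sub>R (x' - y')) = (1 - t) *\<^sub>R (x - y)" by (simp add: x'_def y'_def algebra_simps)
      then show ?thesis using that by (simp add: dist_norm l_def)
    qed
    also have "\<dots> \<le> l" using that l by (simp add: mult_left_le_one_le)
    also have "\<dots> < s * \<tau>" using \<tau> l by simp
    finally show ?thesis using N[OF xy(1) xs \<tau>(1,2)] unfolding x'_def by auto
  qed
  have bd1: "norm (x - y - r *\<^sub>R n) \<le> (1 + 4/s) * l" if "0 \<le> r" "r \<le> \<tau>" for r
  proof -
    have "norm (x - y - r *\<^sub>R n) \<le> l + \<tau>" using norm_triangle_ineq4[of "x - y" "r *\<^sub>R n"] n that by (simp add: l_def)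
    also have "\<dots> \<le> (1 + 4/s) * l" using l s by (simp add: \<tau>_def field_simps)
    finally show ?thesis .
  qed
  have bd2: "norm (t *\<^sub>R (x - y) - r *\<^sub>R n) \<le> (1 + 4/s) * l" if "0 \<le> r" "r \<le> \<tau>" "0 \<le> t" "t \<le> 1" for r t
  proof -
    have "norm (t *\<^sub>R (x - y) - r *\<^sub>R n) \<le> t * l + \<tau>" using norm_triangle_ineq4[of "t *\<^sub>R (x - y)" "r *\<^sub>R n"] n that by (simp add: l_def)
    also have "t * l \<le> l" using that l by (simp add: mult_left_le_one_le)
    also have "l + \<tau> \<le> (1 + 4/s) * l" using l s by (simp add: \<tau>_def field_simps)
    finally show ?thesis by simp
  qed
  have down': "z + t *\<^sub>R (z - \<tau> *\<^sub>R n - z) = z - (t * \<tau>) *\<^sub>R n" for z t by simp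
  have tt: "t * \<tau> \<le> \<tau>" "0 \<le> t * \<tau>" if "0 < t" "t < 1" for t using that \<tau> by (auto simp: mult_left_le_one_le)
  have clo: "z - (t * \<tau>) *\<^sub>R n \<in> closure D" if "z = x \<or> z = y" "t \<in> {0..1}" for z t
    using down[OF that(1), of t] that xy closure_subset[of D] by (cases "t = 0") auto
  have 1: "norm (h x' - h x - A (x' - x)) \<le> \<epsilon> * norm (x' - x)"
    unfolding x'_def
  proof (rule segment_mvt[OF c, where Dh=Dh]; unfold down')
    fix t :: real assume t: "t \<in> {0<..<1}"
    show "norm (Dh (x - (t * \<tau>) *\<^sub>R n) - A) \<le> \<epsilon>"
      using b[OF down, of x t] bd1[OF tt(2,1), of t] t by (simp add: l_def algebra_simps)
  qed (use clo down d in auto)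
  have 2: "norm (h y' - h y - A (y' - y)) \<le> \<epsilon> * norm (y' - y)"
    unfolding y'_def
  proof (rule segment_mvt[OF c, where Dh=Dh]; unfold down')
    fix t :: real assume t: "t \<in> {0<..<1}"
    show "norm (Dh (y - (t * \<tau>) *\<^sub>R n) - A) \<le> \<epsilon>"
      using b[OF down, of y t] bd2[OF tt(2,1), of t 0] t by (simp add: l_def algebra_simps)
  qed (use clo down d in auto)
  have 3: "norm (h x' - h y' - A (x' - y')) \<le> \<epsilon> * norm (x' - y')"
  proof (rule segment_mvt[OF c, where Dh=Dh])
    fix t :: real assume t: "t \<in> {0<..<1}"
    have "y' + t *\<^sub>R (x' - y') - y = t *\<^sub>R (x - y) - \<tau> *\<^sub>R n" by (simp add: x'_def y'_def)
    then show "norm (Dh (y' + t *\<^sub>R (x' - y')) - A) \<le> \<epsilon>"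
      using b[OF mid, of t] bd2[of \<tau> t] t \<tau> by (simp add: l_def)
  qed (use mid closure_subset d in auto)
  have nn: "norm (x' - x) = \<tau>" "norm (y' - y) = \<tau>" "norm (x' - y') = l"
    using n \<tau> by (auto simp: x'_def y'_def l_def)
  define a1 where "a1 = h x' - h x - A (x' - x)"
  define a2 where "a2 = h y' - h y - A (y' - y)"
  define a3 where "a3 = h x' - h y' - A (x' - y')"
  have "h x - h y - A (x - y) = a3 - a1 + a2"
    by (simp add: a1_def a2_def a3_def blinfun.diff_right algebra_simps)
  also have "norm \<dots> \<le> \<epsilon> * l + \<epsilon> * \<tau> + \<epsilon> * \<tau>"
    using 1 2 3 norm_triangle_ineq[of "a3 - a1" a2] norm_triangle_ineq4[of a3 a1]
    unfolding nn a1_def[symmetric] a2_def[symmetric] a3_def[symmetric] by linarith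
  also have "\<dots> = \<epsilon> * (1 + 4/s) * l" using s by (simp add: \<tau>_def field_simps)
  finally show ?thesis by (simp add: l_def)
qed

text \<open>The path of \<open>transversal_mvt\<close> replaces the segment, which may leave
  \<open>D\<close>. The bounds are linear in \<open>b\<close>, so that for a difference of
  parameterizations a small C^2 size yields small first- and second-order remainders.\<close>

lemma C2_closure_estimates:
  fixes D :: "(complex^'n) set"
  assumes T: "transversal D s"
  obtains K where "K > 0"
    "\<And>h Dh D2h b x y. \<lbrakk>continuous_on (closure D) h; continuous_on (closure D) Dh;
       \<And>x. x \<in> D \<Longrightarrow> (h has_derivative blinfun_apply (Dh x)) (at x);
       \<And>x. x \<in> D \<Longrightarrow> (Dh has_derivative blinfun_apply (D2h x)) (at x);
       \<And>x. x \<in> closure D \<Longrightarrow> norm (h x) \<le> b \<and> norm (Dh x) \<le> b \<and> norm (D2h x) \<le> b;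
       x \<in> closure D; y \<in> closure D\<rbrakk>
       \<Longrightarrow> norm (h x - h y :: complex^'n) \<le> b * K * norm (x - y) \<and>
           norm (h x - h y - blinfun_apply (Dh y) (x - y)) \<le> b * K * (norm (x - y))\<^sup>2"
proof -
  have s: "0 < s" "s \<le> 1" using T by (auto simp: transversal_def)
  define M where "M = 1 + 4/s"
  \<comment> \<open>As \<open>M * r = s\<^sup>2/2\<close>, the mean value estimate can be applied a
    second time, to \<open>Dh\<close>, at every point of the path.\<close>
  define r where "r = s\<^sup>2 / (2 * M)"
  \<comment> \<open>\<open>M ^ 3\<close> collects the path factors for \<open>Dh\<close>, for the
    distance of path points from \<open>y\<close>, and for \<open>h\<close>; the other summands are
    for \<open>norm (x - y) \<ge> r\<close>.\<close>
  define K where "K = M ^ 3 + 2/r + 2/r\<^sup>2 + 1/r"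
  have M: "M \<ge> 1" using s by (simp add: M_def)
  have r: "r > 0" "r \<le> s\<^sup>2/2" "M * r = s\<^sup>2/2"
  proof -
    show "r > 0" using s M by (simp add: r_def)
    show e: "M * r = s\<^sup>2/2" using M by (simp add: r_def)
    show "r \<le> s\<^sup>2/2" using e mult_right_mono[OF M, of r] \<open>r > 0\<close> by linarith
  qed
  have K: "K > 0" using M r unfolding K_def by (intro add_pos_pos) auto
  have MK: "M \<le> K" "2/r \<le> K" "M ^ 3 \<le> K" "2/r\<^sup>2 + 1/r \<le> K"
  proof -
    have "M \<le> M ^ 3" using M by (metis power_one_right power_increasing one_le_numeral)
    moreover have "2/r > 0" "2/r\<^sup>2 > 0" "1/r > 0" "M ^ 3 > 0" using r M by auto
    ultimately show "M \<le> K" "2/r \<le> K" "M ^ 3 \<le> K" "2/r\<^sup>2 + 1/r \<le> K" unfolding K_def by linarith+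
  qed
  have main: "norm (h x - h y) \<le> b * K * norm (x - y) \<and>
           norm (h x - h y - blinfun_apply (Dh y) (x - y)) \<le> b * K * (norm (x - y))\<^sup>2"
    if c: "continuous_on (closure D) h" "continuous_on (closure D) Dh"
      and d: "\<And>x. x \<in> D \<Longrightarrow> (h has_derivative blinfun_apply (Dh x)) (at x)"
      and d2: "\<And>x. x \<in> D \<Longrightarrow> (Dh has_derivative blinfun_apply (D2h x)) (at x)"
      and b: "\<And>x. x \<in> closure D \<Longrightarrow> norm (h x) \<le> b \<and> norm (Dh x) \<le> b \<and> norm (D2h x) \<le> b"
      and xy: "x \<in> closure D" "y \<in> closure D"
    for h :: "complex^'n \<Rightarrow> complex^'n" and Dh D2h b x y
  proof -
    define l where "l = norm (x - y)"
    have l0: "l \<ge> 0" by (simp add: l_def)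
    have b0: "b \<ge> 0" using b[OF xy(1)] norm_ge_zero order_trans by blast
    have inD: "z \<in> closure D" if "z \<in> D" for z using that closure_subset by blast
    show ?thesis
    proof (cases "l < r")
      case True
      have ls: "norm (x - y) < s\<^sup>2/2" using True r l_def by simp
      have "norm (h x - h y - blinfun_apply 0 (x - y)) \<le> b * (1 + 4/s) * norm (x - y)"
        by (rule transversal_mvt[OF T c(1) d xy ls]) (use b inD in auto)
      then have "norm (h x - h y) \<le> b * M * l" by (simp add: M_def l_def)
      also have "\<dots> \<le> b * K * l" using MK b0 l0 by (intro mult_right_mono mult_left_mono) auto
      finally have A: "norm (h x - h y) \<le> b * K * l" .
      have Dd: "norm (Dh z - Dh y) \<le> b * M * (M * l)" if z: "z \<in> D" "norm (z - y) \<le> (1 + 4/s) * norm (x - y)" for z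
      proof -
        have zl: "norm (z - y) \<le> M * l" using z by (simp add: M_def l_def)
        also have "M * l < M * r" using True M by simp
        finally have zs: "norm (z - y) < s\<^sup>2/2" using r by simp
        have "norm (Dh z - Dh y - blinfun_apply 0 (z - y)) \<le> b * (1 + 4/s) * norm (z - y)"
          by (rule transversal_mvt[OF T c(2) d2 inD[OF z(1)] xy(2) zs]) (use b inD in auto)
        also have "\<dots> \<le> b * M * (M * l)" using zl b0 M by (simp add: M_def[symmetric] mult_left_mono)
        finally show ?thesis by simp
      qed
      have "norm (h x - h y - Dh y (x - y)) \<le> (b * M * (M * l)) * (1 + 4/s) * norm (x - y)"
        by (rule transversal_mvt[OF T c(1) d xy ls Dd]) auto
      also have "\<dots> = b * M ^ 3 * l\<^sup>2" by (simp add: M_def[symmetric] l_def[symmetric] power2_eq_square power3_eq_cube)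
      also have "\<dots> \<le> b * K * l\<^sup>2" using MK b0 by (intro mult_right_mono mult_left_mono) auto
      finally show ?thesis using A by (simp add: l_def)
    next
      case False
      have hh: "norm (h x - h y) \<le> 2 * b" using b[OF xy(1)] b[OF xy(2)] norm_triangle_ineq4[of "h x" "h y"] by linarith
      have lr: "1 \<le> l / r" using False r by simp
      have "2 * b * 1 \<le> 2 * b * (l / r)" using b0 lr by (intro mult_left_mono) auto
      then have "2 * b \<le> 2 * b * (l / r)" by simp
      also have "\<dots> = b * (2/r) * l" by simp
      also have "\<dots> \<le> b * K * l" using MK b0 l0 by (intro mult_right_mono mult_left_mono) auto
      finally have A: "norm (h x - h y) \<le> b * K * l" using hh by simp
      have "norm (Dh y (x - y)) \<le> norm (Dh y) * l" unfolding l_def by (rule norm_blinfun)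
      also have "\<dots> \<le> b * l" using b[OF xy(2)] l0 by (intro mult_right_mono) auto
      finally have "norm (h x - h y - Dh y (x - y)) \<le> 2 * b + b * l"
        using hh norm_triangle_ineq4[of "h x - h y" "Dh y (x - y)"] by linarith
      also have "\<dots> \<le> 2 * b * (l/r)\<^sup>2 + b * l * (l / r)"
      proof -
        have "1 \<le> (l/r)\<^sup>2" using lr by simp
        then have "2 * b * 1 \<le> 2 * b * (l/r)\<^sup>2" using b0 by (intro mult_left_mono) auto
        moreover have "b * l * 1 \<le> b * l * (l/r)" using b0 l0 lr by (intro mult_left_mono) auto
        ultimately show ?thesis by simp
      qed
      also have "\<dots> = b * (2/r\<^sup>2 + 1/r) * l\<^sup>2" by (simp add: power_divide power2_eq_square algebra_simps)
      also have "\<dots> \<le> b * K * l\<^sup>2" using MK b0 by (intro mult_right_mono mult_left_mono) auto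
      finally show ?thesis using A by (simp add: l_def)
    qed
  qed
  show thesis by (rule that[OF K]) (rule main, assumption+)
qed

section \<open>Families of domains of class C20\<close>

text \<open>The derivatives and the transversality constant are fixed once and for all.
  \<open>C2dom\<close> is recorded next to \<open>img\<close> because the latter speaks of closures
  only.\<close>

locale param_family =
  fixes D0 :: "(complex^'n) set" and \<Gamma> :: "real \<Rightarrow> complex^'n \<Rightarrow> complex^'n" and Dfam :: "real \<Rightarrow> (complex^'n) set"
    and D\<Gamma> :: "real \<Rightarrow> complex^'n \<Rightarrow> ((complex^'n) \<Rightarrow>\<^sub>L (complex^'n))"
    and D2\<Gamma> :: "real \<Rightarrow> complex^'n \<Rightarrow> ((complex^'n) \<Rightarrow>\<^sub>L ((complex^'n) \<Rightarrow>\<^sub>L (complex^'n)))" and s :: real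
  assumes D0: "bounded_C2_domain D0" and T: "transversal D0 s"
    and der: "\<And>t x. t \<in> {0..1} \<Longrightarrow> x \<in> D0 \<Longrightarrow> (\<Gamma> t has_derivative blinfun_apply (D\<Gamma> t x)) (at x)"
    and der2: "\<And>t x. t \<in> {0..1} \<Longrightarrow> x \<in> D0 \<Longrightarrow> (D\<Gamma> t has_derivative blinfun_apply (D2\<Gamma> t x)) (at x)"
    and cont: "continuous_on ({0..1} \<times> closure D0) (\<lambda>(t, x). \<Gamma> t x)"
    and cont1: "continuous_on ({0..1} \<times> closure D0) (\<lambda>(t, x). D\<Gamma> t x)"
    and cont2: "continuous_on ({0..1} \<times> closure D0) (\<lambda>(t, x). D2\<Gamma> t x)"
    and inj: "\<And>t. t \<in> {0..1} \<Longrightarrow> inj_on (\<Gamma> t) (closure D0)"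
    and img: "\<And>t. t \<in> {0..1} \<Longrightarrow> \<Gamma> t ` closure D0 = closure (Dfam t)"
    and injD: "\<And>t x. t \<in> {0..1} \<Longrightarrow> x \<in> closure D0 \<Longrightarrow> inj (blinfun_apply (D\<Gamma> t x))"
    and C2dom: "\<And>t. t \<in> {0..1} \<Longrightarrow> bounded_C2_domain (Dfam t)"

lemma parameterization_param_family:
  assumes "parameterization D0 \<Gamma> Dfam" "\<And>t. t \<in> {0..1} \<Longrightarrow> bounded_C2_domain (Dfam t)"
  obtains D\<Gamma> D2\<Gamma> s where "param_family D0 \<Gamma> Dfam D\<Gamma> D2\<Gamma> s"
proof -
  have "bounded_C2_domain D0" using assms(1) unfolding parameterization_def by (elim conjE)
  then obtain s where s: "transversal D0 s" by (rule bounded_C2_domain_transversal)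
  obtain D\<Gamma> D2\<Gamma> where P: "bounded_C2_domain D0"
      "\<forall>t\<in>{0..1}. \<forall>x\<in>D0. (\<Gamma> t has_derivative blinfun_apply (D\<Gamma> t x)) (at x)"
      "\<forall>t\<in>{0..1}. \<forall>x\<in>D0. (D\<Gamma> t has_derivative blinfun_apply (D2\<Gamma> t x)) (at x)"
      "continuous_on ({0..1} \<times> closure D0) (\<lambda>(t, x). \<Gamma> t x)"
      "continuous_on ({0..1} \<times> closure D0) (\<lambda>(t, x). D\<Gamma> t x)"
      "continuous_on ({0..1} \<times> closure D0) (\<lambda>(t, x). D2\<Gamma> t x)"
      "\<forall>t\<in>{0..1}. inj_on (\<Gamma> t) (closure D0) \<and> \<Gamma> t ` closure D0 = closure (Dfam t) \<and>
            (\<forall>x\<in>closure D0. inj (blinfun_apply (D\<Gamma> t x)))"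
    using assms(1)[unfolded parameterization_def] by (elim conjE exE)
  have "param_family D0 \<Gamma> Dfam D\<Gamma> D2\<Gamma> s"
  proof (rule param_family.intro)
    show "inj_on (\<Gamma> t) (closure D0)" "\<Gamma> t ` closure D0 = closure (Dfam t)" if "t \<in> {0..1}" for t
      using bspec[OF P(7) that] by blast+
    show "inj (blinfun_apply (D\<Gamma> t x))" if "t \<in> {0..1}" "x \<in> closure D0" for t x
      using bspec[OF P(7) that(1)] that(2) by blast
  qed (fact P(1) s P(4,5,6) | rule bspec[OF bspec[OF P(2)]] bspec[OF bspec[OF P(3)]] assms(2), assumption+)+
  then show thesis using that by blast
qed

context param_family
begin

lemma D0_open: "open D0" and D0_bounded: "bounded D0" and D0_connected: "connected D0" and D0_ne: "D0 \<noteq> {}"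
  using D0 unfolding bounded_C2_domain_def bounded_domain_def by auto

lemma compact_closure_D0: "compact (closure D0)"
  using D0_bounded by (simp add: compact_closure)

lemma Dfam_open: "t \<in> {0..1} \<Longrightarrow> open (Dfam t)"
  and Dfam_connected: "t \<in> {0..1} \<Longrightarrow> connected (Dfam t)"
  and Dfam_bounded: "t \<in> {0..1} \<Longrightarrow> bounded (Dfam t)"
  and Dfam_ne: "t \<in> {0..1} \<Longrightarrow> Dfam t \<noteq> {}"
  using C2dom unfolding bounded_C2_domain_def bounded_domain_def by auto

lemma compact_param: "compact ({0..1::real} \<times> closure D0)"
  by (intro compact_Times compact_closure_D0) simp

lemma unif_in_t:
  fixes \<Phi> :: "real \<Rightarrow> complex^'n \<Rightarrow> 'b::real_normed_vector"
  assumes c: "continuous_on ({0..1} \<times> closure D0) (\<lambda>(t, x). \<Phi> t x)" and t0: "t0 \<in> {0..1}" and e: "\<epsilon> > 0"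
  shows "\<exists>\<delta>>0. \<forall>t\<in>{0..1}. \<bar>t - t0\<bar> < \<delta> \<longrightarrow> (\<forall>x\<in>closure D0. norm (\<Phi> t x - \<Phi> t0 x) \<le> \<epsilon>)"
proof -
  obtain \<delta> where \<delta>: "\<delta> > 0" and d: "\<And>p q. p \<in> {0..1} \<times> closure D0 \<Longrightarrow> q \<in> {0..1} \<times> closure D0 \<Longrightarrow> dist q p < \<delta>
      \<Longrightarrow> dist ((\<lambda>(t, x). \<Phi> t x) q) ((\<lambda>(t, x). \<Phi> t x) p) < \<epsilon>"
    using compact_uniformly_continuous[OF c compact_param] e unfolding uniformly_continuous_on_def by metis
  have "norm (\<Phi> t x - \<Phi> t0 x) \<le> \<epsilon>" if "t \<in> {0..1}" "\<bar>t - t0\<bar> < \<delta>" "x \<in> closure D0" for t x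
    using d[of "(t0, x)" "(t, x)"] that t0 by (simp add: dist_Pair_Pair dist_norm)
  then show ?thesis using \<delta> by blast
qed

lemma bdd_in_t:
  fixes \<Phi> :: "real \<Rightarrow> complex^'n \<Rightarrow> 'b::real_normed_vector"
  assumes c: "continuous_on ({0..1} \<times> closure D0) (\<lambda>(t, x). \<Phi> t x)"
  shows "\<exists>b>0. \<forall>t\<in>{0..1}. \<forall>x\<in>closure D0. norm (\<Phi> t x) \<le> b"
proof -
  have "bounded ((\<lambda>(t, x). \<Phi> t x) ` ({0..1} \<times> closure D0))"
    using compact_continuous_image[OF c compact_param] compact_imp_bounded by blast
  then obtain b where "b > 0" and b: "\<And>y. y \<in> (\<lambda>(t, x). \<Phi> t x) ` ({0..1} \<times> closure D0) \<Longrightarrow> norm y \<le> b"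
    using bounded_pos by metis
  have "norm (\<Phi> t x) \<le> b" if "t \<in> {0..1}" "x \<in> closure D0" for t x
    by (rule b) (use that in force)
  with \<open>b > 0\<close> show ?thesis by blast
qed

lemma cont_slice:
  assumes c: "continuous_on ({0..1} \<times> closure D0) (\<lambda>(t, x). \<Phi> t x)" and t: "t \<in> {0..1}"
  shows "continuous_on (closure D0) (\<Phi> t)"
proof -
  have "continuous_on (closure D0) ((\<lambda>(t, x). \<Phi> t x) \<circ> (\<lambda>x. (t, x)))"
    using t by (intro continuous_on_compose continuous_intros continuous_on_subset[OF c]) auto
  then show ?thesis by (simp add: o_def)
qed

text \<open>Uniform continuity on the compact parameter space makes
  \<open>\<Gamma> t - \<Gamma> t0\<close> small in C^2, and \<open>C2_closure_estimates\<close> is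
  linear in that size.\<close>

lemma near_t:
  assumes t0: "t0 \<in> {0..1}" and e: "\<epsilon> > 0"
  shows "\<exists>\<delta>>0. \<forall>t\<in>{0..1}. \<bar>t - t0\<bar> < \<delta> \<longrightarrow> (\<forall>x\<in>closure D0. \<forall>y\<in>closure D0.
     norm (\<Gamma> t x - \<Gamma> t0 x) \<le> \<epsilon> \<and> norm (D\<Gamma> t x - D\<Gamma> t0 x) \<le> \<epsilon> \<and>
     norm ((\<Gamma> t x - \<Gamma> t0 x) - (\<Gamma> t y - \<Gamma> t0 y)) \<le> \<epsilon> * norm (x - y) \<and>
     norm ((\<Gamma> t x - \<Gamma> t0 x) - (\<Gamma> t y - \<Gamma> t0 y) - (D\<Gamma> t y - D\<Gamma> t0 y) (x - y)) \<le> \<epsilon> * (norm (x - y))\<^sup>2)"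
proof -
  obtain K where K: "K > 0" and est: "\<And>h Dh D2h b x y. \<lbrakk>continuous_on (closure D0) h; continuous_on (closure D0) Dh;
       \<And>x. x \<in> D0 \<Longrightarrow> (h has_derivative blinfun_apply (Dh x)) (at x);
       \<And>x. x \<in> D0 \<Longrightarrow> (Dh has_derivative blinfun_apply (D2h x)) (at x);
       \<And>x. x \<in> closure D0 \<Longrightarrow> norm (h x) \<le> b \<and> norm (Dh x) \<le> b \<and> norm (D2h x) \<le> b;
       x \<in> closure D0; y \<in> closure D0\<rbrakk>
       \<Longrightarrow> norm (h x - h y :: complex^'n) \<le> b * K * norm (x - y) \<and>
           norm (h x - h y - blinfun_apply (Dh y) (x - y)) \<le> b * K * (norm (x - y))\<^sup>2"
    using C2_closure_estimates[OF T] by blast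
  define b where "b = min \<epsilon> (\<epsilon> / K)"
  have b: "b > 0" "b \<le> \<epsilon>" "b * K \<le> \<epsilon>"
    using e K by (auto simp: b_def min_def field_simps)
  obtain \<delta>1 where dd1: "\<delta>1 > 0"
    and d1: "\<And>t x. t \<in> {0..1} \<Longrightarrow> \<bar>t - t0\<bar> < \<delta>1 \<Longrightarrow> x \<in> closure D0 \<Longrightarrow> norm (\<Gamma> t x - \<Gamma> t0 x) \<le> b"
    using unif_in_t[OF cont t0 b(1)] by blast
  obtain \<delta>2 where dd2: "\<delta>2 > 0"
    and d2: "\<And>t x. t \<in> {0..1} \<Longrightarrow> \<bar>t - t0\<bar> < \<delta>2 \<Longrightarrow> x \<in> closure D0 \<Longrightarrow> norm (D\<Gamma> t x - D\<Gamma> t0 x) \<le> b"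
    using unif_in_t[OF cont1 t0 b(1)] by blast
  obtain \<delta>3 where dd3: "\<delta>3 > 0"
    and d3: "\<And>t x. t \<in> {0..1} \<Longrightarrow> \<bar>t - t0\<bar> < \<delta>3 \<Longrightarrow> x \<in> closure D0 \<Longrightarrow> norm (D2\<Gamma> t x - D2\<Gamma> t0 x) \<le> b"
    using unif_in_t[OF cont2 t0 b(1)] by blast
  define \<delta> where "\<delta> = min \<delta>1 (min \<delta>2 \<delta>3)"
  have \<delta>: "\<delta> > 0" using dd1 dd2 dd3 by (simp add: \<delta>_def)
  have "norm (\<Gamma> t x - \<Gamma> t0 x) \<le> \<epsilon> \<and> norm (D\<Gamma> t x - D\<Gamma> t0 x) \<le> \<epsilon> \<and>
     norm ((\<Gamma> t x - \<Gamma> t0 x) - (\<Gamma> t y - \<Gamma> t0 y)) \<le> \<epsilon> * norm (x - y) \<and>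
     norm ((\<Gamma> t x - \<Gamma> t0 x) - (\<Gamma> t y - \<Gamma> t0 y) - (D\<Gamma> t y - D\<Gamma> t0 y) (x - y)) \<le> \<epsilon> * (norm (x - y))\<^sup>2"
    if t: "t \<in> {0..1}" "\<bar>t - t0\<bar> < \<delta>" and xy: "x \<in> closure D0" "y \<in> closure D0" for t x y
  proof -
    have td: "\<bar>t - t0\<bar> < \<delta>1" "\<bar>t - t0\<bar> < \<delta>2" "\<bar>t - t0\<bar> < \<delta>3" using t by (auto simp: \<delta>_def)
    have E: "norm ((\<Gamma> t x - \<Gamma> t0 x) - (\<Gamma> t y - \<Gamma> t0 y)) \<le> b * K * norm (x - y) \<and>
      norm ((\<Gamma> t x - \<Gamma> t0 x) - (\<Gamma> t y - \<Gamma> t0 y) - (D\<Gamma> t y - D\<Gamma> t0 y) (x - y)) \<le> b * K * (norm (x - y))\<^sup>2"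
    proof (rule est[where D2h = "\<lambda>x. D2\<Gamma> t x - D2\<Gamma> t0 x"])
      show "continuous_on (closure D0) (\<lambda>x. \<Gamma> t x - \<Gamma> t0 x)" "continuous_on (closure D0) (\<lambda>x. D\<Gamma> t x - D\<Gamma> t0 x)"
        by (intro continuous_on_diff cont_slice[OF cont] cont_slice[OF cont1] t t0)+
      show "((\<lambda>x. \<Gamma> t x - \<Gamma> t0 x) has_derivative blinfun_apply (D\<Gamma> t z - D\<Gamma> t0 z)) (at z)" if "z \<in> D0" for z
        using has_derivative_diff[OF der[OF t(1) that] der[OF t0 that]] by (simp add: minus_blinfun.rep_eq)
      show "((\<lambda>x. D\<Gamma> t x - D\<Gamma> t0 x) has_derivative blinfun_apply (D2\<Gamma> t z - D2\<Gamma> t0 z)) (at z)" if "z \<in> D0" for z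
        using has_derivative_diff[OF der2[OF t(1) that] der2[OF t0 that]] by (simp add: minus_blinfun.rep_eq)
      show "norm (\<Gamma> t z - \<Gamma> t0 z) \<le> b \<and> norm (D\<Gamma> t z - D\<Gamma> t0 z) \<le> b \<and> norm (D2\<Gamma> t z - D2\<Gamma> t0 z) \<le> b"
        if "z \<in> closure D0" for z using d1 d2 d3 t(1) td that by blast
    qed (use xy in auto)
    have "b * K * norm (x - y) \<le> \<epsilon> * norm (x - y)" "b * K * (norm (x - y))\<^sup>2 \<le> \<epsilon> * (norm (x - y))\<^sup>2"
      using b by (intro mult_right_mono; simp)+
    moreover have "norm (\<Gamma> t x - \<Gamma> t0 x) \<le> b" "norm (D\<Gamma> t x - D\<Gamma> t0 x) \<le> b" using d1 d2 t(1) td xy by blast+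
    ultimately show ?thesis using E b by linarith
  qed
  then show ?thesis using \<delta> by blast
qed

lemma Taylor_bound:
  obtains b where "b > 0" "\<And>t x. t \<in> {0..1} \<Longrightarrow> x \<in> closure D0 \<Longrightarrow> norm (\<Gamma> t x) \<le> b \<and> norm (D\<Gamma> t x) \<le> b"
    "\<And>t x y. t \<in> {0..1} \<Longrightarrow> x \<in> closure D0 \<Longrightarrow> y \<in> closure D0 \<Longrightarrow>
      norm (\<Gamma> t x - \<Gamma> t y - D\<Gamma> t y (x - y)) \<le> b * (norm (x - y))\<^sup>2"
proof -
  obtain K where K: "K > 0" and est: "\<And>h Dh D2h b x y. \<lbrakk>continuous_on (closure D0) h; continuous_on (closure D0) Dh;
       \<And>x. x \<in> D0 \<Longrightarrow> (h has_derivative blinfun_apply (Dh x)) (at x);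
       \<And>x. x \<in> D0 \<Longrightarrow> (Dh has_derivative blinfun_apply (D2h x)) (at x);
       \<And>x. x \<in> closure D0 \<Longrightarrow> norm (h x) \<le> b \<and> norm (Dh x) \<le> b \<and> norm (D2h x) \<le> b;
       x \<in> closure D0; y \<in> closure D0\<rbrakk>
       \<Longrightarrow> norm (h x - h y :: complex^'n) \<le> b * K * norm (x - y) \<and>
           norm (h x - h y - blinfun_apply (Dh y) (x - y)) \<le> b * K * (norm (x - y))\<^sup>2"
    using C2_closure_estimates[OF T] by blast
  obtain b1 b2 b3 where bb: "b1 > 0" "b2 > 0" "b3 > 0"
    and d1: "\<And>t x. t \<in> {0..1} \<Longrightarrow> x \<in> closure D0 \<Longrightarrow> norm (\<Gamma> t x) \<le> b1"
    and d2: "\<And>t x. t \<in> {0..1} \<Longrightarrow> x \<in> closure D0 \<Longrightarrow> norm (D\<Gamma> t x) \<le> b2"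
    and d3: "\<And>t x. t \<in> {0..1} \<Longrightarrow> x \<in> closure D0 \<Longrightarrow> norm (D2\<Gamma> t x) \<le> b3"
    using bdd_in_t[OF cont] bdd_in_t[OF cont1] bdd_in_t[OF cont2] by metis
  define b where "b = b1 + b2 + b3"
  have b: "b > 0" "b1 \<le> b" "b2 \<le> b" "b3 \<le> b" using bb by (auto simp: b_def)
  have bd: "norm (\<Gamma> t x) \<le> b \<and> norm (D\<Gamma> t x) \<le> b \<and> norm (D2\<Gamma> t x) \<le> b" if "t \<in> {0..1}" "x \<in> closure D0" for t x
    using d1[OF that] d2[OF that] d3[OF that] b by linarith
  have main: "norm (\<Gamma> t x - \<Gamma> t y - D\<Gamma> t y (x - y)) \<le> b * K * (norm (x - y))\<^sup>2"
    if t: "t \<in> {0..1}" and xy: "x \<in> closure D0" "y \<in> closure D0" for t x y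
    using est[OF cont_slice[OF cont t] cont_slice[OF cont1 t] der[OF t] der2[OF t] bd[OF t] xy] by blast
  define b' where "b' = max b (b * K)"
  show thesis
  proof (rule that[of b'])
    show "b' > 0" using b by (simp add: b'_def)
    show "norm (\<Gamma> t x) \<le> b' \<and> norm (D\<Gamma> t x) \<le> b'" if "t \<in> {0..1}" "x \<in> closure D0" for t x
      using bd[OF that] by (simp add: b'_def max.coboundedI1)
    show "norm (\<Gamma> t x - \<Gamma> t y - D\<Gamma> t y (x - y)) \<le> b' * (norm (x - y))\<^sup>2"
      if t: "t \<in> {0..1}" and xy: "x \<in> closure D0" "y \<in> closure D0" for t x y
    proof -
      have "b * K * (norm (x - y))\<^sup>2 \<le> b' * (norm (x - y))\<^sup>2" by (intro mult_right_mono) (auto simp: b'_def)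
      then show ?thesis using main[OF that] by linarith
    qed
  qed
qed

section \<open>Uniform lower bounds and transition maps\<close>

lemma DGamma_lower:
  assumes t0: "t0 \<in> {0..1}"
  shows "\<exists>m>0. \<forall>y\<in>closure D0. \<forall>u. m * norm u \<le> norm (D\<Gamma> t0 y u)"
proof -
  let ?S = "closure D0 \<times> sphere (0::complex^'n) 1"
  have cD: "continuous_on ?S (\<lambda>p. D\<Gamma> t0 (fst p))"
    by (rule continuous_on_compose2[OF cont_slice[OF cont1 t0] continuous_on_fst]) (auto intro: continuous_on_id)
  have c: "continuous_on ?S (\<lambda>p. norm (D\<Gamma> t0 (fst p) (snd p)))"
    by (intro continuous_on_norm blinfun.continuous_on cD continuous_on_snd continuous_on_id)
  have "compact ?S" by (intro compact_Times compact_closure_D0 compact_sphere)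
  moreover have "?S \<noteq> {}"
  proof -
    obtain u :: "complex^'n" where "norm u = 1" using vector_choose_size[of 1] by auto
    then show ?thesis using D0_ne closure_subset[of D0] by auto
  qed
  ultimately obtain p where p: "p \<in> ?S" and min: "\<forall>q\<in>?S. norm (D\<Gamma> t0 (fst p) (snd p)) \<le> norm (D\<Gamma> t0 (fst q) (snd q))"
    using continuous_attains_inf[OF _ _ c] by blast
  define m where "m = norm (D\<Gamma> t0 (fst p) (snd p))"
  have "D\<Gamma> t0 (fst p) (snd p) \<noteq> 0"
  proof
    assume "D\<Gamma> t0 (fst p) (snd p) = 0"
    then have "D\<Gamma> t0 (fst p) (snd p) = D\<Gamma> t0 (fst p) 0" by (simp add: blinfun.zero_right)
    moreover have "fst p \<in> closure D0" using p by auto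
    ultimately have "snd p = 0" using Fun.injD[OF injD[OF t0]] by blast
    then show False using p by auto
  qed
  then have m: "m > 0" by (simp add: m_def)
  have "m * norm u \<le> norm (D\<Gamma> t0 y u)" if y: "y \<in> closure D0" for y u
  proof (cases "u = 0")
    case False
    have "m \<le> norm (D\<Gamma> t0 y (sgn u))" using bspec[OF min, of "(y, sgn u)"] y False by (simp add: m_def norm_sgn)
    then have "m * norm u \<le> norm (D\<Gamma> t0 y (sgn u)) * norm u" by (intro mult_right_mono) auto
    also have "\<dots> = norm (D\<Gamma> t0 y u)" using False by (simp add: sgn_div_norm blinfun.scaleR_right)
    finally show ?thesis .
  qed simp
  with m show ?thesis by blast
qed

text \<open>Near the diagonal the Taylor remainder is absorbed by the lower bound for the
  derivative; away from it, injectivity and compactness give a positive minimum.\<close>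

lemma Gamma_lower_at:
  assumes t0: "t0 \<in> {0..1}"
  shows "\<exists>m>0. \<forall>x\<in>closure D0. \<forall>y\<in>closure D0. m * norm (x - y) \<le> norm (\<Gamma> t0 x - \<Gamma> t0 y)"
proof -
  obtain m where m: "m > 0" and lo: "\<And>y u. y \<in> closure D0 \<Longrightarrow> m * norm u \<le> norm (D\<Gamma> t0 y u)"
    using DGamma_lower[OF t0] by blast
  obtain b where b: "b > 0" and Tb: "\<And>x y. x \<in> closure D0 \<Longrightarrow> y \<in> closure D0 \<Longrightarrow>
      norm (\<Gamma> t0 x - \<Gamma> t0 y - D\<Gamma> t0 y (x - y)) \<le> b * (norm (x - y))\<^sup>2"
    using Taylor_bound t0 by metis
  define r where "r = m / (2 * b)"
  have r: "r > 0" using m b by (simp add: r_def)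
  have near: "m/2 * norm (x - y) \<le> norm (\<Gamma> t0 x - \<Gamma> t0 y)" if xy: "x \<in> closure D0" "y \<in> closure D0" "norm (x - y) \<le> r" for x y
  proof -
    have "m * norm (x - y) \<le> norm (D\<Gamma> t0 y (x - y))" using lo xy by blast
    also have "\<dots> \<le> norm (\<Gamma> t0 x - \<Gamma> t0 y) + norm (\<Gamma> t0 x - \<Gamma> t0 y - D\<Gamma> t0 y (x - y))"
      using norm_triangle_ineq4[of "\<Gamma> t0 x - \<Gamma> t0 y" "\<Gamma> t0 x - \<Gamma> t0 y - D\<Gamma> t0 y (x - y)"] by simp
    also have "\<dots> \<le> norm (\<Gamma> t0 x - \<Gamma> t0 y) + b * (norm (x - y))\<^sup>2" using Tb xy by simp
    also have "b * (norm (x - y))\<^sup>2 \<le> b * (r * norm (x - y))"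
      using xy b by (intro mult_left_mono) (auto simp: power2_eq_square intro: mult_right_mono)
    also have "b * (r * norm (x - y)) = m/2 * norm (x - y)" using b by (simp add: r_def)
    finally show ?thesis by (simp add: algebra_simps)
  qed
  let ?S = "(closure D0 \<times> closure D0) \<inter> {p. r \<le> norm (fst p - snd p)}"
  have cS: "compact ?S"
    by (intro compact_Int_closed compact_Times compact_closure_D0 closed_Collect_le continuous_intros)
  have "continuous_on ?S (\<lambda>p. \<Gamma> t0 (fst p))"
    by (rule continuous_on_compose2[OF cont_slice[OF cont t0] continuous_on_fst[OF continuous_on_id]]) auto
  moreover have "continuous_on ?S (\<lambda>p. \<Gamma> t0 (snd p))"
    by (rule continuous_on_compose2[OF cont_slice[OF cont t0] continuous_on_snd[OF continuous_on_id]]) auto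
  ultimately have c: "continuous_on ?S (\<lambda>p. norm (\<Gamma> t0 (fst p) - \<Gamma> t0 (snd p)))" by (intro continuous_intros)
  have "\<exists>k>0. \<forall>p\<in>?S. k \<le> norm (\<Gamma> t0 (fst p) - \<Gamma> t0 (snd p))"
  proof (cases "?S = {}")
    case True then show ?thesis by (intro exI[of _ 1]) auto
  next
    case False
    then obtain p where p: "p \<in> ?S" and min: "\<forall>q\<in>?S. norm (\<Gamma> t0 (fst p) - \<Gamma> t0 (snd p)) \<le> norm (\<Gamma> t0 (fst q) - \<Gamma> t0 (snd q))"
      using continuous_attains_inf[OF cS _ c] by blast
    have "fst p \<noteq> snd p" using p r by auto
    then have "\<Gamma> t0 (fst p) \<noteq> \<Gamma> t0 (snd p)" using inj[OF t0] p by (auto dest: inj_onD)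
    then show ?thesis using min by (intro exI[of _ "norm (\<Gamma> t0 (fst p) - \<Gamma> t0 (snd p))"]) auto
  qed
  then obtain k where k: "k > 0" and far: "\<And>p. p \<in> ?S \<Longrightarrow> k \<le> norm (\<Gamma> t0 (fst p) - \<Gamma> t0 (snd p))" by blast
  obtain R where R: "R > 0" "\<And>x. x \<in> closure D0 \<Longrightarrow> norm x \<le> R"
    using compact_imp_bounded[OF compact_closure_D0] bounded_pos by metis
  define m' where "m' = min (m/2) (k / (2 * R))"
  have m': "m' > 0" using m k R by (simp add: m'_def)
  have "m' * norm (x - y) \<le> norm (\<Gamma> t0 x - \<Gamma> t0 y)" if xy: "x \<in> closure D0" "y \<in> closure D0" for x y
  proof (cases "norm (x - y) \<le> r")
    case True
    have "m' * norm (x - y) \<le> m/2 * norm (x - y)" by (intro mult_right_mono) (auto simp: m'_def)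
    then show ?thesis using near[OF xy True] by linarith
  next
    case False
    have "norm (x - y) \<le> 2 * R" using R(2)[OF xy(1)] R(2)[OF xy(2)] norm_triangle_ineq4[of x y] by linarith
    then have "m' * norm (x - y) \<le> k / (2 * R) * (2 * R)" using m' k R by (intro mult_mono) (auto simp: m'_def)
    also have "\<dots> = k" using R by simp
    also have "\<dots> \<le> norm (\<Gamma> t0 x - \<Gamma> t0 y)" using far[of "(x, y)"] xy False by simp
    finally show ?thesis .
  qed
  with m' show ?thesis by blast
qed

text \<open>Half of the constant at \<open>t0\<close> survives, because the difference of the two
  parameterizations has a small Lipschitz constant; uniform closeness alone would not protect nearby
  points.\<close>

lemma Gamma_lower:
  assumes t0: "t0 \<in> {0..1}"
  obtains m \<delta> where "m > 0" "\<delta> > 0"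
    "\<And>t x y. t \<in> {0..1} \<Longrightarrow> \<bar>t - t0\<bar> < \<delta> \<Longrightarrow> x \<in> closure D0 \<Longrightarrow> y \<in> closure D0 \<Longrightarrow> m * norm (x - y) \<le> norm (\<Gamma> t x - \<Gamma> t y)"
    "\<And>t y u. t \<in> {0..1} \<Longrightarrow> \<bar>t - t0\<bar> < \<delta> \<Longrightarrow> y \<in> closure D0 \<Longrightarrow> m * norm u \<le> norm (D\<Gamma> t y u)"
proof -
  obtain m1 where m1: "m1 > 0" and l1: "\<And>y u. y \<in> closure D0 \<Longrightarrow> m1 * norm u \<le> norm (D\<Gamma> t0 y u)"
    using DGamma_lower[OF t0] by blast
  obtain m2 where m2: "m2 > 0" and l2: "\<And>x y. x \<in> closure D0 \<Longrightarrow> y \<in> closure D0 \<Longrightarrow> m2 * norm (x - y) \<le> norm (\<Gamma> t0 x - \<Gamma> t0 y)"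
    using Gamma_lower_at[OF t0] by blast
  define m where "m = min m1 m2 / 2"
  have m: "m > 0" "2 * m \<le> m1" "2 * m \<le> m2" using m1 m2 by (auto simp: m_def)
  obtain \<delta> where \<delta>: "\<delta> > 0" and n: "\<And>t x y. t \<in> {0..1} \<Longrightarrow> \<bar>t - t0\<bar> < \<delta> \<Longrightarrow> x \<in> closure D0 \<Longrightarrow> y \<in> closure D0 \<Longrightarrow>
      norm (D\<Gamma> t x - D\<Gamma> t0 x) \<le> m \<and> norm ((\<Gamma> t x - \<Gamma> t0 x) - (\<Gamma> t y - \<Gamma> t0 y)) \<le> m * norm (x - y)"
    using near_t[OF t0 m(1)] by blast
  show thesis
  proof (rule that[OF m(1) \<delta>])
    fix t assume t: "t \<in> {0..1}" "\<bar>t - t0\<bar> < \<delta>"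
    show "m * norm (x - y) \<le> norm (\<Gamma> t x - \<Gamma> t y)" if xy: "x \<in> closure D0" "y \<in> closure D0" for x y
    proof -
      have "2 * m * norm (x - y) \<le> m2 * norm (x - y)" using m by (intro mult_right_mono) auto
      also have "\<dots> \<le> norm (\<Gamma> t0 x - \<Gamma> t0 y)" using l2 xy by blast
      also have "\<dots> \<le> norm (\<Gamma> t x - \<Gamma> t y) + norm ((\<Gamma> t x - \<Gamma> t0 x) - (\<Gamma> t y - \<Gamma> t0 y))"
        using norm_triangle_ineq4[of "\<Gamma> t x - \<Gamma> t y" "(\<Gamma> t x - \<Gamma> t0 x) - (\<Gamma> t y - \<Gamma> t0 y)"] by simp
      also have "\<dots> \<le> norm (\<Gamma> t x - \<Gamma> t y) + m * norm (x - y)" using n[OF t xy] by simp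
      finally show ?thesis by simp
    qed
    show "m * norm u \<le> norm (D\<Gamma> t y u)" if y: "y \<in> closure D0" for y u
    proof -
      have "2 * m * norm u \<le> m1 * norm u" using m by (intro mult_right_mono) auto
      also have "\<dots> \<le> norm (D\<Gamma> t0 y u)" using l1 y by blast
      also have "\<dots> \<le> norm (D\<Gamma> t y u) + norm ((D\<Gamma> t y - D\<Gamma> t0 y) u)"
        using norm_triangle_ineq4[of "D\<Gamma> t y u" "(D\<Gamma> t y - D\<Gamma> t0 y) u"] by (simp add: blinfun.diff_left)
      also have "norm ((D\<Gamma> t y - D\<Gamma> t0 y) u) \<le> norm (D\<Gamma> t y - D\<Gamma> t0 y) * norm u" by (rule norm_blinfun)
      also have "\<dots> \<le> m * norm u" using n[OF t y y] by (intro mult_right_mono) auto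
      finally show ?thesis by simp
    qed
  qed
qed

text \<open>The change of coordinates \<open>\<Gamma> t0 \<circ> (\<Gamma> t)\<inverse>\<close> is close to the identity up to second order.\<close>
lemma transition_expansion:
  assumes t0: "t0 \<in> {0..1}"
  obtains L :: "real \<Rightarrow> complex^'n \<Rightarrow> ((complex^'n) \<Rightarrow>\<^sub>L (complex^'n))" where
    "\<And>\<epsilon>. \<epsilon> > 0 \<Longrightarrow> \<exists>\<delta>>0. \<forall>t\<in>{0..1}. \<bar>t - t0\<bar> < \<delta> \<longrightarrow> (\<forall>y\<in>closure D0. norm (L t y) \<le> \<epsilon> \<and> (\<forall>x\<in>closure D0.
       norm ((\<Gamma> t0 x - \<Gamma> t0 y) - (\<Gamma> t x - \<Gamma> t y) + L t y (\<Gamma> t x - \<Gamma> t y)) \<le> \<epsilon> * (norm (\<Gamma> t x - \<Gamma> t y))\<^sup>2))"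
proof -
  obtain m \<delta>0 where m: "m > 0" "\<delta>0 > 0"
    and lo: "\<And>t x y. t \<in> {0..1} \<Longrightarrow> \<bar>t - t0\<bar> < \<delta>0 \<Longrightarrow> x \<in> closure D0 \<Longrightarrow> y \<in> closure D0 \<Longrightarrow> m * norm (x - y) \<le> norm (\<Gamma> t x - \<Gamma> t y)"
    and loD: "\<And>t y u. t \<in> {0..1} \<Longrightarrow> \<bar>t - t0\<bar> < \<delta>0 \<Longrightarrow> y \<in> closure D0 \<Longrightarrow> m * norm u \<le> norm (D\<Gamma> t y u)"
    using Gamma_lower[OF t0] by metis
  obtain b where b: "b > 0" and Tb: "\<And>t x y. t \<in> {0..1} \<Longrightarrow> x \<in> closure D0 \<Longrightarrow> y \<in> closure D0 \<Longrightarrow>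
      norm (\<Gamma> t x - \<Gamma> t y - D\<Gamma> t y (x - y)) \<le> b * (norm (x - y))\<^sup>2"
    using Taylor_bound by metis
  have "\<exists>g. linear g \<and> g \<circ> blinfun_apply (D\<Gamma> t y) = id" if "t \<in> {0..1}" "y \<in> closure D0" for t y
    using linear_injective_left_inverse[of "blinfun_apply (D\<Gamma> t y)"] injD[OF that] bounded_linear.linear[OF blinfun.bounded_linear_right]
    by auto
  then obtain g where g: "\<And>t y. t \<in> {0..1} \<Longrightarrow> y \<in> closure D0 \<Longrightarrow> linear (g t y) \<and> g t y \<circ> blinfun_apply (D\<Gamma> t y) = id"
    by metis
  define G where "G t y = Blinfun (g t y)" for t y
  have Gg: "blinfun_apply (G t y) = g t y" if "t \<in> {0..1}" "y \<in> closure D0" for t y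
    unfolding G_def using g[OF that] by (intro bounded_linear_Blinfun_apply) (simp add: linear_conv_bounded_linear)
  have GD: "G t y (D\<Gamma> t y u) = u" if "t \<in> {0..1}" "y \<in> closure D0" for t y u
    using g[OF that] Gg[OF that] by (metis comp_apply id_apply)
  have nG: "norm (G t y) \<le> 1 / m" if t: "t \<in> {0..1}" "\<bar>t - t0\<bar> < \<delta>0" and y: "y \<in> closure D0" for t y
  proof (rule norm_blinfun_bound)
    fix w
    have "surj (blinfun_apply (D\<Gamma> t y))"
      using injD[OF t(1) y] linear_injective_imp_surjective bounded_linear.linear[OF blinfun.bounded_linear_right] by blast
    then obtain u where w: "w = D\<Gamma> t y u" by (metis surjD)
    show "norm (G t y w) \<le> 1 / m * norm w"
      using loD[OF t y, of u] m unfolding w GD[OF t(1) y] by (simp add: field_simps)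
  qed (use m in simp)
  \<comment> \<open>\<open>G t y\<close> inverts \<open>D\<Gamma> t y\<close>, so the identity minus
    \<open>L t y\<close> is \<open>D\<Gamma> t0 y\<close> composed with that inverse, the linear
    part of the transition map.\<close>
  define L where "L t y = (D\<Gamma> t y - D\<Gamma> t0 y) o\<^sub>L G t y" for t y
  show thesis
  proof (rule that[of L])
    fix \<epsilon> :: real assume e: "\<epsilon> > 0"
    \<comment> \<open>The two entries serve the bound for \<open>L\<close> and the remainder. The
      latter carries the factor \<open>b / m + 1\<close> and is divided by \<open>m\<^sup>2\<close>
      in passing from \<open>x - y\<close> to \<open>\<Gamma> t x - \<Gamma> t y\<close>.\<close>
    define \<eta> where "\<eta> = \<epsilon> * min m (m\<^sup>2 / (b / m + 1))"
    have bm: "b / m + 1 > 0" using b m by (simp add: add_pos_pos)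
    have \<eta>: "\<eta> > 0" "\<eta> / m \<le> \<epsilon>" "\<eta> * (b / m + 1) / m\<^sup>2 \<le> \<epsilon>"
    proof -
      show "\<eta> > 0" using e m bm by (simp add: \<eta>_def)
      have "\<eta> \<le> \<epsilon> * m" using e by (simp add: \<eta>_def)
      then show "\<eta> / m \<le> \<epsilon>" using m by (simp add: field_simps)
      have "\<eta> \<le> \<epsilon> * (m\<^sup>2 / (b / m + 1))" unfolding \<eta>_def using e by (intro mult_left_mono) auto
      then have "\<eta> * (b / m + 1) \<le> \<epsilon> * m\<^sup>2" using bm by (simp add: pos_le_divide_eq[symmetric])
      then show "\<eta> * (b / m + 1) / m\<^sup>2 \<le> \<epsilon>" using m by (simp add: pos_divide_le_eq)
    qed
    obtain \<delta>1 where \<delta>1: "\<delta>1 > 0" and n: "\<And>t x y. t \<in> {0..1} \<Longrightarrow> \<bar>t - t0\<bar> < \<delta>1 \<Longrightarrow> x \<in> closure D0 \<Longrightarrow> y \<in> closure D0 \<Longrightarrow>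
        norm (D\<Gamma> t x - D\<Gamma> t0 x) \<le> \<eta> \<and>
        norm ((\<Gamma> t x - \<Gamma> t0 x) - (\<Gamma> t y - \<Gamma> t0 y) - (D\<Gamma> t y - D\<Gamma> t0 y) (x - y)) \<le> \<eta> * (norm (x - y))\<^sup>2"
      using near_t[OF t0 \<eta>(1)] by blast
    have "norm (L t y) \<le> \<epsilon> \<and> norm ((\<Gamma> t0 x - \<Gamma> t0 y) - (\<Gamma> t x - \<Gamma> t y) + L t y (\<Gamma> t x - \<Gamma> t y)) \<le> \<epsilon> * (norm (\<Gamma> t x - \<Gamma> t y))\<^sup>2"
      if t: "t \<in> {0..1}" "\<bar>t - t0\<bar> < min \<delta>0 \<delta>1" and xy: "x \<in> closure D0" "y \<in> closure D0" for t x y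
    proof -
      have td: "\<bar>t - t0\<bar> < \<delta>0" "\<bar>t - t0\<bar> < \<delta>1" using t by auto
      note n1 = n[OF t(1) td(2) xy(2) xy(2)] and n2 = n[OF t(1) td(2) xy]
      have "norm (L t y) \<le> norm (D\<Gamma> t y - D\<Gamma> t0 y) * norm (G t y)"
        unfolding L_def by (rule norm_blinfun_compose)
      also have "\<dots> \<le> \<eta> * (1 / m)" using n1 nG[OF t(1) td(1) xy(2)] \<eta>(1) by (intro mult_mono) auto
      finally have nL': "norm (L t y) \<le> \<eta> / m" by simp
      then have nL: "norm (L t y) \<le> \<epsilon>" using \<eta> by linarith
      define v' where "v' = \<Gamma> t x - \<Gamma> t y"
      define R1 where "R1 = (\<Gamma> t x - \<Gamma> t0 x) - (\<Gamma> t y - \<Gamma> t0 y) - (D\<Gamma> t y - D\<Gamma> t0 y) (x - y)"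
      define R2 where "R2 = v' - D\<Gamma> t y (x - y)"
      define l where "l = norm (x - y)"
      have R1: "norm R1 \<le> \<eta> * l\<^sup>2" using n2 by (simp add: R1_def l_def)
      have R2: "norm R2 \<le> b * l\<^sup>2" using Tb[OF t(1) xy] by (simp add: R2_def v'_def l_def)
      have "L t y (v' - R2) = (D\<Gamma> t y - D\<Gamma> t0 y) (x - y)"
        by (simp add: R2_def L_def GD[OF t(1) xy(2)])
      \<comment> \<open>The linear parts cancel; what remains is \<open>L\<close> of the Taylor
        remainder of \<open>\<Gamma> t\<close> and the remainder of the difference.\<close>
      then have eq: "(\<Gamma> t0 x - \<Gamma> t0 y) - v' + L t y v' = L t y R2 - R1"
        by (simp add: R1_def v'_def blinfun.diff_right blinfun.add_right algebra_simps)
      have "norm (L t y R2) \<le> norm (L t y) * norm R2" by (rule norm_blinfun)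
      also have "\<dots> \<le> (\<eta> / m) * (b * l\<^sup>2)" using nL' R2 \<eta> m by (intro mult_mono) auto
      finally have "norm (L t y R2 - R1) \<le> (\<eta> / m) * (b * l\<^sup>2) + \<eta> * l\<^sup>2"
        using R1 norm_triangle_ineq4[of "L t y R2" R1] by linarith
      also have "\<dots> = \<eta> * (b / m + 1) * l\<^sup>2" by (simp add: algebra_simps)
      also have "\<dots> \<le> \<eta> * (b / m + 1) * ((norm v')\<^sup>2 / m\<^sup>2)"
      proof (rule mult_left_mono)
        have "(m * l)\<^sup>2 \<le> (norm v')\<^sup>2" using lo[OF t(1) td(1) xy] m by (intro power_mono) (auto simp: v'_def l_def)
        then show "l\<^sup>2 \<le> (norm v')\<^sup>2 / m\<^sup>2" using m by (simp add: power_mult_distrib field_simps)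
      qed (use \<eta> bm in simp)
      also have "\<dots> = \<eta> * (b / m + 1) / m\<^sup>2 * (norm v')\<^sup>2" by simp
      also have "\<dots> \<le> \<epsilon> * (norm v')\<^sup>2" using \<eta> by (intro mult_right_mono) auto
      finally show ?thesis using nL eq by (simp add: v'_def)
    qed
    then show "\<exists>\<delta>>0. \<forall>t\<in>{0..1}. \<bar>t - t0\<bar> < \<delta> \<longrightarrow> (\<forall>y\<in>closure D0. norm (L t y) \<le> \<epsilon> \<and> (\<forall>x\<in>closure D0.
       norm ((\<Gamma> t0 x - \<Gamma> t0 y) - (\<Gamma> t x - \<Gamma> t y) + L t y (\<Gamma> t x - \<Gamma> t y)) \<le> \<epsilon> * (norm (\<Gamma> t x - \<Gamma> t y))\<^sup>2))"
      using m \<delta>1 by (intro exI[of _ "min \<delta>0 \<delta>1"]) auto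
  qed
qed

text \<open>By invariance of domain the image of \<open>D0\<close> is an open subset of
  \<open>closure (Dfam t)\<close>, hence contained in its interior, which is \<open>Dfam t\<close>.
  The inverse map is treated in the same way.\<close>

lemma Gamma_image_D0:
  assumes t: "t \<in> {0..1}"
  shows "\<Gamma> t ` D0 = Dfam t"
proof
  have sub: "D0 \<subseteq> closure D0" by (rule closure_subset)
  have c: "continuous_on (closure D0) (\<Gamma> t)" using cont_slice[OF cont t] .
  have "open (\<Gamma> t ` D0)"
    using invariance_of_domain[OF continuous_on_subset[OF c sub] D0_open inj_on_subset[OF inj[OF t] sub]] .
  moreover have "\<Gamma> t ` D0 \<subseteq> closure (Dfam t)" using img[OF t] sub by blast
  ultimately show "\<Gamma> t ` D0 \<subseteq> Dfam t"
    using interior_maximal bounded_C2_domain_interior_closure[OF C2dom[OF t]] by blast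
  let ?g = "the_inv_into (closure D0) (\<Gamma> t)"
  have cg: "continuous_on (closure (Dfam t)) ?g"
    using continuous_on_inv_into[OF c compact_closure_D0 inj[OF t]] img[OF t] by simp
  have ig: "inj_on ?g (closure (Dfam t))"
    using inj_on_the_inv_into[OF inj[OF t]] img[OF t] by simp
  have gim: "?g ` closure (Dfam t) = closure D0"
    using the_inv_into_onto[OF inj[OF t]] img[OF t] by simp
  have "open (?g ` Dfam t)"
    using invariance_of_domain[OF continuous_on_subset[OF cg closure_subset] Dfam_open[OF t] inj_on_subset[OF ig closure_subset]] .
  then have g: "?g ` Dfam t \<subseteq> D0"
    using interior_maximal[of "?g ` Dfam t" "closure D0"] gim closure_subset[of "Dfam t"] bounded_C2_domain_interior_closure[OF D0] by blast
  show "Dfam t \<subseteq> \<Gamma> t ` D0"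
  proof
    fix w assume w: "w \<in> Dfam t"
    then have "\<Gamma> t (?g w) = w" using f_the_inv_into_f[OF inj[OF t], of w] img[OF t] closure_subset by blast
    then show "w \<in> \<Gamma> t ` D0" using g w by (metis image_eqI image_subset_iff)
  qed
qed

lemma Gamma_image_frontier:
  assumes t: "t \<in> {0..1}"
  shows "\<Gamma> t ` frontier D0 = frontier (Dfam t)"
proof -
  have "frontier D0 = closure D0 - D0" "frontier (Dfam t) = closure (Dfam t) - Dfam t"
    using D0_open Dfam_open[OF t] by (auto simp: frontier_def interior_open)
  moreover have "\<Gamma> t ` (closure D0 - D0) = \<Gamma> t ` closure D0 - \<Gamma> t ` D0"
    by (rule inj_on_image_set_diff[OF inj[OF t] Diff_subset closure_subset])
  ultimately show ?thesis using img[OF t] Gamma_image_D0[OF t] by simp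
qed

text \<open>The inverse of \<open>\<Gamma> t0\<close> followed by \<open>\<Gamma> t\<close> moves
  points of the closed ball by at most \<eta>, so by Brouwer's theorem it takes the value
  \<open>z\<close> there.\<close>

lemma cball_subset_Dfam:
  assumes t: "t \<in> {0..1}" "t0 \<in> {0..1}" and near: "\<And>x. x \<in> closure D0 \<Longrightarrow> norm (\<Gamma> t x - \<Gamma> t0 x) \<le> \<eta>"
    and \<eta>: "\<eta> > 0" and z: "cball z \<eta> \<subseteq> Dfam t0"
  shows "z \<in> Dfam t"
proof -
  let ?g = "the_inv_into (closure D0) (\<Gamma> t0)"
  have c: "continuous_on (closure D0) (\<Gamma> t)" "continuous_on (closure D0) (\<Gamma> t0)" using cont_slice[OF cont] t by auto
  have cg: "continuous_on (closure (Dfam t0)) ?g"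
    using continuous_on_inv_into[OF c(2) compact_closure_D0 inj[OF t(2)]] img[OF t(2)] by simp
  have gD: "?g w \<in> D0 \<and> \<Gamma> t0 (?g w) = w" if "w \<in> Dfam t0" for w
  proof -
    have "w \<in> \<Gamma> t0 ` D0" using that by (simp only: Gamma_image_D0[OF t(2)])
    then obtain x where x: "x \<in> D0" "w = \<Gamma> t0 x" by (elim imageE)
    have "x \<in> closure D0" using x(1) closure_subset[of D0] by blast
    then have "?g w = x" using the_inv_into_f_f[OF inj[OF t(2)]] x(2) by simp
    then show ?thesis using x by simp
  qed
  have "continuous_on (cball z \<eta>) (\<lambda>w. \<Gamma> t (?g w))"
  proof (rule continuous_on_compose2[OF c(1)])
    show "continuous_on (cball z \<eta>) ?g"
      by (rule continuous_on_subset[OF cg subset_trans[OF z closure_subset]])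
    show "?g ` cball z \<eta> \<subseteq> closure D0" using gD z closure_subset[of D0] by auto
  qed
  then have "\<exists>y\<in>cball z \<eta>. \<Gamma> t (?g y) = z"
  proof (rule brouwer_surjective_cball[OF _ \<eta>, of _ _ _ "{z}"])
    fix x y assume "x \<in> {z}" and y: "y \<in> cball z \<eta>"
    have "norm (\<Gamma> t (?g y) - \<Gamma> t0 (?g y)) \<le> \<eta>" using near gD[of y] y z closure_subset[of D0] by blast
    then have "norm (y - \<Gamma> t (?g y)) \<le> \<eta>" using gD[of y] y z by (metis norm_minus_commute subsetD)
    then show "x + (y - \<Gamma> t (?g y)) \<in> cball z \<eta>" using \<open>x \<in> {z}\<close> by (simp add: dist_norm norm_minus_commute)
  qed simp
  then obtain y where y: "y \<in> cball z \<eta>" "\<Gamma> t (?g y) = z" by blast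
  then have "?g y \<in> D0" using gD[of y] z by blast
  then show ?thesis using y(2) Gamma_image_D0[OF t(1)] by blast
qed

end

section \<open>Uniform strict pseudoconvexity\<close>

text \<open>Riesz representative, turning the differential of a defining function into the gradient
  vector of \<open>spsc_at\<close>.\<close>

definition rvec :: "('a::euclidean_space \<Rightarrow>\<^sub>L real) \<Rightarrow> 'a" where
  "rvec f = (\<Sum>i\<in>Basis. blinfun_apply f i *\<^sub>R i)"

lemma rvec_inner: "rvec f \<bullet> v = blinfun_apply f v"
proof -
  have "blinfun_apply f v = blinfun_apply f (\<Sum>i\<in>Basis. (v \<bullet> i) *\<^sub>R i)" by (simp add: euclidean_representation)
  also have "\<dots> = (\<Sum>i\<in>Basis. (v \<bullet> i) * blinfun_apply f i)" by (simp add: blinfun.sum_right blinfun.scaleR_right)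
  also have "\<dots> = rvec f \<bullet> v"
    unfolding rvec_def inner_sum_left inner_scaleR_left by (simp add: inner_commute mult.commute)
  finally show ?thesis by simp
qed

lemma norm_rvec: "norm (rvec f) = norm f"
proof (rule antisym)
  have "norm (rvec f) * norm (rvec f) = blinfun_apply f (rvec f)"
    by (simp add: rvec_inner[symmetric] norm_eq_sqrt_inner)
  also have "\<dots> \<le> norm f * norm (rvec f)" using norm_blinfun[of f "rvec f"] by (simp add: abs_le_iff)
  finally show "norm (rvec f) \<le> norm f"
    by (cases "rvec f = 0") (auto simp: mult_le_cancel_right)
  show "norm f \<le> norm (rvec f)"
    by (rule norm_blinfun_bound) (use Cauchy_Schwarz_ineq2[of "rvec f"] in \<open>auto simp: rvec_inner\<close>)
qed

lemma bounded_linear_rvec: "bounded_linear rvec"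
proof (rule bounded_linear_intro[where K=1])
  show "norm (rvec f) \<le> norm f * 1" for f :: "'a \<Rightarrow>\<^sub>L real" by (simp add: norm_rvec)
qed (auto simp: rvec_def blinfun.add_left blinfun.scaleR_left scaleR_add_left sum.distrib scaleR_sum_right)

text \<open>If no weight worked, points violating the bound for weights tending to infinity would
  accumulate at a zero of \<open>h\<close> with \<open>f \<le> 0\<close>.\<close>

lemma positive_on_zeros_penalty:
  fixes f h :: "'a::metric_space \<Rightarrow> real"
  assumes S: "compact S" and c: "continuous_on S f" "continuous_on S h"
    and h: "\<And>p. p \<in> S \<Longrightarrow> h p \<ge> 0" and pos: "\<And>p. p \<in> S \<Longrightarrow> h p = 0 \<Longrightarrow> f p > 0"
  shows "\<exists>A>0. \<exists>e>0. \<forall>p\<in>S. f p + A * h p \<ge> e"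
proof (rule ccontr)
  assume "\<not> ?thesis"
  then have "\<exists>p\<in>S. f p + real (Suc k) * h p < inverse (real (Suc k))" for k
    by (meson inverse_positive_iff_positive not_le of_nat_0_less_iff zero_less_Suc)
  then obtain p where p: "\<And>k. p k \<in> S" "\<And>k. f (p k) + real (Suc k) * h (p k) < inverse (real (Suc k))" by metis
  obtain l \<sigma> where l: "l \<in> S" "strict_mono \<sigma>" "(p \<circ> \<sigma>) \<longlonglongrightarrow> l"
    using S p(1) unfolding compact_def by metis
  have fl: "(\<lambda>k. f (p (\<sigma> k))) \<longlonglongrightarrow> f l" and hl: "(\<lambda>k. h (p (\<sigma> k))) \<longlonglongrightarrow> h l"
    using continuous_on_tendsto_compose[OF c(1) l(3,1)] continuous_on_tendsto_compose[OF c(2) l(3,1)] p(1)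
    by (simp_all add: o_def)
  have inv: "(\<lambda>k. inverse (real (Suc (\<sigma> k)))) \<longlonglongrightarrow> 0"
    using LIMSEQ_subseq_LIMSEQ[OF LIMSEQ_inverse_real_of_nat l(2)] by (simp add: o_def)
  have "f (p (\<sigma> k)) \<le> inverse (real (Suc (\<sigma> k)))" for k
  proof -
    have "real (Suc (\<sigma> k)) * h (p (\<sigma> k)) \<ge> 0" using h[OF p(1)] by (intro mult_nonneg_nonneg) auto
    then show ?thesis using p(2)[of "\<sigma> k"] by linarith
  qed
  then have f0: "f l \<le> 0" by (intro LIMSEQ_le[OF fl inv]) auto
  have "h (p (\<sigma> k)) \<le> inverse (real (Suc (\<sigma> k))) * (inverse (real (Suc (\<sigma> k))) - f (p (\<sigma> k)))" for k
  proof -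
    have "h (p (\<sigma> k)) * real (Suc (\<sigma> k)) \<le> inverse (real (Suc (\<sigma> k))) - f (p (\<sigma> k))"
      using p(2)[of "\<sigma> k"] by (simp only: mult.commute)
    then have "inverse (real (Suc (\<sigma> k))) * (h (p (\<sigma> k)) * real (Suc (\<sigma> k)))
      \<le> inverse (real (Suc (\<sigma> k))) * (inverse (real (Suc (\<sigma> k))) - f (p (\<sigma> k)))"
      by (rule mult_left_mono) simp
    moreover have "inverse (real (Suc (\<sigma> k))) * (h (p (\<sigma> k)) * real (Suc (\<sigma> k))) = h (p (\<sigma> k))" by simp
    ultimately show ?thesis by linarith
  qed
  moreover have "(\<lambda>k. inverse (real (Suc (\<sigma> k))) * (inverse (real (Suc (\<sigma> k))) - f (p (\<sigma> k)))) \<longlonglongrightarrow> 0 * (0 - f l)"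
    by (intro tendsto_intros inv fl)
  ultimately have "h l \<le> 0" by (intro LIMSEQ_le[OF hl]) auto
  then have "f l > 0" using pos[OF l(1)] h[OF l(1)] by simp
  then show False using f0 by simp
qed

text \<open>Uniform continuity of the second derivative on a compact neighbourhood of
  \<open>K\<close> bounds the linearisation error of \<open>D\<rho>\<close>; one more integration
  along the segment gives the remainder.\<close>

lemma C2_on_Taylor_uniform:
  fixes \<rho> :: "'a::euclidean_space \<Rightarrow> real"
  assumes U: "open U" "K \<subseteq> U" "compact K" and C2: "C2_on U \<rho> D\<rho> D2\<rho>" and e: "\<omega> > 0"
  shows "\<exists>r>0. \<forall>q\<in>K. \<forall>v. norm v < r \<longrightarrow> q + v \<in> U \<and>
     \<bar>\<rho> (q + v) - \<rho> q - D\<rho> q v - (D2\<rho> q v v) / 2\<bar> \<le> \<omega> * (norm v)\<^sup>2"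
proof -
  obtain e1 where e1: "e1 > 0" "(\<Union>q\<in>K. cball q e1) \<subseteq> U"
    using compact_subset_open_imp_cball_epsilon_subset[OF U(3,1,2)] by blast
  define KK where "KK = {x + y |x y. x \<in> K \<and> y \<in> cball (0::'a) e1}"
  have cKK: "compact KK" unfolding KK_def by (intro compact_sums U compact_cball)
  have KKU: "KK \<subseteq> U"
  proof
    fix z assume "z \<in> KK"
    then obtain x y where "z = x + y" "x \<in> K" "norm y \<le> e1" by (auto simp: KK_def)
    then have "z \<in> cball x e1" by (simp add: dist_norm)
    then show "z \<in> U" using e1(2) \<open>x \<in> K\<close> by blast
  qed
  have "continuous_on KK D2\<rho>" using C2 KKU continuous_on_subset unfolding C2_on_def by blast
  then have "uniformly_continuous_on KK D2\<rho>" using cKK compact_uniformly_continuous by blast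
  then obtain d where d: "d > 0" "\<forall>x\<in>KK. \<forall>x'\<in>KK. dist x' x < d \<longrightarrow> dist (D2\<rho> x') (D2\<rho> x) < \<omega>"
    using e unfolding uniformly_continuous_on_def by blast
  define r where "r = min d e1"
  have r: "r > 0" using d e1 by (simp add: r_def)
  have inKK: "q + v \<in> KK" if "q \<in> K" "norm v < r" for q v
    using that unfolding KK_def r_def by force
  have main: "\<bar>\<rho> (q + v) - \<rho> q - D\<rho> q v - (D2\<rho> q v v) / 2\<bar> \<le> \<omega> * (norm v)\<^sup>2" if q: "q \<in> K" and v: "norm v < r" for q v
  proof -
    have bU: "ball q r \<subseteq> U"
    proof
      fix z assume "z \<in> ball q r"
      then have "q + (z - q) \<in> KK" using inKK[OF q, of "z - q"] by (simp add: dist_norm norm_minus_commute)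
      then show "z \<in> U" using KKU by auto
    qed
    have D1: "norm (D\<rho> (q + w) - D\<rho> q - D2\<rho> q w) \<le> norm w * \<omega>" if w: "norm w < r" for w
    proof -
      have "norm (D\<rho> (q + w) - D\<rho> q - blinfun_apply (D2\<rho> q) ((q + w) - q)) \<le> norm ((q + w) - q) * \<omega>"
      proof (rule differentiable_bound_linearization[where f'="\<lambda>z. blinfun_apply (D2\<rho> z)" and S="ball q r"])
        fix t :: real assume "t \<in> {0..1}"
        then have "norm (t *\<^sub>R w) \<le> norm w" by (simp add: mult_left_le_one_le)
        then show "q + t *\<^sub>R (q + w - q) \<in> ball q r" using w by (simp add: dist_norm)
      next
        fix z assume z: "z \<in> ball q r"
        show "(D\<rho> has_derivative blinfun_apply (D2\<rho> z)) (at z within ball q r)"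
          using C2 bU z unfolding C2_on_def by (meson has_derivative_at_withinI subsetD)
        have "q + (z - q) \<in> KK" "q + 0 \<in> KK" using inKK[OF q, of "z - q"] inKK[OF q, of 0] z r by (auto simp: dist_norm norm_minus_commute)
        then have "dist (D2\<rho> z) (D2\<rho> q) < \<omega>" using d(2) z by (simp add: r_def dist_commute)
        then show "onorm (blinfun_apply (D2\<rho> z) - blinfun_apply (D2\<rho> q)) \<le> \<omega>"
          by (simp add: dist_norm norm_blinfun.rep_eq minus_blinfun.rep_eq fun_diff_def)
      qed (use r in auto)
      then show ?thesis by simp
    qed
    define f where "f t = \<rho> (q + t *\<^sub>R v) - t * D\<rho> q v - t\<^sup>2 / 2 * D2\<rho> q v v" for t
    have "norm (f 1 - f 0) \<le> 1 * (\<omega> * (norm v)\<^sup>2) - 0 * (\<omega> * (norm v)\<^sup>2)"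
    proof (rule differentiable_bound_general[of 0 1 f "\<lambda>t. t * (\<omega> * (norm v)\<^sup>2)"
        "\<lambda>t. D\<rho> (q + t *\<^sub>R v) v - D\<rho> q v - t * D2\<rho> q v v" "\<lambda>t. \<omega> * (norm v)\<^sup>2"])
      have tv: "norm (t *\<^sub>R v) \<le> norm v" if "0 \<le> t" "t \<le> 1" for t using that by (simp add: mult_left_le_one_le)
      have fd: "(f has_vector_derivative (D\<rho> (q + t *\<^sub>R v) v - D\<rho> q v - t * D2\<rho> q v v)) (at t)" if t: "0 \<le> t" "t \<le> 1" for t
      proof -
        have "q + t *\<^sub>R v \<in> U" using bU tv[OF t] v by (force simp: dist_norm)
        then have dr: "(\<rho> has_derivative D\<rho> (q + t *\<^sub>R v)) (at (q + t *\<^sub>R v))" using C2 unfolding C2_on_def by blast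
        have l: "((\<lambda>t. q + t *\<^sub>R v) has_vector_derivative v) (at t)" by (auto intro!: derivative_eq_intros)
        have "((\<lambda>t. \<rho> (q + t *\<^sub>R v)) has_vector_derivative D\<rho> (q + t *\<^sub>R v) v) (at t)"
          using diff_chain_at[OF l[unfolded has_vector_derivative_def] dr]
          by (simp add: has_vector_derivative_def o_def blinfun.scaleR_right)
        then have a: "((\<lambda>t. \<rho> (q + t *\<^sub>R v)) has_real_derivative D\<rho> (q + t *\<^sub>R v) v) (at t)"
          by (simp add: has_real_derivative_iff_has_vector_derivative)
        show ?thesis
          unfolding f_def has_real_derivative_iff_has_vector_derivative[symmetric]
          by (auto intro!: derivative_eq_intros a)
      qed
      then show "continuous_on {0..1} f"
        by (intro continuous_at_imp_continuous_on ballI) (auto intro: has_vector_derivative_continuous)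
      show "continuous_on {0..1} (\<lambda>t. t * (\<omega> * (norm v)\<^sup>2))" by (intro continuous_intros)
      fix t :: real assume t: "0 < t" "t < 1"
      show "(f has_vector_derivative (D\<rho> (q + t *\<^sub>R v) v - D\<rho> q v - t * D2\<rho> q v v)) (at t)" using fd t by simp
      show "((\<lambda>t. t * (\<omega> * (norm v)\<^sup>2)) has_vector_derivative (\<omega> * (norm v)\<^sup>2)) (at t)"
        by (auto intro!: derivative_eq_intros simp: has_real_derivative_iff_has_vector_derivative[symmetric])
      have "norm ((D\<rho> (q + t *\<^sub>R v) - D\<rho> q - D2\<rho> q (t *\<^sub>R v)) v) \<le> norm (D\<rho> (q + t *\<^sub>R v) - D\<rho> q - D2\<rho> q (t *\<^sub>R v)) * norm v"
        by (rule norm_blinfun)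
      also have "\<dots> \<le> (norm v * \<omega>) * norm v"
      proof (rule mult_right_mono)
        have "norm (D\<rho> (q + t *\<^sub>R v) - D\<rho> q - D2\<rho> q (t *\<^sub>R v)) \<le> norm (t *\<^sub>R v) * \<omega>"
          using D1[of "t *\<^sub>R v"] tv[of t] t v by simp
        also have "\<dots> \<le> norm v * \<omega>" using tv[of t] t e by (intro mult_right_mono) auto
        finally show "norm (D\<rho> (q + t *\<^sub>R v) - D\<rho> q - D2\<rho> q (t *\<^sub>R v)) \<le> norm v * \<omega>" .
      qed simp
      finally show "norm (D\<rho> (q + t *\<^sub>R v) v - D\<rho> q v - t * D2\<rho> q v v) \<le> \<omega> * (norm v)\<^sup>2"
        by (simp add: blinfun.diff_left blinfun.scaleR_left blinfun.scaleR_right power2_eq_square mult.commute mult.left_commute)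
    qed simp
    then show ?thesis by (simp add: f_def algebra_simps)
  qed
  show ?thesis
    using r main inKK KKU by (intro exI[of _ r]) blast
qed

text \<open>Replacing \<open>\<rho>\<close> by \<open>\<rho> + A \<rho>\<^sup>2\<close> with \<open>A\<close> large makes the Levi form positive definite on all of \<open>C^n\<close>.\<close>
lemma strictly_pseudoconvex_spsc_at:
  fixes D :: "(complex^'n) set"
  assumes "bounded_strictly_pseudoconvex_C2 D"
  obtains g :: "complex^'n \<Rightarrow> complex^'n" and B c C where "c > 0"
    "\<And>\<epsilon>. \<epsilon> > 0 \<Longrightarrow> \<exists>r>0. \<forall>q\<in>frontier D. spsc_at D q (g q) (B q) c C \<epsilon> r"
proof -
  obtain U \<rho> D\<rho> D2\<rho> where bd: "bounded_domain D" and d: "C2_defining_function D U \<rho> D\<rho> D2\<rho>"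
    and levi: "\<And>p w. p \<in> frontier D \<Longrightarrow> w \<noteq> 0 \<Longrightarrow> D\<rho> p w = 0 \<Longrightarrow> D\<rho> p (\<i> *s w) = 0 \<Longrightarrow>
            (D2\<rho> p w w + D2\<rho> p (\<i> *s w) (\<i> *s w)) / 4 > 0"
    using assms unfolding bounded_strictly_pseudoconvex_C2_def by blast
  have U: "open U" "frontier D \<subseteq> U" "C2_on U \<rho> D\<rho> D2\<rho>" "D \<inter> U = {z\<in>U. \<rho> z < 0}" "\<And>p. p \<in> frontier D \<Longrightarrow> D\<rho> p \<noteq> 0"
    using d unfolding C2_defining_function_def by auto
  have Do: "open D" and Db: "bounded D" using bd unfolding bounded_domain_def by auto
  let ?K = "frontier D"
  have K: "compact ?K" using Db by (rule compact_frontier_bounded)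
  have cD1: "continuous_on ?K D\<rho>" and cD2: "continuous_on ?K D2\<rho>"
    using U(2,3) continuous_on_subset unfolding C2_on_def by blast+
  obtain c1 where c1: "c1 > 0" "\<forall>q\<in>?K. c1 \<le> norm (D\<rho> q)"
    using brouwer_compactness_lemma[OF K cD1] U(5) by blast
  obtain C1 where C1: "C1 > 0" "\<And>q. q \<in> ?K \<Longrightarrow> norm (D\<rho> q) \<le> C1"
    using compact_imp_bounded[OF compact_continuous_image[OF cD1 K]] by (auto simp: bounded_pos)
  obtain C2 where C2: "C2 > 0" "\<And>q. q \<in> ?K \<Longrightarrow> norm (D2\<rho> q) \<le> C2"
    using compact_imp_bounded[OF compact_continuous_image[OF cD2 K]] by (auto simp: bounded_pos)
  let ?S = "?K \<times> sphere (0::complex^'n) 1"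
  have "\<exists>A>0. \<exists>e>0. \<forall>p\<in>?S. (D2\<rho> (fst p) (snd p) (snd p) + D2\<rho> (fst p) (\<i> *s snd p) (\<i> *s snd p))
       + A * ((D\<rho> (fst p) (snd p))\<^sup>2 + (D\<rho> (fst p) (\<i> *s snd p))\<^sup>2) \<ge> e"
  proof (rule positive_on_zeros_penalty)
    show "compact ?S" by (intro compact_Times K compact_sphere)
    have f: "continuous_on ?S (\<lambda>p. D\<rho> (fst p))" "continuous_on ?S (\<lambda>p. D2\<rho> (fst p))"
    proof -
      show "continuous_on ?S (\<lambda>p. D\<rho> (fst p))"
        by (rule continuous_on_compose2[OF cD1 continuous_on_fst[OF continuous_on_id]]) auto
      show "continuous_on ?S (\<lambda>p. D2\<rho> (fst p))"
        by (rule continuous_on_compose2[OF cD2 continuous_on_fst[OF continuous_on_id]]) auto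
    qed
    have i: "continuous_on ?S (\<lambda>p. \<i> *s snd p)"
      using bounded_linear.continuous_on[OF bounded_linear_vector_smult_right continuous_on_snd[OF continuous_on_id]] .
    have sn: "continuous_on ?S (\<lambda>p. snd p)" by (intro continuous_intros)
    show "continuous_on ?S (\<lambda>p. D2\<rho> (fst p) (snd p) (snd p) + D2\<rho> (fst p) (\<i> *s snd p) (\<i> *s snd p))"
      by (intro continuous_on_add blinfun.continuous_on f i sn)
    show "continuous_on ?S (\<lambda>p. (D\<rho> (fst p) (snd p))\<^sup>2 + (D\<rho> (fst p) (\<i> *s snd p))\<^sup>2)"
      by (intro continuous_on_add continuous_on_power blinfun.continuous_on f i sn)
    fix p assume p: "p \<in> ?S"
    show "0 \<le> (D\<rho> (fst p) (snd p))\<^sup>2 + (D\<rho> (fst p) (\<i> *s snd p))\<^sup>2" by simp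
    assume "(D\<rho> (fst p) (snd p))\<^sup>2 + (D\<rho> (fst p) (\<i> *s snd p))\<^sup>2 = 0"
    then have "D\<rho> (fst p) (snd p) = 0" "D\<rho> (fst p) (\<i> *s snd p) = 0" by (simp_all add: sum_power2_eq_zero_iff)
    moreover have "fst p \<in> ?K" "snd p \<noteq> 0" using p by auto
    ultimately show "0 < D2\<rho> (fst p) (snd p) (snd p) + D2\<rho> (fst p) (\<i> *s snd p) (\<i> *s snd p)"
      using levi by fastforce
  qed
  then obtain A' e where A': "A' > 0" "e > 0" and pos1: "\<And>q w. q \<in> ?K \<Longrightarrow> norm w = 1 \<Longrightarrow>
      (D2\<rho> q w w + D2\<rho> q (\<i> *s w) (\<i> *s w)) + A' * ((D\<rho> q w)\<^sup>2 + (D\<rho> q (\<i> *s w))\<^sup>2) \<ge> e"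
    by fastforce
  \<comment> \<open>At the boundary the Hessian of \<open>\<rho> + A * \<rho>\<^sup>2\<close> gains
    \<open>2 * A\<close> times the square of the differential, hence the halving.\<close>
  define A where "A = A' / 2"
  have A: "A > 0" using A' by (simp add: A_def)
  define g where "g q = rvec (D\<rho> q)" for q
  define B where "B q = Blinfun (\<lambda>v. rvec (D2\<rho> q v) + (2 * A * D\<rho> q v) *\<^sub>R g q)" for q
  have Bv: "B q v = rvec (D2\<rho> q v) + (2 * A * D\<rho> q v) *\<^sub>R g q" for q v
  proof -
    have "bounded_linear (\<lambda>v. rvec (D2\<rho> q v) + (2 * A * D\<rho> q v) *\<^sub>R g q)"
      by (intro bounded_linear_add bounded_linear_compose[OF bounded_linear_rvec] bounded_linear_scaleR_left[THEN bounded_linear_compose]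
          bounded_linear_mult_right[THEN bounded_linear_compose] blinfun.bounded_linear_right)
    then show ?thesis unfolding B_def by (simp add: bounded_linear_Blinfun_apply)
  qed
  have gv: "g q \<bullet> v = D\<rho> q v" for q v by (simp add: g_def rvec_inner)
  have Bvv: "B q v \<bullet> v = D2\<rho> q v v + 2 * A * (D\<rho> q v)\<^sup>2" for q v
    by (simp add: Bv inner_add_left rvec_inner gv power2_eq_square)
  have nB: "norm (B q) \<le> C2 + 2 * A * C1\<^sup>2" if q: "q \<in> ?K" for q
  proof (rule norm_blinfun_bound)
    show "0 \<le> C2 + 2 * A * C1\<^sup>2" using C2 A by simp
    fix v
    have "norm (D2\<rho> q v) \<le> C2 * norm v" using norm_blinfun[of "D2\<rho> q" v] C2(2)[OF q] by (meson mult_right_mono norm_ge_zero order_trans)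
    moreover have "\<bar>D\<rho> q v\<bar> \<le> C1 * norm v"
      using norm_blinfun[of "D\<rho> q" v] mult_right_mono[OF C1(2)[OF q] norm_ge_zero[of v]] by simp
    then have "2 * A * \<bar>D\<rho> q v\<bar> * norm (g q) \<le> 2 * A * (C1 * norm v) * C1"
      using A C1 q by (intro mult_mono) (auto simp: g_def norm_rvec)
    moreover have "norm (B q v) \<le> norm (D2\<rho> q v) + 2 * A * \<bar>D\<rho> q v\<bar> * norm (g q)"
      unfolding Bv using norm_triangle_ineq[of "rvec (D2\<rho> q v)" "(2 * A * D\<rho> q v) *\<^sub>R g q"] A
      by (simp add: norm_rvec abs_mult)
    ultimately have "norm (B q v) \<le> C2 * norm v + 2 * A * (C1 * norm v) * C1" by linarith
    also have "\<dots> = (C2 + 2 * A * C1\<^sup>2) * norm v" by (simp add: algebra_simps power2_eq_square)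
    finally show "norm (B q v) \<le> (C2 + 2 * A * C1\<^sup>2) * norm v" .
  qed
  have pos: "e * (norm v)\<^sup>2 \<le> B q v \<bullet> v + B q (\<i> *s v) \<bullet> (\<i> *s v)" if q: "q \<in> ?K" for q v
  proof (cases "v = 0")
    case False
    define w where "w = sgn v"
    have w: "norm w = 1" "v = norm v *\<^sub>R w" using False by (auto simp: w_def norm_sgn sgn_div_norm)
    have iv: "\<i> *s v = norm v *\<^sub>R (\<i> *s w)" by (subst w(2)) (simp add: vec_eq_iff)
    have "B q v \<bullet> v + B q (\<i> *s v) \<bullet> (\<i> *s v) = (norm v)\<^sup>2 * (B q w \<bullet> w + B q (\<i> *s w) \<bullet> (\<i> *s w))"
      unfolding iv by (subst (1 2) w(2)) (simp add: blinfun.scaleR_right power2_eq_square algebra_simps)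
    also have "\<dots> \<ge> (norm v)\<^sup>2 * e"
    proof (rule mult_left_mono)
      show "e \<le> B q w \<bullet> w + B q (\<i> *s w) \<bullet> (\<i> *s w)"
        using pos1[OF q w(1)] by (simp add: Bvv A_def algebra_simps)
    qed simp
    finally show ?thesis by (simp add: mult.commute)
  qed simp
  define c where "c = min c1 e"
  define C where "C = max C1 (C2 + 2 * A * C1\<^sup>2)"
  have c: "c > 0" using c1 A' by (simp add: c_def)
  define C3 where "C3 = C1 + C2 + 1"
  have C3: "C3 > 0" using C1 C2 by (simp add: C3_def)
  have main: "\<exists>r>0. \<forall>q\<in>?K. spsc_at D q (g q) (B q) c C \<epsilon> r" if eps: "\<epsilon> > 0" for \<epsilon>
  proof -
    define \<omega> where "\<omega> = min 1 (\<epsilon>/2)"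
    have \<omega>: "\<omega> > 0" "\<omega> \<le> 1" "\<omega> \<le> \<epsilon>/2" using eps by (auto simp: \<omega>_def)
    obtain r0 where r0: "r0 > 0" and Tay: "\<And>q v. q \<in> ?K \<Longrightarrow> norm v < r0 \<Longrightarrow> q + v \<in> U \<and>
        \<bar>\<rho> (q + v) - \<rho> q - D\<rho> q v - (D2\<rho> q v v) / 2\<bar> \<le> \<omega> * (norm v)\<^sup>2"
      using C2_on_Taylor_uniform[OF U(1,2) K U(3) \<omega>(1)] by blast
    \<comment> \<open>The last two entries give \<open>\<bar>A * \<rho>\<bar> < 1\<close> and keep
      the cost of replacing \<open>\<rho>\<^sup>2\<close> by the square of its linear part below
      half of the allowed error.\<close>
    define r where "r = min (min r0 1) (min (1 / (2 * A * C3)) (\<epsilon> / (4 * A * C3\<^sup>2)))"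
    have r: "r > 0" "r \<le> r0" "r \<le> 1" "r \<le> 1 / (2 * A * C3)" "r \<le> \<epsilon> / (4 * A * C3\<^sup>2)"
      using r0 A C3 eps by (auto simp: r_def)
    have "spsc_at D q (g q) (B q) c C \<epsilon> r" if q: "q \<in> ?K" for q
    proof -
      have \<rho>q: "\<rho> q = 0"
        using defining_function_frontier[OF Do U(1) C2_on_continuous[OF U(3)] U(4) q] q U(2) by blast
      have T: "(q + v \<in> D \<longrightarrow> g q \<bullet> v + (B q v \<bullet> v) / 2 \<le> \<epsilon> * (norm v)\<^sup>2) \<and>
          (g q \<bullet> v + (B q v \<bullet> v) / 2 < - (\<epsilon> * (norm v)\<^sup>2) \<longrightarrow> q + v \<in> D)" if v: "norm v < r" for v
      proof -
        let ?n = "norm v" and ?\<rho> = "\<rho> (q + v)" and ?l = "D\<rho> q v"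
        have qU: "q + v \<in> U" and T1: "\<bar>?\<rho> - ?l - (D2\<rho> q v v) / 2\<bar> \<le> \<omega> * ?n\<^sup>2"
          using Tay[OF q, of v] v r \<rho>q by auto
        have n1: "?n \<le> 1" "?n\<^sup>2 \<le> ?n" using v r by (auto simp: power2_eq_square mult_left_le_one_le)
        have l1: "\<bar>?l\<bar> \<le> C1 * ?n"
          using norm_blinfun[of "D\<rho> q" v] mult_right_mono[OF C1(2)[OF q] norm_ge_zero[of v]] by simp
        have h1: "\<bar>D2\<rho> q v v\<bar> \<le> C2 * ?n\<^sup>2"
        proof -
          have "\<bar>D2\<rho> q v v\<bar> \<le> norm (D2\<rho> q v) * ?n" using norm_blinfun[of "D2\<rho> q v" v] by simp
          also have "\<dots> \<le> (norm (D2\<rho> q) * ?n) * ?n" by (intro mult_right_mono norm_blinfun) simp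
          also have "\<dots> \<le> (C2 * ?n) * ?n" using C2(2)[OF q] by (intro mult_right_mono) auto
          finally show ?thesis by (simp add: power2_eq_square)
        qed
        have d1: "\<bar>?\<rho> - ?l\<bar> \<le> C3 * ?n\<^sup>2"
        proof -
          have "\<bar>?\<rho> - ?l\<bar> \<le> \<omega> * ?n\<^sup>2 + C2 * ?n\<^sup>2" using T1 h1 C2 by (auto simp: abs_le_iff)
          also have "\<dots> \<le> 1 * ?n\<^sup>2 + C2 * ?n\<^sup>2" using \<omega> by (intro add_right_mono mult_right_mono) auto
          also have "\<dots> \<le> C3 * ?n\<^sup>2" using C1 by (simp add: C3_def algebra_simps)
          finally show ?thesis .
        qed
        have d2: "\<bar>?\<rho>\<bar> \<le> C3 * ?n"
        proof -
          have "\<bar>?\<rho>\<bar> \<le> \<omega> * ?n\<^sup>2 + C2 * ?n\<^sup>2 + C1 * ?n" using T1 h1 l1 C2 by (auto simp: abs_le_iff)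
          also have "\<dots> \<le> 1 * ?n + C2 * ?n + C1 * ?n" using \<omega> n1 C2 by (intro add_right_mono add_mono mult_mono) auto
          finally show ?thesis by (simp add: C3_def algebra_simps)
        qed
        have d3: "\<bar>?\<rho>\<^sup>2 - ?l\<^sup>2\<bar> \<le> 2 * C3\<^sup>2 * ?n * ?n\<^sup>2"
        proof -
          have "C1 * ?n \<le> C3 * ?n" using C2 by (intro mult_right_mono) (auto simp: C3_def)
          then have "\<bar>?\<rho> + ?l\<bar> \<le> 2 * C3 * ?n" using d2 l1 by linarith
          then have "\<bar>?\<rho> - ?l\<bar> * \<bar>?\<rho> + ?l\<bar> \<le> (C3 * ?n\<^sup>2) * (2 * C3 * ?n)" using d1 by (intro mult_mono) auto
          moreover have "?\<rho>\<^sup>2 - ?l\<^sup>2 = (?\<rho> - ?l) * (?\<rho> + ?l)" by (simp add: power2_eq_square algebra_simps)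
          moreover have "(C3 * ?n\<^sup>2) * (2 * C3 * ?n) = 2 * C3\<^sup>2 * ?n * ?n\<^sup>2" by (simp add: power2_eq_square)
          ultimately show ?thesis by (simp only: abs_mult)
        qed
        have small: "A * (2 * C3\<^sup>2 * ?n) \<le> \<epsilon> / 2"
        proof -
          have "?n * (4 * A * C3\<^sup>2) \<le> \<epsilon>" using v r(5) A C3 by (simp add: pos_le_divide_eq[symmetric])
          then show ?thesis by (simp add: algebra_simps)
        qed
        have A\<rho>: "\<bar>A * ?\<rho>\<bar> < 1"
        proof -
          have "?n * (2 * A * C3) \<le> 1" using v r(4) A C3 by (simp add: pos_le_divide_eq[symmetric])
          moreover have "\<bar>A * ?\<rho>\<bar> \<le> A * (C3 * ?n)" unfolding abs_mult using d2 A by (intro mult_mono) auto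
          ultimately show ?thesis by (simp add: algebra_simps)
        qed
        have "\<bar>(?\<rho> + A * ?\<rho>\<^sup>2) - (?l + (B q v \<bullet> v) / 2)\<bar> \<le> \<epsilon> * ?n\<^sup>2"
        proof -
          have eq: "(?\<rho> + A * ?\<rho>\<^sup>2) - (?l + (B q v \<bullet> v) / 2) = (?\<rho> - ?l - (D2\<rho> q v v) / 2) + A * (?\<rho>\<^sup>2 - ?l\<^sup>2)"
            by (simp add: Bvv algebra_simps)
          have "\<bar>A * (?\<rho>\<^sup>2 - ?l\<^sup>2)\<bar> \<le> A * (2 * C3\<^sup>2 * ?n * ?n\<^sup>2)"
            unfolding abs_mult using d3 A by (intro mult_mono) auto
          also have "\<dots> = A * (2 * C3\<^sup>2 * ?n) * ?n\<^sup>2" by simp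
          also have "\<dots> \<le> \<epsilon> / 2 * ?n\<^sup>2" using small by (intro mult_right_mono) auto
          finally have 1: "\<bar>A * (?\<rho>\<^sup>2 - ?l\<^sup>2)\<bar> \<le> \<epsilon> / 2 * ?n\<^sup>2" .
          have 2: "\<omega> * ?n\<^sup>2 \<le> \<epsilon> / 2 * ?n\<^sup>2" using \<omega> by (intro mult_right_mono) auto
          show ?thesis unfolding eq using 1 2 T1 abs_triangle_ineq[of "?\<rho> - ?l - (D2\<rho> q v v) / 2" "A * (?\<rho>\<^sup>2 - ?l\<^sup>2)"] by linarith
        qed
        \<comment> \<open>The new function is \<rho> times a factor that is positive near
          \<open>q\<close>, so it has the sign of \<rho> and cuts out the same domain.\<close>
        then have cmp: "\<bar>?\<rho> * (1 + A * ?\<rho>) - (g q \<bullet> v + (B q v \<bullet> v) / 2)\<bar> \<le> \<epsilon> * ?n\<^sup>2"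
          by (simp add: gv power2_eq_square algebra_simps)
        have pos': "1 + A * ?\<rho> > 0" using A\<rho> by linarith
        have "g q \<bullet> v + (B q v \<bullet> v) / 2 \<le> \<epsilon> * ?n\<^sup>2" if "q + v \<in> D"
        proof -
          have "?\<rho> < 0" using U(4) that qU by blast
          then have "?\<rho> * (1 + A * ?\<rho>) < 0" using pos' by (rule mult_neg_pos)
          then show ?thesis using cmp by linarith
        qed
        moreover have "q + v \<in> D" if "g q \<bullet> v + (B q v \<bullet> v) / 2 < - (\<epsilon> * ?n\<^sup>2)"
        proof -
          have "?\<rho> * (1 + A * ?\<rho>) < 0" using cmp that by linarith
          then have "?\<rho> < 0" using pos' by (simp add: mult_less_0_iff)
          then show ?thesis using U(4) qU by blast
        qed
        ultimately show ?thesis by blast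
      qed
      have "c \<le> norm (g q)" using c1 q by (auto simp: c_def g_def norm_rvec)
      moreover have "norm (g q) \<le> C" using C1(2)[OF q] by (simp add: C_def g_def norm_rvec)
      moreover have "norm (B q) \<le> C" using nB[OF q] by (simp add: C_def)
      moreover have "c * (norm v)\<^sup>2 \<le> B q v \<bullet> v + B q (\<i> *s v) \<bullet> (\<i> *s v)" for v
      proof -
        have "c * (norm v)\<^sup>2 \<le> e * (norm v)\<^sup>2" by (intro mult_right_mono) (auto simp: c_def)
        then show ?thesis using pos[OF q, of v] by linarith
      qed
      ultimately show ?thesis unfolding spsc_at_def using T by blast
    qed
    then show ?thesis using r(1) by blast
  qed
  show thesis by (rule that[OF c main])
qed

text \<open>\<open>X\<close> pairs corresponding points under a transition that is nearly the
  identity, so the forms can be compared only at points of \<open>D'\<close> or its frontier; this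
  yields the first inequality. For the second, a point with negative form is not known to lie in
  \<open>D'\<close>. It is pushed inwards to a point covered by the last hypothesis, and the form
  excludes any crossing of \<open>frontier D'\<close> on the way. The new gradient is the adjoint of
  the identity minus \<open>L\<close>, applied to \<open>g\<close>.\<close>

lemma spsc_at_transfer:
  fixes c C \<epsilon> r0 :: real
  assumes c: "c > 0" "c \<le> C" and eps: "\<epsilon> > 0" and r0: "r0 > 0"
  obtains r \<eta> where "r > 0" "\<eta> > 0"
    "\<And>(D::(complex^'n) set) D' q q' g B L X. \<lbrakk>spsc_at D q g B c C (\<epsilon>/16) r0; norm L \<le> \<eta>; norm (q' - q) \<le> \<eta>;
       \<And>w w'. (w, w') \<in> X \<Longrightarrow> norm ((w - q) - (w' - q') + blinfun_apply L (w' - q')) \<le> \<eta> * (norm (w' - q'))\<^sup>2;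
       \<And>w'. w' \<in> D' \<Longrightarrow> \<exists>w\<in>D. (w, w') \<in> X; \<And>w'. w' \<in> frontier D' \<Longrightarrow> \<exists>w. w \<notin> D \<and> (w, w') \<in> X;
       \<And>z. cball z \<eta> \<subseteq> D \<Longrightarrow> z \<in> D'\<rbrakk> \<Longrightarrow> spsc_at D' q' (g - adjoint (blinfun_apply L) g) B (c/2) (2*C) \<epsilon> r"
proof -
  have C: "C > 0" using c by simp
  define r1 where "r1 = min 1 (r0/2)"
  have r1: "r1 > 0" "r1 \<le> 1" "2 * r1 \<le> r0" using r0 by (auto simp: r1_def)
  \<comment> \<open>Length of the inward push: within \<open>s1\<close> the gradient dominates the
    Hessian and the error term, and the path stays where forms can be compared.\<close>
  define s1 where "s1 = min (r1/2) (c / (16 * (2*C + 4*\<epsilon>)))"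
  have s1: "s1 > 0" "s1 \<le> r1/2" "s1 * (16 * (2*C + 4*\<epsilon>)) \<le> c"
  proof -
    have p: "16 * (2*C + 4*\<epsilon>) > 0" using C eps by simp
    then show "s1 > 0" using r1 c by (simp add: s1_def)
    show "s1 \<le> r1/2" unfolding s1_def by (rule min.cobounded1)
    have "s1 \<le> c / (16 * (2*C + 4*\<epsilon>))" by (simp add: s1_def)
    then show "s1 * (16 * (2*C + 4*\<epsilon>)) \<le> c" using pos_le_divide_eq[OF p] by blast
  qed
  \<comment> \<open>A displacement of size \<open>\<kappa> * s1\<close> costs at most c s1 / 16 in
    the linear term, against the gain c s1 / 4 of the push.\<close>
  define \<kappa> where "\<kappa> = c / (16 * C)"
  have \<kappa>: "\<kappa> > 0" "\<kappa> \<le> 1" "C * \<kappa> = c/16" using c C by (auto simp: \<kappa>_def)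
  define \<eta> where "\<eta> = min (min (1/8) (\<epsilon> / (28 * C))) (min (c / (4 * C)) (\<kappa> * s1 / 4))"
  have \<eta>: "\<eta> > 0" "\<eta> \<le> 1/8" "7 * (C * \<eta>) \<le> \<epsilon>/4" "C * \<eta> \<le> c/4" "\<eta> \<le> \<kappa> * s1 / 4"
  proof -
    show "\<eta> > 0" using c C eps \<kappa> s1 by (simp add: \<eta>_def)
    have "\<eta> \<le> \<epsilon> / (28 * C)" by (simp add: \<eta>_def)
    then have "\<eta> * (28 * C) \<le> \<epsilon>" using C by (simp add: pos_le_divide_eq)
    then show "7 * (C * \<eta>) \<le> \<epsilon>/4" by (simp add: algebra_simps)
    have "\<eta> \<le> c / (4 * C)" by (simp add: \<eta>_def)
    then have "\<eta> * (4 * C) \<le> c" using C by (simp add: pos_le_divide_eq)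
    then show "C * \<eta> \<le> c/4" by (simp add: algebra_simps)
  qed (auto simp: \<eta>_def)
  define r where "r = min (r1/2) (min (c / (4 * (C + 2*\<epsilon>))) (\<kappa> * s1 / 4))"
  have r: "r > 0" "r \<le> r1/2" "r * (4 * (C + 2*\<epsilon>)) \<le> c" "r \<le> \<kappa> * s1 / 4"
  proof -
    have p: "4 * (C + 2*\<epsilon>) > 0" using C eps by simp
    then show "r > 0" using r1 c \<kappa> s1 by (simp add: r_def)
    show "r \<le> r1/2" unfolding r_def by (rule min.cobounded1)
    show "r \<le> \<kappa> * s1 / 4" unfolding r_def by (rule min.coboundedI2[OF min.cobounded2])
    have "r \<le> c / (4 * (C + 2*\<epsilon>))" by (simp add: r_def)
    then show "r * (4 * (C + 2*\<epsilon>)) \<le> c" using pos_le_divide_eq[OF p] by blast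
  qed
  have main: "spsc_at D' q' (g - adjoint (blinfun_apply L) g) B (c/2) (2*C) \<epsilon> r"
    if S: "spsc_at D q g B c C (\<epsilon>/16) r0" and L: "norm L \<le> \<eta>" and qq: "norm (q' - q) \<le> \<eta>"
      and X: "\<And>w w'. (w, w') \<in> X \<Longrightarrow> norm ((w - q) - (w' - q') + blinfun_apply L (w' - q')) \<le> \<eta> * (norm (w' - q'))\<^sup>2"
      and XD: "\<And>w'. w' \<in> D' \<Longrightarrow> \<exists>w\<in>D. (w, w') \<in> X" and XF: "\<And>w'. w' \<in> frontier D' \<Longrightarrow> \<exists>w. w \<notin> D \<and> (w, w') \<in> X"
      and deep: "\<And>z. cball z \<eta> \<subseteq> D \<Longrightarrow> z \<in> D'"
    for D D' :: "(complex^'n) set" and q q' g B L X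
  proof -
    have gB: "c \<le> norm g" "norm g \<le> C" "norm B \<le> C" using S by (auto simp: spsc_at_def)
    have Bn: "\<bar>B v \<bullet> w\<bar> \<le> C * norm v * norm w" for v w
    proof -
      have "norm B * norm v * norm w \<le> C * norm v * norm w" using gB by (intro mult_right_mono) auto
      then show ?thesis using inner_blinfun_le[of B v w] by linarith
    qed
    define a where "a = adjoint (blinfun_apply L) g"
    define g' where "g' = g - a"
    have av: "a \<bullet> v = g \<bullet> blinfun_apply L v" for v
      unfolding a_def using adjoint_works[OF bounded_linear.linear[OF blinfun.bounded_linear_right[of L]], of v g]
      by (simp add: inner_commute)
    have Lv: "norm (blinfun_apply L v) \<le> \<eta> * norm v" for v
      using norm_blinfun[of L v] mult_right_mono[OF L norm_ge_zero[of v]] by linarith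
    have na: "norm a \<le> C * \<eta>"
    proof (cases "a = 0")
      case False
      have "norm a * norm a = g \<bullet> blinfun_apply L a" using av[of a] by (metis dot_square_norm power2_eq_square)
      also have "\<dots> \<le> norm g * norm (blinfun_apply L a)" using norm_cauchy_schwarz .
      also have "\<dots> \<le> C * (\<eta> * norm a)" using gB Lv C by (intro mult_mono) auto
      finally have "norm a * norm a \<le> (C * \<eta>) * norm a" by simp
      then show ?thesis using False mult_right_le_imp_le zero_less_norm_iff by blast
    qed (use C \<eta> in simp)
    have g'v: "g' \<bullet> v = g \<bullet> (v - blinfun_apply L v)" for v
      by (simp add: g'_def av inner_diff_left inner_diff_right)
    have ng': "c/2 \<le> norm g'" "norm g' \<le> 2 * C"
      using gB na \<eta> norm_triangle_ineq2[of g a] norm_triangle_ineq4[of g a] c by (auto simp: g'_def)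
    have cmp: "norm (w - q) \<le> 2 * norm (w' - q') \<and>
        \<bar>(g' \<bullet> (w' - q') + (B (w' - q') \<bullet> (w' - q')) / 2) - (g \<bullet> (w - q) + (B (w - q) \<bullet> (w - q)) / 2)\<bar> \<le> \<epsilon>/4 * (norm (w' - q'))\<^sup>2"
      if ww: "(w, w') \<in> X" and n: "norm (w' - q') < r1" for w w'
    proof -
      define v where "v = w - q"
      define v' where "v' = w' - q'"
      define m where "m = norm v'"
      define E where "E = v - v' + blinfun_apply L v'"
      have E: "norm E \<le> \<eta> * m\<^sup>2" using X[OF ww] by (simp add: E_def v_def v'_def m_def)
      have m: "0 \<le> m" "m \<le> 1" using n r1 by (auto simp: m_def v'_def)
      have m2: "m\<^sup>2 \<le> m" using m by (simp add: power2_eq_square mult_left_le_one_le)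
      have "norm E \<le> \<eta> * m" using E mult_left_mono[OF m2, of \<eta>] \<eta> by linarith
      moreover have "v - v' = E - blinfun_apply L v'" by (simp add: E_def)
      ultimately have dv: "norm (v - v') \<le> 2 * \<eta> * m"
        using norm_triangle_ineq4[of E "blinfun_apply L v'"] Lv[of v'] by (simp add: m_def)
      have "2 * \<eta> * m \<le> 1 * m" using \<eta> m by (intro mult_right_mono) auto
      then have nv: "norm v \<le> 2 * m" using dv norm_triangle_ineq[of "v - v'" v'] by (simp add: m_def)
      have "g' \<bullet> v' - g \<bullet> v = - (g \<bullet> E)" by (simp add: g'v E_def inner_diff_right inner_add_right)
      then have 1: "\<bar>g' \<bullet> v' - g \<bullet> v\<bar> \<le> C * (\<eta> * m\<^sup>2)"
      proof -
        have "\<bar>g \<bullet> E\<bar> \<le> norm g * norm E" by (rule Cauchy_Schwarz_ineq2)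
        also have "\<dots> \<le> C * (\<eta> * m\<^sup>2)" using gB E C by (intro mult_mono) auto
        finally show ?thesis using \<open>g' \<bullet> v' - g \<bullet> v = - (g \<bullet> E)\<close> by simp
      qed
      have "B v' \<bullet> v' - B v \<bullet> v = - (B (v - v') \<bullet> v') - B v \<bullet> (v - v')"
        by (simp add: blinfun.diff_right inner_diff_left inner_diff_right)
      then have "\<bar>B v' \<bullet> v' - B v \<bullet> v\<bar> \<le> C * norm (v - v') * norm v' + C * norm v * norm (v - v')"
        using Bn[of "v - v'" v'] Bn[of v "v - v'"] by linarith
      also have "\<dots> \<le> C * (2 * \<eta> * m) * m + C * (2 * m) * (2 * \<eta> * m)"
        using dv nv C m \<eta> by (intro add_mono mult_mono) (auto simp: m_def)
      also have "\<dots> = 6 * (C * \<eta>) * m\<^sup>2" by (simp add: power2_eq_square)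
      finally have 2: "\<bar>B v' \<bullet> v' - B v \<bullet> v\<bar> \<le> 6 * (C * \<eta>) * m\<^sup>2" .
      have "\<bar>(g' \<bullet> v' + (B v' \<bullet> v') / 2) - (g \<bullet> v + (B v \<bullet> v) / 2)\<bar> \<le> C * (\<eta> * m\<^sup>2) + 3 * (C * \<eta>) * m\<^sup>2"
        using 1 2 by (simp add: abs_le_iff)
      also have "\<dots> = 4 * (C * \<eta>) * m\<^sup>2" by simp
      also have "\<dots> \<le> \<epsilon>/4 * m\<^sup>2"
      proof (rule mult_right_mono)
        have "0 \<le> C * \<eta>" using C \<eta> by simp
        then show "4 * (C * \<eta>) \<le> \<epsilon>/4" using \<eta>(3) by linarith
      qed simp
      finally show ?thesis using nv by (simp add: v_def v'_def m_def)
    qed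
    \<comment> \<open>Source of the error \<epsilon>/16 in the hypothesis: corresponding points are
      at most twice as far from the base point, and the square of 2 brings it to
      \<epsilon>/4.\<close>
    have four: "\<epsilon>/16 * (norm (w - q))\<^sup>2 \<le> \<epsilon>/4 * (norm (w' - q'))\<^sup>2" if "norm (w - q) \<le> 2 * norm (w' - q')" for w w'
    proof -
      have "(norm (w - q))\<^sup>2 \<le> (2 * norm (w' - q'))\<^sup>2" using that by (intro power_mono) auto
      then have "\<epsilon>/16 * (norm (w - q))\<^sup>2 \<le> \<epsilon>/16 * (2 * norm (w' - q'))\<^sup>2" using eps by (intro mult_left_mono) auto
      then show ?thesis by (simp add: power_mult_distrib)
    qed
    define \<psi> where "\<psi> v = g' \<bullet> v + (B v \<bullet> v) / 2" for v
    have N1: "\<psi> v' \<le> \<epsilon> * (norm v')\<^sup>2" if v': "norm v' < r1" "q' + v' \<in> D'" for v'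
    proof -
      obtain w where w: "w \<in> D" "(w, q' + v') \<in> X" using XD[OF v'(2)] by blast
      have n2: "norm (w - q) \<le> 2 * norm v'"
        and cc: "\<bar>\<psi> v' - (g \<bullet> (w - q) + (B (w - q) \<bullet> (w - q)) / 2)\<bar> \<le> \<epsilon>/4 * (norm v')\<^sup>2"
        using cmp[OF w(2)] v'(1) by (simp_all add: \<psi>_def)
      then have "norm (w - q) < r0" using v' r1 by simp
      then have "g \<bullet> (w - q) + (B (w - q) \<bullet> (w - q)) / 2 \<le> \<epsilon>/16 * (norm (w - q))\<^sup>2"
        using S w(1) unfolding spsc_at_def by (metis add.commute diff_add_cancel)
      also have "\<dots> \<le> \<epsilon>/4 * (norm v')\<^sup>2" using four[of w "q' + v'"] n2 by simp
      finally have "\<psi> v' \<le> \<epsilon>/4 * (norm v')\<^sup>2 + \<epsilon>/4 * (norm v')\<^sup>2" using cc by linarith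
      also have "\<dots> = \<epsilon>/2 * (norm v')\<^sup>2" by simp
      also have "\<dots> \<le> \<epsilon> * (norm v')\<^sup>2" using eps by (intro mult_right_mono) auto
      finally show ?thesis .
    qed
    have NF: "\<psi> v' \<ge> - (\<epsilon> * (norm v')\<^sup>2)" if v': "norm v' < r1" "q' + v' \<in> frontier D'" for v'
    proof -
      obtain w where w: "w \<notin> D" "(w, q' + v') \<in> X" using XF[OF v'(2)] by blast
      have n2: "norm (w - q) \<le> 2 * norm v'"
        and cc: "\<bar>\<psi> v' - (g \<bullet> (w - q) + (B (w - q) \<bullet> (w - q)) / 2)\<bar> \<le> \<epsilon>/4 * (norm v')\<^sup>2"
        using cmp[OF w(2)] v'(1) by (simp_all add: \<psi>_def)
      then have "norm (w - q) < r0" using v' r1 by simp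
      then have "- (\<epsilon>/16 * (norm (w - q))\<^sup>2) \<le> g \<bullet> (w - q) + (B (w - q) \<bullet> (w - q)) / 2"
        using S w(1) unfolding spsc_at_def by (metis add.commute diff_add_cancel not_less)
      moreover have "\<epsilon>/16 * (norm (w - q))\<^sup>2 \<le> \<epsilon>/4 * (norm v')\<^sup>2" using four[of w "q' + v'"] n2 by simp
      ultimately have "- (\<epsilon>/4 * (norm v')\<^sup>2 + \<epsilon>/4 * (norm v')\<^sup>2) \<le> \<psi> v'" using cc by linarith
      moreover have "\<epsilon>/4 * (norm v')\<^sup>2 + \<epsilon>/4 * (norm v')\<^sup>2 \<le> \<epsilon> * (norm v')\<^sup>2"
        using mult_right_mono[of "\<epsilon>/2" \<epsilon> "(norm v')\<^sup>2"] eps by simp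
      ultimately show ?thesis by linarith
    qed
    define e where "e = sgn g'"
    have g'0: "g' \<noteq> 0" using ng'(1) c by auto
    have e1: "norm e = 1" using g'0 by (simp add: e_def norm_sgn)
    have g'e: "g' \<bullet> e = norm g'" using g'0 by (simp add: e_def sgn_div_norm power2_norm_eq_inner[symmetric] power2_eq_square)
    have ge: "g \<bullet> e \<ge> c/4"
    proof -
      have "g \<bullet> e = norm g' + a \<bullet> e" using g'e by (simp add: g'_def inner_diff_left)
      moreover have "\<bar>a \<bullet> e\<bar> \<le> C * \<eta>" using Cauchy_Schwarz_ineq2[of a e] e1 na by simp
      ultimately show ?thesis using ng' \<eta> by linarith
    qed
    have N2: "q' + v' \<in> D'" if v': "norm v' < r" and neg: "\<psi> v' < - (\<epsilon> * (norm v')\<^sup>2)" for v'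
    proof -
      \<comment> \<open>The linear gain \<open>s * norm g'\<close> outweighs the cross terms, of
        size \<open>norm v'\<close>, and the terms quadratic in \<open>s\<close>.\<close>
      have path: "\<psi> (v' - s *\<^sub>R e) < - (\<epsilon> * (norm (v' - s *\<^sub>R e))\<^sup>2)" if s: "0 \<le> s" "s \<le> s1" for s
      proof -
        have i: "\<bar>v' \<bullet> e\<bar> \<le> norm v'" using Cauchy_Schwarz_ineq2[of v' e] e1 by simp
        have b: "\<bar>B v' \<bullet> e\<bar> \<le> C * norm v'" "\<bar>B e \<bullet> v'\<bar> \<le> C * norm v'" "\<bar>B e \<bullet> e\<bar> \<le> C"
          using Bn[of v' e] Bn[of e v'] Bn[of e e] e1 by auto
        have "\<psi> (v' - s *\<^sub>R e) + \<epsilon> * (norm (v' - s *\<^sub>R e))\<^sup>2 = \<psi> v' + \<epsilon> * (norm v')\<^sup>2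
            - s * (norm g' + (B v' \<bullet> e + B e \<bullet> v') / 2 - s * (B e \<bullet> e) / 2 + \<epsilon> * (2 * (v' \<bullet> e) - s))"
        proof -
          have h1: "g' \<bullet> (v' - s *\<^sub>R e) = g' \<bullet> v' - s * norm g'" by (simp add: inner_diff_right g'e)
          have h2: "B (v' - s *\<^sub>R e) \<bullet> (v' - s *\<^sub>R e) = B v' \<bullet> v' - s * (B v' \<bullet> e + B e \<bullet> v') + s * s * (B e \<bullet> e)"
            by (simp add: blinfun.diff_right blinfun.scaleR_right inner_diff_left inner_diff_right algebra_simps)
          have ee: "e \<bullet> e = 1" using e1 by (simp add: norm_eq_1)
          have h3: "(norm (v' - s *\<^sub>R e))\<^sup>2 = (norm v')\<^sup>2 - 2 * s * (v' \<bullet> e) + s * s"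
            unfolding power2_norm_eq_inner by (simp add: inner_diff_left inner_diff_right inner_commute ee)
          show ?thesis unfolding \<psi>_def h1 h2 h3 by (simp add: algebra_simps add_divide_distrib diff_divide_distrib)
        qed
        moreover have "norm g' + (B v' \<bullet> e + B e \<bullet> v') / 2 - s * (B e \<bullet> e) / 2 + \<epsilon> * (2 * (v' \<bullet> e) - s) \<ge> 0"
        proof -
          define n where "n = norm v'"
          define Y where "Y = s * (B e \<bullet> e)"
          define Z where "Z = \<epsilon> * (2 * (v' \<bullet> e) - s)"
          have k4: "Y \<le> s * C" unfolding Y_def using b s by (intro mult_left_mono) auto
          have "\<epsilon> * (- 2 * n - s) \<le> Z" unfolding Z_def n_def using i eps by (intro mult_left_mono) auto
          then have k3: "- 2 * (\<epsilon> * n) - s * \<epsilon> \<le> Z" by (simp add: algebra_simps)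
          have "n * (4 * (C + 2*\<epsilon>)) \<le> r * (4 * (C + 2*\<epsilon>))" unfolding n_def using v' C eps by (intro mult_right_mono) auto
          then have "n * (4 * (C + 2*\<epsilon>)) \<le> c" using r(3) by linarith
          then have k1: "C * n + 2 * (\<epsilon> * n) \<le> c/4" by (simp add: algebra_simps)
          have "s * (16 * (2*C + 4*\<epsilon>)) \<le> s1 * (16 * (2*C + 4*\<epsilon>))" using s C eps by (intro mult_right_mono) auto
          then have "s * (16 * (2*C + 4*\<epsilon>)) \<le> c" using s1(3) by linarith
          then have k2: "32 * (s * C) + 64 * (s * \<epsilon>) \<le> c" by (simp add: algebra_simps)
          define sC where "sC = s * C"
          define s\<epsilon> where "s\<epsilon> = s * \<epsilon>"
          define Cn where "Cn = C * n"
          define en where "en = \<epsilon> * n"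
          have "- Cn \<le> B v' \<bullet> e" "- Cn \<le> B e \<bullet> v'" using b(1,2) unfolding Cn_def n_def abs_le_iff by linarith+
          then show ?thesis using ng'(1) k1 k2 k3 k4 c(1)
            unfolding Y_def[symmetric] Z_def[symmetric] sC_def[symmetric] s\<epsilon>_def[symmetric] Cn_def[symmetric] en_def[symmetric]
            by argo
        qed
        then have "s * (norm g' + (B v' \<bullet> e + B e \<bullet> v') / 2 - s * (B e \<bullet> e) / 2 + \<epsilon> * (2 * (v' \<bullet> e) - s)) \<ge> 0"
          by (rule mult_nonneg_nonneg[OF s(1)])
        ultimately show ?thesis using neg by linarith
      qed
      define z where "z = q' + v' - s1 *\<^sub>R e"
      have zD: "z \<in> D'"
      proof (rule deep)
        show "cball z \<eta> \<subseteq> D"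
        proof
          fix y assume y: "y \<in> cball z \<eta>"
          define u where "u = y - (q - s1 *\<^sub>R e)"
          have "u = (y - z) + (q' - q) + v'" by (simp add: u_def z_def)
          moreover have "norm ((y - z) + (q' - q) + v') \<le> norm (y - z) + norm (q' - q) + norm v'"
            using norm_triangle_ineq[of "(y - z) + (q' - q)" v'] norm_triangle_ineq[of "y - z" "q' - q"] by linarith
          ultimately have "norm u \<le> \<eta> + \<eta> + norm v'"
            using y qq by (simp add: dist_norm norm_minus_commute)
          moreover have "\<kappa> * s1 > 0" using \<kappa> s1 by simp
          ultimately have u: "norm u \<le> \<kappa> * s1" using \<eta>(5) v' r(4) by linarith
          define V where "V = u - s1 *\<^sub>R e"
          have "\<kappa> * s1 \<le> 1 * s1" using \<kappa> s1 by (intro mult_right_mono) auto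
          moreover have "norm (s1 *\<^sub>R e) = s1" using e1 s1 by simp
          ultimately have nV: "norm V \<le> 2 * s1" using u norm_triangle_ineq4[of u "s1 *\<^sub>R e"] unfolding V_def by linarith
          have "norm g * norm u \<le> C * (\<kappa> * s1)" using gB u C by (intro mult_mono) auto
          moreover have "C * (\<kappa> * s1) = c/16 * s1" using \<kappa>(3) by (metis mult.assoc)
          moreover have "s1 * (c/4) \<le> s1 * (g \<bullet> e)" using ge s1 by (intro mult_left_mono) auto
          moreover have "g \<bullet> V = g \<bullet> u - s1 * (g \<bullet> e)" by (simp add: V_def inner_diff_right)
          ultimately have gV: "g \<bullet> V \<le> - (3/16 * c * s1)"
            using norm_cauchy_schwarz[of g u] by (simp add: algebra_simps)
          have nV2: "(norm V)\<^sup>2 \<le> 4 * s1\<^sup>2" using power_mono[OF nV norm_ge_zero, of 2] by (simp add: power_mult_distrib)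
          have "\<bar>B V \<bullet> V\<bar> \<le> C * (norm V)\<^sup>2" using Bn[of V V] by (simp add: power2_eq_square)
          also have "\<dots> \<le> C * (4 * s1\<^sup>2)" using nV2 C by (intro mult_left_mono) auto
          finally have BV: "\<bar>B V \<bullet> V\<bar> \<le> C * (4 * s1\<^sup>2)" .
          have eV: "\<epsilon>/16 * (norm V)\<^sup>2 \<le> \<epsilon>/16 * (4 * s1\<^sup>2)" using nV2 eps by (intro mult_left_mono) auto
          have "s1 * (s1 * (16 * (2*C + 4*\<epsilon>))) \<le> s1 * c" using s1 by (intro mult_left_mono) auto
          then have "16 * (2 * C * s1\<^sup>2) + 64 * (\<epsilon> * s1\<^sup>2) \<le> s1 * c" by (simp add: power2_eq_square algebra_simps)
          moreover have "s1 * c > 0" "\<epsilon> * s1\<^sup>2 > 0" using s1 c eps by auto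
          ultimately have "g \<bullet> V + (B V \<bullet> V) / 2 < - (\<epsilon>/16 * (norm V)\<^sup>2)"
            using gV BV eV by (simp add: algebra_simps)
          moreover have "norm V < r0" using nV s1 r1 by linarith
          ultimately have "q + V \<in> D" using S unfolding spsc_at_def by blast
          then show "y \<in> D" by (simp add: V_def u_def)
        qed
      qed
      show ?thesis
      proof (rule ccontr)
        assume nD: "q' + v' \<notin> D'"
        let ?P = "(\<lambda>s. q' + (v' - s *\<^sub>R e)) ` {0..s1}"
        have "connected ?P" by (intro connected_continuous_image continuous_intros) auto
        moreover have "z \<in> ?P \<inter> D'" using zD s1 by (auto simp: z_def intro!: image_eqI[of _ _ s1])
        moreover have "q' + v' \<in> ?P - D'" using nD s1 by (auto intro!: image_eqI[of _ _ 0])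
        ultimately have "?P \<inter> frontier D' \<noteq> {}" using connected_Int_frontier by blast
        then obtain s where "s \<in> {0..s1}" and s3: "q' + (v' - s *\<^sub>R e) \<in> frontier D'" by blast
        then have s: "0 \<le> s" "s \<le> s1" by auto
        have "norm (v' - s *\<^sub>R e) \<le> norm v' + s" using norm_triangle_ineq4[of v' "s *\<^sub>R e"] e1 s by simp
        also have "\<dots> < r1" using v' r s s1 by linarith
        finally have "\<psi> (v' - s *\<^sub>R e) \<ge> - (\<epsilon> * (norm (v' - s *\<^sub>R e))\<^sup>2)" using NF s3 by blast
        then show False using path[OF s(1,2)] by linarith
      qed
    qed
    have "c/2 * (norm v)\<^sup>2 \<le> B v \<bullet> v + B (\<i> *s v) \<bullet> (\<i> *s v)" for v
    proof -
      have "c * (norm v)\<^sup>2 \<le> B v \<bullet> v + B (\<i> *s v) \<bullet> (\<i> *s v)" using S by (simp add: spsc_at_def)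
      moreover have "c/2 * (norm v)\<^sup>2 \<le> c * (norm v)\<^sup>2" using c by (intro mult_right_mono) auto
      ultimately show ?thesis by linarith
    qed
    moreover have "norm B \<le> 2 * C" using gB C by simp
    moreover have "norm v < r1" if "norm v < r" for v :: "complex^'n" using that r r1 by linarith
    ultimately show ?thesis
      unfolding spsc_at_def a_def[symmetric] g'_def[symmetric] using ng' N1 N2 unfolding \<psi>_def by blast
  qed
  show thesis by (rule that[OF r(1) \<eta>(1)]) (rule main, assumption+)
qed

text \<open>\<open>g\<close> and \<open>B\<close> are fixed before \<epsilon>: the scaling argument
  needs one form whose error becomes arbitrarily small on shrinking neighbourhoods. They are
  transported from \<open>t0\<close> by the linear part of the transition map.\<close>

lemma (in param_family) uniform_spsc:
  assumes t0: "t0 \<in> {0..1}" and sp: "bounded_strictly_pseudoconvex_C2 (Dfam t0)"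
  obtains c and g :: "real \<Rightarrow> complex^'n \<Rightarrow> complex^'n" and B C where "c > 0"
    "\<And>\<epsilon>. \<epsilon> > 0 \<Longrightarrow> \<exists>r>0. \<exists>\<delta>>0. \<forall>t\<in>{0..1}. \<bar>t - t0\<bar> < \<delta> \<longrightarrow> (\<forall>q\<in>frontier (Dfam t). spsc_at (Dfam t) q (g t q) (B t q) c C \<epsilon> r)"
proof -
  obtain g0 :: "complex^'n \<Rightarrow> complex^'n" and B0 c C where c: "c > 0"
    and S: "\<And>\<epsilon>. \<epsilon> > 0 \<Longrightarrow> \<exists>r>0. \<forall>q\<in>frontier (Dfam t0). spsc_at (Dfam t0) q (g0 q) (B0 q) c C \<epsilon> r"
    using strictly_pseudoconvex_spsc_at[OF sp] by metis
  have "Dfam t0 \<noteq> UNIV" using Dfam_bounded[OF t0] not_bounded_UNIV by metis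
  then have fne: "frontier (Dfam t0) \<noteq> {}" using Dfam_ne[OF t0] by (simp add: frontier_eq_empty)
  obtain L :: "real \<Rightarrow> complex^'n \<Rightarrow> ((complex^'n) \<Rightarrow>\<^sub>L (complex^'n))" where
    L: "\<And>\<epsilon>. \<epsilon> > 0 \<Longrightarrow> \<exists>\<delta>>0. \<forall>t\<in>{0..1}. \<bar>t - t0\<bar> < \<delta> \<longrightarrow> (\<forall>y\<in>closure D0. norm (L t y) \<le> \<epsilon> \<and> (\<forall>x\<in>closure D0.
       norm ((\<Gamma> t0 x - \<Gamma> t0 y) - (\<Gamma> t x - \<Gamma> t y) + L t y (\<Gamma> t x - \<Gamma> t y)) \<le> \<epsilon> * (norm (\<Gamma> t x - \<Gamma> t y))\<^sup>2))"
    using transition_expansion[OF t0] by blast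
  define Y where "Y t q = the_inv_into (closure D0) (\<Gamma> t) q" for t q
  define g where "g t q = g0 (\<Gamma> t0 (Y t q)) - adjoint (blinfun_apply (L t (Y t q))) (g0 (\<Gamma> t0 (Y t q)))" for t q
  define B where "B t q = B0 (\<Gamma> t0 (Y t q))" for t q
  have cC: "c \<le> C"
  proof -
    obtain r q where "q \<in> frontier (Dfam t0)" "spsc_at (Dfam t0) q (g0 q) (B0 q) c C 1 r"
      using S[of 1] fne by (metis all_not_in_conv zero_less_one)
    then show ?thesis by (auto simp: spsc_at_def)
  qed
  show thesis
  proof (rule that[of "c/2" g B "2 * C"])
    show "c/2 > 0" using c by simp
    fix \<epsilon> :: real assume eps: "\<epsilon> > 0"
    obtain r0 where r0: "r0 > 0" and S0: "\<And>q. q \<in> frontier (Dfam t0) \<Longrightarrow> spsc_at (Dfam t0) q (g0 q) (B0 q) c C (\<epsilon>/16) r0"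
      using S[of "\<epsilon>/16"] eps by auto
    obtain r \<eta> where r: "r > 0" "\<eta> > 0" and TR:
      "\<And>(D::(complex^'n) set) D' q q' g B L X. \<lbrakk>spsc_at D q g B c C (\<epsilon>/16) r0; norm L \<le> \<eta>; norm (q' - q) \<le> \<eta>;
       \<And>w w'. (w, w') \<in> X \<Longrightarrow> norm ((w - q) - (w' - q') + blinfun_apply L (w' - q')) \<le> \<eta> * (norm (w' - q'))\<^sup>2;
       \<And>w'. w' \<in> D' \<Longrightarrow> \<exists>w\<in>D. (w, w') \<in> X; \<And>w'. w' \<in> frontier D' \<Longrightarrow> \<exists>w. w \<notin> D \<and> (w, w') \<in> X;
       \<And>z. cball z \<eta> \<subseteq> D \<Longrightarrow> z \<in> D'\<rbrakk> \<Longrightarrow> spsc_at D' q' (g - adjoint (blinfun_apply L) g) B (c/2) (2*C) \<epsilon> r"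
      using spsc_at_transfer[OF c cC eps r0, where 'n='n] by metis
    obtain \<delta>1 where \<delta>1: "\<delta>1 > 0" and L1: "\<And>t y. t \<in> {0..1} \<Longrightarrow> \<bar>t - t0\<bar> < \<delta>1 \<Longrightarrow> y \<in> closure D0 \<Longrightarrow> norm (L t y) \<le> \<eta> \<and> (\<forall>x\<in>closure D0.
       norm ((\<Gamma> t0 x - \<Gamma> t0 y) - (\<Gamma> t x - \<Gamma> t y) + L t y (\<Gamma> t x - \<Gamma> t y)) \<le> \<eta> * (norm (\<Gamma> t x - \<Gamma> t y))\<^sup>2)"
      using L[OF r(2)] by blast
    obtain \<delta>2 where \<delta>2: "\<delta>2 > 0" and near: "\<And>t x. t \<in> {0..1} \<Longrightarrow> \<bar>t - t0\<bar> < \<delta>2 \<Longrightarrow> x \<in> closure D0 \<Longrightarrow> norm (\<Gamma> t x - \<Gamma> t0 x) \<le> \<eta>"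
      using near_t[OF t0 r(2)] by blast
    have "spsc_at (Dfam t) q' (g t q') (B t q') (c/2) (2*C) \<epsilon> r"
      if t: "t \<in> {0..1}" "\<bar>t - t0\<bar> < min \<delta>1 \<delta>2" and q': "q' \<in> frontier (Dfam t)" for t q'
    proof -
      have td: "\<bar>t - t0\<bar> < \<delta>1" "\<bar>t - t0\<bar> < \<delta>2" using t by auto
      obtain y where y: "y \<in> frontier D0" "q' = \<Gamma> t y" using q' Gamma_image_frontier[OF t(1)] by auto
      have yc: "y \<in> closure D0" using y(1) by (simp add: frontier_def)
      have Yy: "Y t q' = y" unfolding Y_def y(2) using the_inv_into_f_f[OF inj[OF t(1)] yc] .
      have qf: "\<Gamma> t0 y \<in> frontier (Dfam t0)" using y(1) Gamma_image_frontier[OF t0] by auto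
      \<comment> \<open>Graph of the correspondence between the two closures given by a common
        parameter.\<close>
      let ?X = "(\<lambda>x. (\<Gamma> t0 x, \<Gamma> t x)) ` closure D0"
      have "spsc_at (Dfam t) q' (g0 (\<Gamma> t0 y) - adjoint (blinfun_apply (L t y)) (g0 (\<Gamma> t0 y))) (B0 (\<Gamma> t0 y)) (c/2) (2*C) \<epsilon> r"
      proof (rule TR[OF S0[OF qf], where X="?X"])
        show "norm (L t y) \<le> \<eta>" using L1[OF t(1) td(1) yc] by blast
        show "norm (q' - \<Gamma> t0 y) \<le> \<eta>" using near[OF t(1) td(2) yc] y(2) by simp
        show "norm ((w - \<Gamma> t0 y) - (w' - q') + blinfun_apply (L t y) (w' - q')) \<le> \<eta> * (norm (w' - q'))\<^sup>2"
          if "(w, w') \<in> ?X" for w w' using L1[OF t(1) td(1) yc] that y(2) by auto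
        show "\<exists>w\<in>Dfam t0. (w, w') \<in> ?X" if w': "w' \<in> Dfam t" for w'
        proof -
          obtain x where x: "x \<in> D0" "w' = \<Gamma> t x" using w' Gamma_image_D0[OF t(1)] by auto
          have "\<Gamma> t0 x \<in> Dfam t0" using x(1) Gamma_image_D0[OF t0] by auto
          moreover have "x \<in> closure D0" using x(1) closure_subset[of D0] by auto
          ultimately show ?thesis using x(2) by blast
        qed
        show "\<exists>w. w \<notin> Dfam t0 \<and> (w, w') \<in> ?X" if w': "w' \<in> frontier (Dfam t)" for w'
        proof -
          obtain x where x: "x \<in> frontier D0" "w' = \<Gamma> t x" using w' Gamma_image_frontier[OF t(1)] by auto
          have "\<Gamma> t0 x \<in> frontier (Dfam t0)" using x(1) Gamma_image_frontier[OF t0] by auto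
          then have "\<Gamma> t0 x \<notin> Dfam t0" using Dfam_open[OF t0] by (simp add: frontier_def interior_open)
          moreover have "x \<in> closure D0" using x(1) by (simp add: frontier_def)
          ultimately show ?thesis using x(2) by blast
        qed
        show "z \<in> Dfam t" if "cball z \<eta> \<subseteq> Dfam t0" for z
          using cball_subset_Dfam[OF t(1) t0 near[OF t(1) td(2)] r(2) that] .
      qed
      then show ?thesis by (simp add: g_def B_def Yy)
    qed
    then show "\<exists>r>0. \<exists>\<delta>>0. \<forall>t\<in>{0..1}. \<bar>t - t0\<bar> < \<delta> \<longrightarrow> (\<forall>q\<in>frontier (Dfam t). spsc_at (Dfam t) q (g t q) (B t q) (c/2) (2*C) \<epsilon> r)"
      using r(1) \<delta>1 \<delta>2 by (intro exI[of _ r] conjI exI[of _ "min \<delta>1 \<delta>2"]) auto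
  qed
qed

section \<open>Anisotropic scaling\<close>

text \<open>For a unit vector \<open>x\<close> this is the orthogonal projection onto its complex
  line; \<open>x = sgn g\<close> gives the complex normal direction.\<close>

definition par :: "complex^'n \<Rightarrow> complex^'n \<Rightarrow> complex^'n" where
  "par x v = cip v x *s x"

lemma cip_commute: "cip w v = cnj (cip v w)"
  by (simp add: cip_def mult.commute)

lemma bounded_linear_par: "bounded_linear (par x)"
  unfolding par_def using bounded_linear_compose[OF bounded_linear_vector_smult_left bounded_linear_cip] .

lemma par_smult: "par x (a *s v) = a *s par x v"
  by (simp add: par_def cip_smult_left)

lemma par_scaleR: "par x (a *\<^sub>R v) = a *\<^sub>R par x v"
  using bounded_linear.linear[OF bounded_linear_par] by (rule linear_scale)

lemma par_add: "par x (u + v) = par x u + par x v"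
  using bounded_linear.linear[OF bounded_linear_par] by (rule linear_add)

lemma par_diff: "par x (u - v) = par x u - par x v"
  using bounded_linear.linear[OF bounded_linear_par] by (rule linear_diff)

lemma cip_unit: "norm x = 1 \<Longrightarrow> cip x x = 1"
  by (simp add: cip_self)

lemma par_par: "norm x = 1 \<Longrightarrow> par x (par x v) = par x v"
  by (simp add: par_def cip_smult_left cip_unit)

lemma par_self: "norm x = 1 \<Longrightarrow> par x x = x"
  by (simp add: par_def cip_unit)

lemma inner_par:
  assumes "norm x = 1" shows "x \<bullet> par x v = x \<bullet> v"
proof -
  have "par x v \<bullet> x = Re (cip (par x v) x)" by (simp add: Re_cip)
  also have "\<dots> = v \<bullet> x" using assms by (simp add: par_def cip_smult_left cip_unit Re_cip)
  finally show ?thesis by (simp add: inner_commute)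
qed

lemma inner_par_sym: "par x v \<bullet> w = v \<bullet> par x w"
proof -
  have eq: "par x v \<bullet> w = Re (cip v x * cnj (cip w x))" for v w
    unfolding par_def Re_cip[symmetric] cip_smult_left by (subst cip_commute[of x w]) simp
  have "v \<bullet> par x w = par x w \<bullet> v" by (rule inner_commute)
  then show ?thesis unfolding eq by simp
qed

lemma tendsto_par:
  assumes "(f \<longlongrightarrow> x) net" "(h \<longlongrightarrow> v) net"
  shows "((\<lambda>p. par (f p) (h p)) \<longlongrightarrow> par x v) net"
proof (rule vec_tendstoI)
  fix i
  show "((\<lambda>p. par (f p) (h p) $ i) \<longlongrightarrow> par x v $ i) net"
    unfolding par_def cip_def vector_smult_component
    by (intro tendsto_mult tendsto_sum tendsto_cnj tendsto_vec_nth assms)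
qed

text \<open>For a unit vector \<open>x\<close> the factor is 1/\<delta> on its complex line and
  1/sqrt \<delta> on the complement. A form with linear normal and quadratic tangential part stays
  balanced under exactly these rates.\<close>

definition dilate :: "real \<Rightarrow> complex^'n \<Rightarrow> complex^'n \<Rightarrow> complex^'n" where
  "dilate \<delta> x v = (1 / sqrt \<delta>) *\<^sub>R v + (1/\<delta> - 1 / sqrt \<delta>) *\<^sub>R par x v"

text \<open>Written with one factor \<open>sqrt \<delta>\<close> outside because the remaining
  vector tends to the tangential part of \<open>v\<close> as \<delta> tends to 0.\<close>

definition contract :: "real \<Rightarrow> complex^'n \<Rightarrow> complex^'n \<Rightarrow> complex^'n" where
  "contract \<delta> x v = sqrt \<delta> *\<^sub>R (v - par x v + sqrt \<delta> *\<^sub>R par x v)"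

lemma par_contract: "norm x = 1 \<Longrightarrow> \<delta> > 0 \<Longrightarrow> par x (contract \<delta> x v) = \<delta> *\<^sub>R par x v"
  by (simp add: contract_def par_scaleR par_add par_diff par_par)

lemma par_dilate: "norm x = 1 \<Longrightarrow> \<delta> > 0 \<Longrightarrow> par x (dilate \<delta> x v) = (1/\<delta>) *\<^sub>R par x v"
  unfolding dilate_def par_add par_scaleR par_par scaleR_add_left[symmetric] by simp

lemma dilate_contract:
  assumes "norm x = 1" "\<delta> > 0"
  shows "dilate \<delta> x (contract \<delta> x v) = v"
proof -
  have "dilate \<delta> x (contract \<delta> x v) = (1 / sqrt \<delta>) *\<^sub>R contract \<delta> x v + ((1/\<delta> - 1 / sqrt \<delta>) * \<delta>) *\<^sub>R par x v"
    unfolding dilate_def par_contract[OF assms] by simp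
  also have "(1 / sqrt \<delta>) *\<^sub>R contract \<delta> x v = v - par x v + sqrt \<delta> *\<^sub>R par x v"
    using assms by (simp add: contract_def)
  also have "(1/\<delta> - 1 / sqrt \<delta>) * \<delta> = 1 - sqrt \<delta>"
    using assms(2) by (simp add: left_diff_distrib real_div_sqrt)
  finally show ?thesis by (simp add: scaleR_diff_left)
qed

lemma contract_dilate:
  assumes "norm x = 1" "\<delta> > 0"
  shows "contract \<delta> x (dilate \<delta> x v) = v"
proof -
  have "contract \<delta> x (dilate \<delta> x v) = sqrt \<delta> *\<^sub>R dilate \<delta> x v + (sqrt \<delta> * (sqrt \<delta> - 1) / \<delta>) *\<^sub>R par x v"
    unfolding contract_def par_dilate[OF assms]
    by (simp add: scaleR_add_right scaleR_diff_right scaleR_diff_left algebra_simps diff_divide_distrib)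
  also have "sqrt \<delta> *\<^sub>R dilate \<delta> x v = v + (sqrt \<delta> / \<delta> - 1) *\<^sub>R par x v"
    using assms(2) by (simp add: dilate_def scaleR_add_right right_diff_distrib)
  also have "sqrt \<delta> * (sqrt \<delta> - 1) / \<delta> = 1 - sqrt \<delta> / \<delta>"
    using assms(2) by (simp add: right_diff_distrib diff_divide_distrib)
  finally show ?thesis by (simp add: scaleR_diff_left algebra_simps)
qed

lemma contract_smult: "contract \<delta> x (a *s v) = a *s contract \<delta> x v"
  by (simp add: contract_def par_smult vec_eq_iff scaleR_conv_of_real algebra_simps)

lemma dilate_smult: "dilate \<delta> x (a *s v) = a *s dilate \<delta> x v"
  by (simp add: dilate_def par_smult vec_eq_iff scaleR_conv_of_real algebra_simps)

lemma bounded_linear_contract: "bounded_linear (contract \<delta> x)"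
  unfolding contract_def
  by (intro bounded_linear_scaleR_right[THEN bounded_linear_compose] bounded_linear_add bounded_linear_sub bounded_linear_par bounded_linear_ident)

lemma bounded_linear_dilate: "bounded_linear (dilate \<delta> x)"
  unfolding dilate_def
  by (intro bounded_linear_scaleR_right[THEN bounded_linear_compose] bounded_linear_add bounded_linear_par bounded_linear_ident)

text \<open>Defining function of the limit of the rescaled domains: the quadratic term keeps only
  tangential components, since normal ones are of higher order after scaling.\<close>

definition siegel :: "complex^'n \<Rightarrow> ((complex^'n) \<Rightarrow>\<^sub>L (complex^'n)) \<Rightarrow> complex^'n \<Rightarrow> real" where
  "siegel g B v = g \<bullet> v + (B (v - par (sgn g) v) \<bullet> (v - par (sgn g) v)) / 2"

lemma tendsto_siegel_form:
  assumes "(g \<longlongrightarrow> g0) net" "g0 \<noteq> 0" "(B \<longlongrightarrow> B0) net" "(u \<longlongrightarrow> u0) net" "(\<delta> \<longlongrightarrow> (0::real)) net"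
  shows "((\<lambda>p. u p - par (sgn (g p)) (u p) + sqrt (\<delta> p) *\<^sub>R par (sgn (g p)) (u p)) \<longlongrightarrow> u0 - par (sgn g0) u0) net"
    and "((\<lambda>p. g p \<bullet> u p + (blinfun_apply (B p) (u p - par (sgn (g p)) (u p) + sqrt (\<delta> p) *\<^sub>R par (sgn (g p)) (u p))
        \<bullet> (u p - par (sgn (g p)) (u p) + sqrt (\<delta> p) *\<^sub>R par (sgn (g p)) (u p))) / 2
        - \<epsilon> * (norm (u p - par (sgn (g p)) (u p) + sqrt (\<delta> p) *\<^sub>R par (sgn (g p)) (u p)))\<^sup>2)
        \<longlongrightarrow> siegel g0 B0 u0 - \<epsilon> * (norm (u0 - par (sgn g0) u0))\<^sup>2) net"
proof -
  have s: "((\<lambda>p. sgn (g p)) \<longlongrightarrow> sgn g0) net" using tendsto_sgn[OF assms(1,2)] .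
  have "((\<lambda>p. u p - par (sgn (g p)) (u p) + sqrt (\<delta> p) *\<^sub>R par (sgn (g p)) (u p)) \<longlongrightarrow> u0 - par (sgn g0) u0 + sqrt 0 *\<^sub>R par (sgn g0) u0) net"
    by (intro tendsto_intros tendsto_par s assms)
  then show 1: "((\<lambda>p. u p - par (sgn (g p)) (u p) + sqrt (\<delta> p) *\<^sub>R par (sgn (g p)) (u p)) \<longlongrightarrow> u0 - par (sgn g0) u0) net" by simp
  show "((\<lambda>p. g p \<bullet> u p + (blinfun_apply (B p) (u p - par (sgn (g p)) (u p) + sqrt (\<delta> p) *\<^sub>R par (sgn (g p)) (u p))
        \<bullet> (u p - par (sgn (g p)) (u p) + sqrt (\<delta> p) *\<^sub>R par (sgn (g p)) (u p))) / 2
        - \<epsilon> * (norm (u p - par (sgn (g p)) (u p) + sqrt (\<delta> p) *\<^sub>R par (sgn (g p)) (u p)))\<^sup>2)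
        \<longlongrightarrow> siegel g0 B0 u0 - \<epsilon> * (norm (u0 - par (sgn g0) u0))\<^sup>2) net"
    unfolding siegel_def by (intro tendsto_intros blinfun.tendsto assms 1) auto
qed

text \<open>The form and the squared norm each acquire exactly one factor \<delta>, so the
  inequalities of \<open>spsc_at\<close> can be divided by it before the limit is taken.\<close>

lemma form_contract:
  assumes "norm (sgn g) = 1" "\<delta> > 0" and n_def: "n = v - par (sgn g) v + sqrt \<delta> *\<^sub>R par (sgn g) v"
  shows "g \<bullet> contract \<delta> (sgn g) v + (blinfun_apply B (contract \<delta> (sgn g) v) \<bullet> contract \<delta> (sgn g) v) / 2
      = \<delta> * (g \<bullet> v + (blinfun_apply B n \<bullet> n) / 2)"
    and "(norm (contract \<delta> (sgn g) v))\<^sup>2 = \<delta> * (norm n)\<^sup>2"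
proof -
  have g: "g = norm g *\<^sub>R sgn g" using assms(1) by (cases "g = 0") (auto simp: sgn_div_norm)
  have gp: "g \<bullet> par (sgn g) v = g \<bullet> v"
    using inner_par[OF assms(1), of v] by (subst (1 3) g) simp
  have cn: "contract \<delta> (sgn g) v = sqrt \<delta> *\<^sub>R n" by (simp add: contract_def n_def)
  have "g \<bullet> n = sqrt \<delta> * (g \<bullet> v)" by (simp add: n_def inner_add_right inner_diff_right gp)
  then have "g \<bullet> contract \<delta> (sgn g) v = \<delta> * (g \<bullet> v)" using assms(2) by (simp add: cn)
  moreover have "blinfun_apply B (contract \<delta> (sgn g) v) \<bullet> contract \<delta> (sgn g) v = \<delta> * (blinfun_apply B n \<bullet> n)"
    using assms(2) by (simp add: cn blinfun.scaleR_right)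
  ultimately show "g \<bullet> contract \<delta> (sgn g) v + (blinfun_apply B (contract \<delta> (sgn g) v) \<bullet> contract \<delta> (sgn g) v) / 2
      = \<delta> * (g \<bullet> v + (blinfun_apply B n \<bullet> n) / 2)" by (simp add: algebra_simps)
  show "(norm (contract \<delta> (sgn g) v))\<^sup>2 = \<delta> * (norm n)\<^sup>2"
    using assms(2) by (simp add: cn power_mult_distrib)
qed

section \<open>Topology and peak functions of the Siegel domain\<close>

lemma siegel_open: "open {v. siegel g B v < 0}"
proof -
  have "continuous_on UNIV (siegel g B)"
    unfolding siegel_def
    by (intro continuous_intros linear_continuous_on[OF bounded_linear_par] blinfun.continuous_on) auto
  then show ?thesis by (intro open_Collect_less continuous_intros)
qed

text \<open>A shear along \<open>sgn g\<close> by the quadratic term carries a half-space onto the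
  domain; the shear does not change tangential parts and is therefore invertible.\<close>

lemma siegel_connected:
  assumes "g \<noteq> 0"
  shows "connected {v. siegel g B v < 0}"
proof -
  let ?e = "sgn g"
  have e1: "norm ?e = 1" using assms by (simp add: norm_sgn)
  have ge: "g \<bullet> ?e = norm g" using assms by (simp add: sgn_div_norm power2_norm_eq_inner[symmetric] power2_eq_square)
  define t where "t u = (B (u - par ?e u) \<bullet> (u - par ?e u)) / (2 * norm g)" for u
  define h where "h u = u - t u *\<^sub>R ?e" for u
  have perp: "(u + a *\<^sub>R ?e) - par ?e (u + a *\<^sub>R ?e) = u - par ?e u" for u a
    by (simp add: par_add par_scaleR par_self[OF e1])
  have tp: "t (u + a *\<^sub>R ?e) = t u" for u a unfolding t_def perp ..
  have sh: "siegel g B (h u) = g \<bullet> u" for u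
  proof -
    have hu: "h u = u + (- t u) *\<^sub>R ?e" by (simp add: h_def)
    have "h u - par ?e (h u) = u - par ?e u" unfolding hu by (rule perp)
    moreover have "g \<bullet> h u = g \<bullet> u - t u * norm g" unfolding hu inner_add_right inner_scaleR_right ge by simp
    ultimately have "siegel g B (h u) = g \<bullet> u - t u * norm g + (B (u - par ?e u) \<bullet> (u - par ?e u)) / 2"
      unfolding siegel_def by simp
    then show ?thesis using assms by (simp add: t_def)
  qed
  have "continuous_on UNIV h"
    unfolding h_def t_def
    by (intro continuous_intros linear_continuous_on[OF bounded_linear_par] blinfun.continuous_on) (use assms in auto)
  then have "connected (h ` {u. g \<bullet> u < 0})"
    by (intro connected_continuous_image convex_connected convex_halfspace_lt) (rule continuous_on_subset, auto)
  moreover have "h ` {u. g \<bullet> u < 0} = {v. siegel g B v < 0}"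
  proof
    show "h ` {u. g \<bullet> u < 0} \<subseteq> {v. siegel g B v < 0}" using sh by auto
    show "{v. siegel g B v < 0} \<subseteq> h ` {u. g \<bullet> u < 0}"
    proof
      fix v assume v: "v \<in> {v. siegel g B v < 0}"
      define u where "u = v + t v *\<^sub>R ?e"
      have "h u = v" by (simp add: h_def u_def tp)
      moreover then have "g \<bullet> u < 0" using v sh[of u] by simp
      ultimately show "v \<in> h ` {u. g \<bullet> u < 0}" by (metis (mono_tags) image_eqI mem_Collect_eq)
    qed
  qed
  ultimately show ?thesis by simp
qed

text \<open>The function is quadratic, so its second-order expansion at \<open>p\<close> is exact.
  The Levi polynomial of that expansion lies below it by a quarter of the Levi sum, nonnegative by
  \<open>pos\<close> at the tangential projection.\<close>

lemma siegel_peak: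
  assumes pos: "\<And>v. 0 \<le> blinfun_apply B v \<bullet> v + B (\<i> *s v) \<bullet> (\<i> *s v)" and p: "siegel g B p = 0"
  shows "\<exists>P. cholo P UNIV \<and> Re (P p) = 0 \<and> (\<forall>v. Re (P v) \<le> siegel g B v)"
proof -
  define N where "N v = v - par (sgn g) v" for v
  have bN: "bounded_linear N" unfolding N_def by (intro bounded_linear_sub bounded_linear_par bounded_linear_ident)
  have N_add: "N (u + v) = N u + N v" for u v using bounded_linear.linear[OF bN] by (rule linear_add)
  have N_i: "N (\<i> *s v) = \<i> *s N v" for v by (simp add: N_def par_smult vec_eq_iff algebra_simps)
  have N_sym: "N v \<bullet> w = v \<bullet> N w" for v w by (simp add: N_def inner_diff_left inner_diff_right inner_par_sym)
  define Q where "Q = Blinfun (\<lambda>h. N (B (N h)))"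
  have Q: "Q h = N (B (N h))" for h
  proof -
    have "bounded_linear (\<lambda>h. N (B (N h)))"
      by (rule bounded_linear_compose[OF bN bounded_linear_compose[OF blinfun.bounded_linear_right bN]])
    then show ?thesis by (simp add: Q_def bounded_linear_Blinfun_apply)
  qed
  define l where "l = Blinfun (\<lambda>h. g \<bullet> h + (B (N h) \<bullet> N p + B (N p) \<bullet> N h) / 2)"
  have l: "l h = g \<bullet> h + (B (N h) \<bullet> N p + B (N p) \<bullet> N h) / 2" for h
  proof -
    have "bounded_linear (\<lambda>h. B (N h))" by (rule bounded_linear_compose[OF blinfun.bounded_linear_right bN])
    then have "bounded_linear (\<lambda>h. g \<bullet> h + (B (N h) \<bullet> N p + B (N p) \<bullet> N h) / 2)"
      by (intro bounded_linear_add bounded_linear_divide[THEN bounded_linear_compose] bounded_linear_inner_right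
          bounded_linear_inner_left[THEN bounded_linear_compose] bounded_linear_inner_right[THEN bounded_linear_compose] bN)
    then show ?thesis by (simp add: l_def bounded_linear_Blinfun_apply)
  qed
  have eq: "siegel g B (p + h) = siegel g B p + l h + (Q h \<bullet> h) / 2" for h
    unfolding siegel_def N_def[symmetric] l Q N_add
    by (simp add: blinfun.add_right inner_add_left inner_add_right N_sym add_divide_distrib)
  define P where "P v = levi_poly (rvec l) Q (v - p)" for v
  have "Re (P v) \<le> siegel g B v" for v
  proof -
    let ?h = "v - p"
    have "0 \<le> Q ?h \<bullet> ?h + Q (\<i> *s ?h) \<bullet> (\<i> *s ?h)"
      unfolding Q N_sym N_i using pos[of "N ?h"] by simp
    then show ?thesis unfolding P_def Re_levi_poly rvec_inner using eq[of ?h] p by simp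
  qed
  moreover have "Re (P p) = 0" unfolding P_def Re_levi_poly rvec_inner by (simp add: blinfun.zero_right vec_eq_iff[of "_ *s _"])
  moreover have "cholo P UNIV" unfolding P_def by (rule cholo_levi_poly)
  ultimately show ?thesis by blast
qed

lemma par_minus: "par x (- v) = - par x v"
  by (simp add: par_def cip_minus_left vec_eq_iff)

text \<open>The points \<open>w j\<close> converge inside \<Omega>, while \<open>G j\<close> sends
  them to points at distance \<open>\<delta> j\<close> from \<open>q j\<close> on the inner normal,
  with \<open>\<delta> j\<close> tending to 0. \<open>inner\<close> and \<open>outer\<close> express
  convergence of \<open>D' j\<close> to \<Omega>; the latter is stated for subsequences, since
  Montel's theorem selects one later.\<close>

locale scaling =
  fixes D D' :: "nat \<Rightarrow> (complex^'n) set" and \<Omega> :: "(complex^'n) set" and F G :: "nat \<Rightarrow> complex^'n \<Rightarrow> complex^'n"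
    and q w gv :: "nat \<Rightarrow> complex^'n" and Bv :: "nat \<Rightarrow> ((complex^'n) \<Rightarrow>\<^sub>L (complex^'n))"
    and w0 g :: "complex^'n" and B :: "(complex^'n) \<Rightarrow>\<^sub>L (complex^'n)"
    and \<delta> :: "nat \<Rightarrow> real" and c C r1 R R' c' C' r' :: real
  assumes cpos: "c > 0" "r1 > 0" "c' > 0" "r' > 0"
    and D: "\<And>j. open (D j)" "\<And>j. D j \<subseteq> ball 0 R"
    and D': "\<And>j. D' j \<subseteq> ball 0 R'"
    and \<Omega>: "open \<Omega>" "connected \<Omega>"
    and \<Omega>_spsc: "\<And>p. p \<in> frontier \<Omega> \<Longrightarrow> \<exists>g B. spsc_at \<Omega> p g B c' C' (c'/8) r'"
    and inner: "\<And>x. x \<in> \<Omega> \<Longrightarrow> \<exists>s>0. \<forall>\<^sub>F j in sequentially. ball x s \<subseteq> D' j"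
    and outer: "\<And>u x \<sigma>. strict_mono \<sigma> \<Longrightarrow> \<forall>\<^sub>F j in sequentially. u j \<in> D' (\<sigma> j) \<Longrightarrow> u \<longlonglongrightarrow> x \<Longrightarrow> x \<in> closure \<Omega>"
    and F: "\<And>j. holomorphic_map_on (F j) (D j)" "\<And>j. F j ` D j \<subseteq> D' j"
    and G: "\<And>j. holomorphic_map_on (G j) (D' j)" "\<And>j. G j ` D' j \<subseteq> D j"
    and inv: "\<And>j z. z \<in> D j \<Longrightarrow> G j (F j z) = z" "\<And>j x. x \<in> D' j \<Longrightarrow> F j (G j x) = x"
    and q: "\<And>j. q j \<in> frontier (D j)"
    and at: "\<And>j. spsc_at (D j) (q j) (gv j) (Bv j) c C (c/8) r1"
    and at_eps: "\<And>\<epsilon>. \<epsilon> > 0 \<Longrightarrow> \<exists>r>0. \<forall>\<^sub>F j in sequentially. spsc_at (D j) (q j) (gv j) (Bv j) c C \<epsilon> r"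
    and lim: "gv \<longlonglongrightarrow> g" "Bv \<longlonglongrightarrow> B" "w \<longlonglongrightarrow> w0" "\<delta> \<longlonglongrightarrow> 0"
    and \<delta>: "\<And>j. \<delta> j > 0" and wD: "\<And>j. w j \<in> D' j" and w0: "w0 \<in> \<Omega>"
    and Gw: "\<And>j. G j (w j) = q j - \<delta> j *\<^sub>R sgn (gv j)"
begin

text \<open>\<open>f j\<close> is \<open>G j\<close> read in rescaled coordinates at
  \<open>q j\<close>; \<open>k j\<close> is its inverse, read through \<open>F j\<close>.\<close>

definition f where "f j x = dilate (\<delta> j) (sgn (gv j)) (G j x - q j)"
definition k where "k j v = F j (q j + contract (\<delta> j) (sgn (gv j)) v)"

lemma R_pos: "R > 0"
  using D(2)[of 0] G(2)[of 0] wD[of 0] by (metis ball_empty empty_iff image_subset_iff in_mono not_le)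

lemma gv_bounds: "c \<le> norm (gv j)" "norm (gv j) \<le> C" "norm (Bv j) \<le> C"
  using at[of j] by (auto simp: spsc_at_def)

lemma gv_ne: "gv j \<noteq> 0" using gv_bounds(1)[of j] cpos by auto

lemma sgn_gv: "norm (sgn (gv j)) = 1" using gv_ne by (simp add: norm_sgn)

lemma C_pos: "C > 0" using gv_bounds[of 0] cpos by linarith

lemma g_bounds: "c \<le> norm g"
  by (rule LIMSEQ_le_const[OF tendsto_norm[OF lim(1)]]) (use gv_bounds in auto)

lemma g_ne: "g \<noteq> 0" using g_bounds cpos by auto

lemma sgn_g: "norm (sgn g) = 1" using g_ne by (simp add: norm_sgn)

lemma q_notin: "q j \<notin> D j" using q[of j] D(1)[of j] by (simp add: frontier_def interior_open)

lemma B_pos: "0 \<le> blinfun_apply B v \<bullet> v + B (\<i> *s v) \<bullet> (\<i> *s v)"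
proof (rule LIMSEQ_le_const)
  show "(\<lambda>j. Bv j v \<bullet> v + Bv j (\<i> *s v) \<bullet> (\<i> *s v)) \<longlonglongrightarrow> B v \<bullet> v + B (\<i> *s v) \<bullet> (\<i> *s v)"
    by (intro tendsto_intros blinfun.tendsto lim)
  have "0 \<le> Bv j v \<bullet> v + Bv j (\<i> *s v) \<bullet> (\<i> *s v)" for j
  proof -
    have "c * (norm v)\<^sup>2 \<le> Bv j v \<bullet> v + Bv j (\<i> *s v) \<bullet> (\<i> *s v)" using at[of j] unfolding spsc_at_def by blast
    moreover have "c * (norm v)\<^sup>2 \<ge> 0" using cpos by simp
    ultimately show ?thesis by linarith
  qed
  then show "\<exists>N. \<forall>j\<ge>N. 0 \<le> Bv j v \<bullet> v + Bv j (\<i> *s v) \<bullet> (\<i> *s v)" by blast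
qed

text \<open>Harnack's inequality carries a bound of order \<open>\<delta> j\<close> from the centre
  to a ball whose radius depends neither on \<open>j\<close> nor on \<open>M\<close>. The support
  inequality turns it into the square root rate for the distance to \<open>q j\<close>.\<close>

lemma propagate:
  assumes s0: "s0 > 0" and b: "\<forall>\<^sub>F j in sequentially. ball (y j) s0 \<subseteq> D' j" and z: "(\<lambda>j. G j (y j) - q j) \<longlonglongrightarrow> 0"
    and M: "\<forall>\<^sub>F j in sequentially. cmod (levi_poly (gv j) (Bv j) (G j (y j) - q j)) \<le> M * \<delta> j"
  shows "\<forall>\<^sub>F j in sequentially. \<forall>x. dist (y j) x \<le> min (s0/2) (s0 * r1 / (8 * R)) / 2 \<longrightarrow>
     cmod (levi_poly (gv j) (Bv j) (G j x - q j)) \<le> 3 * M * \<delta> j \<and> (norm (G j x - q j))\<^sup>2 \<le> (24 * M / c) * \<delta> j"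
proof -
  have "\<forall>\<^sub>F j in sequentially. norm (G j (y j) - q j) < r1/2"
    using order_tendstoD(2)[OF tendsto_norm[OF z], of "r1/2"] cpos by simp
  with b M show ?thesis
  proof eventually_elim
    case (elim j)
    show ?case
    proof (intro allI impI)
      fix x assume x: "dist (y j) x \<le> min (s0/2) (s0 * r1 / (8 * R)) / 2"
      have h: "holomorphic_map_on (G j) (ball (y j) s0)" using holomorphic_map_on_subset[OF G(1) elim(1)] .
      have im: "G j ` ball (y j) s0 \<subseteq> D j" using G(2)[of j] elim(1) by blast
      note H = spsc_at_Harnack[OF at cpos(1,2) D(2,1) q_notin h s0 im elim(3) x]
      have 1: "cmod (levi_poly (gv j) (Bv j) (G j x - q j)) \<le> 3 * M * \<delta> j" using H(1) elim(2) by simp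
      have "(c/8) * (norm (G j x - q j))\<^sup>2 \<le> 3 * (M * \<delta> j)" using H(2) elim(2) by linarith
      then have "(norm (G j x - q j))\<^sup>2 \<le> (24 * M / c) * \<delta> j" using cpos by (simp add: field_simps)
      with 1 show "cmod (levi_poly (gv j) (Bv j) (G j x - q j)) \<le> 3 * M * \<delta> j \<and> (norm (G j x - q j))\<^sup>2 \<le> (24 * M / c) * \<delta> j" by blast
    qed
  qed
qed

text \<open>The Levi polynomial measures the normal size of \<open>G j y - q j\<close> and the
  squared norm the tangential size; order \<open>\<delta> j\<close> for both is what bounds
  \<open>f j\<close>.\<close>

definition good where "good x \<longleftrightarrow> (\<exists>s>0. \<exists>M. \<forall>\<^sub>F j in sequentially. ball x s \<subseteq> D' j \<and>
    (\<forall>y\<in>ball x s. cmod (levi_poly (gv j) (Bv j) (G j y - q j)) \<le> M * \<delta> j \<and> (norm (G j y - q j))\<^sup>2 \<le> M * \<delta> j))"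

lemma good_from_propagate:
  assumes s0: "s0 > 0" and b: "\<forall>\<^sub>F j in sequentially. ball (y j) s0 \<subseteq> D' j" and z: "(\<lambda>j. G j (y j) - q j) \<longlonglongrightarrow> 0"
    and M: "\<forall>\<^sub>F j in sequentially. cmod (levi_poly (gv j) (Bv j) (G j (y j) - q j)) \<le> M * \<delta> j"
    and x: "\<forall>\<^sub>F j in sequentially. dist (y j) x < min (s0/2) (s0 * r1 / (8 * R)) / 4"
  shows "good x"
proof -
  define \<kappa> where "\<kappa> = min (s0/2) (s0 * r1 / (8 * R)) / 4"
  have \<kappa>: "\<kappa> > 0" "2 * \<kappa> = min (s0/2) (s0 * r1 / (8 * R)) / 2" using s0 cpos R_pos by (auto simp: \<kappa>_def)
  have \<kappa>s: "2 * \<kappa> < s0"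
    using s0 \<kappa>(2) min.cobounded1[of "s0/2" "s0 * r1 / (8 * R)"] by argo
  have "\<forall>\<^sub>F j in sequentially. ball x \<kappa> \<subseteq> D' j \<and>
    (\<forall>y\<in>ball x \<kappa>. cmod (levi_poly (gv j) (Bv j) (G j y - q j)) \<le> max (3 * M) (24 * M / c) * \<delta> j \<and> (norm (G j y - q j))\<^sup>2 \<le> max (3 * M) (24 * M / c) * \<delta> j)"
    using propagate[OF s0 b z M] b x
  proof eventually_elim
    case (elim j)
    have d: "dist (y j) v \<le> 2 * \<kappa>" if "v \<in> ball x \<kappa>" for v
      using elim(3) that dist_triangle[of "y j" v x] unfolding \<kappa>_def[symmetric] by simp
    have "ball x \<kappa> \<subseteq> D' j" using d \<kappa>s elim(2) by force
    moreover have "3 * M * \<delta> j \<le> max (3 * M) (24 * M / c) * \<delta> j" "24 * M / c * \<delta> j \<le> max (3 * M) (24 * M / c) * \<delta> j"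
      using \<delta>[of j] by (intro mult_right_mono; simp)+
    ultimately show ?case using elim(1) d unfolding \<kappa>(2) by fastforce
  qed
  then show ?thesis unfolding good_def using \<kappa>(1) by blast
qed

text \<open>The radius gained in \<open>propagate\<close> depends on the ball available in \<Omega>
  but not on the bound at a good point, so goodness is closed in \<Omega> as well as open; it holds
  at \<open>w0\<close>, and \<Omega> is connected.\<close>

lemma good_all:
  assumes x: "x \<in> \<Omega>" shows "good x"
proof -
  have gopen: "\<exists>e>0. \<forall>y\<in>ball x e. good y" if gx: "good x" for x
  proof -
    obtain s M where s: "s > 0" and ev: "\<forall>\<^sub>F j in sequentially. ball x s \<subseteq> D' j \<and>
      (\<forall>y\<in>ball x s. cmod (levi_poly (gv j) (Bv j) (G j y - q j)) \<le> M * \<delta> j \<and> (norm (G j y - q j))\<^sup>2 \<le> M * \<delta> j)"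
      using gx unfolding good_def by blast
    have "good y" if y: "y \<in> ball x (s/2)" for y
    proof -
      have sub: "ball y (s/2) \<subseteq> ball x s"
      proof
        fix v assume "v \<in> ball y (s/2)"
        then show "v \<in> ball x s" using y dist_triangle[of x v y] by simp
      qed
      have "\<forall>\<^sub>F j in sequentially. ball y (s/2) \<subseteq> D' j \<and>
        (\<forall>v\<in>ball y (s/2). cmod (levi_poly (gv j) (Bv j) (G j v - q j)) \<le> M * \<delta> j \<and> (norm (G j v - q j))\<^sup>2 \<le> M * \<delta> j)"
        using ev by eventually_elim (use sub in blast)
      then show ?thesis unfolding good_def using s half_gt_zero by blast
    qed
    then show ?thesis using s by (intro exI[of _ "s/2"]) auto
  qed
  have gclosed: "\<exists>e>0. \<forall>y\<in>ball x e. good y \<longrightarrow> good x" if xO: "x \<in> \<Omega>" for x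
  proof -
    obtain s where s: "s > 0" "\<forall>\<^sub>F j in sequentially. ball x s \<subseteq> D' j" using inner[OF xO] by blast
    define s0 where "s0 = s/2"
    define \<kappa> where "\<kappa> = min (s0/2) (s0 * r1 / (8 * R)) / 4"
    have s0: "s0 > 0" using s by (simp add: s0_def)
    have \<kappa>: "\<kappa> > 0" using s0 cpos R_pos by (simp add: \<kappa>_def)
    have "good x" if y: "y \<in> ball x (min \<kappa> s0)" and gy: "good y" for y
    proof -
      obtain t M where t: "t > 0" and ev: "\<forall>\<^sub>F j in sequentially. ball y t \<subseteq> D' j \<and>
        (\<forall>v\<in>ball y t. cmod (levi_poly (gv j) (Bv j) (G j v - q j)) \<le> M * \<delta> j \<and> (norm (G j v - q j))\<^sup>2 \<le> M * \<delta> j)"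
        using gy unfolding good_def by blast
      have sub: "ball y s0 \<subseteq> ball x s"
      proof
        fix v assume "v \<in> ball y s0"
        then show "v \<in> ball x s" using y dist_triangle[of x v y] by (simp add: s0_def)
      qed
      have b: "\<forall>\<^sub>F j in sequentially. ball y s0 \<subseteq> D' j" using s(2) by eventually_elim (use sub in blast)
      have M: "\<forall>\<^sub>F j in sequentially. cmod (levi_poly (gv j) (Bv j) (G j y - q j)) \<le> M * \<delta> j"
        using ev by eventually_elim (use t in simp)
      have sq: "\<forall>\<^sub>F j in sequentially. norm (G j y - q j) \<le> sqrt (M * \<delta> j)"
        using ev by eventually_elim (use t in \<open>auto intro: real_le_rsqrt\<close>)
      have "(\<lambda>j. sqrt (M * \<delta> j)) \<longlonglongrightarrow> sqrt (M * 0)" by (intro tendsto_intros lim)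
      then have z: "(\<lambda>j. G j y - q j) \<longlonglongrightarrow> 0" using Lim_null_comparison[OF sq] by simp
      have "\<forall>\<^sub>F j in sequentially. dist y x < min (s0/2) (s0 * r1 / (8 * R)) / 4"
        using y by (simp add: \<kappa>_def dist_commute)
      from good_from_propagate[OF s0 b z M this] show ?thesis .
    qed
    then show ?thesis using \<kappa> s0 by (intro exI[of _ "min \<kappa> s0"]) auto
  qed
  have gw0: "good w0"
  proof -
    obtain s where s: "s > 0" "\<forall>\<^sub>F j in sequentially. ball w0 s \<subseteq> D' j" using inner[OF w0] by blast
    define s0 where "s0 = s/2"
    have s0: "s0 > 0" using s by (simp add: s0_def)
    have near: "\<forall>\<^sub>F j in sequentially. dist (w j) w0 < e" if "e > 0" for e using tendstoD[OF lim(3) that] .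
    \<comment> \<open>The distance to \<open>q j\<close> is exactly \<open>\<delta> j\<close>, so
      the Levi polynomial is of order \<open>\<delta> j\<close> at the base points.\<close>
    have nG: "norm (G j (w j) - q j) = \<delta> j" for j using \<delta>[of j] by (simp add: Gw sgn_gv)
    have dr: "\<forall>\<^sub>F j in sequentially. \<delta> j < r1" using order_tendstoD(2)[OF lim(4) cpos(2)] .
    show ?thesis
    proof (rule good_from_propagate[OF s0])
      show "\<forall>\<^sub>F j in sequentially. ball (w j) s0 \<subseteq> D' j"
        using s(2) near[OF s0]
      proof eventually_elim
        case (elim j)
        have "ball (w j) s0 \<subseteq> ball w0 s"
        proof
          fix v assume "v \<in> ball (w j) s0"
          then show "v \<in> ball w0 s" using elim(2) dist_triangle[of w0 v "w j"] by (simp add: s0_def dist_commute)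
        qed
        then show ?case using elim(1) by blast
      qed
      have "(\<lambda>j. norm (G j (w j) - q j)) \<longlonglongrightarrow> 0" unfolding nG by (rule lim(4))
      then show "(\<lambda>j. G j (w j) - q j) \<longlonglongrightarrow> 0" by (rule tendsto_norm_zero_cancel)
      show "\<forall>\<^sub>F j in sequentially. cmod (levi_poly (gv j) (Bv j) (G j (w j) - q j)) \<le> (C * (1 + r1)) * \<delta> j"
        using dr by eventually_elim (use spsc_at_norm_levi_poly_le[OF at] nG in metis)
      show "\<forall>\<^sub>F j in sequentially. dist (w j) w0 < min (s0/2) (s0 * r1 / (8 * R)) / 4"
        by (rule near) (use s0 cpos R_pos in simp)
    qed
  qed
  have "open {x\<in>\<Omega>. good x}"
    unfolding open_contains_ball
  proof
    fix x assume "x \<in> {x\<in>\<Omega>. good x}"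
    then obtain e1 e2 where "e1 > 0" "\<forall>y\<in>ball x e1. good y" "e2 > 0" "ball x e2 \<subseteq> \<Omega>"
      using gopen \<Omega>(1) unfolding open_contains_ball by blast
    then show "\<exists>e>0. ball x e \<subseteq> {x\<in>\<Omega>. good x}" by (intro exI[of _ "min e1 e2"]) auto
  qed
  moreover have "open {x\<in>\<Omega>. \<not> good x}"
    unfolding open_contains_ball
  proof
    fix x assume xx: "x \<in> {x\<in>\<Omega>. \<not> good x}"
    then obtain e1 e2 where "e1 > 0" "\<forall>y\<in>ball x e1. good y \<longrightarrow> good x" "e2 > 0" "ball x e2 \<subseteq> \<Omega>"
      using gclosed \<Omega>(1) unfolding open_contains_ball by blast
    with xx show "\<exists>e>0. ball x e \<subseteq> {x\<in>\<Omega>. \<not> good x}" by (intro exI[of _ "min e1 e2"]) auto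
  qed
  moreover have "\<Omega> \<subseteq> {x\<in>\<Omega>. good x} \<union> {x\<in>\<Omega>. \<not> good x}" by blast
  ultimately have "{x\<in>\<Omega>. \<not> good x} = {}"
    using connectedD[OF \<Omega>(2), of "{x\<in>\<Omega>. good x}" "{x\<in>\<Omega>. \<not> good x}"] w0 gw0 by blast
  then show ?thesis using x by blast
qed

text \<open>The Levi polynomial differs from \<open>cip v (gv j)\<close> by a quadratic term, itself
  of order \<open>\<delta> j\<close> at good points. Hence the normal component is of order
  \<open>\<delta> j\<close> and the rest of order sqrt (\<open>\<delta> j\<close>), which the
  dilation cancels.\<close>

lemma f_bdd: "evt_holo_bdd f \<Omega>"
  unfolding evt_holo_bdd_def
proof
  fix x assume "x \<in> \<Omega>"
  then obtain s M where s: "s > 0" and ev: "\<forall>\<^sub>F j in sequentially. ball x s \<subseteq> D' j \<and>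
      (\<forall>y\<in>ball x s. cmod (levi_poly (gv j) (Bv j) (G j y - q j)) \<le> M * \<delta> j \<and> (norm (G j y - q j))\<^sup>2 \<le> M * \<delta> j)"
    using good_all unfolding good_def by blast
  have d1: "\<forall>\<^sub>F j in sequentially. \<delta> j < 1" using order_tendstoD(2)[OF lim(4), of 1] by simp
  define K where "K = sqrt M + (1 + C) * M / c"
  have "\<forall>\<^sub>F j in sequentially. holomorphic_map_on (f j) (ball x s) \<and> (\<forall>y\<in>ball x s. norm (f j y) \<le> K)"
    using ev d1
  proof eventually_elim
    case (elim j)
    let ?e = "sgn (gv j)"
    have gvj: "gv j = norm (gv j) *\<^sub>R ?e" using gv_ne by (simp add: sgn_div_norm)
    have hG: "holomorphic_map_on (G j) (ball x s)" using holomorphic_map_on_subset[OF G(1)] elim(1) by blast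
    have hd: "holomorphic_map_on (\<lambda>v. dilate (\<delta> j) ?e v + (- dilate (\<delta> j) ?e (q j))) UNIV"
      by (rule holomorphic_map_on_affine[OF bounded_linear_dilate dilate_smult])
    have "(\<lambda>v. dilate (\<delta> j) ?e v + (- dilate (\<delta> j) ?e (q j))) \<circ> G j = f j"
      by (rule ext) (simp add: f_def linear_diff[OF bounded_linear.linear[OF bounded_linear_dilate]])
    then have h: "holomorphic_map_on (f j) (ball x s)"
      using holomorphic_map_on_compose[OF hG hd] by auto
    have "norm (f j y) \<le> K" if y: "y \<in> ball x s" for y
    proof -
      define v where "v = G j y - q j"
      have lv: "cmod (levi_poly (gv j) (Bv j) v) \<le> M * \<delta> j" and nv: "(norm v)\<^sup>2 \<le> M * \<delta> j"
        using elim(1) y unfolding v_def by auto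
      have nv': "norm v \<le> sqrt M * sqrt (\<delta> j)" using real_le_rsqrt[OF nv] by (simp add: real_sqrt_mult)
      have "cmod (cip v (gv j)) \<le> cmod (levi_poly (gv j) (Bv j) v) + norm (Bv j) * (norm v)\<^sup>2"
        using norm_levi_poly_diff_cip[of "gv j" "Bv j" v] norm_triangle_ineq4[of "levi_poly (gv j) (Bv j) v" "levi_poly (gv j) (Bv j) v - cip v (gv j)"] by simp
      also have "\<dots> \<le> M * \<delta> j + C * (M * \<delta> j)"
        using lv nv gv_bounds(3)[of j] C_pos by (intro add_mono mult_mono) auto
      finally have "norm (gv j) * cmod (cip v ?e) \<le> (1 + C) * M * \<delta> j"
        by (subst (asm) gvj) (simp add: cip_scaleR_right algebra_simps)
      moreover have "c * cmod (cip v ?e) \<le> norm (gv j) * cmod (cip v ?e)"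
        using gv_bounds(1) by (intro mult_right_mono) auto
      ultimately have "cmod (cip v ?e) * c \<le> (1 + C) * M * \<delta> j" by (simp add: mult.commute)
      then have pv: "norm (par ?e v) \<le> (1 + C) * M / c * \<delta> j"
        using cpos by (simp add: par_def norm_vector_smult sgn_gv pos_le_divide_eq)
      have dj: "0 < \<delta> j" "\<delta> j < 1" using \<delta> elim(2) by auto
      have sq: "1 / sqrt (\<delta> j) \<le> 1 / \<delta> j"
      proof (rule divide_left_mono)
        show "\<delta> j \<le> sqrt (\<delta> j)" using dj by (simp add: real_le_rsqrt power2_eq_square mult_left_le_one_le)
      qed (use dj in auto)
      have "norm (f j y) \<le> norm ((1 / sqrt (\<delta> j)) *\<^sub>R v) + norm ((1 / \<delta> j - 1 / sqrt (\<delta> j)) *\<^sub>R par ?e v)"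
        unfolding f_def dilate_def v_def[symmetric] by (rule norm_triangle_ineq)
      also have "\<dots> = 1 / sqrt (\<delta> j) * norm v + (1 / \<delta> j - 1 / sqrt (\<delta> j)) * norm (par ?e v)"
        using sq dj by simp
      also have "\<dots> \<le> 1 / sqrt (\<delta> j) * (sqrt M * sqrt (\<delta> j)) + (1 / \<delta> j) * ((1 + C) * M / c * \<delta> j)"
        using nv' pv sq dj by (intro add_mono mult_mono) auto
      also have "\<dots> = K" using dj by (simp add: K_def)
      finally show ?thesis .
    qed
    with h show ?case by blast
  qed
  then show "\<exists>s>0. \<exists>M J. \<forall>j\<ge>J. holomorphic_map_on (f j) (ball x s) \<and> (\<forall>y\<in>ball x s. norm (f j y) \<le> M)"
    using s unfolding eventually_sequentially by blast
qed

lemma contract_f: "contract (\<delta> j) (sgn (gv j)) (f j x) = G j x - q j"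
  unfolding f_def by (rule contract_dilate[OF sgn_gv \<delta>])

text \<open>One half of the convergence of the rescaled domains. The product filter treats all
  points near \<open>v\<close> at once, giving a single index for a whole ball.\<close>

lemma eventually_near_q:
  assumes v: "siegel g B v < 0"
  shows "\<exists>s>0. \<forall>\<^sub>F j in sequentially. \<forall>v'\<in>ball v s. q j + contract (\<delta> j) (sgn (gv j)) v' \<in> D j"
proof -
  let ?N = "\<lambda>p. snd p - par (sgn (gv (fst p))) (snd p) + sqrt (\<delta> (fst p)) *\<^sub>R par (sgn (gv (fst p))) (snd p)"
  \<comment> \<open>Leaves the strict inequality at \<open>v\<close> intact after the error term is
    added; the summand 1 avoids division by zero.\<close>
  define \<epsilon> where "\<epsilon> = - siegel g B v / (2 * ((norm (v - par (sgn g) v))\<^sup>2 + 1))"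
  have pp: "(norm (v - par (sgn g) v))\<^sup>2 + 1 > 0" by (simp add: add_nonneg_pos)
  have eps: "\<epsilon> > 0" unfolding \<epsilon>_def using v pp by (intro divide_pos_pos) auto
  have neg: "siegel g B v - (- \<epsilon>) * (norm (v - par (sgn g) v))\<^sup>2 < 0"
  proof -
    have "\<epsilon> * ((norm (v - par (sgn g) v))\<^sup>2 + 1) = - siegel g B v / 2"
    proof -
      have "a / (2 * b) * b = a / 2" if "b > 0" for a b :: real using that by simp
      from this[OF pp] show ?thesis unfolding \<epsilon>_def .
    qed
    then show ?thesis using eps v by (simp add: algebra_simps)
  qed
  obtain r where r: "r > 0" and atr: "\<forall>\<^sub>F j in sequentially. spsc_at (D j) (q j) (gv j) (Bv j) c C \<epsilon> r"
    using at_eps[OF eps] by blast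
  let ?net = "sequentially \<times>\<^sub>F nhds v"
  have tf: "((\<lambda>p. a (fst p)) \<longlongrightarrow> l) ?net" if "a \<longlonglongrightarrow> l" for a :: "nat \<Rightarrow> 'b::topological_space" and l
    using filterlim_compose[OF that filterlim_fst] .
  have ts: "((\<lambda>p. snd p) \<longlongrightarrow> v) ?net" using filterlim_snd .
  note tg = tf[OF lim(1)] and tB = tf[OF lim(2)] and td = tf[OF lim(4)]
  note L = tendsto_siegel_form[OF tg g_ne tB ts td]
  have e1: "\<forall>\<^sub>F p in ?net. gv (fst p) \<bullet> snd p + (Bv (fst p) (?N p) \<bullet> ?N p) / 2 - (- \<epsilon>) * (norm (?N p))\<^sup>2 < 0"
    using order_tendstoD(2)[OF L(2) neg] .
  have "((\<lambda>p. norm (sqrt (\<delta> (fst p)) *\<^sub>R ?N p)) \<longlongrightarrow> norm (sqrt 0 *\<^sub>R (v - par (sgn g) v))) ?net"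
    by (intro tendsto_norm tendsto_scaleR L(1) tendsto_real_sqrt td)
  then have e2: "\<forall>\<^sub>F p in ?net. norm (sqrt (\<delta> (fst p)) *\<^sub>R ?N p) < r"
    using r by (intro order_tendstoD(2)) auto
  have e3: "\<forall>\<^sub>F p in ?net. spsc_at (D (fst p)) (q (fst p)) (gv (fst p)) (Bv (fst p)) c C \<epsilon> r"
    using eventually_compose_filterlim[OF atr filterlim_fst] .
  have "\<forall>\<^sub>F p in ?net. q (fst p) + contract (\<delta> (fst p)) (sgn (gv (fst p))) (snd p) \<in> D (fst p)"
    using e1 e2 e3
  proof eventually_elim
    case (elim p)
    let ?c = "contract (\<delta> (fst p)) (sgn (gv (fst p))) (snd p)"
    note fc = form_contract[OF sgn_gv \<delta> refl, of "fst p" "fst p" "snd p"]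
    have nc: "norm ?c < r" using elim(2) by (simp add: contract_def)
    have "\<delta> (fst p) * (gv (fst p) \<bullet> snd p + (Bv (fst p) (?N p) \<bullet> ?N p) / 2) < \<delta> (fst p) * (- (\<epsilon> * (norm (?N p))\<^sup>2))"
      using elim(1) \<delta>[of "fst p"] by (intro mult_strict_left_mono) auto
    then have "gv (fst p) \<bullet> ?c + (Bv (fst p) ?c \<bullet> ?c) / 2 < - (\<epsilon> * (norm ?c)\<^sup>2)"
      unfolding fc by (simp add: mult.left_commute)
    then show ?case using elim(3) nc unfolding spsc_at_def by blast
  qed
  then obtain P Q where PQ: "eventually P sequentially" "eventually Q (nhds v)"
    "\<And>j v'. P j \<Longrightarrow> Q v' \<Longrightarrow> q j + contract (\<delta> j) (sgn (gv j)) v' \<in> D j"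
    unfolding eventually_prod_filter by auto
  obtain s where s: "s > 0" "\<And>v'. dist v' v < s \<Longrightarrow> Q v'" using PQ(2) unfolding eventually_nhds_metric by blast
  have "\<forall>\<^sub>F j in sequentially. \<forall>v'\<in>ball v s. q j + contract (\<delta> j) (sgn (gv j)) v' \<in> D j"
    using PQ(1) by eventually_elim (use PQ(3) s(2) in \<open>auto simp: dist_commute\<close>)
  with s(1) show ?thesis by blast
qed

lemma k_bdd: "evt_holo_bdd k {v. siegel g B v < 0}"
  unfolding evt_holo_bdd_def
proof
  fix v assume "v \<in> {v. siegel g B v < 0}"
  then obtain s where s: "s > 0" and ev: "\<forall>\<^sub>F j in sequentially. \<forall>v'\<in>ball v s. q j + contract (\<delta> j) (sgn (gv j)) v' \<in> D j"
    using eventually_near_q by blast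
  have "\<forall>\<^sub>F j in sequentially. holomorphic_map_on (k j) (ball v s) \<and> (\<forall>y\<in>ball v s. norm (k j y) \<le> R')"
    using ev
  proof eventually_elim
    case (elim j)
    have "holomorphic_map_on (F j \<circ> (\<lambda>v. contract (\<delta> j) (sgn (gv j)) v + q j)) (ball v s)"
      by (rule holomorphic_map_on_compose[OF holomorphic_map_on_affine[OF bounded_linear_contract contract_smult] F(1)])
         (use elim in \<open>auto simp: add.commute\<close>)
    moreover have "F j \<circ> (\<lambda>v. contract (\<delta> j) (sgn (gv j)) v + q j) = k j" by (auto simp: k_def add.commute)
    ultimately have "holomorphic_map_on (k j) (ball v s)" by simp
    moreover have "norm (k j y) \<le> R'" if "y \<in> ball v s" for y
    proof -
      have "k j y \<in> D' j" unfolding k_def using elim that F(2)[of j] by blast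
      then have "k j y \<in> ball 0 R'" using D'[of j] by blast
      then show ?thesis by simp
    qed
    ultimately show ?case by blast
  qed
  then show "\<exists>s>0. \<exists>M J. \<forall>j\<ge>J. holomorphic_map_on (k j) (ball v s) \<and> (\<forall>y\<in>ball v s. norm (k j y) \<le> M)"
    using s unfolding eventually_sequentially by blast
qed

text \<open>The other half: the limit inequality holds up to an error \<epsilon>, and since
  \<open>g\<close> and \<open>B\<close> are the same for all \<epsilon>, letting \<epsilon> tend to
  0 removes it. Goodness brings \<open>G j x\<close> within the radius belonging to
  \<epsilon>.\<close>

lemma f_limit_siegel_le:
  assumes \<sigma>: "strict_mono \<sigma>" and x: "x \<in> \<Omega>" and u: "(\<lambda>j. f (\<sigma> j) x) \<longlonglongrightarrow> u"
  shows "siegel g B u \<le> 0"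
proof -
  let ?N = "\<lambda>j. f (\<sigma> j) x - par (sgn (gv (\<sigma> j))) (f (\<sigma> j) x) + sqrt (\<delta> (\<sigma> j)) *\<^sub>R par (sgn (gv (\<sigma> j))) (f (\<sigma> j) x)"
  have sub: "(\<lambda>j. a (\<sigma> j)) \<longlonglongrightarrow> l" if "a \<longlonglongrightarrow> l" for a :: "nat \<Rightarrow> 'b::topological_space" and l
    using LIMSEQ_subseq_LIMSEQ[OF that \<sigma>] by (simp add: o_def)
  note L = tendsto_siegel_form[OF sub[OF lim(1)] g_ne sub[OF lim(2)] u sub[OF lim(4)]]
  obtain s M where s: "s > 0" and ev: "\<forall>\<^sub>F j in sequentially. ball x s \<subseteq> D' j \<and>
      (\<forall>y\<in>ball x s. cmod (levi_poly (gv j) (Bv j) (G j y - q j)) \<le> M * \<delta> j \<and> (norm (G j y - q j))\<^sup>2 \<le> M * \<delta> j)"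
    using good_all[OF x] unfolding good_def by blast
  have "siegel g B u - \<epsilon> * (norm (u - par (sgn g) u))\<^sup>2 \<le> 0" if eps: "\<epsilon> > 0" for \<epsilon>
  proof -
    obtain r where r: "r > 0" and atr: "\<forall>\<^sub>F j in sequentially. spsc_at (D j) (q j) (gv j) (Bv j) c C \<epsilon> r"
      using at_eps[OF eps] by blast
    have "(\<lambda>j. M * \<delta> j) \<longlonglongrightarrow> M * 0" by (intro tendsto_intros lim)
    then have small: "\<forall>\<^sub>F j in sequentially. M * \<delta> j < r\<^sup>2" using r by (intro order_tendstoD(2)) auto
    have "\<forall>\<^sub>F j in sequentially. spsc_at (D j) (q j) (gv j) (Bv j) c C \<epsilon> r \<and> x \<in> D' j \<and> norm (G j x - q j) < r"
      using ev atr small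
    proof eventually_elim
      case (elim j)
      have "(norm (G j x - q j))\<^sup>2 < r\<^sup>2" using elim(1,3) s by (meson centre_in_ball le_less_trans)
      then have "norm (G j x - q j) < r" using r by (simp add: power_less_imp_less_base)
      then show ?case using elim(1,2) s by auto
    qed
    from eventually_subseq[OF \<sigma> this]
    have "\<forall>\<^sub>F j in sequentially. gv (\<sigma> j) \<bullet> f (\<sigma> j) x + (Bv (\<sigma> j) (?N j) \<bullet> ?N j) / 2 - \<epsilon> * (norm (?N j))\<^sup>2 \<le> 0"
    proof eventually_elim
      case (elim j)
      let ?c = "contract (\<delta> (\<sigma> j)) (sgn (gv (\<sigma> j))) (f (\<sigma> j) x)"
      note fc = form_contract[OF sgn_gv \<delta> refl, of "\<sigma> j" "\<sigma> j" "f (\<sigma> j) x"]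
      have cG: "?c = G (\<sigma> j) x - q (\<sigma> j)" by (rule contract_f)
      have "q (\<sigma> j) + ?c \<in> D (\<sigma> j)" unfolding cG using G(2)[of "\<sigma> j"] elim by auto
      moreover have "norm ?c < r" unfolding cG using elim by blast
      ultimately have "gv (\<sigma> j) \<bullet> ?c + (Bv (\<sigma> j) ?c \<bullet> ?c) / 2 \<le> \<epsilon> * (norm ?c)\<^sup>2"
        using elim unfolding spsc_at_def by blast
      then have "\<delta> (\<sigma> j) * (gv (\<sigma> j) \<bullet> f (\<sigma> j) x + (Bv (\<sigma> j) (?N j) \<bullet> ?N j) / 2) \<le> \<delta> (\<sigma> j) * (\<epsilon> * (norm (?N j))\<^sup>2)"
        unfolding fc by (simp add: mult.left_commute)
      then show ?case using \<delta>[of "\<sigma> j"] by simp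
    qed
    then show ?thesis unfolding eventually_sequentially by (rule LIMSEQ_le_const2[OF L(2)])
  qed
  then have "siegel g B u \<le> 0 + \<epsilon> * (norm (u - par (sgn g) u))\<^sup>2" if "\<epsilon> > 0" for \<epsilon> using that by fastforce
  moreover have "((\<lambda>\<epsilon>. 0 + \<epsilon> * (norm (u - par (sgn g) u))\<^sup>2) \<longlongrightarrow> 0 + 0 * (norm (u - par (sgn g) u))\<^sup>2) (at_right 0)"
    by (intro tendsto_intros)
  ultimately show ?thesis
    using tendsto_lowerbound[of "\<lambda>\<epsilon>. 0 + \<epsilon> * (norm (u - par (sgn g) u))\<^sup>2" 0 "at_right 0" "siegel g B u"]
    by (simp add: eventually_at_right_field) (meson zero_less_one)
qed

lemma f_base: "f j (w j) = - sgn (gv j)"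
proof -
  have "f j (w j) = (1 / sqrt (\<delta> j)) *\<^sub>R (- \<delta> j *\<^sub>R sgn (gv j)) + (1 / \<delta> j - 1 / sqrt (\<delta> j)) *\<^sub>R (- \<delta> j *\<^sub>R sgn (gv j))"
    unfolding f_def Gw dilate_def by (simp add: par_scaleR par_self[OF sgn_gv] par_minus)
  also have "\<dots> = ((1 / sqrt (\<delta> j)) * (- \<delta> j) + (1 / \<delta> j - 1 / sqrt (\<delta> j)) * (- \<delta> j)) *\<^sub>R sgn (gv j)"
    by (simp only: scaleR_scaleR scaleR_add_left)
  also have "(1 / sqrt (\<delta> j)) * (- \<delta> j) + (1 / \<delta> j - 1 / sqrt (\<delta> j)) * (- \<delta> j) = -1"
    using \<delta>[of j] by (simp add: left_diff_distrib)
  finally show ?thesis by simp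
qed

lemma siegel_base: "siegel g B (- sgn g) < 0"
proof -
  have "g \<bullet> sgn g = norm g" using g_ne by (simp add: sgn_div_norm power2_norm_eq_inner[symmetric] power2_eq_square)
  then show ?thesis
    using g_ne by (simp add: siegel_def par_self[OF sgn_g] par_minus)
qed

text \<open>The quadratic term ignores the complex normal line, so imaginary multiples of
  \<open>sgn g\<close> act as translations of the domain.\<close>

lemma siegel_translate: "siegel g B (v + a *s sgn g) = siegel g B v + norm g * Re a"
proof -
  have p: "(v + a *s sgn g) - par (sgn g) (v + a *s sgn g) = v - par (sgn g) v"
    by (simp add: par_add par_smult par_self[OF sgn_g])
  have "g \<bullet> (a *s sgn g) = norm g * Re a"
  proof -
    have "g \<bullet> (a *s sgn g) = Re (cip (a *s sgn g) g)" by (simp add: Re_cip inner_commute)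
    also have "cip (a *s sgn g) g = a * cip (sgn g) (norm g *\<^sub>R sgn g)"
      using g_ne by (simp add: cip_smult_left sgn_div_norm)
    also have "\<dots> = a * of_real (norm g)" 
      unfolding cip_scaleR_right cip_unit[OF sgn_g] by (simp add: scaleR_conv_of_real)
    finally show ?thesis by simp
  qed
  then show ?thesis unfolding siegel_def p by (simp add: inner_add_right)
qed

text \<open>The limits of \<open>f\<close> and \<open>k\<close> could a priori run into the
  boundaries. Their values at \<open>w0\<close> and \<open>- sgn g\<close> are known and interior,
  and peak functions then keep all values interior. So the limits are mutually inverse and transport
  the translation by \<open>\<i> *s sgn g\<close> to \<Omega>; it has no fixed point.\<close>

theorem nontrivial_automorphism: "\<exists>\<phi>. biholomorphism \<phi> \<Omega> \<Omega> \<and> (\<exists>x\<in>\<Omega>. \<phi> x \<noteq> x)"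
proof -
  define S where "S = {v. siegel g B v < 0}"
  have S: "open S" "connected S" unfolding S_def using siegel_open siegel_connected[OF g_ne] by auto
  obtain \<sigma>1 ff where s1: "strict_mono \<sigma>1" and ff: "holomorphic_map_on ff \<Omega>" and l1: "lconv (\<lambda>j. f (\<sigma>1 j)) ff \<Omega>"
    using Montel_subsequence[OF f_bdd] by blast
  obtain \<sigma>2 kk where s2: "strict_mono \<sigma>2" and kk: "holomorphic_map_on kk S" and l2: "lconv (\<lambda>j. k (\<sigma>1 (\<sigma>2 j))) kk S"
    using Montel_subsequence[OF evt_holo_bdd_subseq[OF k_bdd s1]] unfolding S_def by blast
  define \<sigma> where "\<sigma> = \<sigma>1 \<circ> \<sigma>2"
  have \<sigma>: "strict_mono \<sigma>" using strict_mono_o[OF s1 s2] by (simp add: \<sigma>_def)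
  have lf: "lconv (\<lambda>j. f (\<sigma> j)) ff \<Omega>" using lconv_subseq[OF l1 s2] by (simp add: \<sigma>_def)
  have lk: "lconv (\<lambda>j. k (\<sigma> j)) kk S" using l2 by (simp add: \<sigma>_def)
  have sub: "(\<lambda>j. a (\<sigma> j)) \<longlonglongrightarrow> l" if "a \<longlonglongrightarrow> l" for a :: "nat \<Rightarrow> 'b::topological_space" and l
    using LIMSEQ_subseq_LIMSEQ[OF that \<sigma>] by (simp add: o_def)
  have cff: "continuous (at x) ff" if "x \<in> \<Omega>" for x
    using holomorphic_map_on_continuous[OF ff] that \<Omega>(1) continuous_on_eq_continuous_at by blast
  have ckk: "continuous (at x) kk" if "x \<in> S" for x
    using holomorphic_map_on_continuous[OF kk] that S(1) continuous_on_eq_continuous_at by blast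
  have e: "(\<lambda>j. - sgn (gv (\<sigma> j))) \<longlonglongrightarrow> - sgn g" by (intro tendsto_minus tendsto_sgn sub lim g_ne)
  have base: "- sgn g \<in> S" using siegel_base by (simp add: S_def)
  have ffw: "ff w0 = - sgn g"
    using LIMSEQ_unique[OF lconv_tendsto_at[OF lf w0 cff[OF w0] sub[OF lim(3)]]] e by (simp add: f_base)
  have fX: "siegel g B (ff x) \<le> 0" if x: "x \<in> \<Omega>" for x
    using f_limit_siegel_le[OF \<sigma> x lconv_tendsto_at[OF lf x cff[OF x] tendsto_const]] .
  have fS: "ff x \<in> S" if x: "x \<in> \<Omega>" for x
  proof (rule holomorphic_map_stays_inside[OF ff \<Omega> _ S(1) _ w0 _ x, where X="{v. siegel g B v \<le> 0}"])
    fix p assume "p \<in> {v. siegel g B v \<le> 0} - S"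
    then have "siegel g B p = 0" by (simp add: S_def)
    then obtain P where P: "cholo P UNIV" "Re (P p) = 0" "\<forall>v. Re (P v) \<le> siegel g B v"
      using siegel_peak[OF B_pos] by blast
    have le: "Re (P v) \<le> 0" if "siegel g B v \<le> 0" for v using P(3)[rule_format, of v] that by linarith
    have lt: "Re (P v) < 0" if "siegel g B v < 0" for v using P(3)[rule_format, of v] that by linarith
    then show "\<exists>r>0. \<exists>P. cholo P (ball p r) \<and> Re (P p) = 0 \<and> (\<forall>v\<in>{v. siegel g B v \<le> 0} \<inter> ball p r. Re (P v) \<le> 0) \<and> (\<forall>v\<in>S \<inter> ball p r. Re (P v) < 0)"
      using P(2) cholo_subset[OF P(1) subset_UNIV] le lt
      by (intro exI[of _ 1] conjI exI[of _ P]) (auto simp: S_def)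
  qed (use fX ffw base in auto)
  have evk: "\<forall>\<^sub>F j in sequentially. q (\<sigma> j) + contract (\<delta> (\<sigma> j)) (sgn (gv (\<sigma> j))) v \<in> D (\<sigma> j)" if v: "v \<in> S" for v
  proof -
    obtain s where s: "s > 0" "\<forall>\<^sub>F j in sequentially. \<forall>v'\<in>ball v s. q j + contract (\<delta> j) (sgn (gv j)) v' \<in> D j"
      using eventually_near_q v unfolding S_def by blast
    show ?thesis using eventually_subseq[OF \<sigma> s(2)] by eventually_elim (use s(1) in simp)
  qed
  have kX: "kk v \<in> closure \<Omega>" if v: "v \<in> S" for v
  proof (rule outer[OF \<sigma>])
    show "(\<lambda>j. k (\<sigma> j) v) \<longlonglongrightarrow> kk v" using lconv_tendsto_at[OF lk v ckk[OF v] tendsto_const] .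
    show "\<forall>\<^sub>F j in sequentially. k (\<sigma> j) v \<in> D' (\<sigma> j)"
      using evk[OF v] by eventually_elim (use F(2) in \<open>auto simp: k_def\<close>)
  qed
  have kw: "k j (- sgn (gv j)) = w j" for j
  proof -
    have "contract (\<delta> j) (sgn (gv j)) (- sgn (gv j)) = G j (w j) - q j" using contract_f[of j "w j"] by (simp add: f_base)
    then show ?thesis using inv(2)[OF wD] by (simp add: k_def)
  qed
  have kkb: "kk (- sgn g) = w0"
    using LIMSEQ_unique[OF lconv_tendsto_at[OF lk base ckk[OF base] e]] sub[OF lim(3)] by (simp add: kw)
  have k\<Omega>: "kk v \<in> \<Omega>" if v: "v \<in> S" for v
    by (rule holomorphic_map_stays_in_spsc[OF kk S \<Omega>(1) cpos(3,4) \<Omega>_spsc kX base _ v]) (use kkb w0 in auto)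
  have fk: "ff (kk v) = v" if v: "v \<in> S" for v
  proof -
    have "(\<lambda>j. f (\<sigma> j) (k (\<sigma> j) v)) \<longlonglongrightarrow> ff (kk v)"
      using lconv_tendsto_at[OF lf k\<Omega>[OF v] cff[OF k\<Omega>[OF v]] lconv_tendsto_at[OF lk v ckk[OF v] tendsto_const]] .
    moreover have "(\<lambda>j. f (\<sigma> j) (k (\<sigma> j) v)) \<longlonglongrightarrow> v"
    proof (rule tendsto_eventually)
      show "\<forall>\<^sub>F j in sequentially. f (\<sigma> j) (k (\<sigma> j) v) = v" using evk[OF v]
    proof eventually_elim
      case (elim j)
      show ?case unfolding f_def k_def inv(1)[OF elim] using dilate_contract[OF sgn_gv \<delta>] by simp
    qed
    qed
    ultimately show ?thesis by (rule LIMSEQ_unique)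
  qed
  have kf: "kk (ff x) = x" if x: "x \<in> \<Omega>" for x
  proof -
    have "(\<lambda>j. k (\<sigma> j) (f (\<sigma> j) x)) \<longlonglongrightarrow> kk (ff x)"
      using lconv_tendsto_at[OF lk fS[OF x] ckk[OF fS[OF x]] lconv_tendsto_at[OF lf x cff[OF x] tendsto_const]] .
    moreover have "(\<lambda>j. k (\<sigma> j) (f (\<sigma> j) x)) \<longlonglongrightarrow> x"
    proof (rule tendsto_eventually)
      obtain s where s: "s > 0" "\<forall>\<^sub>F j in sequentially. ball x s \<subseteq> D' j" using inner[OF x] by blast
      show "\<forall>\<^sub>F j in sequentially. k (\<sigma> j) (f (\<sigma> j) x) = x" using eventually_subseq[OF \<sigma> s(2)]
      proof eventually_elim
        case (elim j)
        then have "x \<in> D' (\<sigma> j)" using s(1) by auto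
        then show ?case unfolding k_def contract_f using inv(2) by simp
      qed
    qed
    ultimately show ?thesis by (rule LIMSEQ_unique)
  qed
  have TS: "v + a *s sgn g \<in> S" if "v \<in> S" "Re a = 0" for v a
    using that by (simp add: S_def siegel_translate)
  have aut: "holomorphic_map_on (\<lambda>x. kk (ff x + a *s sgn g)) \<Omega>" if a: "Re a = 0" for a
  proof -
    have "holomorphic_map_on (\<lambda>v. v + a *s sgn g) S"
      by (rule holomorphic_map_on_affine[of "\<lambda>v. v", OF bounded_linear_ident refl])
    from holomorphic_map_on_compose[OF holomorphic_map_on_compose[OF ff this] kk]
    show ?thesis using fS TS[OF _ a] by (auto simp: o_def image_subset_iff)
  qed
  define \<phi> where "\<phi> x = kk (ff x + \<i> *s sgn g)" for x
  define \<phi>' where "\<phi>' x = kk (ff x + (-\<i>) *s sgn g)" for x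
  have i0: "Re \<i> = 0" "Re (-\<i>) = 0" by auto
  have cancel: "v + \<i> *s sgn g + (-\<i>) *s sgn g = v" "v + (-\<i>) *s sgn g + \<i> *s sgn g = v" for v
    by (simp_all add: vec_eq_iff)
  have \<phi>\<Omega>: "\<phi> x \<in> \<Omega>" "\<phi>' x \<in> \<Omega>" if "x \<in> \<Omega>" for x
    unfolding \<phi>_def \<phi>'_def using k\<Omega> TS fS[OF that] i0 by blast+
  have inv1: "\<phi>' (\<phi> x) = x" "\<phi> (\<phi>' x) = x" if x: "x \<in> \<Omega>" for x
  proof -
    have "ff (\<phi> x) = ff x + \<i> *s sgn g" "ff (\<phi>' x) = ff x + (-\<i>) *s sgn g"
      unfolding \<phi>_def \<phi>'_def using fk TS fS[OF x] i0 by blast+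
    then show "\<phi>' (\<phi> x) = x" "\<phi> (\<phi>' x) = x"
      using kf[OF x] unfolding \<phi>_def[of "\<phi>' x"] \<phi>'_def[of "\<phi> x"] by (simp_all only: cancel)
  qed
  have "bij_betw \<phi> \<Omega> \<Omega>"
    by (rule bij_betw_byWitness[where f'=\<phi>']) (use \<phi>\<Omega> inv1 in auto)
  moreover have "holomorphic_map_on \<phi> \<Omega>" "holomorphic_map_on \<phi>' \<Omega>"
    unfolding \<phi>_def \<phi>'_def using aut[OF i0(1)] aut[OF i0(2)] by auto
  ultimately have "biholomorphism \<phi> \<Omega> \<Omega>" unfolding biholomorphism_def using inv1 by blast
  moreover have "\<phi> w0 \<noteq> w0"
  proof
    assume "\<phi> w0 = w0"
    then have "ff w0 + \<i> *s sgn g = ff w0" unfolding \<phi>_def using fk TS fS[OF w0] i0(1) by metis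
    then have "norm (\<i> *s sgn g) = 0" by simp
    then show False using sgn_g by simp
  qed
  ultimately show ?thesis using w0 by blast
qed

end

section \<open>Families of biholomorphisms\<close>

context param_family
begin

section \<open>Convergence of the domains as t tends to t0\<close>

lemma Dfam_outer:
  assumes t: "\<And>j. t j \<in> {0..1}" "t \<longlonglongrightarrow> t0" "t0 \<in> {0..1}"
    and u: "\<forall>\<^sub>F j in sequentially. u j \<in> Dfam (t j)" "u \<longlonglongrightarrow> x"
  shows "x \<in> closure (Dfam t0)"
proof -
  have "\<forall>j. \<exists>y. u j \<in> Dfam (t j) \<longrightarrow> y \<in> D0 \<and> u j = \<Gamma> (t j) y"
    using Gamma_image_D0[OF t(1)] by blast
  then obtain y where y: "\<And>j. u j \<in> Dfam (t j) \<Longrightarrow> y j \<in> D0 \<and> u j = \<Gamma> (t j) (y j)" by metis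
  have lim: "(\<lambda>j. \<Gamma> t0 (y j)) \<longlonglongrightarrow> x"
  proof (rule tendstoI)
    fix e :: real assume e: "e > 0"
    obtain \<delta> where \<delta>: "\<delta> > 0" and n: "\<And>t x. t \<in> {0..1} \<Longrightarrow> \<bar>t - t0\<bar> < \<delta> \<Longrightarrow> x \<in> closure D0 \<Longrightarrow> norm (\<Gamma> t x - \<Gamma> t0 x) \<le> e/2"
      using near_t[OF t(3), of "e/2"] e by (metis half_gt_zero)
    have "\<forall>\<^sub>F j in sequentially. \<bar>t j - t0\<bar> < \<delta>" using tendstoD[OF t(2) \<delta>] by (simp add: dist_real_def)
    moreover have "\<forall>\<^sub>F j in sequentially. dist (u j) x < e/2" using tendstoD[OF u(2), of "e/2"] e by simp
    ultimately show "\<forall>\<^sub>F j in sequentially. dist (\<Gamma> t0 (y j)) x < e"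
      using u(1)
    proof eventually_elim
      case (elim j)
      have yj: "y j \<in> D0" "u j = \<Gamma> (t j) (y j)" using y[OF elim(3)] by auto
      have "norm (\<Gamma> (t j) (y j) - \<Gamma> t0 (y j)) \<le> e/2" using n[OF t(1) elim(1)] yj(1) closure_subset[of D0] by blast
      then have "dist (\<Gamma> t0 (y j)) (u j) \<le> e/2" using yj(2) by (simp add: dist_norm norm_minus_commute)
      then show ?case using elim(2) dist_triangle[of "\<Gamma> t0 (y j)" x "u j"] by linarith
    qed
  qed
  have "\<forall>\<^sub>F j in sequentially. \<Gamma> t0 (y j) \<in> closure (Dfam t0)"
    using u(1)
  proof eventually_elim
    case (elim j)
    have "\<Gamma> t0 (y j) \<in> Dfam t0" using y[OF elim] Gamma_image_D0[OF t(3)] by blast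
    then show ?case using closure_subset by blast
  qed
  then show ?thesis using Lim_in_closed_set[OF closed_closure _ sequentially_bot lim] by blast
qed

lemma Dfam_inner:
  assumes t: "\<And>j. t j \<in> {0..1}" "t \<longlonglongrightarrow> t0" "t0 \<in> {0..1}" and x: "x \<in> Dfam t0"
  shows "\<exists>s>0. \<forall>\<^sub>F j in sequentially. ball x s \<subseteq> Dfam (t j)"
proof -
  obtain e where e: "e > 0" "ball x e \<subseteq> Dfam t0" using Dfam_open[OF t(3)] x unfolding open_contains_ball by blast
  define s where "s = e/3"
  have s: "s > 0" using e by (simp add: s_def)
  obtain \<delta> where \<delta>: "\<delta> > 0" and n: "\<And>t x. t \<in> {0..1} \<Longrightarrow> \<bar>t - t0\<bar> < \<delta> \<Longrightarrow> x \<in> closure D0 \<Longrightarrow> norm (\<Gamma> t x - \<Gamma> t0 x) \<le> s"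
    using near_t[OF t(3) s] by blast
  have "\<forall>\<^sub>F j in sequentially. \<bar>t j - t0\<bar> < \<delta>" using tendstoD[OF t(2) \<delta>] by (simp add: dist_real_def)
  then have "\<forall>\<^sub>F j in sequentially. ball x s \<subseteq> Dfam (t j)"
  proof eventually_elim
    case (elim j)
    show ?case
    proof
      fix v assume v: "v \<in> ball x s"
      have "cball v s \<subseteq> ball x e"
      proof
        fix u assume "u \<in> cball v s"
        then show "u \<in> ball x e" using v dist_triangle[of x u v] s by (simp add: s_def)
      qed
      then show "v \<in> Dfam (t j)"
        using cball_subset_Dfam[OF t(1) t(3) n[OF t(1) elim] s] e(2) by blast
    qed
  qed
  then show ?thesis using s by blast
qed

text \<open>A limit on the frontier would be \<open>\<Gamma> t0 y\<close> with \<open>y\<close> in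
  \<open>frontier D0\<close>; the frontier points \<open>\<Gamma> (t j) y\<close> would then come
  closer to \<open>u j\<close> than \<open>r0\<close>.\<close>

lemma Dfam_deep_limit:
  assumes t: "\<And>j. t j \<in> {0..1}" "t \<longlonglongrightarrow> t0" "t0 \<in> {0..1}"
    and u: "\<forall>\<^sub>F j in sequentially. u j \<in> Dfam (t j) \<and> r0 \<le> dep (Dfam (t j)) (u j)" "u \<longlonglongrightarrow> x" and r0: "r0 > 0"
  shows "x \<in> Dfam t0"
proof (rule ccontr)
  assume nx: "x \<notin> Dfam t0"
  have "\<forall>\<^sub>F j in sequentially. u j \<in> Dfam (t j)" using u(1) by eventually_elim blast
  then have "x \<in> closure (Dfam t0)" using Dfam_outer[OF t _ u(2)] by blast
  then have "x \<in> frontier (Dfam t0)" using nx Dfam_open[OF t(3)] by (simp add: frontier_def interior_open)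
  then obtain y where y: "y \<in> frontier D0" "x = \<Gamma> t0 y" using Gamma_image_frontier[OF t(3)] by blast
  have yc: "y \<in> closure D0" using y by (simp add: frontier_def)
  obtain \<delta> where \<delta>: "\<delta> > 0" and n: "\<And>t x. t \<in> {0..1} \<Longrightarrow> \<bar>t - t0\<bar> < \<delta> \<Longrightarrow> x \<in> closure D0 \<Longrightarrow> norm (\<Gamma> t x - \<Gamma> t0 x) \<le> r0/2"
    using near_t[OF t(3), of "r0/2"] r0 by (metis half_gt_zero)
  have e1: "\<forall>\<^sub>F j in sequentially. \<bar>t j - t0\<bar> < \<delta>" using tendstoD[OF t(2) \<delta>] by (simp add: dist_real_def)
  have e2: "\<forall>\<^sub>F j in sequentially. dist (u j) x < r0/2" using tendstoD[OF u(2), of "r0/2"] r0 by simp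
  have "\<forall>\<^sub>F j in sequentially. False"
    using e1 e2 u(1)
  proof eventually_elim
    case (elim j)
    have "\<Gamma> (t j) y \<in> frontier (Dfam (t j))" using y(1) Gamma_image_frontier[OF t(1)] by blast
    then have "\<Gamma> (t j) y \<notin> Dfam (t j)" using Dfam_open[OF t(1)] by (simp add: frontier_def interior_open)
    then have "r0 \<le> dist (u j) (\<Gamma> (t j) y)" using dep_le elim(3) order_trans by blast
    also have "\<dots> \<le> dist (u j) x + dist x (\<Gamma> (t j) y)" by (rule dist_triangle)
    also have "dist x (\<Gamma> (t j) y) \<le> r0/2" using n[OF t(1) elim(1) yc] y(2) by (simp add: dist_norm norm_minus_commute)
    finally show False using elim(2) by linarith
  qed
  then show False by simp
qed

lemma Dfam_uniform_bound:
  obtains R where "R > 0" "\<And>t. t \<in> {0..1} \<Longrightarrow> Dfam t \<subseteq> ball 0 R"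
proof -
  obtain b where b: "b > 0" and bb: "\<And>t x. t \<in> {0..1} \<Longrightarrow> x \<in> closure D0 \<Longrightarrow> norm (\<Gamma> t x) \<le> b \<and> norm (D\<Gamma> t x) \<le> b"
    using Taylor_bound by metis
  show thesis
  proof (rule that[of "b + 1"])
    fix t :: real assume t: "t \<in> {0..1}"
    show "Dfam t \<subseteq> ball 0 (b + 1)"
    proof
      fix w assume "w \<in> Dfam t"
      then obtain x where x: "x \<in> D0" "w = \<Gamma> t x" using Gamma_image_D0[OF t] by blast
      then have "norm w \<le> b" using bb[OF t] closure_subset[of D0] by blast
      then show "w \<in> ball 0 (b + 1)" by simp
    qed
  qed (use b in simp)
qed

lemma uniform_spsc_dom:
  assumes t0: "t0 \<in> {0..1}" and sp: "bounded_strictly_pseudoconvex_C2 (Dfam t0)"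
  obtains c C r R \<delta> where "c > 0" "C > 0" "r > 0" "\<delta> > 0" "\<And>t. t \<in> {0..1} \<Longrightarrow> \<bar>t - t0\<bar> < \<delta> \<Longrightarrow> spsc_dom (Dfam t) c C r R"
proof -
  obtain c and g :: "real \<Rightarrow> complex^'n \<Rightarrow> complex^'n" and B C where c: "c > 0" and S: "\<And>\<epsilon>. \<epsilon> > 0 \<Longrightarrow> \<exists>r>0. \<exists>\<delta>>0. \<forall>t\<in>{0..1}. \<bar>t - t0\<bar> < \<delta> \<longrightarrow> (\<forall>q\<in>frontier (Dfam t). spsc_at (Dfam t) q (g t q) (B t q) c C \<epsilon> r)"
    by (rule uniform_spsc[OF t0 sp], rule that) blast+
  obtain r \<delta> where r: "r > 0" "\<delta> > 0" and S1: "\<And>t q. t \<in> {0..1} \<Longrightarrow> \<bar>t - t0\<bar> < \<delta> \<Longrightarrow> q \<in> frontier (Dfam t) \<Longrightarrow> spsc_at (Dfam t) q (g t q) (B t q) c C (c/8) r"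
    using S[of "c/8"] c by auto
  obtain R where "R > 0" and R: "\<And>t. t \<in> {0..1} \<Longrightarrow> Dfam t \<subseteq> ball 0 R" by (rule Dfam_uniform_bound, rule that) blast+
  have "Dfam t0 \<noteq> UNIV" using Dfam_bounded[OF t0] not_bounded_UNIV by metis
  then obtain q where "q \<in> frontier (Dfam t0)" using Dfam_ne[OF t0] frontier_eq_empty by blast
  then have "spsc_at (Dfam t0) q (g t0 q) (B t0 q) c C (c/8) r" using S1[OF t0] r(2) by simp
  then have C: "C > 0" using c by (auto simp: spsc_at_def)
  have "spsc_dom (Dfam t) c C r R" if "t \<in> {0..1}" "\<bar>t - t0\<bar> < \<delta>" for t
    unfolding spsc_dom_def using Dfam_open[OF that(1)] R[OF that(1)] c r(1) S1[OF that] by blast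
  then show thesis using that[OF c C r] by blast
qed

end

text \<open>The two parameterizations are independent of each other, and nothing links the maps for
  different \<open>t\<close>.\<close>

locale biholo_families =
  P: param_family D0 \<Gamma> Dfam D\<Gamma> D2\<Gamma> s + P': param_family D0' \<Gamma>' Dtfam D\<Gamma>' D2\<Gamma>' s'
  for D0 \<Gamma> Dfam D\<Gamma> D2\<Gamma> s and D0' :: "(complex^'n) set" and \<Gamma>' Dtfam D\<Gamma>' D2\<Gamma>' s' +
  fixes F G :: "real \<Rightarrow> complex^'n \<Rightarrow> complex^'n"
  assumes spsc: "\<And>t. t \<in> {0..1} \<Longrightarrow> bounded_strictly_pseudoconvex_C2 (Dfam t)"
    and spsc': "\<And>t. t \<in> {0..1} \<Longrightarrow> bounded_strictly_pseudoconvex_C2 (Dtfam t)"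
    and F: "\<And>t. t \<in> {0..1} \<Longrightarrow> holomorphic_map_on (F t) (Dfam t)" "\<And>t. t \<in> {0..1} \<Longrightarrow> F t ` Dfam t \<subseteq> Dtfam t"
    and G: "\<And>t. t \<in> {0..1} \<Longrightarrow> holomorphic_map_on (G t) (Dtfam t)" "\<And>t. t \<in> {0..1} \<Longrightarrow> G t ` Dtfam t \<subseteq> Dfam t"
    and GF: "\<And>t z. t \<in> {0..1} \<Longrightarrow> z \<in> Dfam t \<Longrightarrow> G t (F t z) = z"
    and FG: "\<And>t z. t \<in> {0..1} \<Longrightarrow> z \<in> Dtfam t \<Longrightarrow> F t (G t z) = z"
begin

text \<open>The set \<open>T\<close> covers two uses: \<open>{t}\<close> for extending a single map,
  and \<open>{0..1}\<close> near 0 for the limit. The boundary estimates are common to both.\<close>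

definition depth_control :: "real set \<Rightarrow> real \<Rightarrow> bool" where
  "depth_control T t0 \<longleftrightarrow> (\<forall>r0>0. \<exists>\<eta>>0. \<exists>\<delta>>0. \<forall>t\<in>T. \<bar>t - t0\<bar> < \<delta> \<longrightarrow>
     (\<forall>x\<in>Dtfam t. r0 \<le> dep (Dtfam t) x \<longrightarrow> \<eta> \<le> dep (Dfam t) (G t x)))"

lemma depth_control_single:
  assumes t: "t \<in> {0..1}"
  shows "depth_control {t} t"
  unfolding depth_control_def
proof (intro allI impI)
  fix r0 :: real assume r0: "r0 > 0"
  let ?K = "{x\<in>Dtfam t. r0 \<le> dep (Dtfam t) x}"
  have nU: "- Dtfam t \<noteq> {}" using P'.Dfam_bounded[OF t] not_bounded_UNIV by (metis Compl_UNIV_eq double_complement)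
  have eqK: "?K = {x. r0 \<le> dep (Dtfam t) x}"
  proof -
    have "x \<in> Dtfam t" if "r0 \<le> dep (Dtfam t) x" for x using ball_dep_subset[of x "Dtfam t"] that r0 by force
    then show ?thesis by blast
  qed
  have "closed ?K" unfolding eqK unfolding dep_def by (intro closed_Collect_le continuous_intros)
  moreover have "bounded ?K" using P'.Dfam_bounded[OF t] by (rule bounded_subset) auto
  ultimately have cK: "compact ?K" using compact_eq_bounded_closed by blast
  have "continuous_on ?K (G t)" using holomorphic_map_on_continuous[OF G(1)[OF t]] by (rule continuous_on_subset) auto
  then have cGK: "compact (G t ` ?K)" using cK by (rule compact_continuous_image)
  have "\<exists>\<eta>>0. \<forall>y\<in>G t ` ?K. \<eta> \<le> dep (Dfam t) y"
  proof (cases "?K = {}")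
    case True then show ?thesis by (intro exI[of _ 1]) auto
  next
    case False
    have "continuous_on (G t ` ?K) (dep (Dfam t))" unfolding dep_def by (intro continuous_intros)
    then obtain y where y: "y \<in> G t ` ?K" "\<forall>z\<in>G t ` ?K. dep (Dfam t) y \<le> dep (Dfam t) z"
      using continuous_attains_inf[OF cGK] False by blast
    have "y \<in> Dfam t" using y(1) G(2)[OF t] by blast
    then have "dep (Dfam t) y > 0" using dep_pos[OF P.Dfam_open[OF t] P.Dfam_bounded[OF t]] by blast
    then show ?thesis using y(2) by blast
  qed
  then obtain \<eta> where "\<eta> > 0" "\<forall>y\<in>G t ` ?K. \<eta> \<le> dep (Dfam t) y" by blast
  then show "\<exists>\<eta>>0. \<exists>\<delta>>0. \<forall>ta\<in>{t}. \<bar>ta - t\<bar> < \<delta> \<longrightarrow> (\<forall>x\<in>Dtfam ta. r0 \<le> dep (Dtfam ta) x \<longrightarrow> \<eta> \<le> dep (Dfam ta) (G ta x))"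
    by (intro exI[of _ \<eta>] conjI exI[of _ 1]) auto
qed

text \<open>Failure produces deep points of \<open>Dtfam (t n)\<close> whose images have depth
  tending to 0. Along a subsequence these points converge together with the gradients and Hessians
  at the nearest boundary points, which are the data of \<open>scaling\<close>. The automorphism of
  \<open>Dtfam 0\<close> so obtained is conjugated by \<open>F 0\<close> to one of
  \<open>Dfam 0\<close>.\<close>

lemma depth_control_zero:
  assumes triv: "trivial_Aut (Dfam 0)"
  shows "depth_control {0..1} 0"
proof (rule ccontr)
  assume "\<not> depth_control {0..1} 0"
  then obtain r0 where r0: "r0 > 0" and no: "\<And>\<eta> \<delta>. \<eta> > 0 \<Longrightarrow> \<delta> > 0 \<Longrightarrow> \<exists>t\<in>{0..1}. \<bar>t - 0\<bar> < \<delta> \<and>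
     (\<exists>x\<in>Dtfam t. r0 \<le> dep (Dtfam t) x \<and> dep (Dfam t) (G t x) < \<eta>)"
    unfolding depth_control_def by (metis not_le)
  have z: "(0::real) \<in> {0..1}" by simp
  obtain c and g :: "real \<Rightarrow> complex^'n \<Rightarrow> complex^'n" and B C where c: "c > 0" and S: "\<And>\<epsilon>. \<epsilon> > 0 \<Longrightarrow> \<exists>r>0. \<exists>\<delta>>0. \<forall>t\<in>{0..1}. \<bar>t - 0\<bar> < \<delta> \<longrightarrow> (\<forall>q\<in>frontier (Dfam t). spsc_at (Dfam t) q (g t q) (B t q) c C \<epsilon> r)"
    by (rule P.uniform_spsc[OF z spsc[OF z]], rule that) blast+
  obtain r1 \<delta>1 where r1: "r1 > 0" "\<delta>1 > 0" and S1: "\<And>t q. t \<in> {0..1} \<Longrightarrow> \<bar>t - 0\<bar> < \<delta>1 \<Longrightarrow> q \<in> frontier (Dfam t) \<Longrightarrow> spsc_at (Dfam t) q (g t q) (B t q) c C (c/8) r1"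
    using S[of "c/8"] c by auto
  obtain c' C' r' R'' \<delta>' where cc': "c' > 0" "r' > 0" "\<delta>' > 0" and S': "\<And>t. t \<in> {0..1} \<Longrightarrow> \<bar>t - 0\<bar> < \<delta>' \<Longrightarrow> spsc_dom (Dtfam t) c' C' r' R''"
    using P'.uniform_spsc_dom[OF z spsc'[OF z]] by metis
  obtain R where "R > 0" and R: "\<And>t. t \<in> {0..1} \<Longrightarrow> Dfam t \<subseteq> ball 0 R" by (rule P.Dfam_uniform_bound, rule that) blast+
  obtain R' where "R' > 0" and R': "\<And>t. t \<in> {0..1} \<Longrightarrow> Dtfam t \<subseteq> ball 0 R'" by (rule P'.Dfam_uniform_bound, rule that) blast+
  have "\<exists>t x q. t \<in> {0..1} \<and> \<bar>t\<bar> < \<delta>1 \<and> \<bar>t\<bar> < inverse (real (Suc n)) \<and> x \<in> Dtfam t \<and> r0 \<le> dep (Dtfam t) x \<and>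
      dep (Dfam t) (G t x) < inverse (real (Suc n)) \<and> q \<in> frontier (Dfam t) \<and> dist (G t x) q = dep (Dfam t) (G t x)" for n
  proof -
    have i: "inverse (real (Suc n)) > 0" by simp
    obtain t x where tx: "t \<in> {0..1}" "\<bar>t\<bar> < min \<delta>1 (inverse (real (Suc n)))" "x \<in> Dtfam t" "r0 \<le> dep (Dtfam t) x"
      "dep (Dfam t) (G t x) < inverse (real (Suc n))"
      using no[OF i, of "min \<delta>1 (inverse (real (Suc n)))"] r1 i by auto
    have "G t x \<in> Dfam t" using G(2)[OF tx(1)] tx(3) by blast
    then obtain q where q: "q \<in> frontier (Dfam t)" "dist (G t x) q = dep (Dfam t) (G t x)"
      using dep_attained[OF P.Dfam_open[OF tx(1)] P.Dfam_bounded[OF tx(1)]] by blast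
    then show ?thesis using tx q by (intro exI[of _ t] exI[of _ x] exI[of _ q]) auto
  qed
  then obtain t x q where t: "\<And>n. t n \<in> {0..1}" and td: "\<And>n. \<bar>t n\<bar> < \<delta>1" and tn: "\<And>n. \<bar>t n\<bar> < inverse (real (Suc n))"
    and x: "\<And>n. x n \<in> Dtfam (t n)" "\<And>n. r0 \<le> dep (Dtfam (t n)) (x n)"
    and dn: "\<And>n. dep (Dfam (t n)) (G (t n) (x n)) < inverse (real (Suc n))"
    and q: "\<And>n. q n \<in> frontier (Dfam (t n))" "\<And>n. dist (G (t n) (x n)) (q n) = dep (Dfam (t n)) (G (t n) (x n))"
    by metis
  define gv where "gv n = g (t n) (q n)" for n
  define Bv where "Bv n = B (t n) (q n)" for n
  have at: "spsc_at (Dfam (t n)) (q n) (gv n) (Bv n) c C (c/8) r1" for n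
    unfolding gv_def Bv_def using S1[OF t _ q(1)] td by simp
  have "bounded (range (\<lambda>n. (x n, gv n, Bv n)))"
  proof -
    have "x n \<in> ball 0 R'" for n using x(1) R'[OF t] by blast
    then have "range x \<subseteq> ball 0 R'" by blast
    moreover have "range gv \<subseteq> cball 0 C" "range Bv \<subseteq> cball 0 C" using at by (auto simp: spsc_at_def)
    ultimately have "bounded (range x \<times> (range gv \<times> range Bv))"
      by (intro bounded_Times) (meson bounded_ball bounded_cball bounded_subset)+
    then show ?thesis by (rule bounded_subset) auto
  qed
  then obtain l \<rho> where \<rho>: "strict_mono \<rho>" and l: "((\<lambda>n. (x n, gv n, Bv n)) \<circ> \<rho>) \<longlonglongrightarrow> l"
    using bounded_imp_convergent_subsequence by blast
  define w0 where "w0 = fst l"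
  define g0 where "g0 = fst (snd l)"
  define B0 where "B0 = snd (snd l)"
  have lx: "(\<lambda>n. x (\<rho> n)) \<longlonglongrightarrow> w0" and lg: "(\<lambda>n. gv (\<rho> n)) \<longlonglongrightarrow> g0" and lB: "(\<lambda>n. Bv (\<rho> n)) \<longlonglongrightarrow> B0"
    using tendsto_fst[OF l] tendsto_fst[OF tendsto_snd[OF l]] tendsto_snd[OF tendsto_snd[OF l]]
    by (simp_all add: w0_def g0_def B0_def o_def)
  have inv0: "(\<lambda>n. inverse (real (Suc n))) \<longlonglongrightarrow> 0" by (rule LIMSEQ_inverse_real_of_nat)
  have t0: "t \<longlonglongrightarrow> 0"
    by (rule Lim_null_comparison[OF _ inv0]) (use tn in \<open>auto intro!: always_eventually less_imp_le\<close>)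
  have dl: "(\<lambda>n. dep (Dfam (t n)) (G (t n) (x n))) \<longlonglongrightarrow> 0"
    by (rule Lim_null_comparison[OF _ inv0]) (use dn in \<open>auto intro!: always_eventually less_imp_le\<close>)
  have sub: "(\<lambda>n. a (\<rho> n)) \<longlonglongrightarrow> m" if "a \<longlonglongrightarrow> m" for a :: "nat \<Rightarrow> real" and m
    using LIMSEQ_subseq_LIMSEQ[OF that \<rho>] by (simp add: o_def)
  have w0: "w0 \<in> Dtfam 0"
    by (rule P'.Dfam_deep_limit[OF t sub[OF t0] z _ lx r0]) (use x in simp)
  interpret sc: scaling "\<lambda>n. Dfam (t (\<rho> n))" "\<lambda>n. Dtfam (t (\<rho> n))" "Dtfam 0" "\<lambda>n. F (t (\<rho> n))" "\<lambda>n. G (t (\<rho> n))"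
    "\<lambda>n. q (\<rho> n)" "\<lambda>n. x (\<rho> n)" "\<lambda>n. gv (\<rho> n)" "\<lambda>n. Bv (\<rho> n)" w0 g0 B0 "\<lambda>n. dep (Dfam (t (\<rho> n))) (G (t (\<rho> n)) (x (\<rho> n)))"
    c C r1 R R' c' C' r'
  proof
    show "c > 0" "r1 > 0" "c' > 0" "r' > 0" by (fact c r1(1) cc'(1,2))+
    show "open (Dfam (t (\<rho> n)))" "Dfam (t (\<rho> n)) \<subseteq> ball 0 R" "Dtfam (t (\<rho> n)) \<subseteq> ball 0 R'" for n
      using P.Dfam_open[OF t] R[OF t] R'[OF t] by blast+
    show "open (Dtfam 0)" "connected (Dtfam 0)" using P'.Dfam_open[OF z] P'.Dfam_connected[OF z] by blast+
    show "\<exists>g B. spsc_at (Dtfam 0) p g B c' C' (c'/8) r'" if "p \<in> frontier (Dtfam 0)" for p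
      using S'[OF z] cc'(3) that unfolding spsc_dom_def by simp
    show "\<exists>s>0. \<forall>\<^sub>F j in sequentially. ball v s \<subseteq> Dtfam (t (\<rho> j))" if "v \<in> Dtfam 0" for v
      by (rule P'.Dfam_inner[OF t sub[OF t0] z that])
    show "v \<in> closure (Dtfam 0)" if s: "strict_mono \<sigma>" and u: "\<forall>\<^sub>F j in sequentially. u j \<in> Dtfam (t (\<rho> (\<sigma> j)))" "u \<longlonglongrightarrow> v" for u v \<sigma>
    proof (rule P'.Dfam_outer[OF t _ z u])
      show "(\<lambda>j. t (\<rho> (\<sigma> j))) \<longlonglongrightarrow> 0" using LIMSEQ_subseq_LIMSEQ[OF sub[OF t0] s] by (simp add: o_def)
    qed
    show "holomorphic_map_on (F (t (\<rho> n))) (Dfam (t (\<rho> n)))" "F (t (\<rho> n)) ` Dfam (t (\<rho> n)) \<subseteq> Dtfam (t (\<rho> n))"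
      "holomorphic_map_on (G (t (\<rho> n))) (Dtfam (t (\<rho> n)))" "G (t (\<rho> n)) ` Dtfam (t (\<rho> n)) \<subseteq> Dfam (t (\<rho> n))" for n
      by (fact F(1)[OF t] F(2)[OF t] G(1)[OF t] G(2)[OF t])+
    show "G (t (\<rho> n)) (F (t (\<rho> n)) v) = v" if "v \<in> Dfam (t (\<rho> n))" for n v using GF[OF t that] .
    show "F (t (\<rho> n)) (G (t (\<rho> n)) v) = v" if "v \<in> Dtfam (t (\<rho> n))" for n v using FG[OF t that] .
    show "q (\<rho> n) \<in> frontier (Dfam (t (\<rho> n)))" for n by (rule q)
    show "spsc_at (Dfam (t (\<rho> n))) (q (\<rho> n)) (gv (\<rho> n)) (Bv (\<rho> n)) c C (c/8) r1" for n by (rule at)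
    show "\<exists>r>0. \<forall>\<^sub>F n in sequentially. spsc_at (Dfam (t (\<rho> n))) (q (\<rho> n)) (gv (\<rho> n)) (Bv (\<rho> n)) c C \<epsilon> r" if eps: "\<epsilon> > 0" for \<epsilon>
    proof -
      obtain r \<delta> where r: "r > 0" "\<delta> > 0" and Sr: "\<And>t q. t \<in> {0..1} \<Longrightarrow> \<bar>t - 0\<bar> < \<delta> \<Longrightarrow> q \<in> frontier (Dfam t) \<Longrightarrow> spsc_at (Dfam t) q (g t q) (B t q) c C \<epsilon> r"
        using S[OF eps] by blast
      have "\<forall>\<^sub>F n in sequentially. \<bar>t (\<rho> n)\<bar> < \<delta>" using tendstoD[OF sub[OF t0] r(2)] by simp
      then have "\<forall>\<^sub>F n in sequentially. spsc_at (Dfam (t (\<rho> n))) (q (\<rho> n)) (gv (\<rho> n)) (Bv (\<rho> n)) c C \<epsilon> r"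
        by eventually_elim (use Sr[OF t _ q(1)] in \<open>auto simp: gv_def Bv_def\<close>)
      then show ?thesis using r(1) by blast
    qed
    show "(\<lambda>n. gv (\<rho> n)) \<longlonglongrightarrow> g0" "(\<lambda>n. Bv (\<rho> n)) \<longlonglongrightarrow> B0" "(\<lambda>n. x (\<rho> n)) \<longlonglongrightarrow> w0" by (fact lg lB lx)+
    show "(\<lambda>n. dep (Dfam (t (\<rho> n))) (G (t (\<rho> n)) (x (\<rho> n)))) \<longlonglongrightarrow> 0" using sub[OF dl] .
    have GD: "G (t n) (x n) \<in> Dfam (t n)" for n using G(2)[OF t] x(1) by blast
    show "0 < dep (Dfam (t (\<rho> n))) (G (t (\<rho> n)) (x (\<rho> n)))" for n
      using dep_pos[OF P.Dfam_open[OF t] P.Dfam_bounded[OF t] GD] .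
    show "x (\<rho> n) \<in> Dtfam (t (\<rho> n))" for n by (rule x)
    show "w0 \<in> Dtfam 0" by (rule w0)
    \<comment> \<open>Choosing \<open>q\<close> as a nearest boundary point is what puts the image
      on the normal, so that its rescaled position is a unit vector.\<close>
    show "G (t (\<rho> n)) (x (\<rho> n)) = q (\<rho> n) - dep (Dfam (t (\<rho> n))) (G (t (\<rho> n)) (x (\<rho> n))) *\<^sub>R sgn (gv (\<rho> n))" for n
    proof (rule spsc_at_normal[OF at c r1(1) P.Dfam_open[OF t] GD _ q(2)])
      show "q (\<rho> n) \<notin> Dfam (t (\<rho> n))" using q(1)[of "\<rho> n"] P.Dfam_open[OF t] by (simp add: frontier_def interior_open)
    qed
  qed
  obtain \<phi> y where \<phi>: "biholomorphism \<phi> (Dtfam 0) (Dtfam 0)" and y: "y \<in> Dtfam 0" "\<phi> y \<noteq> y"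
    using sc.nontrivial_automorphism by blast
  obtain \<phi>' where bij: "bij_betw \<phi> (Dtfam 0) (Dtfam 0)" and h: "holomorphic_map_on \<phi> (Dtfam 0)" "holomorphic_map_on \<phi>' (Dtfam 0)"
    and i1: "\<forall>z\<in>Dtfam 0. \<phi>' (\<phi> z) = z" and i2: "\<forall>z\<in>Dtfam 0. \<phi> (\<phi>' z) = z"
    using \<phi> unfolding biholomorphism_def by blast
  have im: "\<phi> ` Dtfam 0 \<subseteq> Dtfam 0" using bij by (simp add: bij_betw_def)
  have im': "\<phi>' z \<in> Dtfam 0" if "z \<in> Dtfam 0" for z
  proof -
    have "z \<in> \<phi> ` Dtfam 0" using bij that by (simp add: bij_betw_def)
    then obtain u where "u \<in> Dtfam 0" "z = \<phi> u" by (rule imageE)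
    then show ?thesis using i1 by simp
  qed
  have FD: "F 0 z \<in> Dtfam 0" if "z \<in> Dfam 0" for z using F(2)[OF z] that by blast
  have GD: "G 0 z \<in> Dfam 0" if "z \<in> Dtfam 0" for z using G(2)[OF z] that by blast
  have im1: "\<phi> z \<in> Dtfam 0" if "z \<in> Dtfam 0" for z using im that by blast
  have "biholomorphism (G 0 \<circ> (\<phi> \<circ> F 0)) (Dfam 0) (Dfam 0)"
    unfolding biholomorphism_def
  proof (intro conjI exI[of _ "G 0 \<circ> (\<phi>' \<circ> F 0)"] ballI)
    show "bij_betw (G 0 \<circ> (\<phi> \<circ> F 0)) (Dfam 0) (Dfam 0)"
      by (rule bij_betw_byWitness[where f'="G 0 \<circ> (\<phi>' \<circ> F 0)"])
         (use FD GD im1 im' i1 i2 GF[OF z] FG[OF z] in auto)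
    show "holomorphic_map_on (G 0 \<circ> (\<phi> \<circ> F 0)) (Dfam 0)"
      by (rule holomorphic_map_on_compose[OF holomorphic_map_on_compose[OF F(1)[OF z] h(1)] G(1)[OF z]]) (use FD im1 in auto)
    show "holomorphic_map_on (G 0 \<circ> (\<phi>' \<circ> F 0)) (Dfam 0)"
      by (rule holomorphic_map_on_compose[OF holomorphic_map_on_compose[OF F(1)[OF z] h(2)] G(1)[OF z]]) (use FD im' in auto)
  qed (use FD GD im1 im' i1 i2 GF[OF z] FG[OF z] in auto)
  then have "(G 0 \<circ> (\<phi> \<circ> F 0)) (G 0 y) = G 0 y"
    using triv GD[OF y(1)] unfolding trivial_Aut_def by blast
  then have "G 0 (\<phi> y) = G 0 y" using FG[OF z y(1)] by simp
  then have "\<phi> y = y" using FG[OF z y(1)] FG[OF z im1[OF y(1)]] by metis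
  then show False using y(2) by simp
qed

section \<open>Equicontinuity up to the boundary\<close>

lemma equicontinuity:
  assumes t0: "t0 \<in> {0..1}" and T: "T \<subseteq> {0..1}" and dc: "depth_control T t0"
  obtains \<delta> where "\<delta> > 0" "\<And>\<epsilon>. \<epsilon> > 0 \<Longrightarrow> \<exists>d>0. \<forall>t\<in>T. \<bar>t - t0\<bar> < \<delta> \<longrightarrow>
     (\<forall>x\<in>D0. \<forall>y\<in>D0. norm (x - y) < d \<longrightarrow> norm (F t (\<Gamma> t x) - F t (\<Gamma> t y)) < \<epsilon>)"
proof -
  obtain c C r R \<delta>1 where c: "c > 0" "C > 0" "r > 0" "\<delta>1 > 0" and S: "\<And>t. t \<in> {0..1} \<Longrightarrow> \<bar>t - t0\<bar> < \<delta>1 \<Longrightarrow> spsc_dom (Dfam t) c C r R"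
    using P.uniform_spsc_dom[OF t0 spsc[OF t0]] by metis
  obtain c' C' r' R' \<delta>2 where c': "c' > 0" "C' > 0" "r' > 0" "\<delta>2 > 0" and S': "\<And>t. t \<in> {0..1} \<Longrightarrow> \<bar>t - t0\<bar> < \<delta>2 \<Longrightarrow> spsc_dom (Dtfam t) c' C' r' R'"
    using P'.uniform_spsc_dom[OF t0 spsc'[OF t0]] by metis
  define \<rho> where "\<rho> = min (r'/2) (c' / (2 * C'))"
  have \<rho>: "\<rho> > 0" "\<rho> \<le> r'/2" "\<rho> \<le> c' / (2 * C')" using c' unfolding \<rho>_def by (auto intro: min.cobounded1 min.cobounded2)
  obtain \<eta>0 \<delta>3 where \<eta>0: "\<eta>0 > 0" "\<delta>3 > 0" and K0: "\<And>t x. t \<in> T \<Longrightarrow> \<bar>t - t0\<bar> < \<delta>3 \<Longrightarrow> x \<in> Dtfam t \<Longrightarrow> \<rho>/2 \<le> dep (Dtfam t) x \<Longrightarrow> \<eta>0 \<le> dep (Dfam t) (G t x)"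
    using dc[unfolded depth_control_def, rule_format, of "\<rho>/2"] \<rho>(1) by auto
  \<comment> \<open>Lowered below \<open>r\<close>, as \<open>gradient_estimate\<close> requires;
    depth control persists for smaller \<eta>.\<close>
  define \<eta> where "\<eta> = min \<eta>0 (r/2)"
  have \<eta>: "\<eta> > 0" "\<eta> < r" "\<eta> \<le> \<eta>0" using \<eta>0 c by (auto simp: \<eta>_def)
  obtain K where K: "\<And>(D::(complex^'n) set) (D'::(complex^'n) set) F G z L v. \<lbrakk>spsc_dom D c C r R; spsc_dom D' c' C' r' R';
      holomorphic_map_on F D; holomorphic_map_on G D'; F ` D \<subseteq> D'; G ` D' \<subseteq> D; \<forall>z\<in>D. G (F z) = z;
      \<forall>x\<in>D'. \<rho>/2 \<le> dep D' x \<longrightarrow> \<eta> \<le> dep D (G x); z \<in> D; (F has_derivative L) (at z)\<rbrakk>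
      \<Longrightarrow> norm (L v) \<le> K * norm v / sqrt (dep D z)"
    using gradient_estimate[OF c(1,3) c'(1,3) \<eta>(1,2) \<rho>, where 'n='n] by blast
  obtain m \<delta>4 where m: "m > 0" "\<delta>4 > 0" and lo: "\<And>t x y. t \<in> {0..1} \<Longrightarrow> \<bar>t - t0\<bar> < \<delta>4 \<Longrightarrow> x \<in> closure D0 \<Longrightarrow> y \<in> closure D0 \<Longrightarrow> m * norm (x - y) \<le> norm (\<Gamma> t x - \<Gamma> t y)"
    using P.Gamma_lower[OF t0] by metis
  obtain b where b: "b > 0" and bb: "\<And>t x. t \<in> {0..1} \<Longrightarrow> x \<in> closure D0 \<Longrightarrow> norm (\<Gamma> t x) \<le> b \<and> norm (D\<Gamma> t x) \<le> b"
    using P.Taylor_bound by metis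
  define K1 where "K1 = (\<bar>K\<bar> + 1) * b / sqrt m"
  have K1: "K1 > 0" using b m by (simp add: K1_def)
  define \<delta> where "\<delta> = min (min \<delta>1 \<delta>2) (min \<delta>3 \<delta>4)"
  have \<delta>: "\<delta> > 0" using c c' \<eta>0 m by (simp add: \<delta>_def)
  have D0dep: "dep D0 x > 0" if "x \<in> D0" for x using dep_pos[OF P.D0_open P.D0_bounded that] .
  have grad: "\<exists>L. ((\<lambda>x. F t (\<Gamma> t x)) has_derivative L) (at x) \<and> (\<forall>h. norm (L h) \<le> K1 / sqrt (dep D0 x) * norm h)"
    if t: "t \<in> T" "\<bar>t - t0\<bar> < \<delta>" and x: "x \<in> D0" for t x
  proof -
    have t1: "t \<in> {0..1}" using t T by blast
    have td: "\<bar>t - t0\<bar> < \<delta>1" "\<bar>t - t0\<bar> < \<delta>2" "\<bar>t - t0\<bar> < \<delta>3" "\<bar>t - t0\<bar> < \<delta>4" using t(2) by (auto simp: \<delta>_def)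
    have xc: "x \<in> closure D0" using x closure_subset by blast
    have zD: "\<Gamma> t x \<in> Dfam t" using x P.Gamma_image_D0[OF t1] by blast
    obtain L where L: "(F t has_derivative L) (at (\<Gamma> t x))"
      using F(1)[OF t1] zD unfolding holomorphic_map_on_def by blast
    have est: "norm (L v) \<le> K * norm v / sqrt (dep (Dfam t) (\<Gamma> t x))" for v
    proof (rule K[OF S[OF t1 td(1)] S'[OF t1 td(2)] F(1)[OF t1] G(1)[OF t1] F(2)[OF t1] G(2)[OF t1] _ _ zD L])
      show "\<forall>z\<in>Dfam t. G t (F t z) = z" using GF[OF t1] by blast
      show "\<forall>x\<in>Dtfam t. \<rho>/2 \<le> dep (Dtfam t) x \<longrightarrow> \<eta> \<le> dep (Dfam t) (G t x)"
        using K0[OF t(1) td(3)] \<eta>(3) order_trans by blast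
    qed
    \<comment> \<open>\<open>\<Gamma> t\<close> maps frontier to frontier and contracts distances by
      at most the factor \<open>m\<close>, so the depths upstairs and downstairs are comparable
      uniformly in \<open>t\<close>.\<close>
    have dd: "m * dep D0 x \<le> dep (Dfam t) (\<Gamma> t x)"
    proof -
      obtain u where u: "u \<in> frontier (Dfam t)" "dist (\<Gamma> t x) u = dep (Dfam t) (\<Gamma> t x)"
        using dep_attained[OF P.Dfam_open[OF t1] P.Dfam_bounded[OF t1] zD] .
      obtain y where y: "y \<in> frontier D0" "u = \<Gamma> t y" using u(1) P.Gamma_image_frontier[OF t1] by blast
      have "y \<notin> D0" "y \<in> closure D0" using y(1) P.D0_open by (auto simp: frontier_def interior_open)
      then have "m * dep D0 x \<le> m * norm (x - y)" using dep_le[of y D0 x] m by (simp add: dist_norm)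
      also have "\<dots> \<le> norm (\<Gamma> t x - \<Gamma> t y)" by (rule lo[OF t1 td(4) xc \<open>y \<in> closure D0\<close>])
      finally show ?thesis using u(2) y(2) by (simp add: dist_norm)
    qed
    have mp: "m * dep D0 x > 0" using m D0dep[OF x] by simp
    have "((\<lambda>x. F t (\<Gamma> t x)) has_derivative (\<lambda>h. L (D\<Gamma> t x h))) (at x)"
      using diff_chain_at[OF P.der[OF t1 x] L] by (simp add: o_def)
    moreover have "norm (L (D\<Gamma> t x h)) \<le> K1 / sqrt (dep D0 x) * norm h" for h
    proof -
      have n1: "norm (D\<Gamma> t x h) \<le> b * norm h"
        using norm_blinfun[of "D\<Gamma> t x" h] bb[OF t1 xc] mult_right_mono[of "norm (D\<Gamma> t x)" b "norm h"] by auto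
      have "norm (L (D\<Gamma> t x h)) \<le> K * norm (D\<Gamma> t x h) / sqrt (dep (Dfam t) (\<Gamma> t x))" by (rule est)
      also have "\<dots> \<le> (\<bar>K\<bar> + 1) * (b * norm h) / sqrt (dep (Dfam t) (\<Gamma> t x))"
      proof (rule divide_right_mono)
        have "K * norm (D\<Gamma> t x h) \<le> (\<bar>K\<bar> + 1) * norm (D\<Gamma> t x h)" by (intro mult_right_mono) auto
        also have "\<dots> \<le> (\<bar>K\<bar> + 1) * (b * norm h)" using n1 by (intro mult_left_mono) auto
        finally show "K * norm (D\<Gamma> t x h) \<le> (\<bar>K\<bar> + 1) * (b * norm h)" .
      qed simp
      also have "\<dots> \<le> (\<bar>K\<bar> + 1) * (b * norm h) / sqrt (m * dep D0 x)"
      proof (rule divide_left_mono)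
        show "sqrt (m * dep D0 x) \<le> sqrt (dep (Dfam t) (\<Gamma> t x))" using dd by simp
        show "0 \<le> (\<bar>K\<bar> + 1) * (b * norm h)" using b by simp
        have "dep (Dfam t) (\<Gamma> t x) > 0" using mp dd by linarith
        then show "0 < sqrt (dep (Dfam t) (\<Gamma> t x)) * sqrt (m * dep D0 x)" using mp by simp
      qed
      also have "\<dots> = K1 / sqrt (dep D0 x) * norm h" by (simp add: K1_def real_sqrt_mult)
      finally show ?thesis .
    qed
    ultimately show ?thesis by blast
  qed
  have s: "0 < s" "s \<le> 1" using P.T by (auto simp: transversal_def)
  have "\<exists>d>0. \<forall>t\<in>T. \<bar>t - t0\<bar> < \<delta> \<longrightarrow> (\<forall>x\<in>D0. \<forall>y\<in>D0. norm (x - y) < d \<longrightarrow> norm (F t (\<Gamma> t x) - F t (\<Gamma> t y)) < \<epsilon>)"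
    if eps: "\<epsilon> > 0" for \<epsilon>
  proof -
    \<comment> \<open>Each descent contributes 2 K1 / sqrt s, from integrating K1 / sqrt (s \<tau>),
      and the crossing contributes K1, all times sqrt (\<open>\<tau>1\<close>).\<close>
    define M where "M = 4 * K1 / sqrt s + K1"
    have M: "M > 0" using K1 s by (simp add: M_def add_pos_pos)
    define \<tau>1 where "\<tau>1 = min s ((\<epsilon> / (2 * M))\<^sup>2)"
    have \<tau>1: "\<tau>1 > 0" "\<tau>1 \<le> s" using s M eps by (auto simp: \<tau>1_def)
    have sq: "M * sqrt \<tau>1 < \<epsilon>"
    proof -
      have "sqrt \<tau>1 \<le> sqrt ((\<epsilon> / (2 * M))\<^sup>2)" unfolding \<tau>1_def real_sqrt_le_iff by (rule min.cobounded2)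
      also have "\<dots> = \<epsilon> / (2 * M)" using eps M by simp
      finally have "M * sqrt \<tau>1 \<le> M * (\<epsilon> / (2 * M))" using M by (intro mult_left_mono) auto
      also have "\<dots> = \<epsilon>/2" using M by simp
      finally show ?thesis using eps by linarith
    qed
    \<comment> \<open>The descended \<open>x\<close> has depth at least \<open>2 * d\<close>, so a
      crossing shorter than \<open>d\<close> stays at depth at least \<open>d\<close>.\<close>
    define d where "d = s * \<tau>1 / 2"
    have d: "d > 0" "d < s"
    proof -
      show "d > 0" using s \<tau>1 by (simp add: d_def)
      have "s * \<tau>1 \<le> s * 1" using s \<tau>1 by (intro mult_left_mono) auto
      then show "d < s" using s by (simp add: d_def)
    qed
    have "norm (F t (\<Gamma> t x) - F t (\<Gamma> t y)) < \<epsilon>"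
      if t: "t \<in> T" "\<bar>t - t0\<bar> < \<delta>" and xy: "x \<in> D0" "y \<in> D0" "norm (x - y) < d" for t x y
    proof -
      define h where "h = (\<lambda>x. F t (\<Gamma> t x))"
      have "\<forall>x\<in>D0. \<exists>L. (h has_derivative L) (at x) \<and> (\<forall>v. norm (L v) \<le> K1 / sqrt (dep D0 x) * norm v)"
        using grad[OF t] unfolding h_def by blast
      then obtain L where L: "\<And>x. x \<in> D0 \<Longrightarrow> (h has_derivative L x) (at x)"
        and nL: "\<And>x v. x \<in> D0 \<Longrightarrow> norm (L x v) \<le> K1 / sqrt (dep D0 x) * norm v" by metis
      have xc: "x \<in> closure D0" "y \<in> closure D0" using xy closure_subset by blast+
      \<comment> \<open>The direction attached to \<open>x\<close> serves \<open>y\<close> as well,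
        because \<open>d < s\<close>.\<close>
      obtain n where n: "norm n = 1" and N: "\<And>z \<tau>. z \<in> closure D0 \<Longrightarrow> z \<in> ball x s \<Longrightarrow> 0 < \<tau> \<Longrightarrow> \<tau> \<le> s \<Longrightarrow> ball (z - \<tau> *\<^sub>R n) (s * \<tau>) \<subseteq> D0"
        using P.T xc(1) unfolding transversal_def by fastforce
      have nU: "D0 \<noteq> UNIV" using P.D0_bounded not_bounded_UNIV by metis
      have deep: "s * \<tau> \<le> dep D0 (z - \<tau> *\<^sub>R n) \<and> z - \<tau> *\<^sub>R n \<in> D0" if "z = x \<or> z = y" "0 < \<tau>" "\<tau> \<le> \<tau>1" for z \<tau>
      proof -
        have zz: "z \<in> closure D0" "z \<in> ball x s"
          using that(1) xc xy(3) d s by (auto simp: dist_norm)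
        have sub: "ball (z - \<tau> *\<^sub>R n) (s * \<tau>) \<subseteq> D0" using N[OF zz that(2)] that(3) \<tau>1(2) by simp
        have "s * \<tau> > 0" using s that by simp
        then show ?thesis using dep_ge_ball[OF sub nU] sub centre_in_ball by blast
      qed
      have down: "norm (h (z - \<tau>1 *\<^sub>R n) - h z) \<le> 2 * K1 / sqrt s * sqrt \<tau>1" if z: "z = x \<or> z = y" for z
      proof -
        have zD: "z - \<tau> *\<^sub>R n \<in> D0" if "0 \<le> \<tau>" "\<tau> \<le> \<tau>1" for \<tau>
          using deep[OF z, of \<tau>] that z xy by (cases "\<tau> = 0") auto
        have l: "((\<lambda>\<tau>. z - \<tau> *\<^sub>R n) has_vector_derivative (- n)) (at \<tau>)" for \<tau>
          by (auto intro!: derivative_eq_intros)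
        have hd: "((\<lambda>\<tau>. h (z - \<tau> *\<^sub>R n)) has_vector_derivative L (z - \<tau> *\<^sub>R n) (- n)) (at \<tau>)" if "0 \<le> \<tau>" "\<tau> \<le> \<tau>1" for \<tau>
        proof -
          note Lz = L[OF zD[OF that]]
          have "((\<lambda>\<tau>. h (z - \<tau> *\<^sub>R n)) has_derivative (\<lambda>a. L (z - \<tau> *\<^sub>R n) (a *\<^sub>R (- n)))) (at \<tau>)"
            using diff_chain_at[OF l[unfolded has_vector_derivative_def] Lz] by (simp add: o_def)
          then show ?thesis
            using linear_scale[OF has_derivative_linear[OF Lz]] by (simp only: has_vector_derivative_def)
        qed
        have "norm (h (z - \<tau>1 *\<^sub>R n) - h (z - 0 *\<^sub>R n)) \<le> 2 * K1 / sqrt s * sqrt \<tau>1 - 2 * K1 / sqrt s * sqrt 0"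
        proof (rule differentiable_bound_general[OF \<tau>1(1), of "\<lambda>\<tau>. h (z - \<tau> *\<^sub>R n)" "\<lambda>\<tau>. 2 * K1 / sqrt s * sqrt \<tau>"
              "\<lambda>\<tau>. L (z - \<tau> *\<^sub>R n) (- n)" "\<lambda>\<tau>. K1 / sqrt (s * \<tau>)"])
          show "continuous_on {0..\<tau>1} (\<lambda>\<tau>. h (z - \<tau> *\<^sub>R n))"
            by (intro continuous_at_imp_continuous_on ballI has_vector_derivative_continuous[OF hd]) auto
          show "continuous_on {0..\<tau>1} (\<lambda>\<tau>. 2 * K1 / sqrt s * sqrt \<tau>)" using s by (intro continuous_intros) auto
          fix \<tau> assume tt: "0 < \<tau>" "\<tau> < \<tau>1"
          show "((\<lambda>\<tau>. h (z - \<tau> *\<^sub>R n)) has_vector_derivative L (z - \<tau> *\<^sub>R n) (- n)) (at \<tau>)" using hd tt by simp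
          have "((\<lambda>\<tau>. 2 * K1 / sqrt s * sqrt \<tau>) has_real_derivative 2 * K1 / sqrt s * (inverse (sqrt \<tau>) / 2)) (at \<tau>)"
            by (rule DERIV_cmult[OF DERIV_real_sqrt[OF tt(1)]])
          moreover have "2 * K1 / sqrt s * (inverse (sqrt \<tau>) / 2) = K1 / sqrt (s * \<tau>)"
            unfolding real_sqrt_mult divide_inverse inverse_mult_distrib by (simp only: mult.assoc mult.left_commute mult.commute) simp
          ultimately show "((\<lambda>\<tau>. 2 * K1 / sqrt s * sqrt \<tau>) has_vector_derivative K1 / sqrt (s * \<tau>)) (at \<tau>)"
            by (simp add: has_real_derivative_iff_has_vector_derivative)
          have dz: "s * \<tau> \<le> dep D0 (z - \<tau> *\<^sub>R n)" using deep[OF z tt(1)] tt by simp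
          have "norm (L (z - \<tau> *\<^sub>R n) (- n)) \<le> K1 / sqrt (dep D0 (z - \<tau> *\<^sub>R n)) * norm (- n)"
            using nL[OF zD] tt less_imp_le by metis
          also have "\<dots> \<le> K1 / sqrt (s * \<tau>)"
          proof -
            have sp: "0 < sqrt (s * \<tau>)" using s tt by simp
            have "sqrt (s * \<tau>) \<le> sqrt (dep D0 (z - \<tau> *\<^sub>R n))" using dz by simp
            then show ?thesis using n K1 sp by (simp add: frac_le)
          qed
          finally show "norm (L (z - \<tau> *\<^sub>R n) (- n)) \<le> K1 / sqrt (s * \<tau>)" .
        qed
        then show ?thesis by simp
      qed
      define x' where "x' = x - \<tau>1 *\<^sub>R n"
      define y' where "y' = y - \<tau>1 *\<^sub>R n"
      have x'd: "s * \<tau>1 \<le> dep D0 x'" using deep[of x \<tau>1] \<tau>1 by (simp add: x'_def)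
      have mid: "norm (h x' - h y') \<le> K1 / sqrt d * norm (x' - y')"
      proof (rule differentiable_bound[OF convex_closed_segment[of y' x'], where f'=L])
        have segD: "dep D0 z \<ge> d \<and> z \<in> D0" if z: "z \<in> closed_segment y' x'" for z
        proof -
          have "dist x' z \<le> dist y' x'" using dist_in_closed_segment[OF z] by (simp add: dist_commute)
          also have "\<dots> < d" using xy(3) by (simp add: x'_def y'_def dist_norm norm_minus_commute)
          finally have dz: "dist x' z < d" .
          have "dep D0 z \<ge> d" using x'd dz dep_lipschitz[of D0 x' z] by (simp add: d_def)
          moreover have "z \<in> ball x' (dep D0 x')" using dz x'd d by (simp add: d_def)
          ultimately show ?thesis using ball_dep_subset by blast
        qed
        show "(h has_derivative L z) (at z within closed_segment y' x')" if "z \<in> closed_segment y' x'" for z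
          using L segD[OF that] has_derivative_at_withinI by blast
        show "onorm (L z) \<le> K1 / sqrt d" if "z \<in> closed_segment y' x'" for z
        proof (rule onorm_le)
          fix v
          have "norm (L z v) \<le> K1 / sqrt (dep D0 z) * norm v" using nL segD[OF that] by blast
          also have "\<dots> \<le> K1 / sqrt d * norm v"
            using segD[OF that] K1 d by (intro mult_right_mono frac_le) auto
          finally show "norm (L z v) \<le> K1 / sqrt d * norm v" .
        qed
      qed auto
      have "norm (x' - y') < d" using xy(3) by (simp add: x'_def y'_def)
      then have "K1 / sqrt d * norm (x' - y') \<le> K1 / sqrt d * d" using K1 d by (intro mult_left_mono) auto
      also have "\<dots> = K1 * (d / sqrt d)" by simp
      also have "\<dots> = K1 * sqrt d" using d by (simp only: real_div_sqrt less_imp_le)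
      also have "\<dots> \<le> K1 * sqrt \<tau>1"
      proof -
        have "s * \<tau>1 \<le> 1 * \<tau>1" using s \<tau>1 by (intro mult_right_mono) auto
        then have "d \<le> \<tau>1" using \<tau>1 by (simp add: d_def)
        then show ?thesis using K1 by simp
      qed
      finally have mid': "norm (h x' - h y') \<le> K1 * sqrt \<tau>1" using mid by linarith
      have "h x - h y = - (h x' - h x) + (h x' - h y') + (h y' - h y)" by simp
      also have "norm \<dots> \<le> norm (h x' - h x) + norm (h x' - h y') + norm (h y' - h y)"
        using norm_triangle_ineq[of "- (h x' - h x) + (h x' - h y')" "h y' - h y"] norm_triangle_ineq[of "- (h x' - h x)" "h x' - h y'"]
        unfolding norm_minus_cancel by linarith
      also have "\<dots> \<le> 2 * K1 / sqrt s * sqrt \<tau>1 + K1 * sqrt \<tau>1 + 2 * K1 / sqrt s * sqrt \<tau>1"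
        using down[of x] down[of y] mid' unfolding x'_def y'_def by simp
      also have "\<dots> = M * sqrt \<tau>1" by (simp add: M_def algebra_simps)
      finally show ?thesis using sq by (simp add: h_def)
    qed
    then show ?thesis using d(1) by blast
  qed
  with \<delta> show thesis using that by blast
qed

end

context biholo_families
begin

text \<open>The lower Lipschitz bound for \<open>\<Gamma> t\<close> turns equicontinuity in the
  parameter domain into uniform continuity on \<open>Dfam t\<close> itself.\<close>

lemma uniformly_continuous:
  assumes t: "t \<in> {0..1}"
  shows "uniformly_continuous_on (Dfam t) (F t)"
proof -
  have tt: "{t} \<subseteq> {0..1}" using t by simp
  obtain \<delta> where \<delta>: "\<delta> > 0" and eq: "\<And>\<epsilon>. \<epsilon> > 0 \<Longrightarrow> \<exists>d>0. \<forall>t'\<in>{t}. \<bar>t' - t\<bar> < \<delta> \<longrightarrow>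
     (\<forall>x\<in>D0. \<forall>y\<in>D0. norm (x - y) < d \<longrightarrow> norm (F t' (\<Gamma> t' x) - F t' (\<Gamma> t' y)) < \<epsilon>)"
    by (rule equicontinuity[OF t tt depth_control_single[OF t]], rule that) blast+
  obtain m where m: "m > 0" and lo: "\<And>x y. x \<in> closure D0 \<Longrightarrow> y \<in> closure D0 \<Longrightarrow> m * norm (x - y) \<le> norm (\<Gamma> t x - \<Gamma> t y)"
    using P.Gamma_lower_at[OF t] by blast
  show ?thesis
    unfolding uniformly_continuous_on_def
  proof (intro allI impI)
    fix \<epsilon> :: real assume "\<epsilon> > 0"
    then obtain d where d: "d > 0" and ne: "\<And>x y. x \<in> D0 \<Longrightarrow> y \<in> D0 \<Longrightarrow> norm (x - y) < d \<Longrightarrow> norm (F t (\<Gamma> t x) - F t (\<Gamma> t y)) < \<epsilon>"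
      using eq[of \<epsilon>] \<delta> by auto
    have "dist (F t w') (F t w) < \<epsilon>" if w: "w \<in> Dfam t" "w' \<in> Dfam t" "dist w' w < m * d" for w w'
    proof -
      obtain x where x: "x \<in> D0" "w = \<Gamma> t x" using w(1) P.Gamma_image_D0[OF t] by blast
      obtain y where y: "y \<in> D0" "w' = \<Gamma> t y" using w(2) P.Gamma_image_D0[OF t] by blast
      have "x \<in> closure D0" "y \<in> closure D0" using x y closure_subset by blast+
      then have "m * norm (y - x) \<le> dist w' w" using lo[of y x] x y by (simp add: dist_norm)
      then have "m * norm (y - x) < m * d" using w(3) by linarith
      then have "norm (y - x) < d" using m by simp
      then show ?thesis using ne[OF y(1) x(1)] x y by (simp add: dist_norm)
    qed
    moreover have "m * d > 0" using m d by simp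
    ultimately show "\<exists>d>0. \<forall>x\<in>Dfam t. \<forall>x'\<in>Dfam t. dist x' x < d \<longrightarrow> dist (F t x') (F t x) < \<epsilon>" by blast
  qed
qed

text \<open>The limits \<open>H\<close> of the maps and \<open>K\<close> of their inverses a priori
  take values in closures. Depth control puts \<open>K w0\<close> inside; peak functions then keep
  \<open>K\<close> inside, and \<open>H\<close> too since \<open>H (K w0) = w0\<close>. So
  \<open>H\<close> and \<open>K\<close> are mutually inverse, and \<open>G 0 \<circ> H\<close> is an
  automorphism of \<open>Dfam 0\<close>. Moving points \<open>u\<close> are allowed because
  \<open>\<Gamma> t y\<close> moves with \<open>t\<close>.\<close>

lemma tendsto_subsequence:
  assumes triv: "trivial_Aut (Dfam 0)" and t: "\<And>j. t j \<in> {0..1}" "t \<longlonglongrightarrow> 0"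
  obtains k where "strict_mono k" "\<And>z u. z \<in> Dfam 0 \<Longrightarrow> u \<longlonglongrightarrow> z \<Longrightarrow> (\<lambda>j. F (t (k j)) (u j)) \<longlonglongrightarrow> F 0 z"
proof -
  have z: "(0::real) \<in> {0..1}" by simp
  obtain R where R: "\<And>t. t \<in> {0..1} \<Longrightarrow> Dfam t \<subseteq> ball 0 R" using P.Dfam_uniform_bound by metis
  obtain R' where R': "\<And>t. t \<in> {0..1} \<Longrightarrow> Dtfam t \<subseteq> ball 0 R'" using P'.Dfam_uniform_bound by metis
  have "evt_holo_bdd (\<lambda>j. F (t j)) (Dfam 0)"
    unfolding evt_holo_bdd_def
  proof
    fix x assume "x \<in> Dfam 0"
    then obtain s where s: "s > 0" "\<forall>\<^sub>F j in sequentially. ball x s \<subseteq> Dfam (t j)" using P.Dfam_inner[OF t z] by blast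
    then obtain J where J: "\<And>j. j \<ge> J \<Longrightarrow> ball x s \<subseteq> Dfam (t j)" unfolding eventually_sequentially by blast
    have "holomorphic_map_on (F (t j)) (ball x s) \<and> (\<forall>y\<in>ball x s. norm (F (t j) y) \<le> R')" if "j \<ge> J" for j
    proof (intro conjI ballI)
      show "holomorphic_map_on (F (t j)) (ball x s)" by (rule holomorphic_map_on_subset[OF F(1)[OF t(1)] J[OF that]])
      fix y assume "y \<in> ball x s"
      then have "F (t j) y \<in> ball 0 R'" using J[OF that] F(2)[OF t(1)] R'[OF t(1)] by blast
      then show "norm (F (t j) y) \<le> R'" by simp
    qed
    then show "\<exists>s>0. \<exists>M J. \<forall>j\<ge>J. holomorphic_map_on (F (t j)) (ball x s) \<and> (\<forall>y\<in>ball x s. norm (F (t j) y) \<le> M)"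
      using s(1) by blast
  qed
  then obtain k1 H where k1: "strict_mono k1" and H: "holomorphic_map_on H (Dfam 0)" and l1: "lconv (\<lambda>j. F (t (k1 j))) H (Dfam 0)"
    by (rule Montel_subsequence)
  have "evt_holo_bdd (\<lambda>j. G (t j)) (Dtfam 0)"
    unfolding evt_holo_bdd_def
  proof
    fix x assume "x \<in> Dtfam 0"
    then obtain s where s: "s > 0" "\<forall>\<^sub>F j in sequentially. ball x s \<subseteq> Dtfam (t j)" using P'.Dfam_inner[OF t z] by blast
    then obtain J where J: "\<And>j. j \<ge> J \<Longrightarrow> ball x s \<subseteq> Dtfam (t j)" unfolding eventually_sequentially by blast
    have "holomorphic_map_on (G (t j)) (ball x s) \<and> (\<forall>y\<in>ball x s. norm (G (t j) y) \<le> R)" if "j \<ge> J" for j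
    proof (intro conjI ballI)
      show "holomorphic_map_on (G (t j)) (ball x s)" by (rule holomorphic_map_on_subset[OF G(1)[OF t(1)] J[OF that]])
      fix y assume "y \<in> ball x s"
      then have "G (t j) y \<in> ball 0 R" using J[OF that] G(2)[OF t(1)] R[OF t(1)] by blast
      then show "norm (G (t j) y) \<le> R" by simp
    qed
    then show "\<exists>s>0. \<exists>M J. \<forall>j\<ge>J. holomorphic_map_on (G (t j)) (ball x s) \<and> (\<forall>y\<in>ball x s. norm (G (t j) y) \<le> M)"
      using s(1) by blast
  qed
  from evt_holo_bdd_subseq[OF this k1]
  obtain k2 K where k2: "strict_mono k2" and K: "holomorphic_map_on K (Dtfam 0)" and l2: "lconv (\<lambda>j. G (t (k1 (k2 j)))) K (Dtfam 0)"
    by (rule Montel_subsequence)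
  define k where "k = k1 \<circ> k2"
  have k: "strict_mono k" unfolding k_def by (rule strict_mono_o[OF k1 k2])
  define \<tau> where "\<tau> j = t (k j)" for j
  have \<tau>: "\<And>j. \<tau> j \<in> {0..1}" "\<tau> \<longlonglongrightarrow> 0" using t(1) LIMSEQ_subseq_LIMSEQ[OF t(2) k] by (simp_all add: \<tau>_def[abs_def] o_def)
  have lF: "lconv (\<lambda>j. F (\<tau> j)) H (Dfam 0)" using lconv_subseq[OF l1 k2] by (simp add: \<tau>_def k_def)
  have lG: "lconv (\<lambda>j. G (\<tau> j)) K (Dtfam 0)" using l2 by (simp add: \<tau>_def k_def)
  have o: "open (Dfam 0)" "open (Dtfam 0)" "connected (Dfam 0)" "connected (Dtfam 0)"
    using P.Dfam_open[OF z] P'.Dfam_open[OF z] P.Dfam_connected[OF z] P'.Dfam_connected[OF z] .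
  have cH: "continuous (at x) H" if "x \<in> Dfam 0" for x
    using holomorphic_map_on_continuous[OF H] o(1) that by (simp add: continuous_on_eq_continuous_at)
  have cK: "continuous (at x) K" if "x \<in> Dtfam 0" for x
    using holomorphic_map_on_continuous[OF K] o(2) that by (simp add: continuous_on_eq_continuous_at)
  have limF: "(\<lambda>j. F (\<tau> j) (u j)) \<longlonglongrightarrow> H x" if "x \<in> Dfam 0" "u \<longlonglongrightarrow> x" for x u
    by (rule lconv_tendsto_at[OF lF that(1) cH[OF that(1)] that(2)])
  have limG: "(\<lambda>j. G (\<tau> j) (u j)) \<longlonglongrightarrow> K x" if "x \<in> Dtfam 0" "u \<longlonglongrightarrow> x" for x u
    by (rule lconv_tendsto_at[OF lG that(1) cK[OF that(1)] that(2)])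
  have inF: "\<forall>\<^sub>F j in sequentially. x \<in> Dfam (\<tau> j)" if "x \<in> Dfam 0" for x
  proof -
    obtain s where s: "s > 0" "\<forall>\<^sub>F j in sequentially. ball x s \<subseteq> Dfam (\<tau> j)" using P.Dfam_inner[OF \<tau> z \<open>x \<in> Dfam 0\<close>] by blast
    show ?thesis using s(2) by eventually_elim (use s(1) in auto)
  qed
  have inG: "\<exists>s>0. \<forall>\<^sub>F j in sequentially. x \<in> Dtfam (\<tau> j) \<and> s \<le> dep (Dtfam (\<tau> j)) x" if "x \<in> Dtfam 0" for x
  proof -
    obtain s where s: "s > 0" "\<forall>\<^sub>F j in sequentially. ball x s \<subseteq> Dtfam (\<tau> j)" using P'.Dfam_inner[OF \<tau> z \<open>x \<in> Dtfam 0\<close>] by blast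
    have nU: "Dtfam (\<tau> j) \<noteq> UNIV" for j using P'.Dfam_bounded[OF \<tau>(1)] not_bounded_UNIV by metis
    have "\<forall>\<^sub>F j in sequentially. x \<in> Dtfam (\<tau> j) \<and> s \<le> dep (Dtfam (\<tau> j)) x"
      using s(2) by eventually_elim (use s(1) dep_ge_ball[OF _ nU] in auto)
    then show ?thesis using s(1) by blast
  qed
  have Hcl: "H x \<in> closure (Dtfam 0)" if "x \<in> Dfam 0" for x
  proof (rule P'.Dfam_outer[OF \<tau> z _ limF[OF that tendsto_const]])
    show "\<forall>\<^sub>F j in sequentially. F (\<tau> j) x \<in> Dtfam (\<tau> j)"
      using inF[OF that] by eventually_elim (use F(2)[OF \<tau>(1)] in blast)
  qed
  have Kcl: "K x \<in> closure (Dfam 0)" if x: "x \<in> Dtfam 0" for x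
  proof (rule P.Dfam_outer[OF \<tau> z _ limG[OF x tendsto_const]])
    obtain s where "\<forall>\<^sub>F j in sequentially. x \<in> Dtfam (\<tau> j) \<and> s \<le> dep (Dtfam (\<tau> j)) x" using inG[OF x] by blast
    then show "\<forall>\<^sub>F j in sequentially. G (\<tau> j) x \<in> Dfam (\<tau> j)"
      by eventually_elim (use G(2)[OF \<tau>(1)] in blast)
  qed
  have HK: "H (K w) = w" if w: "w \<in> Dtfam 0" and Kw: "K w \<in> Dfam 0" for w
  proof -
    obtain s where s: "\<forall>\<^sub>F j in sequentially. w \<in> Dtfam (\<tau> j) \<and> s \<le> dep (Dtfam (\<tau> j)) w" using inG[OF w] by blast
    have "(\<lambda>j. F (\<tau> j) (G (\<tau> j) w)) \<longlonglongrightarrow> H (K w)" by (rule limF[OF Kw limG[OF w tendsto_const]])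
    moreover have "\<forall>\<^sub>F j in sequentially. F (\<tau> j) (G (\<tau> j) w) = w"
      using s by eventually_elim (use FG[OF \<tau>(1)] in blast)
    then have "(\<lambda>j. F (\<tau> j) (G (\<tau> j) w)) \<longlonglongrightarrow> w" by (rule tendsto_eventually)
    ultimately show ?thesis by (rule LIMSEQ_unique)
  qed
  have KH: "K (H x) = x" if x: "x \<in> Dfam 0" and Hx: "H x \<in> Dtfam 0" for x
  proof -
    have "(\<lambda>j. G (\<tau> j) (F (\<tau> j) x)) \<longlonglongrightarrow> K (H x)" by (rule limG[OF Hx limF[OF x tendsto_const]])
    moreover have "\<forall>\<^sub>F j in sequentially. G (\<tau> j) (F (\<tau> j) x) = x"
      using inF[OF x] by eventually_elim (use GF[OF \<tau>(1)] in blast)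
    then have "(\<lambda>j. G (\<tau> j) (F (\<tau> j) x)) \<longlonglongrightarrow> x" by (rule tendsto_eventually)
    ultimately show ?thesis by (rule LIMSEQ_unique)
  qed
  obtain w0 where w0: "w0 \<in> Dtfam 0" using P'.Dfam_ne[OF z] by blast
  have Kw0: "K w0 \<in> Dfam 0"
  proof -
    obtain s where s: "s > 0" "\<forall>\<^sub>F j in sequentially. w0 \<in> Dtfam (\<tau> j) \<and> s \<le> dep (Dtfam (\<tau> j)) w0" using inG[OF w0] by blast
    obtain \<eta> \<delta> where \<eta>: "\<eta> > 0" "\<delta> > 0" and dc: "\<And>t x. t \<in> {0..1} \<Longrightarrow> \<bar>t - 0\<bar> < \<delta> \<Longrightarrow> x \<in> Dtfam t \<Longrightarrow> s \<le> dep (Dtfam t) x \<Longrightarrow> \<eta> \<le> dep (Dfam t) (G t x)"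
      using depth_control_zero[OF triv, unfolded depth_control_def, rule_format, OF s(1)] by blast
    have "\<forall>\<^sub>F j in sequentially. \<bar>\<tau> j - 0\<bar> < \<delta>" using tendstoD[OF \<tau>(2) \<eta>(2)] by (simp add: dist_real_def)
    then have "\<forall>\<^sub>F j in sequentially. G (\<tau> j) w0 \<in> Dfam (\<tau> j) \<and> \<eta> \<le> dep (Dfam (\<tau> j)) (G (\<tau> j) w0)"
      using s(2) by eventually_elim (use dc[OF \<tau>(1)] G(2)[OF \<tau>(1)] in blast)
    then show ?thesis by (rule P.Dfam_deep_limit[OF \<tau> z _ limG[OF w0 tendsto_const] \<eta>(1)])
  qed
  obtain c C r \<rho> \<delta> where \<delta>: "\<delta> > 0" and S: "\<And>t. t \<in> {0..1} \<Longrightarrow> \<bar>t - 0\<bar> < \<delta> \<Longrightarrow> spsc_dom (Dfam t) c C r \<rho>"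
    using P.uniform_spsc_dom[OF z spsc[OF z]] by metis
  obtain c' C' r' \<rho>' \<delta>' where \<delta>': "\<delta>' > 0" and S': "\<And>t. t \<in> {0..1} \<Longrightarrow> \<bar>t - 0\<bar> < \<delta>' \<Longrightarrow> spsc_dom (Dtfam t) c' C' r' \<rho>'"
    using P'.uniform_spsc_dom[OF z spsc'[OF z]] by metis
  have S0: "Dfam 0 \<subseteq> ball 0 \<rho>" "c > 0" "r > 0" "\<And>q. q \<in> frontier (Dfam 0) \<Longrightarrow> \<exists>g B. spsc_at (Dfam 0) q g B c C (c/8) r"
    using S[OF z] \<delta> unfolding spsc_dom_def by simp_all
  have S0': "Dtfam 0 \<subseteq> ball 0 \<rho>'" "c' > 0" "r' > 0" "\<And>q. q \<in> frontier (Dtfam 0) \<Longrightarrow> \<exists>g B. spsc_at (Dtfam 0) q g B c' C' (c'/8) r'"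
    using S'[OF z] \<delta>' unfolding spsc_dom_def by simp_all
  have KD: "K w \<in> Dfam 0" if "w \<in> Dtfam 0" for w
    by (rule holomorphic_map_stays_in_spsc[OF K o(2,4,1) S0(2,3,4) Kcl w0 Kw0 that])
  have HD: "H x \<in> Dtfam 0" if "x \<in> Dfam 0" for x
    by (rule holomorphic_map_stays_in_spsc[OF H o(1,3,2) S0'(2,3,4) Hcl Kw0 _ that]) (use HK[OF w0 Kw0] w0 in auto)
  have FD: "F 0 x \<in> Dtfam 0" if "x \<in> Dfam 0" for x using F(2)[OF z] that by blast
  have GD: "G 0 w \<in> Dfam 0" if "w \<in> Dtfam 0" for w using G(2)[OF z] that by blast
  have "biholomorphism (G 0 \<circ> H) (Dfam 0) (Dfam 0)"
    unfolding biholomorphism_def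
  proof (intro conjI exI[of _ "K \<circ> F 0"] ballI)
    show "bij_betw (G 0 \<circ> H) (Dfam 0) (Dfam 0)"
      by (rule bij_betw_byWitness[where f'="K \<circ> F 0"])
         (use FD GD HD KD GF[OF z] FG[OF z] HK KH in auto)
    show "holomorphic_map_on (G 0 \<circ> H) (Dfam 0)"
      by (rule holomorphic_map_on_compose[OF H G(1)[OF z]]) (use HD in auto)
    show "holomorphic_map_on (K \<circ> F 0) (Dfam 0)"
      by (rule holomorphic_map_on_compose[OF F(1)[OF z] K]) (use FD in auto)
  qed (use FD GD HD KD GF[OF z] FG[OF z] HK KH in auto)
  then have "G 0 (H x) = x" if "x \<in> Dfam 0" for x using triv that unfolding trivial_Aut_def by force
  then have eq: "H x = F 0 x" if "x \<in> Dfam 0" for x using FG[OF z HD[OF that]] that by metis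
  show thesis
  proof (rule that[OF k])
    fix x u assume x: "x \<in> Dfam 0" "u \<longlonglongrightarrow> x"
    show "(\<lambda>j. F (t (k j)) (u j)) \<longlonglongrightarrow> F 0 x" using limF[OF x] eq[OF x(1)] by (simp add: \<tau>_def)
  qed
qed

text \<open>By continuity of the extensions a violation on \<open>closure D0\<close> yields one in
  \<open>D0\<close> with \<epsilon> halved, so that only \<open>F\<close> has to be estimated. Near
  an accumulation point of such violations one fixed interior \<open>y\<close> is compared with them
  by equicontinuity, both at \<open>t\<close> and at 0, and \<open>tendsto_subsequence\<close>
  settles \<open>y\<close>.\<close>

theorem uniform_convergence:
  assumes triv: "trivial_Aut (Dfam 0)"
    and ext: "\<And>t. t \<in> {0..1} \<Longrightarrow> continuous_on (closure (Dfam t)) (Fbar t)"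
      "\<And>t z. t \<in> {0..1} \<Longrightarrow> z \<in> Dfam t \<Longrightarrow> Fbar t z = F t z"
    and eps: "\<epsilon> > 0"
  shows "\<exists>\<delta>>0. \<forall>t\<in>{0..1}. t < \<delta> \<longrightarrow> (\<forall>x\<in>closure D0. dist (Fbar t (\<Gamma> t x)) (Fbar 0 (\<Gamma> 0 x)) < \<epsilon>)"
proof (rule ccontr)
  assume no: "\<not> ?thesis"
  have z: "(0::real) \<in> {0..1}" by simp
  have cont: "continuous_on (closure D0) (\<lambda>x. Fbar t (\<Gamma> t x))" if t: "t \<in> {0..1}" for t
    by (rule continuous_on_compose2[OF ext(1)[OF t] P.cont_slice[OF P.cont t]]) (use P.img t in auto)
  have "\<exists>t x. t \<in> {0..1} \<and> t < inverse (real (Suc n)) \<and> x \<in> D0 \<and> \<epsilon>/2 < dist (F t (\<Gamma> t x)) (F 0 (\<Gamma> 0 x))" for n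
  proof -
    have "inverse (real (Suc n)) > 0" by simp
    then obtain t x where t: "t \<in> {0..1}" "t < inverse (real (Suc n))" and x: "x \<in> closure D0"
      and far: "\<not> dist (Fbar t (\<Gamma> t x)) (Fbar 0 (\<Gamma> 0 x)) < \<epsilon>" using no by blast
    have "\<exists>y\<in>D0. \<epsilon>/2 < dist (Fbar t (\<Gamma> t y)) (Fbar 0 (\<Gamma> 0 y))"
    proof (rule ccontr)
      assume "\<not> ?thesis"
      then have le: "dist (Fbar t (\<Gamma> t y)) (Fbar 0 (\<Gamma> 0 y)) \<le> \<epsilon>/2" if "y \<in> D0" for y using that by force
      have "dist (Fbar t (\<Gamma> t x)) (Fbar 0 (\<Gamma> 0 x)) \<le> \<epsilon>/2"
        by (rule continuous_le_on_closure[OF continuous_on_dist[OF cont[OF t(1)] cont[OF z]] x le])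
      then show False using far eps by linarith
    qed
    then obtain y where y: "y \<in> D0" "\<epsilon>/2 < dist (Fbar t (\<Gamma> t y)) (Fbar 0 (\<Gamma> 0 y))" by blast
    have "\<Gamma> t y \<in> Dfam t" "\<Gamma> 0 y \<in> Dfam 0" using y(1) P.Gamma_image_D0[OF t(1)] P.Gamma_image_D0[OF z] by blast+
    then show ?thesis using t y ext(2)[OF t(1)] ext(2)[OF z] by auto
  qed
  then obtain t x where t: "\<And>n. t n \<in> {0..1}" and tn: "\<And>n. t n < inverse (real (Suc n))" and x: "\<And>n. x n \<in> D0"
    and far: "\<And>n. \<epsilon>/2 < dist (F (t n) (\<Gamma> (t n) (x n))) (F 0 (\<Gamma> 0 (x n)))" by metis
  have t0: "t \<longlonglongrightarrow> 0"
    by (rule Lim_null_comparison[OF _ LIMSEQ_inverse_real_of_nat]) (use t tn in \<open>auto intro!: always_eventually less_imp_le\<close>)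
  obtain k where k: "strict_mono k" and limF: "\<And>z u. z \<in> Dfam 0 \<Longrightarrow> u \<longlonglongrightarrow> z \<Longrightarrow> (\<lambda>j. F (t (k j)) (u j)) \<longlonglongrightarrow> F 0 z"
    by (rule tendsto_subsequence[OF triv t t0], rule that) blast+
  have "\<forall>n. x (k n) \<in> closure D0" using x closure_subset[of D0] by blast
  then obtain p l where p: "p \<in> closure D0" and l: "strict_mono l" "((\<lambda>n. x (k n)) \<circ> l) \<longlonglongrightarrow> p"
    using P.compact_closure_D0 unfolding compact_def by metis
  obtain \<delta> where \<delta>: "\<delta> > 0" and eq: "\<And>\<epsilon>. \<epsilon> > 0 \<Longrightarrow> \<exists>d>0. \<forall>t\<in>{0..1}. \<bar>t - 0\<bar> < \<delta> \<longrightarrow>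
     (\<forall>x\<in>D0. \<forall>y\<in>D0. norm (x - y) < d \<longrightarrow> norm (F t (\<Gamma> t x) - F t (\<Gamma> t y)) < \<epsilon>)"
    by (rule equicontinuity[OF z subset_refl depth_control_zero[OF triv]], rule that) blast+
  \<comment> \<open>Three errors of this size stay below the gap \<epsilon>/2.\<close>
  have e6: "\<epsilon>/6 > 0" using eps by simp
  obtain d where d: "d > 0" and ne: "\<And>t x y. t \<in> {0..1} \<Longrightarrow> \<bar>t - 0\<bar> < \<delta> \<Longrightarrow> x \<in> D0 \<Longrightarrow> y \<in> D0 \<Longrightarrow> norm (x - y) < d
      \<Longrightarrow> norm (F t (\<Gamma> t x) - F t (\<Gamma> t y)) < \<epsilon>/6"
    using eq[OF e6] by blast
  have "d/2 > 0" using d by simp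
  then obtain y where y: "y \<in> D0" "dist y p < d/2" using p unfolding closure_approachable by blast
  have yc: "y \<in> closure D0" using y(1) closure_subset by blast
  have gy: "(\<lambda>j. \<Gamma> (t (k j)) y) \<longlonglongrightarrow> \<Gamma> 0 y"
  proof (rule tendstoI)
    fix e :: real assume e: "e > 0"
    then have "e/2 > 0" by simp
    then obtain \<delta>1 where \<delta>1: "\<delta>1 > 0" and n: "\<And>t x. t \<in> {0..1} \<Longrightarrow> \<bar>t - 0\<bar> < \<delta>1 \<Longrightarrow> x \<in> closure D0 \<Longrightarrow> norm (\<Gamma> t x - \<Gamma> 0 x) \<le> e/2"
      using P.near_t[OF z] by metis
    have "\<forall>\<^sub>F j in sequentially. \<bar>t (k j) - 0\<bar> < \<delta>1"
      using tendstoD[OF LIMSEQ_subseq_LIMSEQ[OF t0 k] \<delta>1] by (simp add: dist_real_def)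
    then show "\<forall>\<^sub>F j in sequentially. dist (\<Gamma> (t (k j)) y) (\<Gamma> 0 y) < e"
    proof eventually_elim
      case (elim j)
      show ?case using n[OF t elim yc] e by (simp add: dist_norm)
    qed
  qed
  have "\<Gamma> 0 y \<in> Dfam 0" using y(1) P.Gamma_image_D0[OF z] by blast
  then have Fy: "(\<lambda>j. F (t (k j)) (\<Gamma> (t (k j)) y)) \<longlonglongrightarrow> F 0 (\<Gamma> 0 y)" using gy by (rule limF)
  have ev1: "\<forall>\<^sub>F j in sequentially. dist (F (t (k (l j))) (\<Gamma> (t (k (l j))) y)) (F 0 (\<Gamma> 0 y)) < \<epsilon>/6"
    using tendstoD[OF LIMSEQ_subseq_LIMSEQ[OF Fy l(1)] e6] by (simp add: o_def)
  have ev2: "\<forall>\<^sub>F j in sequentially. dist (x (k (l j))) p < d/2" using tendstoD[OF l(2) \<open>d/2 > 0\<close>] by (simp add: o_def)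
  have ev3: "\<forall>\<^sub>F j in sequentially. \<bar>t (k (l j)) - 0\<bar> < \<delta>"
    using tendstoD[OF LIMSEQ_subseq_LIMSEQ[OF LIMSEQ_subseq_LIMSEQ[OF t0 k] l(1)] \<delta>] by (simp add: dist_real_def o_def)
  have "\<forall>\<^sub>F j in sequentially. False"
    using ev1 ev2 ev3
  proof eventually_elim
    case (elim j)
    define i where "i = k (l j)"
    have close: "norm (x i - y) < d"
      using elim(2) y(2) dist_triangle2[of "x i" y p] by (simp add: dist_norm i_def)
    have a: "dist (F (t i) (\<Gamma> (t i) (x i))) (F (t i) (\<Gamma> (t i) y)) < \<epsilon>/6"
      using ne[OF t _ x y(1) close] elim(3) by (simp add: dist_norm i_def)
    have b: "dist (F 0 (\<Gamma> 0 (x i))) (F 0 (\<Gamma> 0 y)) < \<epsilon>/6"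
      using ne[OF z _ x y(1) close] \<delta> by (simp add: dist_norm)
    have c: "dist (F (t i) (\<Gamma> (t i) y)) (F 0 (\<Gamma> 0 y)) < \<epsilon>/6" using elim(1) by (simp add: i_def)
    have "dist (F (t i) (\<Gamma> (t i) (x i))) (F 0 (\<Gamma> 0 (x i))) \<le> dist (F (t i) (\<Gamma> (t i) (x i))) (F (t i) (\<Gamma> (t i) y))
        + (dist (F (t i) (\<Gamma> (t i) y)) (F 0 (\<Gamma> 0 y)) + dist (F 0 (\<Gamma> 0 (x i))) (F 0 (\<Gamma> 0 y)))"
      using dist_triangle[of "F (t i) (\<Gamma> (t i) (x i))" "F 0 (\<Gamma> 0 (x i))" "F (t i) (\<Gamma> (t i) y)"]
        dist_triangle2[of "F (t i) (\<Gamma> (t i) y)" "F 0 (\<Gamma> 0 (x i))" "F 0 (\<Gamma> 0 y)"] by linarith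
    then show False using a b c far[of i] by linarith
  qed
  then show False by simp
qed

end

section \<open>Extension of the maps and assembly\<close>

theorem theorem4p1:
  fixes Dfam Dtfam :: "real \<Rightarrow> (complex^'n) set"
    and F :: "real \<Rightarrow> complex^'n \<Rightarrow> complex^'n"
  assumes "C20_family Dfam" and "C20_family Dtfam"
    and "\<forall>t\<in>{0..1}. bounded_strictly_pseudoconvex_C2 (Dfam t)"
    and "\<forall>t\<in>{0..1}. bounded_strictly_pseudoconvex_C2 (Dtfam t)"
    and "\<forall>t\<in>{0..1}. biholomorphism (F t) (Dfam t) (Dtfam t)"
    and "trivial_Aut (Dfam 0)"
  shows "\<exists>Fbar. (\<forall>t\<in>{0..1}. continuous_on (closure (Dfam t)) (Fbar t) \<and>
                               (\<forall>z\<in>Dfam t. Fbar t z = F t z)) \<and>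
     (\<forall>D0 \<Gamma>. parameterization D0 \<Gamma> Dfam \<longrightarrow>
        (\<forall>\<epsilon>>0. \<exists>\<delta>>0. \<forall>t\<in>{0..1}. t < \<delta> \<longrightarrow>
           (\<forall>x\<in>closure D0. dist (Fbar t (\<Gamma> t x)) (Fbar 0 (\<Gamma> 0 x)) < \<epsilon>)))"
proof -
  have C2: "bounded_C2_domain (Dfam t)" "bounded_C2_domain (Dtfam t)" if "t \<in> {0..1}" for t
    using assms(3,4) that unfolding bounded_strictly_pseudoconvex_C2_def bounded_C2_domain_def by blast+
  have "\<forall>t\<in>{0..1}. \<exists>G. holomorphic_map_on G (Dtfam t) \<and> (\<forall>z\<in>Dfam t. G (F t z) = z) \<and> (\<forall>w\<in>Dtfam t. F t (G w) = w)"
    using assms(5) unfolding biholomorphism_def by blast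
  then obtain G where G: "\<forall>t\<in>{0..1}. holomorphic_map_on (G t) (Dtfam t) \<and> (\<forall>z\<in>Dfam t. G t (F t z) = z) \<and> (\<forall>w\<in>Dtfam t. F t (G t w) = w)"
    by (rule bchoice[THEN exE])
  have F: "holomorphic_map_on (F t) (Dfam t)" "F t ` Dfam t = Dtfam t" if "t \<in> {0..1}" for t
    using assms(5) that unfolding biholomorphism_def bij_betw_def by blast+
  obtain D0' \<Gamma>' where p': "parameterization D0' \<Gamma>' Dtfam" using assms(2) unfolding C20_family_def by blast
  obtain D\<Gamma>' D2\<Gamma>' s' where par': "param_family D0' \<Gamma>' Dtfam D\<Gamma>' D2\<Gamma>' s'" by (rule parameterization_param_family[OF p' C2(2)])
  \<comment> \<open>The parameterization of \<open>Dfam\<close> is left arbitrary because the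
    conclusion quantifies over all of them; one for \<open>Dtfam\<close> serves throughout.\<close>
  have families: "\<exists>D\<Gamma> D2\<Gamma> s. biholo_families D0 \<Gamma> Dfam D\<Gamma> D2\<Gamma> s D0' \<Gamma>' Dtfam D\<Gamma>' D2\<Gamma>' s' F G"
    if p: "parameterization D0 \<Gamma> Dfam" for D0 \<Gamma>
  proof -
    obtain D\<Gamma> D2\<Gamma> s where par: "param_family D0 \<Gamma> Dfam D\<Gamma> D2\<Gamma> s" by (rule parameterization_param_family[OF p C2(1)])
    have GD: "G t ` Dtfam t \<subseteq> Dfam t" if "t \<in> {0..1}" for t
    proof -
      have "G t ` Dtfam t = (\<lambda>z. G t (F t z)) ` Dfam t" unfolding F(2)[OF that, symmetric] by (rule image_image)
      also have "\<dots> = Dfam t" using G that by simp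
      finally show ?thesis by simp
    qed
    have "biholo_families D0 \<Gamma> Dfam D\<Gamma> D2\<Gamma> s D0' \<Gamma>' Dtfam D\<Gamma>' D2\<Gamma>' s' F G"
      by (intro biholo_families.intro biholo_families_axioms.intro par par') (use assms(3,4) F G GD in auto)
    then show ?thesis by blast
  qed
  \<comment> \<open>A single parameterization suffices here: the extension to the closure does not
    refer to it, so the same \<open>Fbar\<close> works for all parameterizations.\<close>
  have "\<exists>f. continuous_on (closure (Dfam t)) f \<and> (\<forall>z\<in>Dfam t. f z = F t z)" if t: "t \<in> {0..1}" for t
  proof -
    obtain D0 \<Gamma> where "parameterization D0 \<Gamma> Dfam" using assms(1) unfolding C20_family_def by blast
    then obtain D\<Gamma> D2\<Gamma> s where "biholo_families D0 \<Gamma> Dfam D\<Gamma> D2\<Gamma> s D0' \<Gamma>' Dtfam D\<Gamma>' D2\<Gamma>' s' F G" using families by blast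
    then have "uniformly_continuous_on (Dfam t) (F t)" using biholo_families.uniformly_continuous t by blast
    then obtain f where "uniformly_continuous_on (closure (Dfam t)) f" "\<And>z. z \<in> Dfam t \<Longrightarrow> F t z = f z"
      using uniformly_continuous_on_extension_on_closure by metis
    then show ?thesis using uniformly_continuous_imp_continuous by metis
  qed
  then have "\<forall>t\<in>{0..1}. \<exists>f. continuous_on (closure (Dfam t)) f \<and> (\<forall>z\<in>Dfam t. f z = F t z)" by blast
  then obtain Fbar where Fbar: "\<forall>t\<in>{0..1}. continuous_on (closure (Dfam t)) (Fbar t) \<and> (\<forall>z\<in>Dfam t. Fbar t z = F t z)"
    by (rule bchoice[THEN exE])
  have "\<exists>\<delta>>0. \<forall>t\<in>{0..1}. t < \<delta> \<longrightarrow> (\<forall>x\<in>closure D0. dist (Fbar t (\<Gamma> t x)) (Fbar 0 (\<Gamma> 0 x)) < \<epsilon>)"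
    if par: "parameterization D0 \<Gamma> Dfam" and eps: "\<epsilon> > 0" for D0 \<Gamma> and \<epsilon> :: real
  proof -
    obtain D\<Gamma> D2\<Gamma> s where "biholo_families D0 \<Gamma> Dfam D\<Gamma> D2\<Gamma> s D0' \<Gamma>' Dtfam D\<Gamma>' D2\<Gamma>' s' F G" using families[OF par] by blast
    then show ?thesis
      by (rule biholo_families.uniform_convergence) (use Fbar assms(6) eps in auto)
  qed
  with Fbar show ?thesis by blast
qed

end
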